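(* Let $(R,\mathfrak m)$ be an equidimensional local ring of dimension $d\ge1$ satisfying $(S_1)$. Let $S_1(R)$ be the (full) subcategory of $\operatorname{mod}R$ consisting of all modules satisfying $(S_1)$. Let $I$ be an $\mathfrak m$-primary ideal. Then $\operatorname{Ext}^1_R(-,-)^{e^T_I}:S_1(R)^{op}\times S_1(R)\to\operatorname{mod}R$ is a subfunctor of $\operatorname{Ext}^1_R(-,-):S_1(R)^{op}\times S_1(R)\to\operatorname{mod}R$.
   Context: Local rings are commutative Noetherian; $\operatorname{mod}R$ is the category of finitely generated $R$-modules; $\lambda$ denotes length. $R$ is equidimensional if $\dim R/\mathfrak p=\dim R$ for all minimal primes $\mathfrak p$. A finitely generated module $M$ satisfies $(S_n)$ if $\operatorname{depth}M_{\mathfrak p}\ge\inf\{n,\dim R_{\mathfrak p}\}$ for all $\mathfrak p\in\operatorname{Spec}R$ (the zero module has depth $\infty$). For $R$ as in the statement and $M\in S_1(R)$, the function $n\mapsto\lambda(\operatorname{Tor}^R_1(M,R/I^{n+1}))$ agrees for $n\gg0$ with a polynomial of degree $\le d-1$, and one sets $$e^T_I(M):=(d-1)!\lim_{n\to\infty}\frac{\lambda(\operatorname{Tor}^R_1(M,R/I^{n+1}))}{n^{d-1}}.$$ For $M,N\in S_1(R)$, $\operatorname{Ext}^1_R(M,N)^{e^T_I}$ is the set of Yoneda classes in $\operatorname{Ext}^1_R(M,N)$ of short exact sequences $0\to N\to X\to M\to0$ with $e^T_I(X)=e^T_I(M)+e^T_I(N)$ (note $X\in S_1(R)$ automatically,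 since $S_1(R)$ is closed under extensions). Subfunctor means via the natural inclusions: these are $R$-submodules, preserved by the maps induced by morphisms in each variable. *)

theory Defs
  imports Complex_Main "HOL-Library.Extended_Nat" "HOL-Algebra.Algebra"
begin

section \<open>Modules over a commutative ring\<close>

text \<open>The record type of modules extends that of rings, so every module carries two fields
  \<open>mult\<close> and \<open>one\<close> which the locale \<^locale>\<open>module\<close> never looks at; below they are
  left \<open>undefined\<close>.\<close>

definition self_mod :: "('a, 'k) ring_scheme \<Rightarrow> ('a, 'a) module" where
  "self_mod R = \<lparr>carrier = carrier R, monoid.mult = undefined, one = undefined,
     ring.zero = \<zero>\<^bsub>R\<^esub>, ring.add = (\<lambda>x y. x \<oplus>\<^bsub>R\<^esub> y), module.smult = (\<lambda>a x. a \<otimes>\<^bsub>R\<^esub> x)\<rparr>"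

definition mod_hom :: "('a, 'k) ring_scheme \<Rightarrow> ('a, 'b) module \<Rightarrow> ('a, 'c) module \<Rightarrow> ('b \<Rightarrow> 'c) set" where
  "mod_hom R M N = {f \<in> carrier M \<rightarrow> carrier N.
     (\<forall>x\<in>carrier M. \<forall>y\<in>carrier M. f (x \<oplus>\<^bsub>M\<^esub> y) = f x \<oplus>\<^bsub>N\<^esub> f y) \<and>
     (\<forall>a\<in>carrier R. \<forall>x\<in>carrier M. f (a \<odot>\<^bsub>M\<^esub> x) = a \<odot>\<^bsub>N\<^esub> f x)}"

definition mod_span :: "('a, 'k) ring_scheme \<Rightarrow> ('a, 'b) module \<Rightarrow> 'b set \<Rightarrow> 'b set" where
  "mod_span R M A = \<Inter>{H. submodule H R M \<and> A \<subseteq> H}"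

definition fg_modules :: "('a, 'k) ring_scheme \<Rightarrow> ('a, 'b) module set" where
  "fg_modules R = {M. module R M \<and> (\<exists>A. A \<subseteq> carrier M \<and> finite A \<and> mod_span R M A = carrier M)}"

definition quot_mod :: "('a, 'b) module \<Rightarrow> 'b set \<Rightarrow> ('a, 'b set) module" where
  "quot_mod M K = \<lparr>carrier = a_rcosets\<^bsub>M\<^esub> K, monoid.mult = undefined, one = undefined,
     ring.zero = K, add = set_add M, module.smult = (\<lambda>a C. \<Union>x\<in>C. K +>\<^bsub>M\<^esub> (a \<odot>\<^bsub>M\<^esub> x))\<rparr>"

definition dsum_mod :: "('a, 'b) module \<Rightarrow> ('a, 'c) module \<Rightarrow> ('a, 'b \<times> 'c) module" where
  "dsum_mod M N = \<lparr>carrier = carrier M \<times> carrier N, monoid.mult = undefined, one = undefined,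
     ring.zero = (\<zero>\<^bsub>M\<^esub>, \<zero>\<^bsub>N\<^esub>),
     ring.add = (\<lambda>(x, y) (x', y'). (x \<oplus>\<^bsub>M\<^esub> x', y \<oplus>\<^bsub>N\<^esub> y')),
     module.smult = (\<lambda>a (x, y). (a \<odot>\<^bsub>M\<^esub> x, a \<odot>\<^bsub>N\<^esub> y))\<rparr>"

definition free_mod :: "('a, 'k) ring_scheme \<Rightarrow> 's set \<Rightarrow> ('a, 's \<Rightarrow> 'a) module" where
  "free_mod R S = \<lparr>carrier = {f. (\<forall>s. f s \<in> carrier R) \<and> (\<forall>s. s \<notin> S \<longrightarrow> f s = \<zero>\<^bsub>R\<^esub>) \<and>
                                finite {s. f s \<noteq> \<zero>\<^bsub>R\<^esub>}},
     monoid.mult = undefined, one = undefined,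
     ring.zero = (\<lambda>s. \<zero>\<^bsub>R\<^esub>), ring.add = (\<lambda>f g s. f s \<oplus>\<^bsub>R\<^esub> g s), module.smult = (\<lambda>a f s. a \<otimes>\<^bsub>R\<^esub> f s)\<rparr>"

definition free_gen :: "('a, 'k) ring_scheme \<Rightarrow> 's \<Rightarrow> ('s \<Rightarrow> 'a)" where
  "free_gen R s = (\<lambda>t. if t = s then \<one>\<^bsub>R\<^esub> else \<zero>\<^bsub>R\<^esub>)"

text \<open>The canonical surjection from the free module on the set \<open>carrier M\<close> onto \<open>M\<close>.\<close>

definition free_cover :: "('a, 'k) ring_scheme \<Rightarrow> ('a, 'b) module \<Rightarrow> ('b \<Rightarrow> 'a) \<Rightarrow> 'b" where
  "free_cover R M f = (\<Oplus>\<^bsub>M\<^esub>x\<in>{x. f x \<noteq> \<zero>\<^bsub>R\<^esub>}. f x \<odot>\<^bsub>M\<^esub> x)"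

text \<open>Length of a module: the supremum of the lengths of strict chains of submodules.\<close>

definition mod_length :: "('a, 'k) ring_scheme \<Rightarrow> ('a, 'b) module \<Rightarrow> enat" where
  "mod_length R M = Sup {enat n | n. \<exists>c :: nat \<Rightarrow> 'b set.
     (\<forall>i\<le>n. submodule (c i) R M) \<and> (\<forall>i<n. c i \<subset> c (Suc i))}"


section \<open>Tensor products and \<open>Tor\<^sub>1\<close>\<close>

definition tensor_rels ::
    "('a, 'k) ring_scheme \<Rightarrow> ('a, 'b) module \<Rightarrow> ('a, 'c) module \<Rightarrow> ('b \<times> 'c \<Rightarrow> 'a) set" where
  "tensor_rels R M N =
    (let F = free_mod R (carrier M \<times> carrier N); e = free_gen R in
      {e (x \<oplus>\<^bsub>M\<^esub> x', y) \<ominus>\<^bsub>F\<^esub> (e (x, y) \<oplus>\<^bsub>F\<^esub> e (x', y)) | x x' y.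
          x \<in> carrier M \<and> x' \<in> carrier M \<and> y \<in> carrier N} \<union>
      {e (x, y \<oplus>\<^bsub>N\<^esub> y') \<ominus>\<^bsub>F\<^esub> (e (x, y) \<oplus>\<^bsub>F\<^esub> e (x, y')) | x y y'.
          x \<in> carrier M \<and> y \<in> carrier N \<and> y' \<in> carrier N} \<union>
      {e (a \<odot>\<^bsub>M\<^esub> x, y) \<ominus>\<^bsub>F\<^esub> (a \<odot>\<^bsub>F\<^esub> e (x, y)) | a x y.
          a \<in> carrier R \<and> x \<in> carrier M \<and> y \<in> carrier N} \<union>
      {e (x, a \<odot>\<^bsub>N\<^esub> y) \<ominus>\<^bsub>F\<^esub> (a \<odot>\<^bsub>F\<^esub> e (x, y)) | a x y.
          a \<in> carrier R \<and> x \<in> carrier M \<and> y \<in> carrier N})"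

definition tensor_ker ::
    "('a, 'k) ring_scheme \<Rightarrow> ('a, 'b) module \<Rightarrow> ('a, 'c) module \<Rightarrow> ('b \<times> 'c \<Rightarrow> 'a) set" where
  "tensor_ker R M N = mod_span R (free_mod R (carrier M \<times> carrier N)) (tensor_rels R M N)"

definition tensor_mod ::
    "('a, 'k) ring_scheme \<Rightarrow> ('a, 'b) module \<Rightarrow> ('a, 'c) module \<Rightarrow> ('a, ('b \<times> 'c \<Rightarrow> 'a) set) module" where
  "tensor_mod R M N = quot_mod (free_mod R (carrier M \<times> carrier N)) (tensor_ker R M N)"

definition pure_tensor ::
    "('a, 'k) ring_scheme \<Rightarrow> ('a, 'b) module \<Rightarrow> ('a, 'c) module \<Rightarrow> 'b \<Rightarrow> 'c \<Rightarrow> ('b \<times> 'c \<Rightarrow> 'a) set" where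
  "pure_tensor R M N x y =
     tensor_ker R M N +>\<^bsub>free_mod R (carrier M \<times> carrier N)\<^esub> free_gen R (x, y)"

definition tensor_map ::
    "('a, 'k) ring_scheme \<Rightarrow> ('a, 'b) module \<Rightarrow> ('a, 'c) module \<Rightarrow> ('a, 'd) module \<Rightarrow> ('a, 'e) module \<Rightarrow>
     ('b \<Rightarrow> 'd) \<Rightarrow> ('c \<Rightarrow> 'e) \<Rightarrow> ('b \<times> 'c \<Rightarrow> 'a) set \<Rightarrow> ('d \<times> 'e \<Rightarrow> 'a) set" where
  "tensor_map R M N M' N' f g =
     (THE h. h \<in> mod_hom R (tensor_mod R M N) (tensor_mod R M' N') \<and>
             h \<in> extensional (carrier (tensor_mod R M N)) \<and>
             (\<forall>x\<in>carrier M. \<forall>y\<in>carrier N.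
                h (pure_tensor R M N x y) = pure_tensor R M' N' (f x) (g y)))"

text \<open>The first syzygy of \<open>M\<close> with respect to \<^const>\<open>free_cover\<close>.\<close>

definition syz_mod :: "('a, 'k) ring_scheme \<Rightarrow> ('a, 'b) module \<Rightarrow> ('a, 'b \<Rightarrow> 'a) module" where
  "syz_mod R M = (free_mod R (carrier M))
     \<lparr>carrier := a_kernel (free_mod R (carrier M)) M (free_cover R M)\<rparr>"

text \<open>\<open>Tor\<^sub>1\<close> is the homology at \<open>F1 \<otimes> N\<close> of the complex \<open>F2 \<otimes> N \<rightarrow> F1 \<otimes> N \<rightarrow> F0 \<otimes> N\<close>, where
  \<open>F2 \<rightarrow> F1 \<rightarrow> F0 \<rightarrow> M \<rightarrow> 0\<close> is the beginning of the functorial free resolution obtained by iterating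
  \<^const>\<open>free_cover\<close>.  The differentials \<open>d1\<close>, \<open>d2\<close> are the covers of the syzygies \<open>Z0\<close>, \<open>Z1\<close>,
  viewed as maps into the free modules \<open>F0\<close>, \<open>F1\<close> containing them.\<close>

definition Tor1 ::
    "('a, 'k) ring_scheme \<Rightarrow> ('a, 'b) module \<Rightarrow> ('a, 'c) module \<Rightarrow>
     ('a, ((('b \<Rightarrow> 'a) \<Rightarrow> 'a) \<times> 'c \<Rightarrow> 'a) set set) module" where
  "Tor1 R M N =
    (let F0 = free_mod R (carrier M);
         Z0 = syz_mod R M;
         F1 = free_mod R (carrier Z0);
         d1 = free_cover R Z0;
         Z1 = syz_mod R Z0;
         F2 = free_mod R (carrier Z1);
         d2 = free_cover R Z1;
         T0 = tensor_mod R F0 N;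
         T1 = tensor_mod R F1 N;
         T2 = tensor_mod R F2 N
     in quot_mod
          (T1\<lparr>carrier := a_kernel T1 T0 (tensor_map R F1 N F0 N d1 (\<lambda>y. y))\<rparr>)
          (tensor_map R F2 N F1 N d2 (\<lambda>y. y) ` carrier T2))"


section \<open>Local rings, dimension, localization, depth\<close>

text \<open>\<^locale>\<open>maximalideal\<close> is proper by definition, so \<open>R\<close> is not the zero ring.\<close>

definition noeth_local_ring :: "('a, 'k) ring_scheme \<Rightarrow> 'a set \<Rightarrow> bool" where
  "noeth_local_ring R \<mm> \<longleftrightarrow> cring R \<and> noetherian_ring R \<and> maximalideal \<mm> R \<and>
     (\<forall>J. maximalideal J R \<longrightarrow> J = \<mm>)"

definition krull_dim :: "('a, 'k) ring_scheme \<Rightarrow> enat" where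
  "krull_dim R = Sup {enat n | n. \<exists>c :: nat \<Rightarrow> 'a set.
     (\<forall>i\<le>n. primeideal (c i) R) \<and> (\<forall>i<n. c i \<subset> c (Suc i))}"

definition minimal_prime :: "('a, 'k) ring_scheme \<Rightarrow> 'a set \<Rightarrow> bool" where
  "minimal_prime R P \<longleftrightarrow> primeideal P R \<and> (\<forall>Q. primeideal Q R \<and> Q \<subseteq> P \<longrightarrow> Q = P)"

definition equidimensional :: "('a, 'k) ring_scheme \<Rightarrow> bool" where
  "equidimensional R \<longleftrightarrow> (\<forall>P. minimal_prime R P \<longrightarrow> krull_dim (R Quot P) = krull_dim R)"

definition primary_ideal_of :: "('a, 'k) ring_scheme \<Rightarrow> 'a set \<Rightarrow> 'a set \<Rightarrow> bool" where
  "primary_ideal_of R P I \<longleftrightarrow> ideal I R \<and> I \<noteq> carrier R \<and>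
     (\<forall>a\<in>carrier R. \<forall>b\<in>carrier R. a \<otimes>\<^bsub>R\<^esub> b \<in> I \<longrightarrow> a \<in> I \<or> (\<exists>n::nat. b [^]\<^bsub>R\<^esub> n \<in> I)) \<and>
     {a \<in> carrier R. \<exists>n::nat. a [^]\<^bsub>R\<^esub> n \<in> I} = P"

text \<open>The fraction \<open>x / s\<close>, as a set of pairs (numerator, denominator); with \<open>M = self_mod R\<close>
  this also gives the elements of the localized ring.\<close>

definition frac_class ::
    "('a, 'k) ring_scheme \<Rightarrow> ('a, 'b) module \<Rightarrow> 'a set \<Rightarrow> 'b \<Rightarrow> 'a \<Rightarrow> ('b \<times> 'a) set" where
  "frac_class R M S x s = {(y, t). y \<in> carrier M \<and> t \<in> S \<and>
     (\<exists>u\<in>S. u \<odot>\<^bsub>M\<^esub> (t \<odot>\<^bsub>M\<^esub> x) = u \<odot>\<^bsub>M\<^esub> (s \<odot>\<^bsub>M\<^esub> y))}"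

definition loc_ring :: "('a, 'k) ring_scheme \<Rightarrow> 'a set \<Rightarrow> ('a \<times> 'a) set ring" where
  "loc_ring R S =
    (let fr = frac_class R (self_mod R) S in
     \<lparr>carrier = {fr a s | a s. a \<in> carrier R \<and> s \<in> S},
      monoid.mult = (\<lambda>U V. \<Union>{fr (a \<otimes>\<^bsub>R\<^esub> b) (s \<otimes>\<^bsub>R\<^esub> t) | a s b t. (a, s) \<in> U \<and> (b, t) \<in> V}),
      one = fr \<one>\<^bsub>R\<^esub> \<one>\<^bsub>R\<^esub>,
      ring.zero = fr \<zero>\<^bsub>R\<^esub> \<one>\<^bsub>R\<^esub>,
      ring.add = (\<lambda>U V. \<Union>{fr (t \<otimes>\<^bsub>R\<^esub> a \<oplus>\<^bsub>R\<^esub> s \<otimes>\<^bsub>R\<^esub> b) (s \<otimes>\<^bsub>R\<^esub> t) | a s b t. (a, s) \<in> U \<and> (b, t) \<in> V})\<rparr>)"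

definition loc_mod ::
    "('a, 'k) ring_scheme \<Rightarrow> 'a set \<Rightarrow> ('a, 'b) module \<Rightarrow> (('a \<times> 'a) set, ('b \<times> 'a) set) module" where
  "loc_mod R S M =
    (let fr = frac_class R M S in
     \<lparr>carrier = {fr x s | x s. x \<in> carrier M \<and> s \<in> S},
      monoid.mult = undefined, one = undefined,
      ring.zero = fr \<zero>\<^bsub>M\<^esub> \<one>\<^bsub>R\<^esub>,
      ring.add = (\<lambda>U V. \<Union>{fr (t \<odot>\<^bsub>M\<^esub> x \<oplus>\<^bsub>M\<^esub> s \<odot>\<^bsub>M\<^esub> y) (s \<otimes>\<^bsub>R\<^esub> t) | x s y t. (x, s) \<in> U \<and> (y, t) \<in> V}),
      module.smult = (\<lambda>A U. \<Union>{fr (a \<odot>\<^bsub>M\<^esub> x) (s \<otimes>\<^bsub>R\<^esub> t) | a s x t. (a, s) \<in> A \<and> (x, t) \<in> U})\<rparr>)"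

text \<open>The submodule \<open>(x\<^sub>1, \<dots>, x\<^sub>n) M\<close>.\<close>

definition seq_submod :: "('a, 'k) ring_scheme \<Rightarrow> ('a, 'b) module \<Rightarrow> 'a list \<Rightarrow> 'b set" where
  "seq_submod R M xs = mod_span R M {a \<odot>\<^bsub>M\<^esub> m | a m. a \<in> set xs \<and> m \<in> carrier M}"

definition regular_seq :: "('a, 'k) ring_scheme \<Rightarrow> ('a, 'b) module \<Rightarrow> 'a list \<Rightarrow> bool" where
  "regular_seq R M xs \<longleftrightarrow> set xs \<subseteq> carrier R \<and>
     (\<forall>i<length xs. let Q = quot_mod M (seq_submod R M (take i xs)) in
        \<forall>q\<in>carrier Q. xs ! i \<odot>\<^bsub>Q\<^esub> q = \<zero>\<^bsub>Q\<^esub> \<longrightarrow> q = \<zero>\<^bsub>Q\<^esub>) \<and>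
     seq_submod R M xs \<noteq> carrier M"

text \<open>Depth of a finitely generated module over a Noetherian local ring \<open>R\<close>; only used for
  such \<open>R\<close>, where the definite description denotes the maximal ideal.\<close>

definition depth :: "('a, 'k) ring_scheme \<Rightarrow> ('a, 'b) module \<Rightarrow> enat" where
  "depth R M = (if carrier M = {\<zero>\<^bsub>M\<^esub>} then \<infinity>
     else Sup {enat (length xs) | xs. set xs \<subseteq> (THE \<mm>. maximalideal \<mm> R) \<and> regular_seq R M xs})"

definition serre :: "('a, 'k) ring_scheme \<Rightarrow> nat \<Rightarrow> ('a, 'b) module \<Rightarrow> bool" where
  "serre R n M \<longleftrightarrow> (\<forall>P. primeideal P R \<longrightarrow>
     min (enat n) (krull_dim (loc_ring R (carrier R - P)))
       \<le> depth (loc_ring R (carrier R - P)) (loc_mod R (carrier R - P) M))"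

text \<open>The full subcategory \<open>S\<^sub>1(R)\<close> of \<open>mod R\<close>, restricted to modules whose elements lie in the
  type \<open>'b\<close>.  For \<open>'b = (nat \<Rightarrow> 'a) set\<close> it contains an isomorphic copy of every object,
  since a finitely generated module is a quotient of a free module on a finite subset of \<open>nat\<close>.\<close>

definition S1_modules :: "('a, 'k) ring_scheme \<Rightarrow> ('a, 'b) module set" where
  "S1_modules R = {M \<in> fg_modules R. serre R 1 M}"


section \<open>The multiplicity \<open>e\<^sup>T\<close>\<close>

text \<open>The length is finite whenever \<open>M\<close> is finitely generated and \<open>I\<close> is primary to the maximal
  ideal, so \<^const>\<open>the_enat\<close> is applied to finite values only.\<close>

definition eT :: "('a, 'k) ring_scheme \<Rightarrow> 'a set \<Rightarrow> ('a, 'b) module \<Rightarrow> real" where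
  "eT R I M = (let d = the_enat (krull_dim R) in
     fact (d - 1) *
     lim (\<lambda>n. real (the_enat (mod_length R
                (Tor1 R M (quot_mod (self_mod R) (I [^]\<^bsub>ideals_set R\<^esub> (n + 1))))))
              / real n ^ (d - 1)))"


section \<open>Yoneda \<open>Ext\<^sup>1\<close>\<close>

text \<open>A record of this type stands for \<open>0 \<rightarrow> N \<rightarrow> X \<rightarrow> M \<rightarrow> 0\<close>.\<close>

record ('a, 'n, 'x, 'm) extn =
  ext_mid :: "('a, 'x) module"
  ext_in :: "'n \<Rightarrow> 'x"
  ext_out :: "'x \<Rightarrow> 'm"

definition is_ext ::
    "('a, 'k) ring_scheme \<Rightarrow> ('a, 'm) module \<Rightarrow> ('a, 'n) module \<Rightarrow> ('a, 'n, 'x, 'm) extn \<Rightarrow> bool" where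
  "is_ext R M N E \<longleftrightarrow> module R (ext_mid E) \<and>
     ext_in E \<in> mod_hom R N (ext_mid E) \<and> ext_out E \<in> mod_hom R (ext_mid E) M \<and>
     inj_on (ext_in E) (carrier N) \<and>
     ext_in E ` carrier N = a_kernel (ext_mid E) M (ext_out E) \<and>
     ext_out E ` carrier (ext_mid E) = carrier M"

definition ext_equiv ::
    "('a, 'k) ring_scheme \<Rightarrow> ('a, 'm) module \<Rightarrow> ('a, 'n) module \<Rightarrow>
     ('a, 'n, 'x, 'm) extn \<Rightarrow> ('a, 'n, 'y, 'm) extn \<Rightarrow> bool" where
  "ext_equiv R M N E E' \<longleftrightarrow> (\<exists>\<phi>\<in>mod_hom R (ext_mid E) (ext_mid E').
     (\<forall>n\<in>carrier N. \<phi> (ext_in E n) = ext_in E' n) \<and>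
     (\<forall>x\<in>carrier (ext_mid E). ext_out E' (\<phi> x) = ext_out E x))"

text \<open>The Yoneda class of \<open>E\<close>, represented as the set of equivalent extensions with elements in
  \<open>'n \<times> 'm\<close>.  This type is large enough: the middle term of an extension of \<open>M\<close> by \<open>N\<close> is in
  bijection with \<open>carrier N \<times> carrier M\<close>, so no class is empty, wherever the
  middle term of \<open>E\<close> lives.\<close>

definition yoneda_class ::
    "('a, 'k) ring_scheme \<Rightarrow> ('a, 'm) module \<Rightarrow> ('a, 'n) module \<Rightarrow>
     ('a, 'n, 'x, 'm) extn \<Rightarrow> ('a, 'n, 'n \<times> 'm, 'm) extn set" where
  "yoneda_class R M N E = {E'. is_ext R M N E' \<and> ext_equiv R M N E E'}"

definition pull_ext ::
    "('a, 'l) module \<Rightarrow> ('l \<Rightarrow> 'm) \<Rightarrow> ('a, 'n, 'x, 'm) extn \<Rightarrow> ('a, 'n, 'x \<times> 'l, 'l) extn" where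
  "pull_ext M' f E =
     \<lparr>ext_mid = (dsum_mod (ext_mid E) M')
        \<lparr>carrier := {(x, m). x \<in> carrier (ext_mid E) \<and> m \<in> carrier M' \<and> ext_out E x = f m}\<rparr>,
      ext_in = (\<lambda>n. (ext_in E n, \<zero>\<^bsub>M'\<^esub>)),
      ext_out = snd\<rparr>"

definition push_ext ::
    "('a, 'n) module \<Rightarrow> ('a, 'l) module \<Rightarrow> ('n \<Rightarrow> 'l) \<Rightarrow>
     ('a, 'n, 'x, 'm) extn \<Rightarrow> ('a, 'l, ('l \<times> 'x) set, 'm) extn" where
  "push_ext N N' g E =
    (let D = dsum_mod N' (ext_mid E);
         K = (\<lambda>n. (g n, \<ominus>\<^bsub>ext_mid E\<^esub> (ext_in E n))) ` carrier N
     in \<lparr>ext_mid = quot_mod D K,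
         ext_in = (\<lambda>n'. K +>\<^bsub>D\<^esub> (n', \<zero>\<^bsub>ext_mid E\<^esub>)),
         ext_out = (\<lambda>C. the_elem ((\<lambda>(n', x). ext_out E x) ` C))\<rparr>)"

definition dsum_ext ::
    "('a, 'n, 'x, 'm) extn \<Rightarrow> ('a, 'n, 'y, 'm) extn \<Rightarrow> ('a, 'n \<times> 'n, 'x \<times> 'y, 'm \<times> 'm) extn" where
  "dsum_ext E E' =
     \<lparr>ext_mid = dsum_mod (ext_mid E) (ext_mid E'),
      ext_in = map_prod (ext_in E) (ext_in E'),
      ext_out = map_prod (ext_out E) (ext_out E')\<rparr>"

text \<open>Baer sum: pull the direct sum back along the diagonal of \<open>M\<close>, then push it out along the
  codiagonal of \<open>N\<close>.\<close>

definition baer_ext ::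
    "('a, 'm) module \<Rightarrow> ('a, 'n) module \<Rightarrow> ('a, 'n, 'x, 'm) extn \<Rightarrow> ('a, 'n, 'y, 'm) extn \<Rightarrow>
     ('a, 'n, ('n \<times> (('x \<times> 'y) \<times> 'm)) set, 'm) extn" where
  "baer_ext M N E E' =
     push_ext (dsum_mod N N) N (\<lambda>(n, n'). n \<oplus>\<^bsub>N\<^esub> n') (pull_ext M (\<lambda>m. (m, m)) (dsum_ext E E'))"

definition split_ext :: "('a, 'm) module \<Rightarrow> ('a, 'n) module \<Rightarrow> ('a, 'n, 'n \<times> 'm, 'm) extn" where
  "split_ext M N = \<lparr>ext_mid = dsum_mod N M, ext_in = (\<lambda>n. (n, \<zero>\<^bsub>M\<^esub>)), ext_out = snd\<rparr>"

text \<open>In the next two definitions the unions run over representatives of a class and are unions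
  of copies of one and the same class.\<close>

definition Ext1 ::
    "('a, 'k) ring_scheme \<Rightarrow> ('a, 'm) module \<Rightarrow> ('a, 'n) module \<Rightarrow>
     ('a, ('a, 'n, 'n \<times> 'm, 'm) extn set) module" where
  "Ext1 R M N =
     \<lparr>carrier = {yoneda_class R M N E | E :: ('a, 'n, 'n \<times> 'm, 'm) extn. is_ext R M N E},
      monoid.mult = undefined, one = undefined,
      ring.zero = yoneda_class R M N (split_ext M N),
      ring.add = (\<lambda>c c'. \<Union>E\<in>c. \<Union>E'\<in>c'. yoneda_class R M N (baer_ext M N E E')),
      module.smult = (\<lambda>a c. \<Union>E\<in>c. yoneda_class R M N (push_ext N N (\<lambda>n. a \<odot>\<^bsub>N\<^esub> n) E))\<rparr>"

text \<open>The map induced by \<open>f : M' \<rightarrow> M\<close> and \<open>g : N \<rightarrow> N'\<close>.\<close>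

definition Ext1_map ::
    "('a, 'k) ring_scheme \<Rightarrow> ('a, 'm) module \<Rightarrow> ('a, 'n) module \<Rightarrow> ('a, 'p) module \<Rightarrow> ('a, 'q) module \<Rightarrow>
     ('p \<Rightarrow> 'm) \<Rightarrow> ('n \<Rightarrow> 'q) \<Rightarrow>
     ('a, 'n, 'n \<times> 'm, 'm) extn set \<Rightarrow> ('a, 'q, 'q \<times> 'p, 'p) extn set" where
  "Ext1_map R M N M' N' f g c =
     (\<Union>E\<in>c. yoneda_class R M' N' (push_ext N N' g (pull_ext M' f E)))"

definition Ext1_eT ::
    "('a, 'k) ring_scheme \<Rightarrow> 'a set \<Rightarrow> ('a, 'm) module \<Rightarrow> ('a, 'n) module \<Rightarrow>
     ('a, 'n, 'n \<times> 'm, 'm) extn set set" where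
  "Ext1_eT R I M N =
     {yoneda_class R M N E | E :: ('a, 'n, 'n \<times> 'm, 'm) extn.
        is_ext R M N E \<and> eT R I (ext_mid E) = eT R I M + eT R I N}"


section \<open>Bifunctors and subfunctors\<close>

text \<open>A functor \<open>C\<^sup>o\<^sup>p \<times> C \<rightarrow> mod R\<close>, for a full subcategory of modules with class of
  objects \<open>C\<close>: \<open>F\<close> is its action on objects, and \<open>Fm M N M' N' f g : F M N \<rightarrow> F M' N'\<close> is its
  action on a pair of morphisms \<open>f : M' \<rightarrow> M\<close>, \<open>g : N \<rightarrow> N'\<close>.\<close>

definition mod_bifunctor ::
    "('a, 'k) ring_scheme \<Rightarrow> ('a, 'b) module set \<Rightarrow>
     (('a, 'b) module \<Rightarrow> ('a, 'b) module \<Rightarrow> ('a, 'e) module) \<Rightarrow>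
     (('a, 'b) module \<Rightarrow> ('a, 'b) module \<Rightarrow> ('a, 'b) module \<Rightarrow> ('a, 'b) module \<Rightarrow>
        ('b \<Rightarrow> 'b) \<Rightarrow> ('b \<Rightarrow> 'b) \<Rightarrow> 'e \<Rightarrow> 'e) \<Rightarrow> bool" where
  "mod_bifunctor R C F Fm \<longleftrightarrow>
     (\<forall>M\<in>C. \<forall>N\<in>C. F M N \<in> fg_modules R) \<and>
     (\<forall>M\<in>C. \<forall>N\<in>C. \<forall>M'\<in>C. \<forall>N'\<in>C. \<forall>f\<in>mod_hom R M' M. \<forall>g\<in>mod_hom R N N'.
        Fm M N M' N' f g \<in> mod_hom R (F M N) (F M' N')) \<and>
     (\<forall>M\<in>C. \<forall>N\<in>C. \<forall>c\<in>carrier (F M N). Fm M N M N id id c = c) \<and>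
     (\<forall>M\<in>C. \<forall>N\<in>C. \<forall>M'\<in>C. \<forall>N'\<in>C. \<forall>M''\<in>C. \<forall>N''\<in>C.
        \<forall>f\<in>mod_hom R M' M. \<forall>g\<in>mod_hom R N N'. \<forall>f'\<in>mod_hom R M'' M'. \<forall>g'\<in>mod_hom R N' N''.
        \<forall>c\<in>carrier (F M N).
          Fm M N M'' N'' (f \<circ> f') (g' \<circ> g) c = Fm M' N' M'' N'' f' g' (Fm M N M' N' f g c))"

text \<open>\<open>G M N\<close> is the underlying set of the value of the subfunctor.\<close>

definition mod_subfunctor ::
    "('a, 'k) ring_scheme \<Rightarrow> ('a, 'b) module set \<Rightarrow>
     (('a, 'b) module \<Rightarrow> ('a, 'b) module \<Rightarrow> 'e set) \<Rightarrow>
     (('a, 'b) module \<Rightarrow> ('a, 'b) module \<Rightarrow> ('a, 'e) module) \<Rightarrow>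
     (('a, 'b) module \<Rightarrow> ('a, 'b) module \<Rightarrow> ('a, 'b) module \<Rightarrow> ('a, 'b) module \<Rightarrow>
        ('b \<Rightarrow> 'b) \<Rightarrow> ('b \<Rightarrow> 'b) \<Rightarrow> 'e \<Rightarrow> 'e) \<Rightarrow> bool" where
  "mod_subfunctor R C G F Fm \<longleftrightarrow>
     mod_bifunctor R C F Fm \<and>
     (\<forall>M\<in>C. \<forall>N\<in>C. submodule (G M N) R (F M N) \<and> (F M N)\<lparr>carrier := G M N\<rparr> \<in> fg_modules R) \<and>
     (\<forall>M\<in>C. \<forall>N\<in>C. \<forall>M'\<in>C. \<forall>N'\<in>C. \<forall>f\<in>mod_hom R M' M. \<forall>g\<in>mod_hom R N N'.
        Fm M N M' N' f g ` G M N \<subseteq> G M' N')"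

end

theory Submission
  imports Defs
begin

text \<open>The function \<open>e\<^sup>T\<close> is additive on direct sums and, because \<open>Tor\<^sub>1\<close> is half exact, subadditive on short
  exact sequences. If it is additive on \<open>0 \<rightarrow> N \<rightarrow> Y \<rightarrow> M \<rightarrow> 0\<close> and \<open>Y'\<close> is the pushout along \<open>N \<rightarrow> N'\<close>, then
  \<open>0 \<rightarrow> N \<rightarrow> N' \<oplus> Y \<rightarrow> Y' \<rightarrow> 0\<close> gives \<open>e N' + e Y \<le> e N + e Y'\<close>, that is, \<open>e M + e N' \<le> e Y'\<close>; so additivity passes
  to pushouts, dually to pullbacks, hence to Baer sums and scalar multiples.

  The limit defining \<open>e\<^sup>T\<close> exists for every finitely generated module. For a presentation
  \<open>0 \<rightarrow> Z \<rightarrow> F \<rightarrow> M \<rightarrow> 0\<close> with \<open>F\<close> free, \<open>Tor\<^sub>1(M, R/I\<^sup>n) = (Z \<inter> I\<^sup>n F) / I\<^sup>n Z\<close>. Its length is eventually polynomial by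
  the Hilbert--Serre argument, applied to families of submodules of \<open>F\<close> with the ascending chain condition
  supplied by Hilbert's basis theorem. By Artin--Rees it is at most the length of \<open>I\<^sup>n\<^sup>-\<^sup>k Z / I\<^sup>n Z\<close>, and the length of
  \<open>Z / I\<^sup>n Z\<close> is \<open>O(n\<^sup>d)\<close> by devissage to the modules \<open>R/P\<close>, so the degree is at most \<open>d - 1\<close>.

  The group \<open>Ext\<^sup>1(M, N)\<close> is handled through the surjection from \<open>Hom(Z, N)\<close> that sends a map to the pushout of
  the presentation; it turns the Baer sum into addition of maps.\<close>

section \<open>Submodules, homomorphisms and spans\<close>

text \<open>The degree bound d - 1 needs more than a growth estimate: a length of order n^d may have
  single increments of order n^d. Therefore the Hilbert-Serre argument is run twice, for (Z cap I^n
  F)/I^n Z and for I^n Z/I^(n+1) Z. The second run makes the length of Z/I^n Z eventually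
  polynomial, and only then does its bound O(n^d) give O(n^(d-1)) for the differences. Two encodings
  keep the types under control. The length of a subquotient A/B is measured by chains of submodules
  of one ambient module, without forming the quotient. The functorial resolution behind
  \<open>Tor1\<close> is traded for a finite presentation by comparing presentations whose
  generators have different types. No long exact sequence is set up: half exactness is a horseshoe
  lemma for presentations. On the side of \<open>Ext1\<close> every class is labelled by a map Z ->
  N, so that equality of Yoneda classes, independence of representatives and the functor laws become
  identities between composites of maps.\<close>

locale rmodule = module R M for R :: "('a, 'k) ring_scheme" (structure) and M :: "('a, 'b) module" (structure)

lemma rmoduleI: "module R M \<Longrightarrow> rmodule R M"
  by (rule rmodule.intro)

lemma (in rmodule) module_M: "module R M" ..

context rmodule
begin

text \<open>Closure under negation is multiplication by -1, so a submodule is recognised by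
  conditions on zero, sums and scalars alone; \<open>smI\<close> and \<open>smD\<close> package this
  form.\<close>

lemma submodule_iff:
  "submodule H R M \<longleftrightarrow> H \<subseteq> carrier M \<and> \<zero>\<^bsub>M\<^esub> \<in> H \<and>
     (\<forall>x\<in>H. \<forall>y\<in>H. x \<oplus>\<^bsub>M\<^esub> y \<in> H) \<and> (\<forall>a\<in>carrier R. \<forall>x\<in>H. a \<odot>\<^bsub>M\<^esub> x \<in> H)" (is "?L \<longleftrightarrow> ?R")
proof
  assume ?L
  then interpret H: submodule H R M .
  show ?R using H.subset H.one_closed H.m_closed by auto
next
  assume r: ?R
  show ?L
  proof (rule submoduleI)
    fix x assume x: "x \<in> H"
    hence "(\<ominus> \<one>) \<odot>\<^bsub>M\<^esub> x \<in> H" using r by auto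
    moreover have "x \<in> carrier M" using x r by auto
    ultimately show "\<ominus>\<^bsub>M\<^esub> x \<in> H" by (simp add: smult_l_minus)
  qed (use r in auto)
qed

lemma smI:
  assumes "H \<subseteq> carrier M" "\<zero>\<^bsub>M\<^esub> \<in> H" "\<And>x y. x \<in> H \<Longrightarrow> y \<in> H \<Longrightarrow> x \<oplus>\<^bsub>M\<^esub> y \<in> H"
    "\<And>a x. a \<in> carrier R \<Longrightarrow> x \<in> H \<Longrightarrow> a \<odot>\<^bsub>M\<^esub> x \<in> H"
  shows "submodule H R M"
  unfolding submodule_iff using assms by auto

lemma smD:
  assumes "submodule H R M"
  shows "\<And>x. x \<in> H \<Longrightarrow> x \<in> carrier M" "\<zero>\<^bsub>M\<^esub> \<in> H"
    "\<And>x y. x \<in> H \<Longrightarrow> y \<in> H \<Longrightarrow> x \<oplus>\<^bsub>M\<^esub> y \<in> H"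
    "\<And>a x. a \<in> carrier R \<Longrightarrow> x \<in> H \<Longrightarrow> a \<odot>\<^bsub>M\<^esub> x \<in> H"
    "\<And>x. x \<in> H \<Longrightarrow> \<ominus>\<^bsub>M\<^esub> x \<in> H"
    "\<And>x y. x \<in> H \<Longrightarrow> y \<in> H \<Longrightarrow> x \<ominus>\<^bsub>M\<^esub> y \<in> H"
  using assms submoduleE[OF assms] unfolding submodule_iff by (auto simp: a_minus_def)

lemma sm_zero: "submodule {\<zero>\<^bsub>M\<^esub>} R M"
  by (rule smI) auto

lemma sm_inter: "submodule A R M \<Longrightarrow> submodule B R M \<Longrightarrow> submodule (A \<inter> B) R M"
  unfolding submodule_iff by auto

lemma sm_Inter: "S \<noteq> {} \<Longrightarrow> (\<And>H. H \<in> S \<Longrightarrow> submodule H R M) \<Longrightarrow> submodule (\<Inter>S) R M"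
  unfolding submodule_iff by blast

lemma set_addI: "x \<in> A \<Longrightarrow> y \<in> B \<Longrightarrow> x \<oplus>\<^bsub>M\<^esub> y \<in> A <+>\<^bsub>M\<^esub> B"
  by (auto simp: set_add_def')

lemma set_addE: "z \<in> A <+>\<^bsub>M\<^esub> B \<Longrightarrow> (\<And>x y. x \<in> A \<Longrightarrow> y \<in> B \<Longrightarrow> z = x \<oplus>\<^bsub>M\<^esub> y \<Longrightarrow> P) \<Longrightarrow> P"
  by (auto simp: set_add_def')

lemma sm_add:
  assumes A: "submodule A R M" and B: "submodule B R M"
  shows "submodule (A <+>\<^bsub>M\<^esub> B) R M"
proof (rule smI)
  note [simp] = smD(1)[OF A] smD(1)[OF B]
  show "A <+>\<^bsub>M\<^esub> B \<subseteq> carrier M" by (auto elim!: set_addE)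
  show "\<zero>\<^bsub>M\<^esub> \<in> A <+>\<^bsub>M\<^esub> B"
    using set_addI[OF smD(2)[OF A] smD(2)[OF B]] by simp
  show "x \<oplus>\<^bsub>M\<^esub> y \<in> A <+>\<^bsub>M\<^esub> B" if "x \<in> A <+>\<^bsub>M\<^esub> B" "y \<in> A <+>\<^bsub>M\<^esub> B" for x y
  proof -
    from that obtain a b a' b' where *: "a \<in> A" "b \<in> B" "a' \<in> A" "b' \<in> B" "x = a \<oplus>\<^bsub>M\<^esub> b" "y = a' \<oplus>\<^bsub>M\<^esub> b'"
      by (auto elim!: set_addE)
    hence "x \<oplus>\<^bsub>M\<^esub> y = (a \<oplus>\<^bsub>M\<^esub> a') \<oplus>\<^bsub>M\<^esub> (b \<oplus>\<^bsub>M\<^esub> b')" by (simp add: M.a_ac)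
    thus ?thesis using * smD(3)[OF A] smD(3)[OF B] by (auto intro: set_addI)
  qed
  show "r \<odot>\<^bsub>M\<^esub> x \<in> A <+>\<^bsub>M\<^esub> B" if r: "r \<in> carrier R" "x \<in> A <+>\<^bsub>M\<^esub> B" for r x
    using r(2)
  proof (rule set_addE)
    fix a b assume *: "a \<in> A" "b \<in> B" "x = a \<oplus>\<^bsub>M\<^esub> b"
    hence "r \<odot>\<^bsub>M\<^esub> x = r \<odot>\<^bsub>M\<^esub> a \<oplus>\<^bsub>M\<^esub> r \<odot>\<^bsub>M\<^esub> b" using r by (simp add: smult_r_distr)
    thus ?thesis using * r smD(4)[OF A] smD(4)[OF B] by (auto intro: set_addI)
  qed
qed

lemma set_add_upper1: "submodule A R M \<Longrightarrow> submodule B R M \<Longrightarrow> A \<subseteq> A <+>\<^bsub>M\<^esub> B"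
  by (metis M.r_zero set_addI smD(1) smD(2) subsetI)

lemma set_add_upper2: "submodule A R M \<Longrightarrow> submodule B R M \<Longrightarrow> B \<subseteq> A <+>\<^bsub>M\<^esub> B"
  by (metis M.l_zero set_addI smD(1) smD(2) subsetI)

lemma set_add_least: "submodule C R M \<Longrightarrow> A \<subseteq> C \<Longrightarrow> B \<subseteq> C \<Longrightarrow> A <+>\<^bsub>M\<^esub> B \<subseteq> C"
  by (auto elim!: set_addE intro!: smD(3)[of C])

lemma set_add_mono: "A \<subseteq> A' \<Longrightarrow> B \<subseteq> B' \<Longrightarrow> A <+>\<^bsub>M\<^esub> B \<subseteq> A' <+>\<^bsub>M\<^esub> B'"
  by (auto elim!: set_addE intro!: set_addI)

lemma mod_span_sm: "A \<subseteq> carrier M \<Longrightarrow> submodule (mod_span R M A) R M"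
  unfolding mod_span_def using carrier_is_submodule by (intro sm_Inter) auto

lemma mod_span_incl: "A \<subseteq> mod_span R M A"
  unfolding mod_span_def by auto

lemma mod_span_least: "submodule H R M \<Longrightarrow> A \<subseteq> H \<Longrightarrow> mod_span R M A \<subseteq> H"
  unfolding mod_span_def by auto

lemma minus_add_cancel: "x \<in> carrier M \<Longrightarrow> y \<in> carrier M \<Longrightarrow> x \<ominus>\<^bsub>M\<^esub> y \<oplus>\<^bsub>M\<^esub> y = x"
  by (simp add: a_minus_def M.a_assoc M.l_neg)

lemma add_minus_cancel: "x \<in> carrier M \<Longrightarrow> y \<in> carrier M \<Longrightarrow> x \<oplus>\<^bsub>M\<^esub> y \<ominus>\<^bsub>M\<^esub> y = x"
  by (simp add: a_minus_def M.a_assoc M.r_neg)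

lemma add_minus_cancel': "x \<in> carrier M \<Longrightarrow> y \<in> carrier M \<Longrightarrow> y \<oplus>\<^bsub>M\<^esub> x \<ominus>\<^bsub>M\<^esub> y = x"
  by (simp add: M.a_comm add_minus_cancel)

lemma minus_eq_zero_iff: "x \<in> carrier M \<Longrightarrow> y \<in> carrier M \<Longrightarrow> x \<ominus>\<^bsub>M\<^esub> y = \<zero>\<^bsub>M\<^esub> \<longleftrightarrow> x = y"
  by (metis M.l_zero M.r_neg a_minus_def minus_add_cancel)

lemma smult_minus_distr: "a \<in> carrier R \<Longrightarrow> x \<in> carrier M \<Longrightarrow> y \<in> carrier M \<Longrightarrow>
   a \<odot>\<^bsub>M\<^esub> (x \<ominus>\<^bsub>M\<^esub> y) = a \<odot>\<^bsub>M\<^esub> x \<ominus>\<^bsub>M\<^esub> a \<odot>\<^bsub>M\<^esub> y"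
  by (simp add: a_minus_def smult_r_distr smult_r_minus)

lemma smult_lcomm: "a \<in> carrier R \<Longrightarrow> b \<in> carrier R \<Longrightarrow> x \<in> carrier M \<Longrightarrow>
   a \<odot>\<^bsub>M\<^esub> (b \<odot>\<^bsub>M\<^esub> x) = b \<odot>\<^bsub>M\<^esub> (a \<odot>\<^bsub>M\<^esub> x)"
  by (metis R.m_comm smult_assoc1)

lemma add_minus_add: "\<lbrakk>x \<in> carrier M; y \<in> carrier M; x' \<in> carrier M; y' \<in> carrier M\<rbrakk> \<Longrightarrow>
  (x \<oplus>\<^bsub>M\<^esub> y) \<ominus>\<^bsub>M\<^esub> (x' \<oplus>\<^bsub>M\<^esub> y') = (x \<ominus>\<^bsub>M\<^esub> x') \<oplus>\<^bsub>M\<^esub> (y \<ominus>\<^bsub>M\<^esub> y')"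
  by (simp add: a_minus_def M.minus_add M.a_ac)

text \<open>Modular law. An element x of D is c + b with c in C and b in B, and b = x - c lies in D
  cap B = C cap B, hence in C. Consequently a strict inclusion of submodules stays strict after
  adding B or after intersecting with B.\<close>

lemma modular_eq:
  assumes sm: "submodule C R M" "submodule D R M" "submodule B R M"
    and "C \<subseteq> D" "C <+>\<^bsub>M\<^esub> B = D <+>\<^bsub>M\<^esub> B" "C \<inter> B = D \<inter> B"
  shows "C = D"
proof
  show "D \<subseteq> C"
  proof
    fix x assume x: "x \<in> D"
    hence "x \<in> C <+>\<^bsub>M\<^esub> B" using assms set_add_upper1 by blast
    then obtain c b where cb: "c \<in> C" "b \<in> B" "x = c \<oplus>\<^bsub>M\<^esub> b" by (rule set_addE)
    note [simp] = smD(1)[OF sm(1) cb(1)] smD(1)[OF sm(3) cb(2)]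
    have "b = x \<ominus>\<^bsub>M\<^esub> c" using cb by (simp add: add_minus_cancel')
    also have "\<dots> \<in> D" using x cb assms(4) smD(6)[OF sm(2)] by blast
    finally have "b \<in> C" using cb assms by blast
    thus "x \<in> C" using cb smD(3)[OF sm(1)] by blast
  qed
qed (rule assms)

end

section \<open>Homomorphisms and their effect on submodules and spans\<close>

lemma mod_homI:
  assumes "\<And>x. x \<in> carrier M \<Longrightarrow> f x \<in> carrier N"
    "\<And>x y. x \<in> carrier M \<Longrightarrow> y \<in> carrier M \<Longrightarrow> f (x \<oplus>\<^bsub>M\<^esub> y) = f x \<oplus>\<^bsub>N\<^esub> f y"
    "\<And>a x. a \<in> carrier R \<Longrightarrow> x \<in> carrier M \<Longrightarrow> f (a \<odot>\<^bsub>M\<^esub> x) = a \<odot>\<^bsub>N\<^esub> f x"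
  shows "f \<in> mod_hom R M N"
  using assms by (auto simp: mod_hom_def)

lemma mod_homD:
  assumes "f \<in> mod_hom R M N"
  shows "\<And>x. x \<in> carrier M \<Longrightarrow> f x \<in> carrier N"
    "\<And>x y. x \<in> carrier M \<Longrightarrow> y \<in> carrier M \<Longrightarrow> f (x \<oplus>\<^bsub>M\<^esub> y) = f x \<oplus>\<^bsub>N\<^esub> f y"
    "\<And>a x. a \<in> carrier R \<Longrightarrow> x \<in> carrier M \<Longrightarrow> f (a \<odot>\<^bsub>M\<^esub> x) = a \<odot>\<^bsub>N\<^esub> f x"
  using assms by (auto simp: mod_hom_def)

lemma mod_hom_comp:
  "f \<in> mod_hom R M N \<Longrightarrow> g \<in> mod_hom R N L \<Longrightarrow> g \<circ> f \<in> mod_hom R M L"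
  by (rule mod_homI) (simp_all add: mod_homD)

lemma mod_hom_cong:
  assumes "f \<in> mod_hom R M N" "module R M" "\<And>x. x \<in> carrier M \<Longrightarrow> g x = f x"
  shows "g \<in> mod_hom R M N"
proof -
  interpret rmodule R M using assms by (intro rmoduleI)
  show ?thesis by (rule mod_homI) (use assms(3) in \<open>simp_all add: mod_homD[OF assms(1)]\<close>)
qed

lemma mod_hom_id: "id \<in> mod_hom R M M" "(\<lambda>x. x) \<in> mod_hom R M M"
  by (auto intro: mod_homI)

locale mod_homo = M: rmodule R M + N: rmodule R N
  for R (structure) and M (structure) and N (structure) and f +
  assumes hom: "f \<in> mod_hom R M N"
begin

lemmas closed = mod_homD(1)[OF hom]
lemmas add = mod_homD(2)[OF hom]
lemmas smult = mod_homD(3)[OF hom]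

lemma zero: "f \<zero>\<^bsub>M\<^esub> = \<zero>\<^bsub>N\<^esub>"
  using smult[of "\<zero>\<^bsub>R\<^esub>" "\<zero>\<^bsub>M\<^esub>"] closed[of "\<zero>\<^bsub>M\<^esub>"] by simp

lemma neg: "x \<in> carrier M \<Longrightarrow> f (\<ominus>\<^bsub>M\<^esub> x) = \<ominus>\<^bsub>N\<^esub> f x"
  using smult[of "\<ominus> \<one>" x] closed by (simp add: M.smult_l_minus N.smult_l_minus)

lemma minus: "x \<in> carrier M \<Longrightarrow> y \<in> carrier M \<Longrightarrow> f (x \<ominus>\<^bsub>M\<^esub> y) = f x \<ominus>\<^bsub>N\<^esub> f y"
  by (simp add: a_minus_def add neg)

lemma image_sm: 
  assumes A: "submodule A R M" shows "submodule (f ` A) R N"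
proof (rule N.smI)
  note * = M.smD[OF A]
  show "f ` A \<subseteq> carrier N" using * closed by auto
  show "\<zero>\<^bsub>N\<^esub> \<in> f ` A" using *(2) zero by (metis imageI)
  show "x \<oplus>\<^bsub>N\<^esub> y \<in> f ` A" if "x \<in> f ` A" "y \<in> f ` A" for x y
    using that * by (auto simp: add[symmetric])
  show "r \<odot>\<^bsub>N\<^esub> x \<in> f ` A" if "r \<in> carrier R" "x \<in> f ` A" for r x
    using that * by (auto simp: smult[symmetric])
qed

lemma vimage_sm:
  assumes "submodule A R M" "submodule B R N" shows "submodule {x \<in> A. f x \<in> B} R M"
  by (rule M.smI) (use assms in \<open>auto simp: M.smD N.smD add smult zero\<close>)

lemma kernel_sm: "submodule (a_kernel M N f) R M"
  using vimage_sm[OF M.carrier_is_submodule N.sm_zero] by (simp add: a_kernel_def')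

lemma span_image_le:
  assumes "A \<subseteq> carrier M" "submodule H R N" "f ` A \<subseteq> H"
  shows "f ` mod_span R M A \<subseteq> H"
proof -
  have "mod_span R M A \<subseteq> {x \<in> carrier M. f x \<in> H}"
    using assms by (intro M.mod_span_least vimage_sm M.carrier_is_submodule) auto
  thus ?thesis by auto
qed

lemma span_image:
  assumes "A \<subseteq> carrier M"
  shows "f ` mod_span R M A = mod_span R N (f ` A)"
proof
  have "f ` A \<subseteq> carrier N" using assms closed by auto
  thus "f ` mod_span R M A \<subseteq> mod_span R N (f ` A)"
    using assms by (intro span_image_le N.mod_span_sm N.mod_span_incl)
  show "mod_span R N (f ` A) \<subseteq> f ` mod_span R M A"
    using assms M.mod_span_incl[of A] by (intro N.mod_span_least image_sm M.mod_span_sm) auto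
qed

end

lemma mod_homoI: "module R M \<Longrightarrow> module R N \<Longrightarrow> f \<in> mod_hom R M N \<Longrightarrow> mod_homo R M N f"
  by (simp add: mod_homo_def mod_homo_axioms_def rmodule_def)

section \<open>Relative length\<close>

text \<open>The number \<open>n\<close> counts strict inclusions, so the supremum over
  \<open>n\<close> is the length of A/B. Chains between B and A in the ambient module replace chains
  in the quotient, whose elements would be sets; iterated subquotients thus stay in one
  type.\<close>

definition has_chain :: "('a, 'k) ring_scheme \<Rightarrow> ('a, 'b) module \<Rightarrow> 'b set \<Rightarrow> 'b set \<Rightarrow> nat \<Rightarrow> bool" where
  "has_chain R M A B n \<longleftrightarrow> (\<exists>c :: nat \<Rightarrow> 'b set.
     (\<forall>i\<le>n. submodule (c i) R M \<and> B \<subseteq> c i \<and> c i \<subseteq> A) \<and> (\<forall>i<n. c i \<subset> c (Suc i)))"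

definition rlen :: "('a, 'k) ring_scheme \<Rightarrow> ('a, 'b) module \<Rightarrow> 'b set \<Rightarrow> 'b set \<Rightarrow> enat" where
  "rlen R M A B = Sup {enat n | n. has_chain R M A B n}"

lemma has_chainI:
  assumes "\<And>i. i \<le> n \<Longrightarrow> submodule (c i) R M" "\<And>i. i \<le> n \<Longrightarrow> B \<subseteq> c i" "\<And>i. i \<le> n \<Longrightarrow> c i \<subseteq> A"
    "\<And>i. i < n \<Longrightarrow> c i \<subset> c (Suc i)"
  shows "has_chain R M A B n"
  unfolding has_chain_def using assms by (intro exI[of _ c]) simp

lemma has_chainE:
  assumes "has_chain R M A B n"
  obtains c where "\<And>i. i \<le> n \<Longrightarrow> submodule (c i) R M" "\<And>i. i \<le> n \<Longrightarrow> B \<subseteq> c i" "\<And>i. i \<le> n \<Longrightarrow> c i \<subseteq> A"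
    "\<And>i. i < n \<Longrightarrow> c i \<subset> c (Suc i)"
  using assms unfolding has_chain_def by blast

lemma has_chain_less: "has_chain R M A B n \<Longrightarrow> m \<le> n \<Longrightarrow> has_chain R M A B m"
  by (erule has_chainE, rule_tac c = c in has_chainI) simp_all

lemma has_chain_0: "submodule A R M \<Longrightarrow> B \<subseteq> A \<Longrightarrow> has_chain R M A B 0"
  unfolding has_chain_def by auto

text \<open>Chains can be truncated, so the attained lengths form an initial segment, and every
  finite number below the supremum is attained even if the length is infinite. Equalities of lengths
  can then be proved by operating on chains.\<close>

lemma enat_le_rlen:
  assumes "submodule A R M" "B \<subseteq> A"
  shows "enat n \<le> rlen R M A B \<longleftrightarrow> has_chain R M A B n"
proof
  show "enat n \<le> rlen R M A B" if "has_chain R M A B n"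
    unfolding rlen_def using that by (auto intro: Sup_upper)
  assume *: "enat n \<le> rlen R M A B"
  show "has_chain R M A B n"
  proof (rule ccontr)
    assume no: "\<not> has_chain R M A B n"
    with has_chain_0[OF assms] obtain k where k: "n = Suc k" by (cases n) auto
    have "rlen R M A B \<le> enat k"
      unfolding rlen_def
    proof (rule Sup_least, clarsimp)
      fix m assume "has_chain R M A B m"
      hence "\<not> n \<le> m" using no has_chain_less by blast
      thus "m \<le> k" using k by auto
    qed
    hence "enat n \<le> enat k" using * order_trans by blast
    thus False using k by simp
  qed
qed

lemma enat_le_eqI:
  assumes "\<And>n. enat n \<le> x \<Longrightarrow> enat n \<le> y" shows "x \<le> y"
proof (cases x)
  case (enat k) thus ?thesis using assms[of k] by simp
next
  case infinity
  hence *: "enat n \<le> y" for n using assms[of n] by simp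
  have "y = \<infinity>" using *[of "Suc (the_enat y)"] by (cases y) auto
  thus ?thesis by simp
qed

text \<open>Turns a finite number below a sum of two lengths into the lengths of two chains that can
  be put on top of each other; an infinite first summand absorbs everything.\<close>

lemma enat_le_add_split:
  assumes "enat n \<le> x + y"
  obtains a b where "n = a + b" "enat a \<le> x" "enat b \<le> y"
proof (cases x)
  case (enat k)
  show ?thesis
  proof (cases "n \<le> k")
    case True thus ?thesis using that[of n 0] enat by (simp add: zero_enat_def[symmetric])
  next
    case False
    have "enat (n - k) \<le> y" using assms enat False by (cases y) auto
    thus ?thesis using that[of k "n - k"] enat False by simp
  qed
next
  case infinity
  thus ?thesis using that[of n 0] by (simp add: zero_enat_def[symmetric])
qed

lemma rlen_leI: "(\<And>n. has_chain R M A B n \<Longrightarrow> enat n \<le> y) \<Longrightarrow> rlen R M A B \<le> y"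
  unfolding rlen_def by (rule Sup_least) auto

lemma has_chain_extend:
  assumes "has_chain R M A B n" "submodule A' R M" "A \<subset> A'"
  shows "has_chain R M A' B (Suc n)"
  using assms(1)
proof (rule has_chainE)
  fix c assume c: "\<And>i. i \<le> n \<Longrightarrow> submodule (c i) R M" "\<And>i. i \<le> n \<Longrightarrow> B \<subseteq> c i"
    "\<And>i. i \<le> n \<Longrightarrow> c i \<subseteq> A" "\<And>i. i < n \<Longrightarrow> c i \<subset> c (Suc i)"
  have 1: "c n \<subset> A'" "B \<subseteq> A'" using c(2)[of n] c(3)[of n] assms(3) by auto
  let ?c = "c(Suc n := A')"
  show ?thesis
  proof (rule has_chainI[of _ ?c])
    fix i assume i: "i \<le> Suc n"
    show "submodule (?c i) R M" using i c(1) assms(2) by simp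
    show "B \<subseteq> ?c i" using i c(2) 1 by simp
    show "?c i \<subseteq> A'" using i c(3)[of i] assms(3) by (cases "i = Suc n") auto
  next
    fix i assume "i < Suc n"
    thus "?c i \<subset> ?c (Suc i)" using c(4)[of i] 1 by (cases "i = n") auto
  qed
qed

lemma has_chain_mono: "has_chain R M A B n \<Longrightarrow> A \<subseteq> A' \<Longrightarrow> B' \<subseteq> B \<Longrightarrow> has_chain R M A' B' n"
  by (erule has_chainE, rule_tac c = c in has_chainI) (simp_all, (meson order_trans)+)

lemma has_chain_concat:
  assumes "has_chain R M A B n" "has_chain R M B C m"
  shows "has_chain R M A C (m + n)"
proof -
  from assms(1) obtain c where c: "\<And>i. i \<le> n \<Longrightarrow> submodule (c i) R M" "\<And>i. i \<le> n \<Longrightarrow> B \<subseteq> c i"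
    "\<And>i. i \<le> n \<Longrightarrow> c i \<subseteq> A" "\<And>i. i < n \<Longrightarrow> c i \<subset> c (Suc i)" by (rule has_chainE) blast
  from assms(2) obtain d where d: "\<And>i. i \<le> m \<Longrightarrow> submodule (d i) R M" "\<And>i. i \<le> m \<Longrightarrow> C \<subseteq> d i"
    "\<And>i. i \<le> m \<Longrightarrow> d i \<subseteq> B" "\<And>i. i < m \<Longrightarrow> d i \<subset> d (Suc i)" by (rule has_chainE) blast
  have CB: "C \<subseteq> B" "B \<subseteq> A" using d(2,3)[of 0] c(2,3)[of 0] by auto
  let ?e = "\<lambda>i. if i < m then d i else c (i - m)"
  show ?thesis
  proof (rule has_chainI[of _ ?e])
    fix i assume i: "i \<le> m + n"
    have im: "i - m \<le> n" using i by simp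
    show "submodule (?e i) R M" using i c(1) d(1) by simp
    show "C \<subseteq> ?e i" using c(2)[OF im] d(2)[of i] CB by (cases "i < m") auto
    show "?e i \<subseteq> A" using c(3)[OF im] d(3)[of i] CB by (cases "i < m") auto
  next
    fix i assume i: "i < m + n"
    consider "Suc i < m" | "Suc i = m" | "m \<le> i" by linarith
    thus "?e i \<subset> ?e (Suc i)"
    proof cases
      case 2
      thus ?thesis using d(4)[of i] d(3)[of m] c(2)[of 0] by auto
    next
      case 3
      thus ?thesis using c(4)[of "i - m"] i by (simp add: Suc_diff_le)
    qed (use d(4) in auto)
  qed
qed

context rmodule
begin

text \<open>The chain is followed through its images c_i + B and its traces c_i cap B. By
  \<open>modular_eq\<close> each strict step remains strict in at least one of the two, so the
  induction extends one of the two chains at every step.\<close>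

lemma has_chain_split:
  assumes B: "submodule B R M" "C \<subseteq> B"
    and "\<forall>i\<le>n. submodule (c i) R M \<and> C \<subseteq> c i" "\<forall>i<n. c i \<subset> c (Suc i)"
  shows "\<exists>n1 n2. n = n1 + n2 \<and> has_chain R M (c n <+>\<^bsub>M\<^esub> B) B n1 \<and> has_chain R M (c n \<inter> B) C n2"
  using assms(3,4)
proof (induct n)
  case 0
  have "submodule (c 0 <+>\<^bsub>M\<^esub> B) R M" "submodule (c 0 \<inter> B) R M" "B \<subseteq> c 0 <+>\<^bsub>M\<^esub> B"
    using 0 B sm_add sm_inter set_add_upper2 by auto
  thus ?case using 0 B by (auto intro!: has_chain_0)
next
  case (Suc n)
  then obtain n1 n2 where n: "n = n1 + n2" "has_chain R M (c n <+>\<^bsub>M\<^esub> B) B n1" "has_chain R M (c n \<inter> B) C n2"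
    by auto
  have sm: "submodule (c n) R M" "submodule (c (Suc n)) R M" "c n \<subset> c (Suc n)" using Suc by auto
  hence le: "c n <+>\<^bsub>M\<^esub> B \<subseteq> c (Suc n) <+>\<^bsub>M\<^esub> B" "c n \<inter> B \<subseteq> c (Suc n) \<inter> B"
    using set_add_mono[of "c n" "c (Suc n)" B B] by auto
  show ?case
  proof (cases "c n <+>\<^bsub>M\<^esub> B = c (Suc n) <+>\<^bsub>M\<^esub> B")
    case True
    hence "c n \<inter> B \<subset> c (Suc n) \<inter> B" using modular_eq[OF sm(1,2) B(1)] sm(3) le(2) by blast
    hence "has_chain R M (c (Suc n) \<inter> B) C (Suc n2)"
      using has_chain_extend[OF n(3)] sm_inter[OF sm(2) B(1)] by blast
    thus ?thesis using n True by (intro exI[of _ n1] exI[of _ "Suc n2"]) auto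
  next
    case False
    hence "has_chain R M (c (Suc n) <+>\<^bsub>M\<^esub> B) B (Suc n1)"
      using has_chain_extend[OF n(2)] sm_add[OF sm(2) B(1)] le(1) by blast
    thus ?thesis using n le(2) by (intro exI[of _ "Suc n1"] exI[of _ "n2"]) (auto intro: has_chain_mono)
  qed
qed

text \<open>A chain from C to A is split along B by \<open>has_chain_split\<close>; conversely a
  chain from C to B is continued by one from B to A.\<close>

lemma rlen_add:
  assumes A: "submodule A R M" and B: "submodule B R M" and "C \<subseteq> B" "B \<subseteq> A"
  shows "rlen R M A C = rlen R M A B + rlen R M B C"
proof (rule antisym)
  have CA: "C \<subseteq> A" using assms by auto
  show "rlen R M A C \<le> rlen R M A B + rlen R M B C"
  proof (rule rlen_leI)
    fix n assume "has_chain R M A C n"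
    then obtain c where c: "\<And>i. i \<le> n \<Longrightarrow> submodule (c i) R M" "\<And>i. i \<le> n \<Longrightarrow> C \<subseteq> c i"
    "\<And>i. i \<le> n \<Longrightarrow> c i \<subseteq> A" "\<And>i. i < n \<Longrightarrow> c i \<subset> c (Suc i)" by (rule has_chainE) blast
    have "\<forall>i\<le>n. submodule (c i) R M \<and> C \<subseteq> c i" "\<forall>i<n. c i \<subset> c (Suc i)" using c by auto
    from has_chain_split[OF B \<open>C \<subseteq> B\<close> this] obtain n1 n2 where
      n: "n = n1 + n2" "has_chain R M (c n <+>\<^bsub>M\<^esub> B) B n1" "has_chain R M (c n \<inter> B) C n2" by auto
    have "c n <+>\<^bsub>M\<^esub> B \<subseteq> A" using c(3)[of n] assms by (intro set_add_least) auto
    hence "has_chain R M A B n1" "has_chain R M B C n2" using n has_chain_mono by blast+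
    hence "enat n1 \<le> rlen R M A B" "enat n2 \<le> rlen R M B C"
      using assms enat_le_rlen by blast+
    thus "enat n \<le> rlen R M A B + rlen R M B C"
      unfolding n(1) plus_enat_simps(1)[symmetric] by (rule add_mono)
  qed
  show "rlen R M A B + rlen R M B C \<le> rlen R M A C"
  proof (rule enat_le_eqI)
    fix n assume "enat n \<le> rlen R M A B + rlen R M B C"
    then obtain a b where "n = a + b" "enat a \<le> rlen R M A B" "enat b \<le> rlen R M B C"
      by (rule enat_le_add_split)
    thus "enat n \<le> rlen R M A C"
      using has_chain_concat[of R M A B a C b] enat_le_rlen[OF A CA] enat_le_rlen[OF A \<open>B \<subseteq> A\<close>]
        enat_le_rlen[OF B \<open>C \<subseteq> B\<close>] by (simp add: add.commute)
  qed
qed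

lemma rlen_self: "rlen R M A A = 0"
proof -
  have "rlen R M A A \<le> 0"
  proof (rule rlen_leI)
    fix n assume "has_chain R M A A n"
    then obtain c where c: "\<And>i. i \<le> n \<Longrightarrow> submodule (c i) R M" "\<And>i. i \<le> n \<Longrightarrow> A \<subseteq> c i"
    "\<And>i. i \<le> n \<Longrightarrow> c i \<subseteq> A" "\<And>i. i < n \<Longrightarrow> c i \<subset> c (Suc i)" by (rule has_chainE) blast
    have "n = 0" using c(4)[of 0] c(2)[of 0] c(3)[of 1] by (cases n) auto
    thus "enat n \<le> 0" by (simp add: zero_enat_def)
  qed
  thus ?thesis by simp
qed

end

section \<open>Relative length under homomorphisms\<close>

lemma (in mod_homo) rlen_surj_le:
  assumes "submodule A R M" "submodule B' R N" "B \<subseteq> A"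
    and "A' \<subseteq> f ` A <+>\<^bsub>N\<^esub> B'" "f ` B \<subseteq> B'"
  shows "rlen R N A' B' \<le> rlen R M A B"
proof (rule rlen_leI)
  fix n assume "has_chain R N A' B' n"
  then obtain c where c: "\<And>i. i \<le> n \<Longrightarrow> submodule (c i) R N" "\<And>i. i \<le> n \<Longrightarrow> B' \<subseteq> c i"
    "\<And>i. i \<le> n \<Longrightarrow> c i \<subseteq> A'" "\<And>i. i < n \<Longrightarrow> c i \<subset> c (Suc i)" by (rule has_chainE) blast
  \<comment> \<open>The chain above B' is pulled back to A. Distinct members stay distinct because
    the image of A covers A' modulo B': a new element y equals f x + b with b in B', and x separates
    the two preimages.\<close>
  have "has_chain R M A B n"
  proof (rule has_chainI[of _ "\<lambda>i. {x \<in> A. f x \<in> c i}"])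
    fix i assume i: "i \<le> n"
    show "submodule {x \<in> A. f x \<in> c i} R M" using c i assms vimage_sm by auto
    have "B' \<subseteq> c i" using c(2) i by auto
    thus "B \<subseteq> {x \<in> A. f x \<in> c i}" using assms by auto
  next
    fix i assume i: "i < n"
    hence sm: "submodule (c i) R N" "submodule (c (Suc i)) R N" "B' \<subseteq> c i" and lt: "c i \<subset> c (Suc i)"
      and le: "c (Suc i) \<subseteq> A'" using c(1,2,3,4)[of i] c(1,3)[of "Suc i"] by auto
    then obtain y where y: "y \<in> c (Suc i)" "y \<notin> c i" by auto
    hence "y \<in> f ` A <+>\<^bsub>N\<^esub> B'" using le assms(4) by auto
    then obtain x b where xb: "x \<in> A" "b \<in> B'" "y = f x \<oplus>\<^bsub>N\<^esub> b"
      by (auto elim!: N.set_addE)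
    have cl: "f x \<in> carrier N" "b \<in> carrier N" using xb assms closed M.smD N.smD by auto
    have "f x = y \<ominus>\<^bsub>N\<^esub> b" using xb cl by (simp add: N.add_minus_cancel)
    moreover have "b \<in> c (Suc i)" using xb sm(3) lt by auto
    ultimately have "f x \<in> c (Suc i)" using N.smD(6)[OF sm(2) y(1)] by simp
    moreover have "f x \<notin> c i" using y xb N.smD(3)[OF sm(1)] sm(3) by auto
    ultimately show "{x \<in> A. f x \<in> c i} \<subset> {x \<in> A. f x \<in> c (Suc i)}" using xb lt by blast
  qed auto
  thus "enat n \<le> rlen R M A B" using enat_le_rlen assms by blast
qed

lemma (in mod_homo) rlen_inj_le:
  assumes A: "submodule A R M" and A': "submodule A' R N" and B': "submodule B' R N" and "B' \<subseteq> A'"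
    and "f ` A \<subseteq> A'" "{x \<in> A. f x \<in> B'} \<subseteq> B"
  shows "rlen R M A B \<le> rlen R N A' B'"
proof (rule rlen_leI)
  fix n assume "has_chain R M A B n"
  then obtain c where c: "\<And>i. i \<le> n \<Longrightarrow> submodule (c i) R M" "\<And>i. i \<le> n \<Longrightarrow> B \<subseteq> c i"
    "\<And>i. i \<le> n \<Longrightarrow> c i \<subseteq> A" "\<And>i. i < n \<Longrightarrow> c i \<subset> c (Suc i)" by (rule has_chainE) blast
  \<comment> \<open>The chain is pushed forward and B' is added. Strictness: if f x = f y + b with b
    in B', then x - y lies in A and maps into B', so it lies in B and in every member of the
    chain.\<close>
  have "has_chain R N A' B' n"
  proof (rule has_chainI[of _ "\<lambda>i. f ` c i <+>\<^bsub>N\<^esub> B'"])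
    fix i assume i: "i \<le> n"
    have sm: "submodule (f ` c i) R N" using c i image_sm by auto
    show "submodule (f ` c i <+>\<^bsub>N\<^esub> B') R N" "B' \<subseteq> f ` c i <+>\<^bsub>N\<^esub> B'"
      using sm B' N.sm_add N.set_add_upper2 by auto
    have "f ` c i \<subseteq> A'" using c(3)[of i] i assms by blast
    thus "f ` c i <+>\<^bsub>N\<^esub> B' \<subseteq> A'" using assms by (intro N.set_add_least) auto
  next
    fix i assume i: "i < n"
    hence sm: "submodule (c i) R M" "submodule (c (Suc i)) R M" "B \<subseteq> c i" and lt: "c i \<subset> c (Suc i)"
      and le: "c (Suc i) \<subseteq> A" using c(1,2,3,4)[of i] c(1,3)[of "Suc i"] by auto
    from lt obtain x where x: "x \<in> c (Suc i)" "x \<notin> c i" by auto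
    have "f x \<in> f ` c (Suc i) <+>\<^bsub>N\<^esub> B'"
      using x N.set_add_upper1[OF image_sm[OF sm(2)] B'] by auto
    moreover have "f x \<notin> f ` c i <+>\<^bsub>N\<^esub> B'"
    proof
      assume "f x \<in> f ` c i <+>\<^bsub>N\<^esub> B'"
      then obtain y b where yb: "y \<in> c i" "b \<in> B'" "f x = f y \<oplus>\<^bsub>N\<^esub> b" by (auto elim!: N.set_addE)
      have cl: "x \<in> carrier M" "y \<in> carrier M" "b \<in> carrier N"
        using yb x M.smD(1)[OF sm(1)] M.smD(1)[OF sm(2)] N.smD(1)[OF B'] by auto
      have "f (x \<ominus>\<^bsub>M\<^esub> y) = b" using yb cl by (simp add: minus N.add_minus_cancel' closed)
      moreover have "x \<ominus>\<^bsub>M\<^esub> y \<in> A" using x yb lt le M.smD(6)[OF A] by blast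
      ultimately have "x \<ominus>\<^bsub>M\<^esub> y \<in> c i" using assms(6) yb sm by auto
      hence "x \<ominus>\<^bsub>M\<^esub> y \<oplus>\<^bsub>M\<^esub> y \<in> c i" using yb M.smD(3)[OF sm(1)] by auto
      thus False using x cl by (simp add: M.minus_add_cancel)
    qed
    ultimately show "f ` c i <+>\<^bsub>N\<^esub> B' \<subset> f ` c (Suc i) <+>\<^bsub>N\<^esub> B'"
      using lt by (metis N.set_add_mono image_mono order_refl psubsetI psubset_imp_subset)
  qed
  thus "enat n \<le> rlen R N A' B'" using enat_le_rlen assms by blast
qed

text \<open>The last two hypotheses express that f induces a surjection and an injection A/B ->
  A'/B'. Isomorphic subquotients of different ambient modules are compared in this form.\<close>

lemma (in mod_homo) rlen_eq:
  assumes "submodule A R M" "submodule A' R N" "submodule B' R N" "B' \<subseteq> A'"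
    and "f ` A <+>\<^bsub>N\<^esub> B' = A'" "{x \<in> A. f x \<in> B'} = B"
  shows "rlen R M A B = rlen R N A' B'"
proof (rule antisym)
  show "rlen R M A B \<le> rlen R N A' B'"
    using assms N.set_add_upper1[OF image_sm[OF assms(1)] assms(3)] by (intro rlen_inj_le) auto
  show "rlen R N A' B' \<le> rlen R M A B"
    using assms by (intro rlen_surj_le) auto
qed

context rmodule
begin

lemma id_homo: "mod_homo R M M (\<lambda>x. x)"
  using module_M mod_hom_id by (intro mod_homoI)

lemma smult_hom: "a \<in> carrier R \<Longrightarrow> (\<lambda>x. a \<odot>\<^bsub>M\<^esub> x) \<in> mod_hom R M M"
  by (rule mod_homI) (auto simp: smult_r_distr smult_lcomm)

lemma smult_homo: "a \<in> carrier R \<Longrightarrow> mod_homo R M M (\<lambda>x. a \<odot>\<^bsub>M\<^esub> x)"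
  using module_M smult_hom by (intro mod_homoI)

end

section \<open>Constructions of modules\<close>

text \<open>Every module axiom is an identity or the existence of negatives, so it survives under a
  surjection compatible with the operations, injective or not. Quotients, small copies of middle
  terms and \<open>Ext1\<close> get their module structure in this way.\<close>

lemma module_transport:
  assumes "module R M" and onto: "\<theta> ` carrier M = carrier E"
    and t1: "\<And>x y. x \<in> carrier M \<Longrightarrow> y \<in> carrier M \<Longrightarrow> \<theta> (x \<oplus>\<^bsub>M\<^esub> y) = \<theta> x \<oplus>\<^bsub>E\<^esub> \<theta> y"
    and t2: "\<And>a x. a \<in> carrier R \<Longrightarrow> x \<in> carrier M \<Longrightarrow> \<theta> (a \<odot>\<^bsub>M\<^esub> x) = a \<odot>\<^bsub>E\<^esub> \<theta> x"
    and t3: "\<theta> \<zero>\<^bsub>M\<^esub> = \<zero>\<^bsub>E\<^esub>"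
  shows "module R E" "\<theta> \<in> mod_hom R M E"
proof -
  interpret rmodule R M using assms(1) by (rule rmoduleI)
  note th = t1[symmetric] t2[symmetric] t3[symmetric]
  show "\<theta> \<in> mod_hom R M E" using onto t1 t2 by (intro mod_homI) auto
  show "module R E"
  proof (rule moduleI)
    show "cring R" by (rule R.is_cring)
    show "abelian_group E"
    proof (rule abelian_groupI)
      show "\<exists>y\<in>carrier E. y \<oplus>\<^bsub>E\<^esub> x = \<zero>\<^bsub>E\<^esub>" if "x \<in> carrier E" for x
      proof -
        from that onto obtain x' where x': "x' \<in> carrier M" "x = \<theta> x'" by auto
        hence "\<theta> (\<ominus>\<^bsub>M\<^esub> x') \<oplus>\<^bsub>E\<^esub> x = \<zero>\<^bsub>E\<^esub>" by (simp add: th M.l_neg)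
        thus ?thesis using x' onto by (metis M.a_inv_closed imageI)
      qed
    qed (unfold onto[symmetric], auto simp: th M.a_ac)
  qed (unfold onto[symmetric], auto simp: th smult_l_distr smult_r_distr smult_assoc1)
qed

context cring
begin

lemma self_mod_simps [simp]:
  "carrier (self_mod R) = carrier R" "\<zero>\<^bsub>self_mod R\<^esub> = \<zero>" "x \<oplus>\<^bsub>self_mod R\<^esub> y = x \<oplus> y"
  "a \<odot>\<^bsub>self_mod R\<^esub> x = a \<otimes> x"
  by (simp_all add: self_mod_def)

lemma self_mod_module: "module R (self_mod R)"
proof (rule moduleI)
  show "abelian_group (self_mod R)"
    by (rule abelian_groupI) (auto simp: a_ac intro: l_neg)
qed (auto simp: is_cring l_distr r_distr m_assoc)

lemma submodule_self_mod_iff: "submodule H R (self_mod R) \<longleftrightarrow> ideal H R"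
proof
  interpret S: rmodule R "self_mod R" using self_mod_module by (rule rmoduleI)
  show "ideal H R" if H: "submodule H R (self_mod R)"
  proof (rule idealI)
    show "ring R" by (rule ring_axioms)
    show "subgroup H (add_monoid R)"
    proof (rule add.subgroupI)
      show "H \<subseteq> carrier R" "H \<noteq> {}" using S.smD(1,2)[OF H] by auto
      show "x \<oplus> y \<in> H" if "x \<in> H" "y \<in> H" for x y using S.smD(3)[OF H that] by simp
      show "\<ominus> x \<in> H" if "x \<in> H" for x
        using S.smD(4)[OF H _ that, of "\<ominus> \<one>"] S.smD(1)[OF H that] by (simp add: l_minus)
    qed
    show "x \<otimes> a \<in> H" "a \<otimes> x \<in> H" if "a \<in> H" "x \<in> carrier R" for a x
      using S.smD(4)[OF H that(2,1)] S.smD(1)[OF H that(1)] that by (auto simp: m_comm)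
  qed
  assume "ideal H R"
  then interpret ideal H R .
  show "submodule H R (self_mod R)"
    by (rule S.smI) (use Icarr in \<open>auto intro: I_l_closed\<close>)
qed

lemma free_mod_simps [simp]:
  "\<zero>\<^bsub>free_mod R S\<^esub> = (\<lambda>s. \<zero>)" "f \<oplus>\<^bsub>free_mod R S\<^esub> g = (\<lambda>s. f s \<oplus> g s)"
  "a \<odot>\<^bsub>free_mod R S\<^esub> f = (\<lambda>s. a \<otimes> f s)"
  by (simp_all add: free_mod_def)

lemma free_mod_carrier_iff: "f \<in> carrier (free_mod R S) \<longleftrightarrow>
   (\<forall>s. f s \<in> carrier R) \<and> (\<forall>s. s \<notin> S \<longrightarrow> f s = \<zero>) \<and> finite {s. f s \<noteq> \<zero>}"
  by (simp add: free_mod_def)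

lemma free_mod_module: "module R (free_mod R S)"
proof -
  have supp_add: "finite {s. f s \<oplus> g s \<noteq> \<zero>}"
    if "finite {s. f s \<noteq> \<zero>}" "finite {s. g s \<noteq> \<zero>}" "\<forall>s. f s \<in> carrier R" for f g :: "'c \<Rightarrow> 'a"
    by (rule finite_subset[OF _ finite_UnI[OF that(1,2)]]) auto
  have supp_smult: "finite {s. a \<otimes> f s \<noteq> \<zero>}"
    if "finite {s. f s \<noteq> \<zero>}" "a \<in> carrier R" for f :: "'c \<Rightarrow> 'a" and a
    by (rule finite_subset[OF _ that(1)]) (use that(2) in auto)
  show ?thesis
  proof (rule moduleI)
    show "abelian_group (free_mod R S)"
    proof (rule abelian_groupI)
      show "\<exists>y\<in>carrier (free_mod R S). y \<oplus>\<^bsub>free_mod R S\<^esub> x = \<zero>\<^bsub>free_mod R S\<^esub>"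
        if "x \<in> carrier (free_mod R S)" for x
        using that supp_smult[of x "\<ominus> \<one>"]
        by (intro bexI[of _ "\<lambda>s. (\<ominus> \<one>) \<otimes> x s"])
          (auto simp: free_mod_carrier_iff l_minus l_neg)
    qed (auto simp: free_mod_carrier_iff supp_add fun_eq_iff a_ac)
  qed (auto simp: free_mod_carrier_iff supp_smult is_cring fun_eq_iff l_distr r_distr m_assoc)
qed

lemma free_gen_closed: "s \<in> S \<Longrightarrow> free_gen R s \<in> carrier (free_mod R S)"
  by (auto simp: free_mod_carrier_iff free_gen_def)

lemma free_mod_induct:
  assumes H: "submodule H R (free_mod R S)" and gen: "\<And>s. s \<in> S \<Longrightarrow> free_gen R s \<in> H"
    and f: "f \<in> carrier (free_mod R S)"
  shows "f \<in> H"
proof -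
  interpret F: rmodule R "free_mod R S" using free_mod_module by (rule rmoduleI)
  \<comment> \<open>Induction over a finite set containing the support: the coordinate at t is
    erased and added back as f t times a generator. If t lies outside S, this coordinate was zero
    from the start.\<close>
  have "f \<in> H" if "finite T" "f \<in> carrier (free_mod R S)" "{s. f s \<noteq> \<zero>} \<subseteq> T" for T and f
    using that
  proof (induct arbitrary: f)
    case empty
    hence "f = \<zero>\<^bsub>free_mod R S\<^esub>" by auto
    thus ?case using F.smD(2)[OF H] by simp
  next
    case (insert t T)
    have cl: "f s \<in> carrier R" for s using insert by (simp add: free_mod_carrier_iff)
    have "f(t := \<zero>) \<in> carrier (free_mod R S)"
    proof -
      have "finite {s. (f(t := \<zero>)) s \<noteq> \<zero>}"
        by (rule finite_subset[of _ "{s. f s \<noteq> \<zero>}"])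
          (use insert.prems(1) in \<open>auto simp: free_mod_carrier_iff\<close>)
      thus ?thesis using insert.prems(1) by (simp add: free_mod_carrier_iff)
    qed
    moreover have "{s. (f(t := \<zero>)) s \<noteq> \<zero>} \<subseteq> T" using insert.prems(2) by auto
    ultimately have 1: "f(t := \<zero>) \<in> H" by (rule insert.hyps(3))
    show ?case
    proof (cases "t \<in> S")
      case True
      have "f = f(t := \<zero>) \<oplus>\<^bsub>free_mod R S\<^esub> (f t \<odot>\<^bsub>free_mod R S\<^esub> free_gen R t)"
        using cl by (auto simp: free_gen_def)
      thus ?thesis using F.smD(3,4)[OF H] 1 gen[OF True] cl by metis
    next
      case False
      hence "f(t := \<zero>) = f" using insert.prems by (auto simp: free_mod_carrier_iff)
      thus ?thesis using 1 by simp
    qed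
  qed
  thus ?thesis using f by (auto simp: free_mod_carrier_iff)
qed

end

lemma dsum_mod_simps [simp]:
  "carrier (dsum_mod M N) = carrier M \<times> carrier N" "\<zero>\<^bsub>dsum_mod M N\<^esub> = (\<zero>\<^bsub>M\<^esub>, \<zero>\<^bsub>N\<^esub>)"
  "p \<oplus>\<^bsub>dsum_mod M N\<^esub> q = (fst p \<oplus>\<^bsub>M\<^esub> fst q, snd p \<oplus>\<^bsub>N\<^esub> snd q)"
  "a \<odot>\<^bsub>dsum_mod M N\<^esub> p = (a \<odot>\<^bsub>M\<^esub> fst p, a \<odot>\<^bsub>N\<^esub> snd p)"
  by (simp_all add: dsum_mod_def split: prod.splits)

lemma dsum_module:
  assumes "module R M" "module R N"
  shows "module R (dsum_mod M N)"
proof -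
  interpret M: rmodule R M using assms(1) by (rule rmoduleI)
  interpret N: rmodule R N using assms(2) by (rule rmoduleI)
  show ?thesis
  proof (rule moduleI)
    show "abelian_group (dsum_mod M N)"
    proof (rule abelian_groupI)
      show "\<exists>y\<in>carrier (dsum_mod M N). y \<oplus>\<^bsub>dsum_mod M N\<^esub> x = \<zero>\<^bsub>dsum_mod M N\<^esub>"
        if "x \<in> carrier (dsum_mod M N)" for x
        using that by (intro bexI[of _ "(\<ominus>\<^bsub>M\<^esub> fst x, \<ominus>\<^bsub>N\<^esub> snd x)"]) (auto simp: M.l_neg N.l_neg)
    qed (auto simp: M.a_ac N.a_ac)
  qed (auto simp: M.R.is_cring M.smult_l_distr N.smult_l_distr M.smult_r_distr N.smult_r_distr
      M.smult_assoc1 N.smult_assoc1)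
qed

lemma dsum_minus:
  assumes "module R M" "module R N" "p \<in> carrier (dsum_mod M N)" "q \<in> carrier (dsum_mod M N)"
  shows "p \<ominus>\<^bsub>dsum_mod M N\<^esub> q = (fst p \<ominus>\<^bsub>M\<^esub> fst q, snd p \<ominus>\<^bsub>N\<^esub> snd q)"
proof -
  interpret M: rmodule R M using assms(1) by (rule rmoduleI)
  interpret N: rmodule R N using assms(2) by (rule rmoduleI)
  interpret D: rmodule R "dsum_mod M N" using dsum_module assms(1,2) by (intro rmoduleI)
  interpret f: mod_homo R "dsum_mod M N" M fst
    by (intro mod_homoI mod_homI D.module_M M.module_M) auto
  interpret s: mod_homo R "dsum_mod M N" N snd
    by (intro mod_homoI mod_homI D.module_M N.module_M) auto
  show ?thesis using f.minus[OF assms(3,4)] s.minus[OF assms(3,4)] by (simp add: prod_eq_iff)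
qed

subsection \<open>Quotient modules\<close>

context rmodule
begin

lemma a_r_coset_iff:
  assumes K: "submodule K R M" and x: "x \<in> carrier M"
  shows "y \<in> K +>\<^bsub>M\<^esub> x \<longleftrightarrow> y \<in> carrier M \<and> y \<ominus>\<^bsub>M\<^esub> x \<in> K"
proof
  assume "y \<in> K +>\<^bsub>M\<^esub> x"
  then obtain k where k: "k \<in> K" "y = k \<oplus>\<^bsub>M\<^esub> x" by (auto simp: a_r_coset_def')
  thus "y \<in> carrier M \<and> y \<ominus>\<^bsub>M\<^esub> x \<in> K" using smD(1)[OF K k(1)] x by (simp add: add_minus_cancel)
next
  assume "y \<in> carrier M \<and> y \<ominus>\<^bsub>M\<^esub> x \<in> K"
  thus "y \<in> K +>\<^bsub>M\<^esub> x" using x unfolding a_r_coset_def'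
    by (auto intro!: bexI[of _ "y \<ominus>\<^bsub>M\<^esub> x"] simp: minus_add_cancel)
qed

lemma minus_self: "x \<in> carrier M \<Longrightarrow> x \<ominus>\<^bsub>M\<^esub> x = \<zero>\<^bsub>M\<^esub>"
  by (simp add: minus_eq_zero_iff)

lemma minus_zero: "x \<in> carrier M \<Longrightarrow> x \<ominus>\<^bsub>M\<^esub> \<zero>\<^bsub>M\<^esub> = x"
  by (metis M.zero_closed M.r_zero minus_add_cancel M.minus_closed)

lemma minus_trans: "x \<in> carrier M \<Longrightarrow> y \<in> carrier M \<Longrightarrow> z \<in> carrier M \<Longrightarrow>
   (x \<ominus>\<^bsub>M\<^esub> y) \<oplus>\<^bsub>M\<^esub> (y \<ominus>\<^bsub>M\<^esub> z) = x \<ominus>\<^bsub>M\<^esub> z"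
  by (metis M.minus_closed M.a_assoc a_minus_def minus_add_cancel M.a_inv_closed)

lemma minus_swap: "x \<in> carrier M \<Longrightarrow> y \<in> carrier M \<Longrightarrow> \<ominus>\<^bsub>M\<^esub> (x \<ominus>\<^bsub>M\<^esub> y) = y \<ominus>\<^bsub>M\<^esub> x"
  by (simp add: a_minus_def M.minus_add M.a_comm)

lemma a_r_coset_eq_iff:
  assumes K: "submodule K R M" and x: "x \<in> carrier M" and y: "y \<in> carrier M"
  shows "K +>\<^bsub>M\<^esub> x = K +>\<^bsub>M\<^esub> y \<longleftrightarrow> x \<ominus>\<^bsub>M\<^esub> y \<in> K"
proof
  assume "K +>\<^bsub>M\<^esub> x = K +>\<^bsub>M\<^esub> y"
  moreover have "x \<in> K +>\<^bsub>M\<^esub> x" using a_r_coset_iff[OF K x] x smD(2)[OF K] by (simp add: minus_self)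
  ultimately show "x \<ominus>\<^bsub>M\<^esub> y \<in> K" using a_r_coset_iff[OF K y] by simp
next
  assume xy: "x \<ominus>\<^bsub>M\<^esub> y \<in> K"
  have yx: "y \<ominus>\<^bsub>M\<^esub> x \<in> K" using smD(5)[OF K xy] x y by (simp add: minus_swap)
  show "K +>\<^bsub>M\<^esub> x = K +>\<^bsub>M\<^esub> y"
  proof (rule Set.set_eqI)
    fix z show "z \<in> K +>\<^bsub>M\<^esub> x \<longleftrightarrow> z \<in> K +>\<^bsub>M\<^esub> y"
      unfolding a_r_coset_iff[OF K x] a_r_coset_iff[OF K y]
      using smD(3)[OF K _ xy, of "z \<ominus>\<^bsub>M\<^esub> x"] smD(3)[OF K _ yx, of "z \<ominus>\<^bsub>M\<^esub> y"] x y
      by (auto simp: minus_trans)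
  qed
qed

lemma quot_mod_simps:
  "carrier (quot_mod M K) = (\<lambda>x. K +>\<^bsub>M\<^esub> x) ` carrier M" "\<zero>\<^bsub>quot_mod M K\<^esub> = K"
  by (auto simp: quot_mod_def A_RCOSETS_def')

lemma quot_mod_proj:
  assumes K: "submodule K R M"
  shows "module R (quot_mod M K)" "(\<lambda>x. K +>\<^bsub>M\<^esub> x) \<in> mod_hom R M (quot_mod M K)"
proof -
  let ?p = "\<lambda>x. K +>\<^bsub>M\<^esub> x"
  have add: "?p (x \<oplus>\<^bsub>M\<^esub> y) = ?p x \<oplus>\<^bsub>quot_mod M K\<^esub> ?p y" if [simp]: "x \<in> carrier M" "y \<in> carrier M" for x y
  proof -
    have "?p x <+>\<^bsub>M\<^esub> ?p y = ?p (x \<oplus>\<^bsub>M\<^esub> y)"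
    proof (rule Set.set_eqI, rule iffI)
      fix z assume "z \<in> ?p x <+>\<^bsub>M\<^esub> ?p y"
      then obtain u v where "u \<in> ?p x" "v \<in> ?p y" "z = u \<oplus>\<^bsub>M\<^esub> v" by (rule set_addE)
      thus "z \<in> ?p (x \<oplus>\<^bsub>M\<^esub> y)" using smD(3)[OF K]
        by (auto simp: a_r_coset_iff[OF K] add_minus_add)
    next
      fix z assume "z \<in> ?p (x \<oplus>\<^bsub>M\<^esub> y)"
      then obtain k where k: "k \<in> K" "z = k \<oplus>\<^bsub>M\<^esub> (x \<oplus>\<^bsub>M\<^esub> y)" by (auto simp: a_r_coset_def')
      have [simp]: "k \<in> carrier M" using smD(1)[OF K] k by simp
      have "z = (k \<oplus>\<^bsub>M\<^esub> x) \<oplus>\<^bsub>M\<^esub> y" using k by (simp add: M.a_assoc)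
      moreover have "k \<oplus>\<^bsub>M\<^esub> x \<in> ?p x" using k by (auto simp: a_r_coset_def')
      moreover have "y \<in> ?p y" using smD(2)[OF K] by (simp add: a_r_coset_iff[OF K] minus_self)
      ultimately show "z \<in> ?p x <+>\<^bsub>M\<^esub> ?p y" by (auto intro: set_addI)
    qed
    thus ?thesis by (simp add: quot_mod_def)
  qed
  have smult: "?p (a \<odot>\<^bsub>M\<^esub> x) = a \<odot>\<^bsub>quot_mod M K\<^esub> ?p x" if [simp]: "a \<in> carrier R" "x \<in> carrier M" for a x
  proof -
    have "?p (a \<odot>\<^bsub>M\<^esub> y) = ?p (a \<odot>\<^bsub>M\<^esub> x)" if "y \<in> ?p x" for y
    proof -
      have y: "y \<in> carrier M" "y \<ominus>\<^bsub>M\<^esub> x \<in> K" using that by (auto simp: a_r_coset_iff[OF K])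
      show ?thesis using smD(4)[OF K _ y(2), of a] y
        by (simp add: a_r_coset_eq_iff[OF K] smult_minus_distr)
    qed
    moreover have "x \<in> ?p x" using smD(2)[OF K] by (simp add: a_r_coset_iff[OF K] minus_self)
    ultimately have "(\<Union>y\<in>?p x. ?p (a \<odot>\<^bsub>M\<^esub> y)) = ?p (a \<odot>\<^bsub>M\<^esub> x)" by blast
    thus ?thesis by (simp add: quot_mod_def)
  qed
  have "?p \<zero>\<^bsub>M\<^esub> = K"
    by (rule Set.set_eqI) (use smD(1)[OF K] in \<open>auto simp: a_r_coset_iff[OF K] minus_zero\<close>)
  hence zero: "?p \<zero>\<^bsub>M\<^esub> = \<zero>\<^bsub>quot_mod M K\<^esub>" by (simp add: quot_mod_simps)
  show "module R (quot_mod M K)" "?p \<in> mod_hom R M (quot_mod M K)"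
    using module_transport[OF module_M quot_mod_simps(1)[symmetric] add smult zero] by auto
qed

lemma quot_mod_homo: "submodule K R M \<Longrightarrow> mod_homo R M (quot_mod M K) (\<lambda>x. K +>\<^bsub>M\<^esub> x)"
  using quot_mod_proj module_M by (intro mod_homoI)

lemma coset_eq_zero_iff:
  assumes K: "submodule K R M" and x: "x \<in> carrier M"
  shows "K +>\<^bsub>M\<^esub> x = K \<longleftrightarrow> x \<in> K"
proof -
  interpret q: mod_homo R M "quot_mod M K" "\<lambda>x. K +>\<^bsub>M\<^esub> x" by (rule quot_mod_homo[OF K])
  have "K +>\<^bsub>M\<^esub> \<zero>\<^bsub>M\<^esub> = K" using q.zero by (simp add: quot_mod_simps)
  thus ?thesis using a_r_coset_eq_iff[OF K x, of "\<zero>\<^bsub>M\<^esub>"] x by (simp add: minus_zero)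
qed

subsection \<open>Submodules as modules\<close>

lemma restrict_module: "submodule H R M \<Longrightarrow> module R (M\<lparr>carrier := H\<rparr>)"
  using submodule.submodule_is_module module_M by blast

lemma submodule_restrict_iff:
  assumes H: "submodule H R M"
  shows "submodule A R (M\<lparr>carrier := H\<rparr>) \<longleftrightarrow> submodule A R M \<and> A \<subseteq> H"
proof -
  interpret H: rmodule R "M\<lparr>carrier := H\<rparr>" using restrict_module[OF H] by (rule rmoduleI)
  show ?thesis using smD(1)[OF H] unfolding H.submodule_iff submodule_iff by auto
qed

lemma mod_span_restrict:
  assumes H: "submodule H R M" and "A \<subseteq> H"
  shows "mod_span R (M\<lparr>carrier := H\<rparr>) A = mod_span R M A"
proof -
  interpret H: rmodule R "M\<lparr>carrier := H\<rparr>" using restrict_module[OF H] by (rule rmoduleI)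
  have "A \<subseteq> carrier M" using assms smD(1)[OF H] by auto
  note sm = mod_span_sm[OF this]
  have "mod_span R M A \<subseteq> H" using assms by (intro mod_span_least)
  hence "submodule (mod_span R M A) R (M\<lparr>carrier := H\<rparr>)" using sm submodule_restrict_iff[OF H] by simp
  hence "mod_span R (M\<lparr>carrier := H\<rparr>) A \<subseteq> mod_span R M A"
    by (intro H.mod_span_least mod_span_incl)
  moreover have "submodule (mod_span R (M\<lparr>carrier := H\<rparr>) A) R M"
    using H.mod_span_sm[of A] assms submodule_restrict_iff[OF H] by simp
  hence "mod_span R M A \<subseteq> mod_span R (M\<lparr>carrier := H\<rparr>) A"
    by (intro mod_span_least H.mod_span_incl)
  ultimately show ?thesis by auto
qed

lemma restrict_incl_hom: "submodule H R M \<Longrightarrow> (\<lambda>x. x) \<in> mod_hom R (M\<lparr>carrier := H\<rparr>) M"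
  by (rule mod_homI) (simp_all add: smD(1))

lemma mod_length_eq_rlen: "mod_length R M = rlen R M (carrier M) {\<zero>\<^bsub>M\<^esub>}"
proof -
  have "(\<forall>i\<le>n. submodule (c i) R M) \<longleftrightarrow>
    (\<forall>i\<le>n. submodule (c i) R M \<and> {\<zero>\<^bsub>M\<^esub>} \<subseteq> c i \<and> c i \<subseteq> carrier M)" for c and n :: nat
    unfolding submodule_iff by auto
  thus ?thesis unfolding mod_length_def rlen_def has_chain_def by simp
qed

end

lemma mod_hom_restrict_iff:
  "f \<in> mod_hom R M (N\<lparr>carrier := H\<rparr>) \<longleftrightarrow> f \<in> carrier M \<rightarrow> H \<and>
    (\<forall>x\<in>carrier M. \<forall>y\<in>carrier M. f (x \<oplus>\<^bsub>M\<^esub> y) = f x \<oplus>\<^bsub>N\<^esub> f y) \<and>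
     (\<forall>a\<in>carrier R. \<forall>x\<in>carrier M. f (a \<odot>\<^bsub>M\<^esub> x) = a \<odot>\<^bsub>N\<^esub> f x)"
  by (simp add: mod_hom_def)

text \<open>Connects the length of a quotient of a submodule, the shape in which \<open>Tor1\<close>
  is defined, with relative length: \<open>rlen_eq\<close> is applied along the projection from A
  and along the inclusion of A.\<close>

lemma (in rmodule) mod_length_quot_restrict:
  assumes A: "submodule A R M" and B: "submodule B R M" and "B \<subseteq> A"
  shows "mod_length R (quot_mod (M\<lparr>carrier := A\<rparr>) B) = rlen R M A B"
proof -
  let ?A = "M\<lparr>carrier := A\<rparr>"
  interpret A: rmodule R ?A using restrict_module[OF A] by (rule rmoduleI)
  have B': "submodule B R ?A" using assms submodule_restrict_iff by auto
  interpret q: mod_homo R ?A "quot_mod ?A B" "\<lambda>x. B +>\<^bsub>?A\<^esub> x" by (rule A.quot_mod_homo[OF B'])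
  interpret i: mod_homo R ?A M "\<lambda>x. x"
    using restrict_incl_hom[OF A] A.module_M module_M by (intro mod_homoI)
  have "rlen R ?A A B = rlen R (quot_mod ?A B) (carrier (quot_mod ?A B)) {\<zero>\<^bsub>quot_mod ?A B\<^esub>}"
  proof (rule q.rlen_eq)
    show "submodule A R ?A" using A.carrier_is_submodule by simp
    show "submodule (carrier (quot_mod ?A B)) R (quot_mod ?A B)" by (rule q.N.carrier_is_submodule)
    show "submodule {\<zero>\<^bsub>quot_mod ?A B\<^esub>} R (quot_mod ?A B)" by (rule q.N.sm_zero)
    show "{\<zero>\<^bsub>quot_mod ?A B\<^esub>} \<subseteq> carrier (quot_mod ?A B)" by simp
    show "(\<lambda>x. B +>\<^bsub>?A\<^esub> x) ` A <+>\<^bsub>quot_mod ?A B\<^esub> {\<zero>\<^bsub>quot_mod ?A B\<^esub>} = carrier (quot_mod ?A B)"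
      using A.quot_mod_simps(1)[of B] q.N.r_zero by (auto simp: set_add_def')
    show "{x \<in> A. B +>\<^bsub>?A\<^esub> x \<in> {\<zero>\<^bsub>quot_mod ?A B\<^esub>}} = B"
      using A.coset_eq_zero_iff[OF B'] A.quot_mod_simps(2)[of B] \<open>B \<subseteq> A\<close> by auto
  qed
  moreover have "rlen R ?A A B = rlen R M A B"
  proof (rule i.rlen_eq)
    show "submodule A R ?A" using A.carrier_is_submodule by simp
    show "(\<lambda>x. x) ` A <+>\<^bsub>M\<^esub> B = A"
      using set_add_upper1[OF A B] set_add_least[OF A _ \<open>B \<subseteq> A\<close>, of A] by auto
  qed (use assms in auto)
  ultimately show ?thesis using q.N.mod_length_eq_rlen by simp
qed

section \<open>Linear combinations\<close>

text \<open>Extends \<open>free_cover\<close> to an arbitrary family w of elements, so that finite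
  presentations and presentations adapted to an extension are covered together with the functorial
  one.\<close>

definition lin :: "('a, 'k) ring_scheme \<Rightarrow> ('a, 'b) module \<Rightarrow> ('s \<Rightarrow> 'b) \<Rightarrow> ('s \<Rightarrow> 'a) \<Rightarrow> 'b" where
  "lin R M w f = (\<Oplus>\<^bsub>M\<^esub>s\<in>{s. f s \<noteq> \<zero>\<^bsub>R\<^esub>}. f s \<odot>\<^bsub>M\<^esub> w s)"

lemma free_cover_eq_lin: "free_cover R M = lin R M (\<lambda>x. x)"
  by (simp add: free_cover_def lin_def fun_eq_iff)

context rmodule
begin

lemma lin_superset:
  assumes "f \<in> carrier (free_mod R S)" "\<And>s. s \<in> S \<Longrightarrow> w s \<in> carrier M"
    "finite T" "{s. f s \<noteq> \<zero>} \<subseteq> T" "T \<subseteq> S"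
  shows "lin R M w f = (\<Oplus>\<^bsub>M\<^esub>s\<in>T. f s \<odot>\<^bsub>M\<^esub> w s)"
  unfolding lin_def
  using assms by (intro M.add.finprod_mono_neutral_cong_left) (auto simp: R.free_mod_carrier_iff)

lemma supp_subset: "f \<in> carrier (free_mod R S) \<Longrightarrow> {s. f s \<noteq> \<zero>} \<subseteq> S \<and> finite {s. f s \<noteq> \<zero>}"
  by (auto simp: R.free_mod_carrier_iff)

lemma lin_hom:
  assumes w: "\<And>s. s \<in> S \<Longrightarrow> w s \<in> carrier M"
  shows "lin R M w \<in> mod_hom R (free_mod R S) M"
proof (rule mod_homI)
  interpret F: rmodule R "free_mod R S" using R.free_mod_module by (rule rmoduleI)
  show "lin R M w f \<in> carrier M" if "f \<in> carrier (free_mod R S)" for f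
    using that w unfolding lin_def by (intro M.finsum_closed) (auto simp: R.free_mod_carrier_iff)
  show "lin R M w (f \<oplus>\<^bsub>free_mod R S\<^esub> g) = lin R M w f \<oplus>\<^bsub>M\<^esub> lin R M w g"
    if f: "f \<in> carrier (free_mod R S)" and g: "g \<in> carrier (free_mod R S)" for f g
  proof -
    let ?T = "{s. f s \<noteq> \<zero>} \<union> {s. g s \<noteq> \<zero>}"
    have T: "finite ?T" "?T \<subseteq> S" using f g supp_subset by auto
    have fg: "f \<oplus>\<^bsub>free_mod R S\<^esub> g \<in> carrier (free_mod R S)" using f g F.a_closed by blast
    have cl: "f s \<in> carrier R" "g s \<in> carrier R" for s using f g by (simp_all add: R.free_mod_carrier_iff)
    have "lin R M w (f \<oplus>\<^bsub>free_mod R S\<^esub> g) = (\<Oplus>\<^bsub>M\<^esub>s\<in>?T. (f \<oplus>\<^bsub>free_mod R S\<^esub> g) s \<odot>\<^bsub>M\<^esub> w s)"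
      using T w fg by (intro lin_superset) auto
    also have "\<dots> = (\<Oplus>\<^bsub>M\<^esub>s\<in>?T. f s \<odot>\<^bsub>M\<^esub> w s \<oplus>\<^bsub>M\<^esub> g s \<odot>\<^bsub>M\<^esub> w s)"
      by (rule M.finsum_cong') (use T w cl in \<open>auto simp: smult_l_distr\<close>)
    also have "\<dots> = (\<Oplus>\<^bsub>M\<^esub>s\<in>?T. f s \<odot>\<^bsub>M\<^esub> w s) \<oplus>\<^bsub>M\<^esub> (\<Oplus>\<^bsub>M\<^esub>s\<in>?T. g s \<odot>\<^bsub>M\<^esub> w s)"
      by (rule M.finsum_addf) (use T w cl in auto)
    also have "\<dots> = lin R M w f \<oplus>\<^bsub>M\<^esub> lin R M w g"
      using lin_superset[OF f w T(1) _ T(2)] lin_superset[OF g w T(1) _ T(2)] by simp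
    finally show ?thesis .
  qed
  show "lin R M w (a \<odot>\<^bsub>free_mod R S\<^esub> f) = a \<odot>\<^bsub>M\<^esub> lin R M w f"
    if a: "a \<in> carrier R" and f: "f \<in> carrier (free_mod R S)" for a f
  proof -
    let ?T = "{s. f s \<noteq> \<zero>}"
    have T: "finite ?T" "?T \<subseteq> S" using f supp_subset by auto
    have af: "a \<odot>\<^bsub>free_mod R S\<^esub> f \<in> carrier (free_mod R S)" using a f F.smult_closed by blast
    have cl: "f s \<in> carrier R" for s using f by (simp add: R.free_mod_carrier_iff)
    have "lin R M w (a \<odot>\<^bsub>free_mod R S\<^esub> f) = (\<Oplus>\<^bsub>M\<^esub>s\<in>?T. (a \<odot>\<^bsub>free_mod R S\<^esub> f) s \<odot>\<^bsub>M\<^esub> w s)"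
      using T w af a by (intro lin_superset) auto
    also have "\<dots> = (\<Oplus>\<^bsub>M\<^esub>s\<in>?T. a \<odot>\<^bsub>M\<^esub> (f s \<odot>\<^bsub>M\<^esub> w s))"
      by (rule M.finsum_cong') (use T w cl a in \<open>auto simp: smult_assoc1\<close>)
    also have "\<dots> = a \<odot>\<^bsub>M\<^esub> lin R M w f"
      unfolding lin_def by (rule finsum_smult_ldistr[symmetric]) (use T w cl a in auto)
    finally show ?thesis .
  qed
qed

lemma lin_gen:
  assumes "w s \<in> carrier M"
  shows "lin R M w (free_gen R s) = w s"
\<comment> \<open>In the zero ring the support of \<open>free_gen\<close> is empty and the sum has
  no term; there w s is zero as well.\<close>
proof (cases "\<one> = \<zero>")
  case True
  hence "w s = \<zero>\<^bsub>M\<^esub>" using assms by (metis smult_l_null smult_one)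
  thus ?thesis using True by (simp add: lin_def free_gen_def)
next
  case False
  hence "{t. free_gen R s t \<noteq> \<zero>} = {s}" by (auto simp: free_gen_def)
  thus ?thesis using assms by (simp add: lin_def free_gen_def)
qed

lemma lin_homo: "(\<And>s. s \<in> S \<Longrightarrow> w s \<in> carrier M) \<Longrightarrow> mod_homo R (free_mod R S) M (lin R M w)"
  using R.free_mod_module module_M by (intro mod_homoI lin_hom) auto

lemma free_hom_eqI:
  assumes "f \<in> mod_hom R (free_mod R S) M" "g \<in> mod_hom R (free_mod R S) M"
    "\<And>s. s \<in> S \<Longrightarrow> f (free_gen R s) = g (free_gen R s)" "x \<in> carrier (free_mod R S)"
  shows "f x = g x"
proof -
  interpret f: mod_homo R "free_mod R S" M f using assms R.free_mod_module module_M by (intro mod_homoI)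
  interpret g: mod_homo R "free_mod R S" M g using assms R.free_mod_module module_M by (intro mod_homoI)
  have "submodule {x \<in> carrier (free_mod R S). f x = g x} R (free_mod R S)"
  proof (rule f.M.smI)
    fix a x assume "a \<in> carrier R" "x \<in> {x \<in> carrier (free_mod R S). f x = g x}"
    thus "a \<odot>\<^bsub>free_mod R S\<^esub> x \<in> {x \<in> carrier (free_mod R S). f x = g x}"
      using f.M.smult_closed f.smult g.smult by auto
  next
    fix x y assume "x \<in> {x \<in> carrier (free_mod R S). f x = g x}" "y \<in> {x \<in> carrier (free_mod R S). f x = g x}"
    thus "x \<oplus>\<^bsub>free_mod R S\<^esub> y \<in> {x \<in> carrier (free_mod R S). f x = g x}"
      using f.M.a_closed f.add g.add by auto
  qed (use f.zero g.zero f.M.zero_closed in auto)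
  hence "x \<in> {x \<in> carrier (free_mod R S). f x = g x}"
    by (rule R.free_mod_induct) (use assms R.free_gen_closed in auto)
  thus ?thesis by simp
qed

lemma lin_image: 
  assumes "\<And>s. s \<in> S \<Longrightarrow> w s \<in> carrier M"
  shows "lin R M w ` carrier (free_mod R S) = mod_span R M (w ` S)"
proof
  interpret l: mod_homo R "free_mod R S" M "lin R M w" using assms by (rule lin_homo)
  have wS: "w ` S \<subseteq> carrier M" using assms by auto
  show "mod_span R M (w ` S) \<subseteq> lin R M w ` carrier (free_mod R S)"
  proof (rule mod_span_least)
    show "submodule (lin R M w ` carrier (free_mod R S)) R M"
      using l.M.carrier_is_submodule by (rule l.image_sm)
    show "w ` S \<subseteq> lin R M w ` carrier (free_mod R S)"
    proof clarify
      fix s assume s: "s \<in> S"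
      show "w s \<in> lin R M w ` carrier (free_mod R S)"
        using lin_gen[of w s, OF assms[OF s], symmetric] R.free_gen_closed[OF s] by (rule image_eqI)
    qed
  qed
  show "lin R M w ` carrier (free_mod R S) \<subseteq> mod_span R M (w ` S)"
  proof clarify
    fix f assume f: "f \<in> carrier (free_mod R S)"
    have "f \<in> {x \<in> carrier (free_mod R S). lin R M w x \<in> mod_span R M (w ` S)}"
    proof (rule R.free_mod_induct[OF _ _ f])
      show "submodule {x \<in> carrier (free_mod R S). lin R M w x \<in> mod_span R M (w ` S)} R (free_mod R S)"
        using l.vimage_sm l.M.carrier_is_submodule mod_span_sm[OF wS] by blast
      fix s assume s: "s \<in> S"
      hence "w s \<in> mod_span R M (w ` S)" using mod_span_incl[of "w ` S"] by auto
      thus "free_gen R s \<in> {x \<in> carrier (free_mod R S). lin R M w x \<in> mod_span R M (w ` S)}"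
        using s lin_gen[of w s, OF assms[OF s]] R.free_gen_closed by auto
    qed
    thus "lin R M w f \<in> mod_span R M (w ` S)" by simp
  qed
qed

end

section \<open>Projectivity of free modules and factorisation through surjections\<close>

lemma free_lift:
  assumes L: "module R L" and M: "module R M" and p: "p \<in> mod_hom R L M" and onto: "carrier M \<subseteq> p ` carrier L"
    and f: "f \<in> mod_hom R (free_mod R S) M"
  obtains u where "u \<in> mod_hom R (free_mod R S) L" "\<And>x. x \<in> carrier (free_mod R S) \<Longrightarrow> p (u x) = f x"
proof -
  interpret L: rmodule R L using L by (rule rmoduleI)
  interpret M: rmodule R M using M by (rule rmoduleI)
  have "\<exists>y. y \<in> carrier L \<and> p y = f (free_gen R s)" if "s \<in> S" for s
    using onto mod_homD(1)[OF f L.R.free_gen_closed[OF that]] by force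
  then obtain w where w: "\<And>s. s \<in> S \<Longrightarrow> w s \<in> carrier L \<and> p (w s) = f (free_gen R s)" by metis
  have hom: "lin R L w \<in> mod_hom R (free_mod R S) L" using w by (intro L.lin_hom) auto
  moreover have "(p \<circ> lin R L w) x = f x" if "x \<in> carrier (free_mod R S)" for x
  proof (rule M.free_hom_eqI[OF _ f _ that])
    show "p \<circ> lin R L w \<in> mod_hom R (free_mod R S) M" using hom p by (rule mod_hom_comp)
    show "(p \<circ> lin R L w) (free_gen R s) = f (free_gen R s)" if "s \<in> S" for s
      using w[OF that] L.lin_gen[of w s] by simp
  qed
  ultimately show ?thesis using that by simp
qed

text \<open>The homomorphism theorem for a surjection q that is not literally a quotient map: the
  factor picks a preimage by choice, and the kernel condition makes the value independent of it. It
  supplies the maps between tensor products and those between equivalent extensions.\<close>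

lemma hom_factor:
  assumes D: "module R D" and L: "module R L" and Y: "module R Y"
    and q: "q \<in> mod_hom R D L" and onto: "carrier L \<subseteq> q ` carrier D" and r: "r \<in> mod_hom R D Y"
    and ker: "\<And>x. x \<in> carrier D \<Longrightarrow> q x = \<zero>\<^bsub>L\<^esub> \<Longrightarrow> r x = \<zero>\<^bsub>Y\<^esub>"
  obtains \<phi> where "\<phi> \<in> mod_hom R L Y" "\<And>x. x \<in> carrier D \<Longrightarrow> \<phi> (q x) = r x"
proof -
  interpret q: mod_homo R D L q using assms by (intro mod_homoI)
  interpret r: mod_homo R D Y r using assms by (intro mod_homoI)
  have wd: "r x = r y" if "x \<in> carrier D" "y \<in> carrier D" "q x = q y" for x y
  proof -
    have "q (x \<ominus>\<^bsub>D\<^esub> y) = \<zero>\<^bsub>L\<^esub>" using that q.closed by (simp add: q.minus q.N.minus_eq_zero_iff)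
    hence "r (x \<ominus>\<^bsub>D\<^esub> y) = \<zero>\<^bsub>Y\<^esub>" using ker that by simp
    thus ?thesis using that r.closed by (simp add: r.minus r.N.minus_eq_zero_iff)
  qed
  define \<phi> where "\<phi> = (\<lambda>z. r (SOME x. x \<in> carrier D \<and> q x = z))"
  have \<phi>: "\<phi> (q x) = r x" if "x \<in> carrier D" for x
  proof -
    have "(SOME y. y \<in> carrier D \<and> q y = q x) \<in> carrier D \<and> q (SOME y. y \<in> carrier D \<and> q y = q x) = q x"
      by (rule someI[of _ x]) (use that in simp)
    thus ?thesis unfolding \<phi>_def using wd that by blast
  qed
  have "\<phi> \<in> mod_hom R L Y"
  proof (rule mod_homI)
    fix x assume "x \<in> carrier L"
    then obtain x' where x': "x' \<in> carrier D" "x = q x'" using onto by auto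
    show "\<phi> x \<in> carrier Y" using x' \<phi> r.closed by simp
    show "\<phi> (a \<odot>\<^bsub>L\<^esub> x) = a \<odot>\<^bsub>Y\<^esub> \<phi> x" if "a \<in> carrier R" for a
      using \<phi>[of "a \<odot>\<^bsub>D\<^esub> x'"] \<phi>[of x'] x' that by (simp add: q.smult r.smult)
    fix y assume "y \<in> carrier L"
    then obtain y' where y': "y' \<in> carrier D" "y = q y'" using onto by auto
    show "\<phi> (x \<oplus>\<^bsub>L\<^esub> y) = \<phi> x \<oplus>\<^bsub>Y\<^esub> \<phi> y"
      using \<phi>[of "x' \<oplus>\<^bsub>D\<^esub> y'"] \<phi>[of x'] \<phi>[of y'] x' y' by (simp add: q.add r.add)
  qed
  thus ?thesis using \<phi> that by blast
qed

section \<open>Multiplication by ideals\<close>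

definition imul :: "('a, 'k) ring_scheme \<Rightarrow> ('a, 'b) module \<Rightarrow> 'a set \<Rightarrow> 'b set \<Rightarrow> 'b set" where
  "imul R M J H = mod_span R M {a \<odot>\<^bsub>M\<^esub> x | a x. a \<in> J \<and> x \<in> H}"

context rmodule
begin

lemma imul_gens: "J \<subseteq> carrier R \<Longrightarrow> H \<subseteq> carrier M \<Longrightarrow> {a \<odot>\<^bsub>M\<^esub> x | a x. a \<in> J \<and> x \<in> H} \<subseteq> carrier M"
  by auto

lemma imul_sm: "J \<subseteq> carrier R \<Longrightarrow> H \<subseteq> carrier M \<Longrightarrow> submodule (imul R M J H) R M"
  unfolding imul_def by (intro mod_span_sm imul_gens)

lemma imul_incl: "a \<in> J \<Longrightarrow> x \<in> H \<Longrightarrow> a \<odot>\<^bsub>M\<^esub> x \<in> imul R M J H"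
  unfolding imul_def by (rule subsetD[OF mod_span_incl]) auto

lemma imul_least: "submodule K R M \<Longrightarrow> (\<And>a x. a \<in> J \<Longrightarrow> x \<in> H \<Longrightarrow> a \<odot>\<^bsub>M\<^esub> x \<in> K) \<Longrightarrow> imul R M J H \<subseteq> K"
  unfolding imul_def by (rule mod_span_least) auto

lemma imul_mono:
  assumes "J \<subseteq> J'" "H \<subseteq> H'" "J' \<subseteq> carrier R" "H' \<subseteq> carrier M"
  shows "imul R M J H \<subseteq> imul R M J' H'"
proof (rule imul_least)
  show "submodule (imul R M J' H') R M" using assms by (intro imul_sm)
  show "a \<odot>\<^bsub>M\<^esub> x \<in> imul R M J' H'" if "a \<in> J" "x \<in> H" for a x
    using that assms by (intro imul_incl) auto
qed

lemma imul_le: "J \<subseteq> carrier R \<Longrightarrow> submodule H R M \<Longrightarrow> imul R M J H \<subseteq> H"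
  by (rule imul_least) (auto intro: smD(4))

lemma imul_prod:
  assumes I: "ideal I R" and J: "ideal J R" and H: "H \<subseteq> carrier M"
  shows "imul R M (ideal_prod R I J) H = imul R M I (imul R M J H)"
proof
  have IR: "I \<subseteq> carrier R" "J \<subseteq> carrier R" using ideal.Icarr[OF I] ideal.Icarr[OF J] by auto
  have IJ: "ideal_prod R I J \<subseteq> carrier R" using I J by (rule R.ideal_prod_in_carrier)
  have JH: "submodule (imul R M J H) R M" using IR H by (intro imul_sm)
  have JHc: "imul R M J H \<subseteq> carrier M" using smD(1)[OF JH] by auto
  have sm: "submodule (imul R M I (imul R M J H)) R M" using IR JHc by (intro imul_sm)
  show "imul R M (ideal_prod R I J) H \<subseteq> imul R M I (imul R M J H)"
  proof (rule imul_least[OF sm])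
    fix a x assume "a \<in> ideal_prod R I J" and x: "x \<in> H"
    thus "a \<odot>\<^bsub>M\<^esub> x \<in> imul R M I (imul R M J H)"
    proof (induct a)
      case (prod i j)
      have "(i \<otimes> j) \<odot>\<^bsub>M\<^esub> x = i \<odot>\<^bsub>M\<^esub> (j \<odot>\<^bsub>M\<^esub> x)" using prod x IR H by (intro smult_assoc1) auto
      thus ?case using prod x by (simp add: imul_incl)
    next
      case (sum s t)
      have "(s \<oplus> t) \<odot>\<^bsub>M\<^esub> x = s \<odot>\<^bsub>M\<^esub> x \<oplus>\<^bsub>M\<^esub> t \<odot>\<^bsub>M\<^esub> x" using sum x IJ H by (intro smult_l_distr) auto
      thus ?case using sum x smD(3)[OF sm] by simp
    qed
  qed
  have sm2: "submodule (imul R M (ideal_prod R I J) H) R M" using IJ H by (intro imul_sm)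
  show "imul R M I (imul R M J H) \<subseteq> imul R M (ideal_prod R I J) H"
  proof (rule imul_least[OF sm2])
    fix a y assume a: "a \<in> I" and y: "y \<in> imul R M J H"
    have ac: "a \<in> carrier R" using a IR by auto
    interpret a: mod_homo R M M "\<lambda>x. a \<odot>\<^bsub>M\<^esub> x" using ac by (rule smult_homo)
    \<comment> \<open>For fixed a the elements that a multiplies into (IJ)H form a submodule, so
      only the generators b x of JH have to be examined.\<close>
    have "imul R M J H \<subseteq> {y \<in> carrier M. a \<odot>\<^bsub>M\<^esub> y \<in> imul R M (ideal_prod R I J) H}"
    proof (rule imul_least)
      show "submodule {y \<in> carrier M. a \<odot>\<^bsub>M\<^esub> y \<in> imul R M (ideal_prod R I J) H} R M"
        using a.vimage_sm[OF carrier_is_submodule sm2] .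
      fix b x assume b: "b \<in> J" "x \<in> H"
      hence c: "b \<in> carrier R" "x \<in> carrier M" using IR H by auto
      have "a \<odot>\<^bsub>M\<^esub> (b \<odot>\<^bsub>M\<^esub> x) = (a \<otimes> b) \<odot>\<^bsub>M\<^esub> x" using c ac by (simp add: smult_assoc1)
      also have "\<dots> \<in> imul R M (ideal_prod R I J) H"
        using ideal_prod.prod[of a I b J R] a b by (intro imul_incl)
      finally show "b \<odot>\<^bsub>M\<^esub> x \<in> {y \<in> carrier M. a \<odot>\<^bsub>M\<^esub> y \<in> imul R M (ideal_prod R I J) H}"
        using c by simp
    qed
    thus "a \<odot>\<^bsub>M\<^esub> y \<in> imul R M (ideal_prod R I J) H" using y by auto
  qed
qed

end

lemma (in mod_homo) imul_image:
  assumes "J \<subseteq> carrier R" "H \<subseteq> carrier M"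
  shows "f ` imul R M J H = imul R N J (f ` H)"
proof -
  have "f ` {a \<odot>\<^bsub>M\<^esub> x | a x. a \<in> J \<and> x \<in> H} = {a \<odot>\<^bsub>N\<^esub> y | a y. a \<in> J \<and> y \<in> f ` H}"
  proof (rule Set.set_eqI, rule iffI)
    fix z assume "z \<in> f ` {a \<odot>\<^bsub>M\<^esub> x | a x. a \<in> J \<and> x \<in> H}"
    then obtain a x where "a \<in> J" "x \<in> H" "z = f (a \<odot>\<^bsub>M\<^esub> x)" by auto
    moreover have "f (a \<odot>\<^bsub>M\<^esub> x) = a \<odot>\<^bsub>N\<^esub> f x" using calculation assms by (intro smult) auto
    ultimately show "z \<in> {a \<odot>\<^bsub>N\<^esub> y | a y. a \<in> J \<and> y \<in> f ` H}" by auto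
  next
    fix z assume "z \<in> {a \<odot>\<^bsub>N\<^esub> y | a y. a \<in> J \<and> y \<in> f ` H}"
    then obtain a x where ax: "a \<in> J" "x \<in> H" "z = a \<odot>\<^bsub>N\<^esub> f x" by auto
    moreover have "f (a \<odot>\<^bsub>M\<^esub> x) = a \<odot>\<^bsub>N\<^esub> f x" using calculation assms by (intro smult) auto
    ultimately have "z = f (a \<odot>\<^bsub>M\<^esub> x)" by simp
    thus "z \<in> f ` {a \<odot>\<^bsub>M\<^esub> x | a x. a \<in> J \<and> x \<in> H}" using ax by blast
  qed
  thus ?thesis unfolding imul_def using span_image[OF M.imul_gens[OF assms]] by simp
qed

section \<open>Noetherian modules\<close>

text \<open>The ascending chain condition for those submodules of M that lie in a set K. It can be
  built up coordinate by coordinate inside one free module, without turning K into a module of its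
  own.\<close>

definition noeth_on :: "('a, 'k) ring_scheme \<Rightarrow> ('a, 'b) module \<Rightarrow> 'b set \<Rightarrow> bool" where
  "noeth_on R M K \<longleftrightarrow> (\<forall>c :: nat \<Rightarrow> 'b set.
     (\<forall>i. submodule (c i) R M) \<longrightarrow> (\<forall>i. c i \<subseteq> K) \<longrightarrow> (\<forall>i. c i \<subseteq> c (Suc i)) \<longrightarrow> (\<exists>N. \<forall>n\<ge>N. c n = c N))"

lemma noeth_onD:
  assumes "noeth_on R M K" "\<And>i. submodule (c i) R M" "\<And>i. c i \<subseteq> K" "\<And>i. c i \<subseteq> c (Suc i)"
  shows "\<exists>N. \<forall>n\<ge>N. c n = c N"
proof -
  have "(\<forall>i. submodule (c i) R M) \<longrightarrow> (\<forall>i. c i \<subseteq> K) \<longrightarrow> (\<forall>i. c i \<subseteq> c (Suc i)) \<longrightarrow> (\<exists>N. \<forall>n\<ge>N. c n = c N)"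
    using assms(1) unfolding noeth_on_def by (rule spec)
  thus ?thesis using assms(2-4) by simp
qed

lemma noeth_on_subset: "noeth_on R M K \<Longrightarrow> K' \<subseteq> K \<Longrightarrow> noeth_on R M K'"
  unfolding noeth_on_def by (meson order_trans)

lemma noeth_max:
  assumes "noeth_on R M K" "S \<noteq> {}" and S: "\<And>H. H \<in> S \<Longrightarrow> submodule H R M" "\<And>H. H \<in> S \<Longrightarrow> H \<subseteq> K"
  obtains B where "B \<in> S" "\<And>B'. B' \<in> S \<Longrightarrow> B \<subseteq> B' \<Longrightarrow> B' = B"
proof (rule ccontr)
  assume *: "\<not> thesis"
  have "\<exists>f :: nat \<Rightarrow> _. \<forall>n. f n \<in> S \<and> f n \<subset> f (Suc n)"
  proof (rule dependent_nat_choice)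
    show "\<exists>x. x \<in> S" using assms(2) by auto
    show "\<exists>y. y \<in> S \<and> x \<subset> y" if "x \<in> S" for x
      using that * \<open>\<And>B. B \<in> S \<Longrightarrow> (\<And>B'. B' \<in> S \<Longrightarrow> B \<subseteq> B' \<Longrightarrow> B' = B) \<Longrightarrow> thesis\<close>[of x] by auto
  qed
  then obtain c :: "nat \<Rightarrow> _" where "\<forall>n. c n \<in> S \<and> c n \<subset> c (Suc n)" by blast
  hence c: "\<And>n. c n \<in> S" "\<And>n. c n \<subset> c (Suc n)" by simp_all
  have le: "c i \<subseteq> c (Suc i)" for i using c(2)[of i] by auto
  obtain N where "\<And>n. n \<ge> N \<Longrightarrow> c n = c N" using noeth_onD[where c = c, OF assms(1) S[OF c(1)] le] by blast
  from this[of "Suc N"] show False using c(2)[of N] by simp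
qed

lemma mono_chain: "(\<And>i. c i \<subseteq> c (Suc i)) \<Longrightarrow> i \<le> j \<Longrightarrow> c i \<subseteq> c (j :: nat)"
  by (rule lift_Suc_mono_le)

text \<open>A chain is constant once its images and its intersections with the kernel are constant,
  since an element of a later member agrees with one of the earlier member up to an element of the
  kernel part.\<close>

lemma (in mod_homo) noeth_step:
  assumes N: "noeth_on R N (carrier N)" and K: "noeth_on R M {x \<in> K. f x = \<zero>\<^bsub>N\<^esub>}"
  shows "noeth_on R M K"
  unfolding noeth_on_def
proof (intro allI impI)
  fix c :: "nat \<Rightarrow> _"
  assume "\<forall>i. submodule (c i) R M" "\<forall>i. c i \<subseteq> K" "\<forall>i. c i \<subseteq> c (Suc i)"
  hence c: "\<And>i. submodule (c i) R M" "\<And>i. c i \<subseteq> K" "\<And>i. c i \<subseteq> c (Suc i)" by auto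
  have f1: "submodule (f ` c i) R N" "f ` c i \<subseteq> carrier N" "f ` c i \<subseteq> f ` c (Suc i)" for i
    using image_sm[OF c(1)] closed M.smD(1)[OF c(1)] image_mono[OF c(3)] by (simp_all add: image_subset_iff)
  obtain n1 where n1: "\<And>n. n \<ge> n1 \<Longrightarrow> f ` c n = f ` c n1" using noeth_onD[where c = "\<lambda>i. f ` c i", OF N f1] by blast
  have k1: "submodule {x \<in> c i. f x = \<zero>\<^bsub>N\<^esub>} R M" for i using vimage_sm[OF c(1) N.sm_zero] by simp
  have k2: "{x \<in> c i. f x = \<zero>\<^bsub>N\<^esub>} \<subseteq> {x \<in> K. f x = \<zero>\<^bsub>N\<^esub>}" for i using c(2)[of i] by auto
  have k3: "{x \<in> c i. f x = \<zero>\<^bsub>N\<^esub>} \<subseteq> {x \<in> c (Suc i). f x = \<zero>\<^bsub>N\<^esub>}" for i using c(3)[of i] by auto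
  obtain n2 where n2: "\<And>n. n \<ge> n2 \<Longrightarrow> {x \<in> c n. f x = \<zero>\<^bsub>N\<^esub>} = {x \<in> c n2. f x = \<zero>\<^bsub>N\<^esub>}"
    using noeth_onD[where c = "\<lambda>i. {x \<in> c i. f x = \<zero>\<^bsub>N\<^esub>}", OF K k1 k2 k3] by blast
  let ?N = "max n1 n2"
  have "c n = c ?N" if n: "n \<ge> ?N" for n
  proof
    show "c ?N \<subseteq> c n" using mono_chain[of c, OF c(3) n] .
    show "c n \<subseteq> c ?N"
    proof
      fix x assume x: "x \<in> c n"
      hence "f x \<in> f ` c ?N" using n1[of n] n1[of ?N] n by auto
      then obtain y where y: "y \<in> c ?N" "f x = f y" by auto
      have yn: "y \<in> c n" using y \<open>c ?N \<subseteq> c n\<close> by auto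
      have cl: "x \<in> carrier M" "y \<in> carrier M" using M.smD(1)[OF c(1)] x y by auto
      have "x \<ominus>\<^bsub>M\<^esub> y \<in> {x \<in> c n. f x = \<zero>\<^bsub>N\<^esub>}"
        using M.smD(6)[OF c(1) x yn] y cl closed by (simp add: minus N.minus_self)
      also have "\<dots> = {x \<in> c ?N. f x = \<zero>\<^bsub>N\<^esub>}" using n2[of n] n2[of ?N] n by auto
      finally have "x \<ominus>\<^bsub>M\<^esub> y \<oplus>\<^bsub>M\<^esub> y \<in> c ?N" using M.smD(3)[OF c(1)] y(1) by auto
      thus "x \<in> c ?N" using cl by (simp add: M.minus_add_cancel)
    qed
  qed
  thus "\<exists>N. \<forall>n\<ge>N. c n = c N" by blast
qed

lemma (in mod_homo) noeth_image:
  assumes M: "noeth_on R M (carrier M)" and onto: "carrier N \<subseteq> f ` carrier M"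
  shows "noeth_on R N (carrier N)"
  unfolding noeth_on_def
proof (intro allI impI)
  fix c :: "nat \<Rightarrow> _"
  assume "\<forall>i. submodule (c i) R N" "\<forall>i. c i \<subseteq> carrier N" "\<forall>i. c i \<subseteq> c (Suc i)"
  hence c: "\<And>i. submodule (c i) R N" "\<And>i. c i \<subseteq> carrier N" "\<And>i. c i \<subseteq> c (Suc i)" by auto
  let ?d = "\<lambda>i. {x \<in> carrier M. f x \<in> c i}"
  have d1: "submodule (?d i) R M" for i by (rule vimage_sm[OF M.carrier_is_submodule c(1)])
  have d2: "?d i \<subseteq> carrier M" "?d i \<subseteq> ?d (Suc i)" for i using c(3)[of i] by auto
  obtain K where K: "\<And>n. n \<ge> K \<Longrightarrow> ?d n = ?d K" using noeth_onD[where c = ?d, OF M d1 d2] by blast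
  have "f ` ?d i = c i" for i using c(2)[of i] onto by auto
  hence "c n = c K" if "n \<ge> K" for n using K[OF that] by metis
  thus "\<exists>N. \<forall>n\<ge>N. c n = c N" by blast
qed

context rmodule
begin

lemma noeth_zero: "noeth_on R M {\<zero>\<^bsub>M\<^esub>}"
  unfolding noeth_on_def
proof (intro allI impI)
  fix c :: "nat \<Rightarrow> _" assume c: "\<forall>i. submodule (c i) R M" "\<forall>i. c i \<subseteq> {\<zero>\<^bsub>M\<^esub>}"
  have "c i = {\<zero>\<^bsub>M\<^esub>}" for i using c smD(2)[of "c i"] by blast
  thus "\<exists>N. \<forall>n\<ge>N. c n = c N" by simp
qed

text \<open>A maximal member among the finitely generated submodules of H absorbs every element of
  H, because adjoining one more generator does not leave the family.\<close>

lemma noeth_fg: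
  assumes K: "noeth_on R M K" and H: "submodule H R M" "H \<subseteq> K"
  obtains A where "finite A" "A \<subseteq> H" "mod_span R M A = H"
proof -
  let ?S = "{mod_span R M A | A. finite A \<and> A \<subseteq> H}"
  have Hc: "H \<subseteq> carrier M" using smD(1)[OF H(1)] by auto
  have span: "submodule (mod_span R M A) R M" "mod_span R M A \<subseteq> H" if "A \<subseteq> H" for A
    using that Hc mod_span_sm[of A] mod_span_least[OF H(1), of A] by auto
  have 1: "?S \<noteq> {}" by blast
  have 2: "submodule B R M" "B \<subseteq> K" if "B \<in> ?S" for B using that span H(2) by auto
  obtain B where B: "B \<in> ?S" "\<And>B'. B' \<in> ?S \<Longrightarrow> B \<subseteq> B' \<Longrightarrow> B' = B"
    by (rule noeth_max[OF K 1 2]) auto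
  then obtain A where A: "B = mod_span R M A" "finite A" "A \<subseteq> H" by auto
  have "x \<in> B" if x: "x \<in> H" for x
  proof -
    have "mod_span R M (insert x A) \<in> ?S" using A x by blast
    moreover have "B \<subseteq> mod_span R M (insert x A)"
      unfolding A(1) using mod_span_incl[of "insert x A"] span(1)[of "insert x A"] A x
      by (intro mod_span_least) auto
    ultimately have "mod_span R M (insert x A) = B" by (rule B(2))
    thus ?thesis using mod_span_incl[of "insert x A"] by auto
  qed
  hence "mod_span R M A = H" using span(2)[OF A(3)] A(1) by auto
  thus ?thesis using that A by blast
qed

lemma noeth_submodule_fg:
  assumes "noeth_on R M (carrier M)" "submodule H R M"
  shows "M\<lparr>carrier := H\<rparr> \<in> fg_modules R"
proof -
  have "H \<subseteq> carrier M" using smD(1)[OF assms(2)] by auto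
  then obtain A where A: "finite A" "A \<subseteq> H" "mod_span R M A = H" using noeth_fg[OF assms] by blast
  thus ?thesis using restrict_module[OF assms(2)] mod_span_restrict[OF assms(2) A(2)]
    unfolding fg_modules_def by auto
qed

end

lemma noeth_self_mod:
  assumes "cring R" "noetherian_ring R"
  shows "noeth_on R (self_mod R) (carrier R)"
  unfolding noeth_on_def
proof (intro allI impI)
  interpret cring R by fact
  interpret noetherian_ring R by fact
  fix c :: "nat \<Rightarrow> _"
  assume "\<forall>i. submodule (c i) R (self_mod R)" "\<forall>i. c i \<subseteq> c (Suc i)"
  hence c: "\<And>i. ideal (c i) R" "\<And>i. c i \<subseteq> c (Suc i)" by (auto simp: submodule_self_mod_iff)
  have mono: "c i \<subseteq> c j \<or> c j \<subseteq> c i" for i j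
    using mono_chain[of c, OF c(2), of i j] mono_chain[of c, OF c(2), of j i] nat_le_linear[of i j] by metis
  have "\<Union>(range c) \<in> range c"
  proof (rule ideal_chain_is_trivial)
    show "subset.chain {I. ideal I R} (range c)"
      unfolding pred_on.chain_def
    proof (intro conjI ballI)
      fix x y assume "x \<in> range c" "y \<in> range c"
      then obtain i j where "x = c i" "y = c j" by blast
      thus "(\<subset>)\<^sup>=\<^sup>= x y \<or> (\<subset>)\<^sup>=\<^sup>= y x" using mono[of i j] by auto
    qed (use c in auto)
  qed simp
  then obtain N where N: "\<Union>(range c) = c N" by auto
  have "c n = c N" if "n \<ge> N" for n
    using N mono_chain[of c, OF c(2) that] by auto
  thus "\<exists>N. \<forall>n\<ge>N. c n = c N" by blast
qed

lemma noeth_free_mod: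
  assumes R: "cring R" "noetherian_ring R" and S: "finite S"
  shows "noeth_on R (free_mod R S) (carrier (free_mod R S))"
proof -
  interpret cring R by fact
  interpret F: rmodule R "free_mod R S" using free_mod_module by (rule rmoduleI)
  \<comment> \<open>Functions supported in a finite set T, by induction on T: evaluation at the new
    point maps to R, and its kernel consists of functions supported in the old set.\<close>
  have "noeth_on R (free_mod R S) {f \<in> carrier (free_mod R S). \<forall>s. s \<notin> T \<longrightarrow> f s = \<zero>\<^bsub>R\<^esub>}" if "finite T" for T
    using that
  proof induct
    case empty
    have "{f \<in> carrier (free_mod R S). \<forall>s. s \<notin> {} \<longrightarrow> f s = \<zero>\<^bsub>R\<^esub>} \<subseteq> {\<zero>\<^bsub>free_mod R S\<^esub>}" by auto
    thus ?case using F.noeth_zero noeth_on_subset by blast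
  next
    case (insert t T)
    interpret ev: mod_homo R "free_mod R S" "self_mod R" "\<lambda>f. f t"
      using free_mod_module self_mod_module by (intro mod_homoI mod_homI) (auto simp: free_mod_carrier_iff)
    show ?case
    proof (rule ev.noeth_step)
      show "noeth_on R (self_mod R) (carrier (self_mod R))" using noeth_self_mod[OF R] by simp
      show "noeth_on R (free_mod R S) {x \<in> {f \<in> carrier (free_mod R S).
              \<forall>s. s \<notin> insert t T \<longrightarrow> f s = \<zero>\<^bsub>R\<^esub>}. x t = \<zero>\<^bsub>self_mod R\<^esub>}"
        by (rule noeth_on_subset[OF insert(3)]) auto
    qed
  qed
  from this[OF S] show ?thesis by (rule noeth_on_subset) (auto simp: free_mod_carrier_iff)
qed

lemma fg_modulesD: "M \<in> fg_modules R \<Longrightarrow> module R M"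
  by (simp add: fg_modules_def)

lemma fg_presentation:
  assumes "M \<in> fg_modules R"
  obtains S where "finite S" "S \<subseteq> carrier M" "lin R M (\<lambda>x. x) ` carrier (free_mod R S) = carrier M"
proof -
  interpret rmodule R M using fg_modulesD[OF assms] by (rule rmoduleI)
  obtain S where S: "S \<subseteq> carrier M" "finite S" "mod_span R M S = carrier M"
    using assms unfolding fg_modules_def by auto
  have "lin R M (\<lambda>x. x) ` carrier (free_mod R S) = mod_span R M ((\<lambda>x. x) ` S)"
    using S by (intro lin_image) auto
  thus ?thesis using that S by simp
qed

lemma fg_modules_noeth:
  assumes "noetherian_ring R" "M \<in> fg_modules R"
  shows "noeth_on R M (carrier M)"
proof -
  interpret rmodule R M using fg_modulesD[OF assms(2)] by (rule rmoduleI)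
  obtain S where S: "finite S" "S \<subseteq> carrier M" "lin R M (\<lambda>x. x) ` carrier (free_mod R S) = carrier M"
    using assms(2) by (rule fg_presentation)
  interpret l: mod_homo R "free_mod R S" M "lin R M (\<lambda>x. x)" using S by (intro lin_homo) auto
  show ?thesis using S noeth_free_mod[OF R.is_cring assms(1) S(1)] by (intro l.noeth_image) auto
qed

lemma noeth_imp_fg: "module R M \<Longrightarrow> noeth_on R M (carrier M) \<Longrightarrow> M \<in> fg_modules R"
  using rmodule.noeth_submodule_fg[OF rmoduleI, of R M "carrier M"] module.carrier_is_submodule[of R M] by simp

section \<open>Growth of \<open>A/(B + I\<^sup>n A)\<close>\<close>

abbreviation ipow :: "('a, 'k) ring_scheme \<Rightarrow> 'a set \<Rightarrow> nat \<Rightarrow> 'a set" where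
  "ipow R I n \<equiv> I [^]\<^bsub>ideals_set R\<^esub> n"

text \<open>The Hilbert-Samuel function of A/B, that is, the length of (A/B)/I^n(A/B), is O(n^c).
  Dividing A by B + I^n A expresses it by submodules of M.\<close>

definition poly_bounded :: "('a, 'k) ring_scheme \<Rightarrow> 'a set \<Rightarrow> nat \<Rightarrow> ('a, 'b) module \<Rightarrow> 'b set \<Rightarrow> 'b set \<Rightarrow> bool" where
  "poly_bounded R I c M A B \<longleftrightarrow>
     (\<exists>C. \<forall>n. rlen R M A (B <+>\<^bsub>M\<^esub> imul R M (ipow R I n) A) \<le> enat (C * (n + 1) ^ c))"

context cring
begin

lemma ipow_0: "ipow R I 0 = carrier R"
  by (simp add: ideals_set_def nat_pow_def)

lemma ipow_Suc: "ipow R I (Suc n) = ideal_prod R (ipow R I n) I"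
  by (simp add: ideals_set_def nat_pow_def)

lemma ipow_ideal: "ideal I R \<Longrightarrow> ideal (ipow R I n) R"
  by (induct n) (simp_all only: ipow_0 ipow_Suc oneideal ideal_prod_is_ideal)

end

context rmodule
begin

lemma imul_ipow_0:
  assumes "submodule H R M" shows "imul R M (ipow R I 0) H = H"
proof
  show "imul R M (ipow R I 0) H \<subseteq> H" using assms by (intro imul_le) (simp_all only: R.ipow_0 subset_refl)
  show "H \<subseteq> imul R M (ipow R I 0) H"
  proof
    fix x assume x: "x \<in> H"
    have "\<one> \<odot>\<^bsub>M\<^esub> x \<in> imul R M (ipow R I 0) H" using x by (intro imul_incl) (simp_all only: R.ipow_0 R.one_closed)
    thus "x \<in> imul R M (ipow R I 0) H" using smD(1)[OF assms x] by simp
  qed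
qed

lemma imul_ipow_Suc:
  assumes "ideal I R" "H \<subseteq> carrier M"
  shows "imul R M (ipow R I (Suc n)) H = imul R M (ipow R I n) (imul R M I H)"
    "imul R M (ipow R I (Suc n)) H = imul R M I (imul R M (ipow R I n) H)"
  unfolding R.ipow_Suc using assms R.ipow_ideal[of I n]
    imul_prod[of "ipow R I n" I] imul_prod[of I "ipow R I n"] R.ideal_prod_commute[of "ipow R I n" I]
  by simp_all

text \<open>Reduction modulo I^n is right exact, and this is enough for an upper bound: A/(B + I^n
  A) is cut at B' + I^n A, and the lower piece is a quotient of B'/(B + I^n B') because I^n B' lies
  in I^n A.\<close>

lemma poly_bounded_trans:
  assumes I: "ideal I R" and sm: "submodule A R M" "submodule B' R M" "submodule B R M" and le: "B \<subseteq> B'" "B' \<subseteq> A"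
    and 1: "poly_bounded R I c M A B'" and 2: "poly_bounded R I c M B' B"
  shows "poly_bounded R I c M A B"
proof -
  obtain C1 where C1: "\<And>n. rlen R M A (B' <+>\<^bsub>M\<^esub> imul R M (ipow R I n) A) \<le> enat (C1 * (n + 1) ^ c)"
    using 1 unfolding poly_bounded_def by blast
  obtain C2 where C2: "\<And>n. rlen R M B' (B <+>\<^bsub>M\<^esub> imul R M (ipow R I n) B') \<le> enat (C2 * (n + 1) ^ c)"
    using 2 unfolding poly_bounded_def by blast
  have cA: "A \<subseteq> carrier M" using smD(1)[OF sm(1)] by auto
  interpret i: mod_homo R M M "\<lambda>x. x" by (rule id_homo)
  show ?thesis unfolding poly_bounded_def
  proof (intro exI[of _ "C1 + C2"] allI)
    fix n
    let ?J = "ipow R I n"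
    have J: "?J \<subseteq> carrier R" using ideal.Icarr[OF R.ipow_ideal[OF I]] by auto
    have IA: "submodule (imul R M ?J A) R M" "imul R M ?J A \<subseteq> A"
      using imul_sm[OF J cA] imul_le[OF J sm(1)] by auto
    have IB: "imul R M ?J B' \<subseteq> imul R M ?J A" using J cA le by (intro imul_mono) auto
    have IB': "imul R M ?J B' \<subseteq> B'" using J sm(2) by (intro imul_le)
    have s: "submodule (B' <+>\<^bsub>M\<^esub> imul R M ?J A) R M" "submodule (B <+>\<^bsub>M\<^esub> imul R M ?J A) R M"
      using sm_add[OF sm(2) IA(1)] sm_add[OF sm(3) IA(1)] by auto
    have "rlen R M A (B <+>\<^bsub>M\<^esub> imul R M ?J A) =
      rlen R M A (B' <+>\<^bsub>M\<^esub> imul R M ?J A) + rlen R M (B' <+>\<^bsub>M\<^esub> imul R M ?J A) (B <+>\<^bsub>M\<^esub> imul R M ?J A)"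
      using s sm(1) le IA by (intro rlen_add set_add_mono set_add_least) auto
    also have "rlen R M (B' <+>\<^bsub>M\<^esub> imul R M ?J A) (B <+>\<^bsub>M\<^esub> imul R M ?J A) \<le>
       rlen R M B' (B <+>\<^bsub>M\<^esub> imul R M ?J B')"
    proof (rule i.rlen_surj_le[OF sm(2) s(2)])
      show "B <+>\<^bsub>M\<^esub> imul R M ?J B' \<subseteq> B'" using sm(2) le IB' by (intro set_add_least)
      show "(\<lambda>x. x) ` (B <+>\<^bsub>M\<^esub> imul R M ?J B') \<subseteq> B <+>\<^bsub>M\<^esub> imul R M ?J A"
        using IB set_add_mono[of B B] by simp
      have "imul R M ?J A \<subseteq> B <+>\<^bsub>M\<^esub> imul R M ?J A" using sm(3) IA(1) by (rule set_add_upper2)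
      thus "B' <+>\<^bsub>M\<^esub> imul R M ?J A \<subseteq> (\<lambda>x. x) ` B' <+>\<^bsub>M\<^esub> (B <+>\<^bsub>M\<^esub> imul R M ?J A)"
        by (simp add: set_add_mono)
    qed
    also have "rlen R M A (B' <+>\<^bsub>M\<^esub> imul R M ?J A) + rlen R M B' (B <+>\<^bsub>M\<^esub> imul R M ?J B')
      \<le> enat (C1 * (n + 1) ^ c) + enat (C2 * (n + 1) ^ c)" using C1 C2 by (rule add_mono)
    finally show "rlen R M A (B <+>\<^bsub>M\<^esub> imul R M ?J A) \<le> enat ((C1 + C2) * (n + 1) ^ c)"
      by (simp add: add_mult_distrib add_left_mono)
  qed
qed

section \<open>Associated primes and devissage\<close>

lemma colon_ideal:
  assumes B: "submodule B R M" and x: "x \<in> carrier M"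
  shows "ideal {r \<in> carrier R. r \<odot>\<^bsub>M\<^esub> x \<in> B} R"
proof -
  interpret h: mod_homo R "self_mod R" M "\<lambda>r. r \<odot>\<^bsub>M\<^esub> x"
    using x R.self_mod_module module_M
    by (intro mod_homoI mod_homI) (auto simp: smult_l_distr smult_assoc1)
  show ?thesis using h.vimage_sm[OF h.M.carrier_is_submodule B] by (simp add: R.submodule_self_mod_iff)
qed

text \<open>A maximal colon ideal (B : x), with x in A outside B, is prime: for b outside it, (B :
  bx) is again such an ideal and contains it, so the two are equal, and ab in (B : x) means a in (B
  : bx).\<close>

lemma ex_prime_colon:
  assumes "noetherian_ring R" and B: "submodule B R M" and A: "A \<subseteq> carrier M" "submodule A R M" "\<not> A \<subseteq> B"
  obtains x where "x \<in> A" "x \<notin> B" "primeideal {r \<in> carrier R. r \<odot>\<^bsub>M\<^esub> x \<in> B} R"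
proof -
  let ?c = "\<lambda>x. {r \<in> carrier R. r \<odot>\<^bsub>M\<^esub> x \<in> B}"
  let ?S = "?c ` (A - B)"
  have 1: "?S \<noteq> {}" using A by auto
  have 2: "submodule H R (self_mod R)" "H \<subseteq> carrier R" if "H \<in> ?S" for H
    using that colon_ideal[OF B] A(1) by (auto simp: R.submodule_self_mod_iff)
  obtain P where P: "P \<in> ?S" "\<And>B'. B' \<in> ?S \<Longrightarrow> P \<subseteq> B' \<Longrightarrow> B' = P"
    by (rule noeth_max[OF noeth_self_mod[OF R.is_cring assms(1)] 1 2]) auto
  then obtain x where x: "x \<in> A" "x \<notin> B" "P = ?c x" by auto
  have xc: "x \<in> carrier M" using x A by auto
  have "primeideal P R"
  proof (rule primeidealI)
    show "ideal P R" using colon_ideal[OF B xc] x by simp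
    show "cring R" by (rule R.is_cring)
    show "carrier R \<noteq> P" using x xc by (metis (no_types, lifting) R.one_closed mem_Collect_eq smult_one)
    fix a b assume ab: "a \<in> carrier R" "b \<in> carrier R" "a \<otimes> b \<in> P"
    show "a \<in> P \<or> b \<in> P"
    proof (cases "b \<in> P")
      case False
      hence b: "b \<odot>\<^bsub>M\<^esub> x \<in> A - B" using x(3) ab(2) smD(4)[OF A(2) ab(2) x(1)] by auto
      have "P \<subseteq> ?c (b \<odot>\<^bsub>M\<^esub> x)"
        unfolding x(3) using smD(4)[OF B ab(2)] xc ab(2) by (auto simp: smult_lcomm[of _ b])
      hence "?c (b \<odot>\<^bsub>M\<^esub> x) = P" using b by (intro P(2)) auto
      moreover have "a \<in> ?c (b \<odot>\<^bsub>M\<^esub> x)" using ab x(3) xc by (auto simp: smult_assoc1)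
      ultimately show ?thesis by simp
    qed simp
  qed
  thus ?thesis using that x by simp
qed

text \<open>Noetherian induction from above. At a maximal counterexample B1, a prime P = (B1 : x)
  gives B2 = B1 + Rx with B2/B1 a quotient of R/P, while A/B2 is bounded by maximality. The primes
  that occur contain the annihilator of A/B; \<open>prime_bounded\<close> relies on this
  restriction.\<close>

lemma devissage:
  assumes noeth: "noetherian_ring R" "noeth_on R M (carrier M)" and I: "ideal I R"
    and A: "submodule A R M" and B: "submodule B R M" "B \<subseteq> A"
    and prime: "\<And>P. primeideal P R \<Longrightarrow> (\<And>a. a \<in> carrier R \<Longrightarrow> (\<And>x. x \<in> A \<Longrightarrow> a \<odot>\<^bsub>M\<^esub> x \<in> B) \<Longrightarrow> a \<in> P)
      \<Longrightarrow> poly_bounded R I c (self_mod R) (carrier R) P"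
  shows "poly_bounded R I c M A B"
proof (rule ccontr)
  assume no: "\<not> poly_bounded R I c M A B"
  have cA: "A \<subseteq> carrier M" using smD(1)[OF A] by auto
  let ?S = "{B'. submodule B' R M \<and> B \<subseteq> B' \<and> B' \<subseteq> A \<and> \<not> poly_bounded R I c M A B'}"
  have 1: "?S \<noteq> {}" using no B by auto
  have 2: "submodule H R M" "H \<subseteq> carrier M" if "H \<in> ?S" for H
    using that cA by auto
  obtain B1 where B1S: "B1 \<in> ?S" and max: "\<And>B'. B' \<in> ?S \<Longrightarrow> B1 \<subseteq> B' \<Longrightarrow> B' = B1"
    by (rule noeth_max[OF noeth(2) 1 2]) auto
  have B1: "submodule B1 R M" "B \<subseteq> B1" "B1 \<subseteq> A" "\<not> poly_bounded R I c M A B1" using B1S by auto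
  have J: "ipow R I n \<subseteq> carrier R" for n using ideal.Icarr[OF R.ipow_ideal[OF I]] by auto
  have "\<not> A \<subseteq> B1"
  proof
    assume "A \<subseteq> B1"
    hence [simp]: "B1 = A" using B1 by simp
    have "A <+>\<^bsub>M\<^esub> imul R M (ipow R I n) A = A" for n
    proof
      show "A <+>\<^bsub>M\<^esub> imul R M (ipow R I n) A \<subseteq> A" using A J by (intro set_add_least imul_le) auto
      show "A \<subseteq> A <+>\<^bsub>M\<^esub> imul R M (ipow R I n) A" using A J cA by (intro set_add_upper1 imul_sm)
    qed
    hence "poly_bounded R I c M A B1" by (auto simp: poly_bounded_def rlen_self)
    thus False using B1 by simp
  qed
  with noeth(1) B1(1) cA A obtain x where x: "x \<in> A" "x \<notin> B1"
    and P: "primeideal {r \<in> carrier R. r \<odot>\<^bsub>M\<^esub> x \<in> B1} R" by (rule ex_prime_colon)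
  let ?P = "{r \<in> carrier R. r \<odot>\<^bsub>M\<^esub> x \<in> B1}"
  have xc: "x \<in> carrier M" using x cA by auto
  interpret h: mod_homo R "self_mod R" M "\<lambda>r. r \<odot>\<^bsub>M\<^esub> x"
    using xc R.self_mod_module module_M
    by (intro mod_homoI mod_homI) (auto simp: smult_l_distr smult_assoc1)
  have "a \<in> ?P" if "a \<in> carrier R" "\<And>x. x \<in> A \<Longrightarrow> a \<odot>\<^bsub>M\<^esub> x \<in> B" for a
    using that(1) that(2)[OF x(1)] B1(2) by auto
  with P have "poly_bounded R I c (self_mod R) (carrier R) ?P" by (rule prime)
  then obtain C where C: "\<And>n. rlen R (self_mod R) (carrier R) (?P <+>\<^bsub>self_mod R\<^esub> imul R (self_mod R) (ipow R I n) (carrier R))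
     \<le> enat (C * (n + 1) ^ c)" unfolding poly_bounded_def by blast
  let ?X = "(\<lambda>r. r \<odot>\<^bsub>M\<^esub> x) ` carrier R"
  have X: "submodule ?X R M" using h.image_sm[OF h.M.carrier_is_submodule] by simp
  have XA: "?X \<subseteq> A" using smD(4)[OF A _ x(1)] by auto
  let ?B2 = "B1 <+>\<^bsub>M\<^esub> ?X"
  have B2: "submodule ?B2 R M" "B1 \<subseteq> ?B2" "?B2 \<subseteq> A" "?X \<subseteq> ?B2"
    using sm_add[OF B1(1) X] set_add_upper1[OF B1(1) X] set_add_least[OF A B1(3) XA] set_add_upper2[OF B1(1) X] by auto
  have "\<one> \<odot>\<^bsub>M\<^esub> x \<in> ?X" by blast
  hence "x \<in> ?B2" using B2(4) xc by auto
  hence "?B2 \<noteq> B1" using x(2) by auto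
  hence "?B2 \<notin> ?S" using max B2(2) by blast
  hence "poly_bounded R I c M A ?B2" using B2 B1(2) by blast
  moreover have "poly_bounded R I c M ?B2 B1"
    unfolding poly_bounded_def
  proof (intro exI allI)
    fix n
    let ?J = "ipow R I n"
    have cB2: "?B2 \<subseteq> carrier M" using B2(3) cA by auto
    have sJ: "submodule (imul R M ?J ?B2) R M" using J cB2 by (intro imul_sm)
    have s: "submodule (B1 <+>\<^bsub>M\<^esub> imul R M ?J ?B2) R M" using sJ B1(1) by (intro sm_add)
    have Ps: "submodule ?P R (self_mod R)" using colon_ideal[OF B1(1) xc] by (simp add: R.submodule_self_mod_iff)
    have JR: "submodule (imul R (self_mod R) ?J (carrier R)) R (self_mod R)"
      using J by (intro h.M.imul_sm) auto
    \<comment> \<open>The map r |-> r x sends R onto B2 modulo B1, and it takes P into B1 and I^n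
      into I^n B2.\<close>
    have "rlen R M ?B2 (B1 <+>\<^bsub>M\<^esub> imul R M ?J ?B2) \<le>
      rlen R (self_mod R) (carrier R) (?P <+>\<^bsub>self_mod R\<^esub> imul R (self_mod R) ?J (carrier R))"
    proof (rule h.rlen_surj_le)
      show "submodule (carrier R) R (self_mod R)" using h.M.carrier_is_submodule by simp
      show "submodule (B1 <+>\<^bsub>M\<^esub> imul R M ?J ?B2) R M" by (rule s)
      show "?P <+>\<^bsub>self_mod R\<^esub> imul R (self_mod R) ?J (carrier R) \<subseteq> carrier R"
        using h.M.smD(1)[OF h.M.sm_add[OF Ps JR]] by auto
      show "?B2 \<subseteq> ?X <+>\<^bsub>M\<^esub> (B1 <+>\<^bsub>M\<^esub> imul R M ?J ?B2)"
        using set_add_upper1[OF B1(1) sJ] set_add_upper1[OF X s] set_add_upper2[OF X s]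
        by (intro set_add_least sm_add X s) auto
      show "(\<lambda>r. r \<odot>\<^bsub>M\<^esub> x) ` (?P <+>\<^bsub>self_mod R\<^esub> imul R (self_mod R) ?J (carrier R)) \<subseteq> B1 <+>\<^bsub>M\<^esub> imul R M ?J ?B2"
      proof clarify
        fix z assume "z \<in> ?P <+>\<^bsub>self_mod R\<^esub> imul R (self_mod R) ?J (carrier R)"
        then obtain p j where pj: "p \<in> ?P" "j \<in> imul R (self_mod R) ?J (carrier R)" "z = p \<oplus>\<^bsub>self_mod R\<^esub> j"
          by (rule h.M.set_addE)
        have "(\<lambda>r. r \<odot>\<^bsub>M\<^esub> x) ` imul R (self_mod R) ?J (carrier R) = imul R M ?J ?X"
          using J by (intro h.imul_image) auto
        also have "\<dots> \<subseteq> imul R M ?J ?B2" using J cB2 B2(4) by (intro imul_mono) auto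
        finally have "j \<odot>\<^bsub>M\<^esub> x \<in> imul R M ?J ?B2" using pj(2) by auto
        moreover have "p \<odot>\<^bsub>M\<^esub> x \<in> B1" using pj(1) by simp
        moreover have "z \<odot>\<^bsub>M\<^esub> x = p \<odot>\<^bsub>M\<^esub> x \<oplus>\<^bsub>M\<^esub> j \<odot>\<^bsub>M\<^esub> x"
          unfolding pj(3) using pj h.M.smD(1)[OF JR] by (intro h.add) auto
        ultimately show "z \<odot>\<^bsub>M\<^esub> x \<in> B1 <+>\<^bsub>M\<^esub> imul R M ?J ?B2" by (simp add: set_addI)
      qed
    qed
    also have "\<dots> \<le> enat (C * (n + 1) ^ c)" by (rule C)
    finally show "rlen R M ?B2 (B1 <+>\<^bsub>M\<^esub> imul R M ?J ?B2) \<le> enat (C * (n + 1) ^ c)" .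
  qed
  ultimately have "poly_bounded R I c M A B1"
    by (rule poly_bounded_trans[OF I A B2(1) B1(1) B2(2,3)])
  thus False using B1 by simp
qed

end

text \<open>The local ring enters through two facts: all primes lie in \<mm>, and \<mm> lies in the
  radical of I. The dimension enters as the bound \<open>chain_le\<close> on chains of primes, the
  form that suits upper bounds for lengths.\<close>

locale primary_setup = cring R + noetherian_ring R for R (structure) +
  fixes \<mm> I :: "'a set" and d :: nat
  assumes maxi: "maximalideal \<mm> R"
    and local: "\<And>P. primeideal P R \<Longrightarrow> P \<subseteq> \<mm>"
    and I: "ideal I R"
    and rad: "\<And>y. y \<in> \<mm> \<Longrightarrow> \<exists>n::nat. y [^] n \<in> I"
    and chain_le: "\<And>n c. (\<And>i. i \<le> n \<Longrightarrow> primeideal (c i) R) \<Longrightarrow> (\<And>i. i < n \<Longrightarrow> c i \<subset> c (Suc i)) \<Longrightarrow> n \<le> d"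
begin

lemma ipow_sub: "ipow R I n \<subseteq> carrier R" 
  using ideal.Icarr[OF ipow_ideal[OF I]] by auto

text \<open>For y in \<mm> some power of y lies in I. A prime containing I would therefore contain
  all of \<mm>, and being itself contained in \<mm> it would be equal to it.\<close>

lemma not_in_prime:
  assumes P: "primeideal P R" "P \<noteq> \<mm>"
  obtains x where "x \<in> I" "x \<notin> P"
proof -
  interpret P: primeideal P R by fact
  have "P \<subseteq> \<mm>" using local P by blast
  then obtain y where y: "y \<in> \<mm>" "y \<notin> P" using P by auto
  have yc: "y \<in> carrier R" using y maxi by (metis ideal.Icarr maximalideal.axioms(1))
  from rad y obtain n :: nat where "y [^] n \<in> I" by auto
  moreover have "y [^] n \<notin> P" for n :: nat
  proof (induct n)
    case 0 thus ?case using P.I_notcarr P.one_imp_carrier by auto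
  next
    case (Suc n) thus ?case using P.I_prime[of "y [^] n" y] yc y by auto
  qed
  ultimately show ?thesis using that by blast
qed

lemma rlen_max_le_one:
  assumes "\<mm> \<subseteq> B"
  shows "rlen R (self_mod R) (carrier R) B \<le> 1"
proof (rule rlen_leI)
  interpret m: maximalideal \<mm> R by (rule maxi)
  fix n assume "has_chain R (self_mod R) (carrier R) B n"
  then obtain c where c: "\<And>i. i \<le> n \<Longrightarrow> submodule (c i) R (self_mod R)" "\<And>i. i \<le> n \<Longrightarrow> B \<subseteq> c i"
    "\<And>i. i \<le> n \<Longrightarrow> c i \<subseteq> carrier R" "\<And>i. i < n \<Longrightarrow> c i \<subset> c (Suc i)" by (rule has_chainE) blast
  have *: "c i = \<mm> \<or> c i = carrier R" if "i \<le> n" for i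
    using m.I_maximal[of "c i"] c(1,2,3)[OF that] assms by (auto simp: submodule_self_mod_iff)
  have "n \<le> 1"
  proof (rule ccontr)
    assume "\<not> n \<le> 1"
    hence n: "0 < n" "1 < n" by auto
    have "c 0 \<subset> c 1" "c 1 \<subset> c 2" using c(4)[of 0] c(4)[of 1] n by (auto simp: numeral_2_eq_2)
    moreover have "\<mm> \<subseteq> c 0" "c 2 \<subseteq> carrier R" using c(2)[of 0] c(3)[of 2] assms n by auto
    ultimately show False using *[of 1] n by auto
  qed
  thus "enat n \<le> 1" by (simp add: one_enat_def)
qed

text \<open>Induction on a bound c for the dimension of R/P. Let h(n) be the length of R/(P + I^n),
  and for P different from \<mm> take x in I outside P. Multiplication by x takes I^n into I^(n+1),
  so h(n+1) is at most h(n) plus the length of R/(P + xR + I^(n+1)). The primes above P + xR lie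
  strictly above P, so devissage bounds the new term with the smaller exponent, and summation raises
  the exponent by one.\<close>

lemma prime_bounded:
  assumes "primeideal P R"
    and "\<And>n ch. ch 0 = P \<Longrightarrow> (\<And>i. i \<le> n \<Longrightarrow> primeideal (ch i) R) \<Longrightarrow> (\<And>i. i < n \<Longrightarrow> ch i \<subset> ch (Suc i)) \<Longrightarrow> n \<le> c"
  shows "poly_bounded R I c (self_mod R) (carrier R) P"
  using assms
proof (induct c arbitrary: P)
  case (0 P)
  have "P = \<mm>"
  proof (rule ccontr)
    assume "P \<noteq> \<mm>"
    hence "P \<subset> \<mm>" using local 0 by blast
    hence "Suc 0 \<le> 0" using maximalideal_prime[OF maxi] 0(1)
      by (intro 0(2)[of "\<lambda>i. if i = 0 then P else \<mm>"]) auto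
    thus False by simp
  qed
  interpret S: rmodule R "self_mod R" using self_mod_module by (rule rmoduleI)
  show ?case unfolding poly_bounded_def
  proof (intro exI[of _ 1] allI)
    fix n
    have "submodule P R (self_mod R)" using primeideal.axioms(1)[OF 0(1)] by (simp add: submodule_self_mod_iff)
    hence "P \<subseteq> P <+>\<^bsub>self_mod R\<^esub> imul R (self_mod R) (ipow R I n) (carrier R)"
      using ipow_sub by (intro S.set_add_upper1 S.imul_sm) auto
    thus "rlen R (self_mod R) (carrier R) (P <+>\<^bsub>self_mod R\<^esub> imul R (self_mod R) (ipow R I n) (carrier R))
      \<le> enat (1 * (n + 1) ^ 0)"
      using rlen_max_le_one \<open>P = \<mm>\<close> by (simp add: one_enat_def)
  qed
next
  case (Suc c P)
  interpret S: rmodule R "self_mod R" using self_mod_module by (rule rmoduleI)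
  define J where "J = (\<lambda>n. imul R (self_mod R) (ipow R I n) (carrier R))"
  have J: "submodule (J n) R (self_mod R)" for n
    unfolding J_def using ipow_sub by (intro S.imul_sm) auto
  have Pid: "ideal P R" using Suc.prems(1) primeideal.axioms(1) by auto
  have P: "submodule P R (self_mod R)" using Pid by (simp add: submodule_self_mod_iff)
  let ?h = "\<lambda>n. rlen R (self_mod R) (carrier R) (P <+>\<^bsub>self_mod R\<^esub> J n)"
  have Rs: "submodule (carrier R) R (self_mod R)" using S.carrier_is_submodule by simp
  have PJ: "submodule (P <+>\<^bsub>self_mod R\<^esub> J n) R (self_mod R)" "P <+>\<^bsub>self_mod R\<^esub> J n \<subseteq> carrier R" for n
    using S.sm_add[OF P J] S.smD(1)[OF S.sm_add[OF P J]] by auto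
  show ?case
  proof (cases "P = \<mm>")
    case True
    show ?thesis unfolding poly_bounded_def J_def[symmetric]
    proof (intro exI[of _ 1] allI)
      fix n
      have "\<mm> \<subseteq> P <+>\<^bsub>self_mod R\<^esub> J n" using S.set_add_upper1[OF P J] True by auto
      hence "?h n \<le> 1" by (rule rlen_max_le_one)
      also have "1 \<le> (n + 1) ^ Suc c" by (rule one_le_power) simp
      hence "1 \<le> enat (1 * (n + 1) ^ Suc c)" by (simp add: one_enat_def del: power_Suc)
      finally show "rlen R (self_mod R) (carrier R) (P <+>\<^bsub>self_mod R\<^esub> imul R (self_mod R) (ipow R I n) (carrier R))
          \<le> enat (1 * (n + 1) ^ Suc c)" unfolding J_def .
    qed
  next
    case False
    with Suc.prems(1) obtain x where x: "x \<in> I" "x \<notin> P" by (rule not_in_prime)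
    have xc: "x \<in> carrier R" using x ideal.Icarr[OF I] by auto
    interpret h: mod_homo R "self_mod R" "self_mod R" "\<lambda>r. x \<odot>\<^bsub>self_mod R\<^esub> r"
      using S.smult_homo xc by simp
    let ?X = "(\<lambda>r. x \<odot>\<^bsub>self_mod R\<^esub> r) ` carrier R"
    let ?B = "P <+>\<^bsub>self_mod R\<^esub> ?X"
    have X: "submodule ?X R (self_mod R)" using h.image_sm[OF Rs] .
    have B: "submodule ?B R (self_mod R)" "?B \<subseteq> carrier R" "P \<subseteq> ?B" "?X \<subseteq> ?B"
      using S.sm_add[OF P X] S.smD(1)[OF S.sm_add[OF P X]] S.set_add_upper1[OF P X] S.set_add_upper2[OF P X] by auto
    have "x \<odot>\<^bsub>self_mod R\<^esub> \<one> \<in> ?X" by blast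
    hence xB: "x \<in> ?B" using B(4) xc by auto
    have "poly_bounded R I c (self_mod R) (carrier R) ?B"
    proof (rule S.devissage[OF noetherian_ring_axioms])
      show "noeth_on R (self_mod R) (carrier (self_mod R))" using noeth_self_mod[OF is_cring noetherian_ring_axioms] by simp
      fix Q assume Q: "primeideal Q R"
        and ann: "\<And>a. a \<in> carrier R \<Longrightarrow> (\<And>y. y \<in> carrier R \<Longrightarrow> a \<odot>\<^bsub>self_mod R\<^esub> y \<in> ?B) \<Longrightarrow> a \<in> Q"
      have BQ: "b \<in> Q" if b: "b \<in> ?B" for b
      proof (rule ann)
        show bc: "b \<in> carrier R" using b B(2) by auto
        show "b \<odot>\<^bsub>self_mod R\<^esub> y \<in> ?B" if "y \<in> carrier R" for y
          using S.smD(4)[OF B(1) that b] that bc by (simp add: m_comm)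
      qed
      hence "P \<subset> Q" using B(3) xB x(2) by auto
      show "poly_bounded R I c (self_mod R) (carrier R) Q"
      proof (rule Suc.hyps[OF Q])
        fix n and ch :: "nat \<Rightarrow> 'a set"
        assume ch: "ch 0 = Q" "\<And>i. i \<le> n \<Longrightarrow> primeideal (ch i) R" "\<And>i. i < n \<Longrightarrow> ch i \<subset> ch (Suc i)"
        \<comment> \<open>Putting P in front of a chain that starts at Q lengthens it by one, so the
          bound c + 1 for P gives c for Q.\<close>
        have "Suc n \<le> Suc c"
        proof (rule Suc.prems(2)[of "\<lambda>i. if i = 0 then P else ch (i - 1)"])
          show "(\<lambda>i. if i = 0 then P else ch (i - 1)) 0 = P" by simp
          show "primeideal (if i = 0 then P else ch (i - 1)) R" if "i \<le> Suc n" for i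
            using that ch(2) Suc.prems(1) by auto
          show "(if i = 0 then P else ch (i - 1)) \<subset> (if Suc i = 0 then P else ch (Suc i - 1))" if "i < Suc n" for i
            using that ch(1) ch(3)[of "i - 1"] \<open>P \<subset> Q\<close> by (cases i) auto
        qed
        thus "n \<le> c" by simp
      qed
    qed (use I B Rs in auto)
    then obtain C where C: "\<And>n. rlen R (self_mod R) (carrier R) (?B <+>\<^bsub>self_mod R\<^esub> J n) \<le> enat (C * (n + 1) ^ c)"
      unfolding poly_bounded_def J_def by blast
    \<comment> \<open>R/(P + I^(n+1)) is cut at B + I^(n+1), where B = P + xR; multiplication by x
      makes the lower piece a quotient of R/(P + I^n).\<close>
    have step: "?h (Suc n) \<le> enat (C * (n + 2) ^ c) + ?h n" for n
    proof -
      have BJ: "submodule (?B <+>\<^bsub>self_mod R\<^esub> J (Suc n)) R (self_mod R)" by (rule S.sm_add[OF B(1) J])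
      have "?h (Suc n) = rlen R (self_mod R) (carrier R) (?B <+>\<^bsub>self_mod R\<^esub> J (Suc n)) +
         rlen R (self_mod R) (?B <+>\<^bsub>self_mod R\<^esub> J (Suc n)) (P <+>\<^bsub>self_mod R\<^esub> J (Suc n))"
        using S.smD(1)[OF BJ] by (intro S.rlen_add Rs BJ S.set_add_mono B) auto
      also have "rlen R (self_mod R) (?B <+>\<^bsub>self_mod R\<^esub> J (Suc n)) (P <+>\<^bsub>self_mod R\<^esub> J (Suc n)) \<le> ?h n"
      proof (rule h.rlen_surj_le[OF Rs PJ(1) PJ(2)])
        note u = S.set_add_upper1[OF P J, of "Suc n"] S.set_add_upper2[OF P J, of "Suc n"]
        have s: "submodule (?X <+>\<^bsub>self_mod R\<^esub> (P <+>\<^bsub>self_mod R\<^esub> J (Suc n))) R (self_mod R)"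
          by (rule S.sm_add[OF X PJ(1)])
        note v = S.set_add_upper1[OF X PJ(1)[of "Suc n"]] S.set_add_upper2[OF X PJ(1)[of "Suc n"]]
        show "?B <+>\<^bsub>self_mod R\<^esub> J (Suc n) \<subseteq> ?X <+>\<^bsub>self_mod R\<^esub> (P <+>\<^bsub>self_mod R\<^esub> J (Suc n))"
          using u v by (intro S.set_add_least s) auto
        have "(\<lambda>r. x \<odot>\<^bsub>self_mod R\<^esub> r) ` J n = imul R (self_mod R) (ipow R I n) ?X"
          unfolding J_def using ipow_sub by (intro h.imul_image) auto
        also have "\<dots> \<subseteq> imul R (self_mod R) (ipow R I n) (imul R (self_mod R) I (carrier R))"
        proof (rule S.imul_mono)
          show "?X \<subseteq> imul R (self_mod R) I (carrier R)" using x by (auto simp del: self_mod_simps intro: S.imul_incl)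
          show "imul R (self_mod R) I (carrier R) \<subseteq> carrier (self_mod R)"
            using S.imul_sm[of I "carrier R"] ideal.Icarr[OF I] S.smD(1) by auto
        qed (use ipow_sub in auto)
        also have "\<dots> = J (Suc n)" unfolding J_def using I by (subst S.imul_ipow_Suc(1)) auto
        finally have xJ: "(\<lambda>r. x \<odot>\<^bsub>self_mod R\<^esub> r) ` J n \<subseteq> J (Suc n)" .
        have xP: "(\<lambda>r. x \<odot>\<^bsub>self_mod R\<^esub> r) ` P \<subseteq> P" using S.smD(4)[OF P xc] by auto
        have "P <+>\<^bsub>self_mod R\<^esub> J n \<subseteq> {r \<in> carrier R. x \<odot>\<^bsub>self_mod R\<^esub> r \<in> P <+>\<^bsub>self_mod R\<^esub> J (Suc n)}"
          using xJ xP u S.smD(1)[OF P] S.smD(1)[OF J]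
          by (intro S.set_add_least h.vimage_sm Rs PJ) auto
        thus "(\<lambda>r. x \<odot>\<^bsub>self_mod R\<^esub> r) ` (P <+>\<^bsub>self_mod R\<^esub> J n) \<subseteq> P <+>\<^bsub>self_mod R\<^esub> J (Suc n)" by auto
      qed
      also have "rlen R (self_mod R) (carrier R) (?B <+>\<^bsub>self_mod R\<^esub> J (Suc n)) + ?h n
          \<le> enat (C * (n + 2) ^ c) + ?h n" using C[of "Suc n"] by (intro add_right_mono) simp
      finally show ?thesis by (simp add: add_left_mono)
    qed
    have "J 0 = carrier R" unfolding J_def using S.imul_ipow_0[OF Rs] .
    hence "P <+>\<^bsub>self_mod R\<^esub> J 0 = carrier R" using PJ(2)[of 0] S.set_add_upper2[OF P J, of 0] by auto
    hence h0: "?h 0 = 0" by (simp add: S.rlen_self)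
    \<comment> \<open>The recursion is summed from \<open>?h 0 = 0\<close>: there are n summands,
      each at most C (n + 1)^c.\<close>
    have "?h n \<le> enat (C * n * (n + 1) ^ c)" for n
    proof (induct n)
      case 0 thus ?case using h0 by (simp add: zero_enat_def)
    next
      case (Suc n)
      have "?h (Suc n) \<le> enat (C * (n + 2) ^ c) + enat (C * n * (n + 1) ^ c)"
        using step[of n] add_left_mono[OF Suc] by (rule order_trans)
      also have "\<dots> = enat (C * (n + 2) ^ c + C * n * (n + 1) ^ c)" by simp
      also have "C * n * (n + 1) ^ c \<le> C * n * (n + 2) ^ c"
        by (intro mult_le_mono power_mono) auto
      hence "enat (C * (n + 2) ^ c + C * n * (n + 1) ^ c) \<le> enat (C * Suc n * (Suc n + 1) ^ c)"
        by (simp add: algebra_simps)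
      finally show ?case .
    qed
    moreover have "C * n * (n + 1) ^ c \<le> C * (n + 1) ^ Suc c" for n by simp
    ultimately have "?h n \<le> enat (C * (n + 1) ^ Suc c)" for n
      using order_trans enat_ord_simps(1) by blast
    thus ?thesis unfolding poly_bounded_def J_def by blast
  qed
qed

lemma growth:
  assumes "module R M" "noeth_on R M (carrier M)" "submodule Z R M"
  obtains C where "\<And>n. rlen R M Z (imul R M (ipow R I n) Z) \<le> enat (C * (n + 1) ^ d)"
proof -
  interpret M: rmodule R M using assms(1) by (rule rmoduleI)
  have "poly_bounded R I d M Z {\<zero>\<^bsub>M\<^esub>}"
  proof (rule M.devissage[OF noetherian_ring_axioms assms(2) I assms(3) M.sm_zero])
    show "{\<zero>\<^bsub>M\<^esub>} \<subseteq> Z" using M.smD(2)[OF assms(3)] by simp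
    show "poly_bounded R I d (self_mod R) (carrier R) P" if "primeideal P R" for P
      using that
    proof (rule prime_bounded)
      fix n and ch :: "nat \<Rightarrow> _"
      assume "\<And>i. i \<le> n \<Longrightarrow> primeideal (ch i) R" "\<And>i. i < n \<Longrightarrow> ch i \<subset> ch (Suc i)"
      thus "n \<le> d" by (rule chain_le)
    qed
  qed
  then obtain C where C: "\<And>n. rlen R M Z ({\<zero>\<^bsub>M\<^esub>} <+>\<^bsub>M\<^esub> imul R M (ipow R I n) Z) \<le> enat (C * (n + 1) ^ d)"
    unfolding poly_bounded_def by blast
  have "{\<zero>\<^bsub>M\<^esub>} <+>\<^bsub>M\<^esub> imul R M (ipow R I n) Z = imul R M (ipow R I n) Z" for n
  proof -
    have sm: "submodule (imul R M (ipow R I n) Z) R M"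
      using ipow_sub M.smD(1)[OF assms(3)] by (intro M.imul_sm) auto
    show ?thesis
      using M.set_add_least[OF sm, of "{\<zero>\<^bsub>M\<^esub>}"] M.set_add_upper2[OF M.sm_zero sm] M.smD(2)[OF sm] by auto
  qed
  with C have "\<And>n. rlen R M Z (imul R M (ipow R I n) Z) \<le> enat (C * (n + 1) ^ d)" by metis
  thus ?thesis by (rule that)
qed

end

section \<open>Eventually polynomial sequences\<close>

text \<open>Eventually a polynomial of degree below k, so k = 0 means eventually zero. In the basis
  of binomial coefficients, differences and sums only shift the index.\<close>

definition evp :: "nat \<Rightarrow> (nat \<Rightarrow> real) \<Rightarrow> bool" where
  "evp k f \<longleftrightarrow> (\<exists>c. \<forall>\<^sub>F n in sequentially. f n = (\<Sum>i<k. c i * real (n choose i)))"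

lemma evp_Suc: "evp k f \<Longrightarrow> evp (Suc k) f"
  unfolding evp_def
proof (elim exE)
  fix c assume "\<forall>\<^sub>F n in sequentially. f n = (\<Sum>i<k. c i * real (n choose i))"
  thus "\<exists>c. \<forall>\<^sub>F n in sequentially. f n = (\<Sum>i<Suc k. c i * real (n choose i))"
    by (intro exI[of _ "c(k := 0)"]) (auto elim!: eventually_mono intro!: sum.cong)
qed

lemma evp_mono: "evp k f \<Longrightarrow> k \<le> l \<Longrightarrow> evp l f"
  by (induct l rule: nat_induct) (auto simp: le_Suc_eq intro: evp_Suc)

lemma evp_zero: "evp k (\<lambda>n. 0)"
  unfolding evp_def by (intro exI[of _ "\<lambda>_. 0"]) simp

lemma evp_diff:
  assumes "evp k f" "evp k g" shows "evp k (\<lambda>n. f n - g n)"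
proof -
  obtain a where a: "\<forall>\<^sub>F n in sequentially. f n = (\<Sum>i<k. a i * real (n choose i))"
    using assms(1) unfolding evp_def by blast
  obtain b where b: "\<forall>\<^sub>F n in sequentially. g n = (\<Sum>i<k. b i * real (n choose i))"
    using assms(2) unfolding evp_def by blast
  have "\<forall>\<^sub>F n in sequentially. f n - g n = (\<Sum>i<k. (a i - b i) * real (n choose i))"
    using a b by eventually_elim (simp add: sum_subtractf left_diff_distrib)
  thus ?thesis unfolding evp_def by (rule exI[of _ "\<lambda>i. a i - b i"])
qed

lemma evp_diff': "evp k f \<Longrightarrow> evp l g \<Longrightarrow> evp (max k l) (\<lambda>n. f n - g n)"
  by (intro evp_diff evp_mono[of _ _ "max k l"]) auto

text \<open>By Pascal's rule the sum of the c_i (n choose i+1) has the prescribed difference, and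
  from N on f differs from it by the constant f N - g N, which becomes the new coefficient of index
  0.\<close>

lemma evp_antidifference:
  assumes "evp k (\<lambda>n. f (Suc n) - f n)" shows "evp (Suc k) f"
proof -
  obtain c where "\<forall>\<^sub>F n in sequentially. f (Suc n) - f n = (\<Sum>i<k. c i * real (n choose i))"
    using assms unfolding evp_def by blast
  then obtain N where N: "\<And>n. n \<ge> N \<Longrightarrow> f (Suc n) - f n = (\<Sum>i<k. c i * real (n choose i))"
    unfolding eventually_sequentially by blast
  define g where "g = (\<lambda>n. \<Sum>i<k. c i * real (n choose Suc i))"
  have g: "g (Suc n) - g n = (\<Sum>i<k. c i * real (n choose i))" for n
    unfolding g_def by (simp add: sum_subtractf[symmetric] algebra_simps sum.distrib)
  have fg: "f n = f N - g N + g n" if "n \<ge> N" for n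
    using that
  proof (induct n rule: dec_induct)
    case (step n) thus ?case using N[of n] g[of n] by simp
  qed simp
  have sum: "(\<Sum>i<Suc k. (case i of 0 \<Rightarrow> f N - g N | Suc j \<Rightarrow> c j) * real (n choose i)) = f N - g N + g n" for n
    unfolding g_def sum.lessThan_Suc_shift by simp
  show ?thesis unfolding evp_def eventually_sequentially
    by (intro exI[of _ "\<lambda>i. case i of 0 \<Rightarrow> f N - g N | Suc j \<Rightarrow> c j"] exI[of _ N] allI impI)
      (simp only: sum fg[symmetric])
qed

lemma evp_difference:
  assumes "evp (Suc k) f" shows "evp k (\<lambda>n. f (Suc n) - f n)"
proof -
  obtain c where "\<forall>\<^sub>F n in sequentially. f n = (\<Sum>i<Suc k. c i * real (n choose i))"
    using assms unfolding evp_def by blast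
  then obtain N where N: "\<And>n. n \<ge> N \<Longrightarrow> f n = (\<Sum>i<Suc k. c i * real (n choose i))"
    unfolding eventually_sequentially by blast
  have "f (Suc n) - f n = (\<Sum>i<k. c (Suc i) * real (n choose i))" if "n \<ge> N" for n
    using that N[of n] N[of "Suc n"] unfolding sum.lessThan_Suc_shift
    by (simp add: sum_subtractf[symmetric] algebra_simps sum.distrib)
  thus ?thesis unfolding evp_def eventually_sequentially
    by (intro exI[of _ "\<lambda>i. c (Suc i)"] exI[of _ N]) auto
qed

section \<open>Asymptotics and degree bounds\<close>

lemma choose_asymp: "(\<lambda>n. real (n choose i) / real n ^ i) \<longlonglongrightarrow> 1 / fact i"
proof (induct i)
  case 0
  have "\<forall>\<^sub>F n in sequentially. real (n choose 0) / real n ^ 0 = 1 / fact 0" by simp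
  thus ?case by (rule tendsto_eventually)
next
  case (Suc i)
  have "(\<lambda>n. 1 - real i * inverse (real n)) \<longlonglongrightarrow> 1 - real i * 0"
    by (intro tendsto_intros lim_inverse_n)
  hence "(\<lambda>n. real (n choose i) / real n ^ i * (1 - real i * inverse (real n)) / real (Suc i)) \<longlonglongrightarrow> (1 / fact i) * (1 - real i * 0) / real (Suc i)"
    by (intro tendsto_divide[OF tendsto_mult[OF Suc] tendsto_const]) auto
  hence *: "(\<lambda>n. real (n choose i) / real n ^ i * (1 - real i * inverse (real n)) / real (Suc i)) \<longlonglongrightarrow> 1 / fact (Suc i)"
    by (simp add: field_simps)
  have "\<forall>\<^sub>F n in sequentially. real (n choose i) / real n ^ i * (1 - real i * inverse (real n)) / real (Suc i)
     = real (n choose Suc i) / real n ^ Suc i"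
    using eventually_gt_at_top[of 0]
  proof eventually_elim
    case (elim n)
    \<comment> \<open>The recursion (i+1) (n choose i+1) = (n - i) (n choose i), in a form without
      subtraction of naturals.\<close>
    have "real n * real (n choose i) = real i * real (n choose i) + real (Suc i) * real (n choose Suc i)"
      using gbinomial_mult_1[of "real n" i] by (simp only: binomial_gbinomial)
    hence "real (n choose Suc i) = (real n - real i) * real (n choose i) / real (Suc i)"
      by (simp add: field_simps)
    moreover have "1 - real i * inverse (real n) = (real n - real i) / real n"
      using elim by (simp add: field_simps)
    ultimately show ?case by (simp add: mult.commute mult.left_commute)
  qed
  thus ?case using * by (rule Lim_transform_eventually[rotated])
qed

lemma choose_asymp_less:
  assumes "i < k" shows "(\<lambda>n. real (n choose i) / real n ^ k) \<longlonglongrightarrow> 0"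
proof -
  obtain j where k: "k = i + Suc j" using less_imp_Suc_add[OF assms] by auto
  have "(\<lambda>n. real (n choose i) / real n ^ i * inverse (real n) ^ Suc j) \<longlonglongrightarrow> 1 / fact i * 0 ^ Suc j"
    by (intro tendsto_intros choose_asymp lim_inverse_n)
  moreover have "real (n choose i) / real n ^ i * inverse (real n) ^ Suc j = real (n choose i) / real n ^ k" for n
    unfolding k power_add by (simp add: field_simps)
  ultimately show ?thesis by simp
qed

lemma evp_limit:
  assumes "\<forall>\<^sub>F n in sequentially. f n = (\<Sum>i<Suc k. c i * real (n choose i))"
  shows "(\<lambda>n. f n / real n ^ k) \<longlonglongrightarrow> c k / fact k"
proof -
  have "(\<lambda>n. (\<Sum>i<k. c i * (real (n choose i) / real n ^ k)) + c k * (real (n choose k) / real n ^ k))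
     \<longlonglongrightarrow> (\<Sum>i<k. c i * 0) + c k * (1 / fact k)"
    by (intro tendsto_intros choose_asymp choose_asymp_less) auto
  moreover have "\<forall>\<^sub>F n in sequentially. (\<Sum>i<k. c i * (real (n choose i) / real n ^ k)) + c k * (real (n choose k) / real n ^ k)
    = f n / real n ^ k"
    using assms by eventually_elim (simp add: add_divide_distrib sum_divide_distrib)
  ultimately have "(\<lambda>n. f n / real n ^ k) \<longlonglongrightarrow> (\<Sum>i<k. c i * 0) + c k * (1 / fact k)"
    by (rule Lim_transform_eventually)
  thus ?thesis by simp
qed

lemma Suc_div_asymp: "(\<lambda>n. real (Suc n) / real n) \<longlonglongrightarrow> 1"
proof -
  have "(\<lambda>n. 1 + inverse (real n)) \<longlonglongrightarrow> 1 + 0" by (intro tendsto_intros lim_inverse_n)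
  moreover have "\<forall>\<^sub>F n in sequentially. 1 + inverse (real n) = real (Suc n) / real n"
    using eventually_gt_at_top[of 0] by eventually_elim (simp add: field_simps)
  ultimately have "(\<lambda>n. real (Suc n) / real n) \<longlonglongrightarrow> 1 + 0" by (rule Lim_transform_eventually)
  thus ?thesis by simp
qed

text \<open>The top coefficient is k! times the limit of f n / n^k. As long as k exceeds e, the
  bound forces this limit to be zero and the degree drops; the induction stops at degree e.\<close>

lemma evp_bounded:
  assumes "evp k f" "\<forall>\<^sub>F n in sequentially. \<bar>f n\<bar> \<le> C * (real n + 1) ^ e"
  shows "evp (Suc e) f"
  using assms(1)
proof (induct k)
  case 0 thus ?case using evp_mono by blast
next
  case (Suc k)
  show ?case
  proof (cases "k \<le> e")
    case True thus ?thesis using Suc(2) evp_mono[of "Suc k" f "Suc e"] by simp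
  next
    case False
    obtain c where c: "\<forall>\<^sub>F n in sequentially. f n = (\<Sum>i<Suc k. c i * real (n choose i))"
      using Suc(2) unfolding evp_def by blast
    obtain j where k: "k = e + Suc j" using False less_imp_Suc_add[of e k] by auto
    have "(\<lambda>n. C * (real (Suc n) / real n) ^ e * inverse (real n) ^ Suc j) \<longlonglongrightarrow> C * 1 ^ e * 0 ^ Suc j"
      by (intro tendsto_intros Suc_div_asymp lim_inverse_n)
    hence 1: "(\<lambda>n. C * (real (Suc n) / real n) ^ e * inverse (real n) ^ Suc j) \<longlonglongrightarrow> 0" by simp
    have 2: "\<forall>\<^sub>F n in sequentially. norm (f n / real n ^ k) \<le> C * (real (Suc n) / real n) ^ e * inverse (real n) ^ Suc j"
      using assms(2)
    proof eventually_elim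
      case (elim n)
      have "norm (f n / real n ^ k) = \<bar>f n\<bar> / real n ^ k" by simp
      also have "\<dots> \<le> C * (real n + 1) ^ e / real n ^ k" using elim by (intro divide_right_mono) auto
      also have "\<dots> = C * (real (Suc n) / real n) ^ e * inverse (real n) ^ Suc j"
        unfolding k power_add by (simp add: field_simps)
      finally show ?case .
    qed
    have "(\<lambda>n. f n / real n ^ k) \<longlonglongrightarrow> 0" 
    proof (rule tendsto_0_le[OF 1, of _ 1])
      show "\<forall>\<^sub>F n in sequentially. norm (f n / real n ^ k)
          \<le> norm (C * (real (Suc n) / real n) ^ e * inverse (real n) ^ Suc j) * 1"
        using 2
      proof eventually_elim
        case (elim n)
        thus ?case by (simp only: real_norm_def mult_1_right)
      qed
    qed
    with evp_limit[OF c] have "c k / fact k = 0" using LIMSEQ_unique by blast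
    hence "evp k f" using c unfolding evp_def by (intro exI[of _ c]) simp
    thus ?thesis by (rule Suc(1))
  qed
qed

lemma evp_bound:
  assumes "evp (Suc k) f"
  obtains C where "C \<ge> 0" "\<forall>\<^sub>F n in sequentially. \<bar>f n\<bar> \<le> C * (real n + 1) ^ k"
proof -
  obtain c where c: "\<forall>\<^sub>F n in sequentially. f n = (\<Sum>i<Suc k. c i * real (n choose i))"
    using assms unfolding evp_def by blast
  show ?thesis
  proof (rule that[of "\<Sum>i<Suc k. \<bar>c i\<bar>"])
    show "(\<Sum>i<Suc k. \<bar>c i\<bar>) \<ge> 0" by (intro sum_nonneg) auto
    show "\<forall>\<^sub>F n in sequentially. \<bar>f n\<bar> \<le> (\<Sum>i<Suc k. \<bar>c i\<bar>) * (real n + 1) ^ k"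
      using c
    proof eventually_elim
      case (elim n)
      have "\<bar>f n\<bar> \<le> (\<Sum>i<Suc k. \<bar>c i * real (n choose i)\<bar>)" unfolding elim by (rule sum_abs)
      also have "\<dots> \<le> (\<Sum>i<Suc k. \<bar>c i\<bar> * (real n + 1) ^ k)"
      proof (rule sum_mono)
        fix i assume i: "i \<in> {..<Suc k}"
        have "real (n choose i) \<le> (real n + 1) ^ k"
        proof (cases "i \<le> n")
          case True
          have "real (n choose i) \<le> real (n ^ i)" using binomial_le_pow[OF True] of_nat_le_iff by blast
          also have "\<dots> \<le> (real n + 1) ^ i" by (simp add: power_mono)
          also have "\<dots> \<le> (real n + 1) ^ k" using i by (intro power_increasing) auto
          finally show ?thesis .
        qed (simp add: binomial_eq_0)
        thus "\<bar>c i * real (n choose i)\<bar> \<le> \<bar>c i\<bar> * (real n + 1) ^ k"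
          by (simp add: abs_mult mult_left_mono)
      qed
      finally show ?case by (simp add: sum_distrib_right distrib_right)
    qed
  qed
qed

text \<open>The argument of f is shifted by one against the power of n because the multiplicity
  pairs I^(n+1) with n^(d-1); the correcting factor ((n+1)/n)^k tends to 1.\<close>

lemma evp_convergent:
  assumes "evp (Suc k) f" shows "convergent (\<lambda>n. f (Suc n) / real n ^ k)"
proof -
  obtain c where c: "\<forall>\<^sub>F n in sequentially. f n = (\<Sum>i<Suc k. c i * real (n choose i))"
    using assms unfolding evp_def by blast
  have "(\<lambda>n. f (Suc n) / real (Suc n) ^ k * (real (Suc n) / real n) ^ k) \<longlonglongrightarrow> c k / fact k * 1 ^ k"
    by (intro tendsto_mult[OF LIMSEQ_Suc[OF evp_limit[OF c]]] tendsto_power Suc_div_asymp)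
  moreover have "f (Suc n) / real (Suc n) ^ k * (real (Suc n) / real n) ^ k = f (Suc n) / real n ^ k" for n
    by (simp add: field_simps del: of_nat_Suc)
  ultimately show ?thesis unfolding convergent_def by auto
qed

section \<open>Graded families of submodules\<close>

text \<open>A family \<open>H\<close> with \<open>as \<cdot> H n \<subseteq> H (n + 1)\<close> is a graded submodule of \<open>M[t]\<close> over the algebra
  generated by \<open>at\<close>, \<open>a \<in> as\<close>; \<open>graded_acc\<close> says that the graded module \<open>A/B\<close> is Noetherian.\<close>

definition graded :: "('a, 'k) ring_scheme \<Rightarrow> ('a, 'b) module \<Rightarrow> 'a set \<Rightarrow> (nat \<Rightarrow> 'b set) \<Rightarrow> bool" where
  "graded R M as H \<longleftrightarrow> (\<forall>n. submodule (H n) R M) \<and> (\<forall>a\<in>as. \<forall>n. \<forall>x\<in>H n. a \<odot>\<^bsub>M\<^esub> x \<in> H (Suc n))"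

definition graded_acc ::
    "('a, 'k) ring_scheme \<Rightarrow> ('a, 'b) module \<Rightarrow> 'a set \<Rightarrow> (nat \<Rightarrow> 'b set) \<Rightarrow> (nat \<Rightarrow> 'b set) \<Rightarrow> bool" where
  "graded_acc R M as A B \<longleftrightarrow> (\<forall>H :: nat \<Rightarrow> nat \<Rightarrow> 'b set. (\<forall>k. graded R M as (H k)) \<longrightarrow>
     (\<forall>k n. B n \<subseteq> H k n \<and> H k n \<subseteq> A n \<and> H k n \<subseteq> H (Suc k) n) \<longrightarrow> (\<exists>K. \<forall>k\<ge>K. H k = H K))"

lemma gradedD:
  assumes "graded R M as H"
  shows "submodule (H n) R M" "a \<in> as \<Longrightarrow> x \<in> H n \<Longrightarrow> a \<odot>\<^bsub>M\<^esub> x \<in> H (Suc n)"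
  using assms unfolding graded_def by auto

lemma gradedI:
  assumes "\<And>n. submodule (H n) R M" "\<And>a n x. a \<in> as \<Longrightarrow> x \<in> H n \<Longrightarrow> a \<odot>\<^bsub>M\<^esub> x \<in> H (Suc n)"
  shows "graded R M as H"
  using assms unfolding graded_def by auto

lemma graded_accD:
  assumes "graded_acc R M as A B" "\<And>k. graded R M as (H k)"
    "\<And>k n. B n \<subseteq> H k n" "\<And>k n. H k n \<subseteq> A n" "\<And>k n. H k n \<subseteq> H (Suc k) n"
  shows "\<exists>K. \<forall>k\<ge>K. H k = H K"
proof -
  have "(\<forall>k. graded R M as (H k)) \<longrightarrow>
     (\<forall>k n. B n \<subseteq> H k n \<and> H k n \<subseteq> A n \<and> H k n \<subseteq> H (Suc k) n) \<longrightarrow> (\<exists>K. \<forall>k\<ge>K. H k = H K)"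
    using assms(1) unfolding graded_acc_def by (rule spec)
  thus ?thesis using assms(2-5) by simp
qed

lemma graded_acc_mono:
  assumes "graded_acc R M as A B" "\<And>n. A' n \<subseteq> A n" "\<And>n. B n \<subseteq> B' n"
  shows "graded_acc R M as A' B'"
  unfolding graded_acc_def
proof (intro allI impI)
  fix H :: "nat \<Rightarrow> nat \<Rightarrow> _"
  assume g: "\<forall>k. graded R M as (H k)" and H: "\<forall>k n. B' n \<subseteq> H k n \<and> H k n \<subseteq> A' n \<and> H k n \<subseteq> H (Suc k) n"
  show "\<exists>K. \<forall>k\<ge>K. H k = H K"
  proof (rule graded_accD[OF assms(1)])
    show "graded R M as (H k)" for k using g by simp
    show "B n \<subseteq> H k n" for k n using H assms(3)[of n] order_trans by blast
    show "H k n \<subseteq> A n" for k n using H assms(2)[of n] order_trans by blast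
    show "H k n \<subseteq> H (Suc k) n" for k n using H by simp
  qed
qed

text \<open>In degree n this is the sum of all a^i V(n - i), the family generated by V under
  multiplication by a, where a raises the degree by one.\<close>

primrec adjoin :: "('a, 'b) module \<Rightarrow> 'a \<Rightarrow> (nat \<Rightarrow> 'b set) \<Rightarrow> nat \<Rightarrow> 'b set" where
  "adjoin M a V 0 = V 0"
| "adjoin M a V (Suc n) = V (Suc n) <+>\<^bsub>M\<^esub> (\<lambda>x. a \<odot>\<^bsub>M\<^esub> x) ` adjoin M a V n"

section \<open>Hilbert's basis theorem, the Artin-Rees lemma and the Hilbert-Serre theorem\<close>

context rmodule
begin

lemma adjoin_graded:
  assumes V: "graded R M as V" and a: "a \<in> carrier R" and as: "as \<subseteq> carrier R"
  shows "graded R M (insert a as) (adjoin M a V)"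
proof (rule gradedI)
  interpret a: mod_homo R M M "\<lambda>x. a \<odot>\<^bsub>M\<^esub> x" using a by (rule smult_homo)
  show W: "submodule (adjoin M a V n) R M" for n
    by (induct n) (simp_all add: gradedD(1)[OF V] sm_add a.image_sm)
  have aW: "a \<odot>\<^bsub>M\<^esub> x \<in> adjoin M a V (Suc n)" if "x \<in> adjoin M a V n" for x n
    using set_add_upper2[OF gradedD(1)[OF V, of "Suc n"] a.image_sm[OF W[of n]]] that by auto
  have VW: "V n \<subseteq> adjoin M a V n" for n
    using set_add_upper1[OF gradedD(1)[OF V] a.image_sm[OF W]] by (cases n) simp_all
  have bW: "b \<odot>\<^bsub>M\<^esub> x \<in> adjoin M a V (Suc n)" if b: "b \<in> as" and "x \<in> adjoin M a V n" for b x n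
    using that(2)
  proof (induct n arbitrary: x)
    case 0
    hence "b \<odot>\<^bsub>M\<^esub> x \<in> V (Suc 0)" using gradedD(2)[OF V b, of x 0] by simp
    thus ?case using VW[of "Suc 0"] by (auto simp del: adjoin.simps)
  next
    case (Suc n)
    then obtain v w where vw: "v \<in> V (Suc n)" "w \<in> adjoin M a V n" "x = v \<oplus>\<^bsub>M\<^esub> a \<odot>\<^bsub>M\<^esub> w"
      by (auto elim: set_addE)
    have c: "v \<in> carrier M" "w \<in> carrier M" "b \<in> carrier R"
      using smD(1)[OF gradedD(1)[OF V] vw(1)] smD(1)[OF W vw(2)] b as by auto
    have "b \<odot>\<^bsub>M\<^esub> x = b \<odot>\<^bsub>M\<^esub> v \<oplus>\<^bsub>M\<^esub> a \<odot>\<^bsub>M\<^esub> (b \<odot>\<^bsub>M\<^esub> w)"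
      using vw c a by (simp add: smult_r_distr smult_lcomm)
    thus ?case using gradedD(2)[OF V b vw(1)] Suc.hyps[OF vw(2)] by (auto intro!: set_addI)
  qed
  show "b \<odot>\<^bsub>M\<^esub> x \<in> adjoin M a V (Suc n)" if "b \<in> insert a as" "x \<in> adjoin M a V n" for b n x
    using that aW bW by auto
qed

text \<open>Hilbert's basis theorem: a graded submodule of \<open>adjoin M a V\<close> is controlled by its modules of
  lowest coefficients (with respect to powers of \<open>a\<close>).\<close>

lemma graded_acc_adjoin:
  assumes V: "graded R M as V" and acc: "graded_acc R M as V (\<lambda>n. {\<zero>\<^bsub>M\<^esub>})"
    and a: "a \<in> carrier R" and as: "as \<subseteq> carrier R"
  shows "graded_acc R M (insert a as) (adjoin M a V) (\<lambda>n. {\<zero>\<^bsub>M\<^esub>})"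
  unfolding graded_acc_def
proof (intro allI impI)
  let ?W = "adjoin M a V"
  have W: "graded R M (insert a as) ?W" using V a as by (rule adjoin_graded)
  \<comment> \<open>T n is a times the previous degree of W, so an element of W n is a coefficient
    in V n plus a tail in T n. This decomposition is not unique, which is why the sets D below
    quantify over the tail.\<close>
  define T where "T = (\<lambda>n. case n of 0 \<Rightarrow> {\<zero>\<^bsub>M\<^esub>} | Suc m \<Rightarrow> (\<lambda>x. a \<odot>\<^bsub>M\<^esub> x) ` ?W m)"
  interpret a: mod_homo R M M "\<lambda>x. a \<odot>\<^bsub>M\<^esub> x" using a by (rule smult_homo)
  have T: "submodule (T n) R M" for n
    using sm_zero a.image_sm[OF gradedD(1)[OF W]] by (auto simp: T_def split: nat.split)
  have Tc: "t \<in> T n \<Longrightarrow> t \<in> carrier M" for t n using smD(1)[OF T] .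
  have Vc: "v \<in> V n \<Longrightarrow> v \<in> carrier M" for v n using smD(1)[OF gradedD(1)[OF V]] .
  have bT: "b \<odot>\<^bsub>M\<^esub> t \<in> T (Suc n)" if b: "b \<in> as" and t: "t \<in> T n" for b t n
  proof (cases n)
    case 0
    hence "b \<odot>\<^bsub>M\<^esub> t = \<zero>\<^bsub>M\<^esub>" using t b as by (auto simp: T_def)
    thus ?thesis using smD(2)[OF T] by simp
  next
    case (Suc m)
    then obtain w where w: "w \<in> ?W m" "t = a \<odot>\<^bsub>M\<^esub> w" using t by (auto simp: T_def)
    have "b \<odot>\<^bsub>M\<^esub> t = a \<odot>\<^bsub>M\<^esub> (b \<odot>\<^bsub>M\<^esub> w)"
      using w b as a smD(1)[OF gradedD(1)[OF W] w(1)] by (auto simp: smult_lcomm)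
    moreover have "b \<odot>\<^bsub>M\<^esub> w \<in> ?W (Suc m)" using gradedD(2)[OF W _ w(1), of b] b by simp
    ultimately show ?thesis unfolding Suc by (simp add: T_def del: adjoin.simps)
  qed
  have WT: "\<exists>v\<in>V n. \<exists>t\<in>T n. w = v \<oplus>\<^bsub>M\<^esub> t" if "w \<in> ?W n" for w n
  proof (cases n)
    case 0
    thus ?thesis using that Vc by (auto simp: T_def intro!: bexI[of _ w])
  next
    case (Suc m)
    thus ?thesis using that by (auto simp: T_def elim!: set_addE)
  qed
  \<comment> \<open>The lowest coefficients, those at a^i, of the elements of H in degree n + i that
    have the form a^i w with w in W n.\<close>
  define D where "D = (\<lambda>i (H :: nat \<Rightarrow> _) n. {v \<in> V n. \<exists>t\<in>T n. a [^] i \<odot>\<^bsub>M\<^esub> (v \<oplus>\<^bsub>M\<^esub> t) \<in> H (n + i)})"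
  have ac: "a [^] (i::nat) \<in> carrier R" for i using a by simp
  have D: "graded R M as (D i H)" if H: "graded R M (insert a as) H" for i H
  proof (rule gradedI)
    have Hs: "submodule (H n) R M" for n using gradedD(1)[OF H] .
    show "submodule (D i H n) R M" for n
    proof (rule smI)
      show "D i H n \<subseteq> carrier M" using Vc by (auto simp: D_def)
      show "\<zero>\<^bsub>M\<^esub> \<in> D i H n"
        using smD(2)[OF gradedD(1)[OF V]] smD(2)[OF T] smD(2)[OF Hs] ac
        by (auto simp: D_def intro!: bexI[of _ "\<zero>\<^bsub>M\<^esub>"])
      fix x assume "x \<in> D i H n"
      then obtain t where x: "x \<in> V n" "t \<in> T n" "a [^] i \<odot>\<^bsub>M\<^esub> (x \<oplus>\<^bsub>M\<^esub> t) \<in> H (n + i)" by (auto simp: D_def)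
      show "r \<odot>\<^bsub>M\<^esub> x \<in> D i H n" if r: "r \<in> carrier R" for r
      proof -
        have "r \<odot>\<^bsub>M\<^esub> (a [^] i \<odot>\<^bsub>M\<^esub> (x \<oplus>\<^bsub>M\<^esub> t)) = a [^] i \<odot>\<^bsub>M\<^esub> (r \<odot>\<^bsub>M\<^esub> x \<oplus>\<^bsub>M\<^esub> r \<odot>\<^bsub>M\<^esub> t)"
          using x Vc Tc r ac by (simp add: smult_r_distr smult_lcomm)
        thus ?thesis using smD(4)[OF Hs r x(3)] smD(4)[OF T r x(2)] smD(4)[OF gradedD(1)[OF V] r x(1)]
          by (auto simp: D_def intro!: bexI[of _ "r \<odot>\<^bsub>M\<^esub> t"])
      qed
      fix y assume "y \<in> D i H n"
      then obtain s where y: "y \<in> V n" "s \<in> T n" "a [^] i \<odot>\<^bsub>M\<^esub> (y \<oplus>\<^bsub>M\<^esub> s) \<in> H (n + i)" by (auto simp: D_def)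
      have "a [^] i \<odot>\<^bsub>M\<^esub> (x \<oplus>\<^bsub>M\<^esub> t) \<oplus>\<^bsub>M\<^esub> a [^] i \<odot>\<^bsub>M\<^esub> (y \<oplus>\<^bsub>M\<^esub> s) = a [^] i \<odot>\<^bsub>M\<^esub> ((x \<oplus>\<^bsub>M\<^esub> y) \<oplus>\<^bsub>M\<^esub> (t \<oplus>\<^bsub>M\<^esub> s))"
        using x y Vc Tc ac by (simp add: smult_r_distr M.a_ac)
      thus "x \<oplus>\<^bsub>M\<^esub> y \<in> D i H n"
        using smD(3)[OF Hs x(3) y(3)] smD(3)[OF T x(2) y(2)] smD(3)[OF gradedD(1)[OF V] x(1) y(1)]
        by (auto simp: D_def intro!: bexI[of _ "t \<oplus>\<^bsub>M\<^esub> s"])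
    qed
    fix b n x assume b: "b \<in> as" and "x \<in> D i H n"
    then obtain t where x: "x \<in> V n" "t \<in> T n" "a [^] i \<odot>\<^bsub>M\<^esub> (x \<oplus>\<^bsub>M\<^esub> t) \<in> H (n + i)" by (auto simp: D_def)
    have "b \<odot>\<^bsub>M\<^esub> (a [^] i \<odot>\<^bsub>M\<^esub> (x \<oplus>\<^bsub>M\<^esub> t)) = a [^] i \<odot>\<^bsub>M\<^esub> (b \<odot>\<^bsub>M\<^esub> x \<oplus>\<^bsub>M\<^esub> b \<odot>\<^bsub>M\<^esub> t)"
      using x Vc Tc b as ac by (simp add: smult_r_distr smult_lcomm subset_iff)
    thus "b \<odot>\<^bsub>M\<^esub> x \<in> D i H (Suc n)"
      using gradedD(2)[OF H _ x(3), of b] b bT[OF b x(2)] gradedD(2)[OF V b x(1)]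
      by (auto simp: D_def intro!: bexI[of _ "b \<odot>\<^bsub>M\<^esub> t"])
  qed
  have D_Suc: "D i H n \<subseteq> D (Suc i) H n" if H: "graded R M (insert a as) H" for i H n
  proof
    fix x assume "x \<in> D i H n"
    then obtain t where x: "x \<in> V n" "t \<in> T n" "a [^] i \<odot>\<^bsub>M\<^esub> (x \<oplus>\<^bsub>M\<^esub> t) \<in> H (n + i)" by (auto simp: D_def)
    have "a \<odot>\<^bsub>M\<^esub> (a [^] i \<odot>\<^bsub>M\<^esub> (x \<oplus>\<^bsub>M\<^esub> t)) = a [^] Suc i \<odot>\<^bsub>M\<^esub> (x \<oplus>\<^bsub>M\<^esub> t)"
      using x Vc Tc a ac by (simp add: smult_assoc1 smult_lcomm)
    thus "x \<in> D (Suc i) H n"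
      using gradedD(2)[OF H _ x(3), of a] x by (auto simp: D_def intro!: bexI[of _ t])
  qed
  fix H :: "nat \<Rightarrow> nat \<Rightarrow> _"
  assume "\<forall>k. graded R M (insert a as) (H k)"
    and "\<forall>k n. {\<zero>\<^bsub>M\<^esub>} \<subseteq> H k n \<and> H k n \<subseteq> ?W n \<and> H k n \<subseteq> H (Suc k) n"
  hence H: "\<And>k. graded R M (insert a as) (H k)" "\<And>k n. H k n \<subseteq> ?W n" "\<And>k n. H k n \<subseteq> H (Suc k) n" by auto
  have Hmono: "H k n \<subseteq> H l n" if "k \<le> l" for k l n
    using mono_chain[of "\<lambda>k. H k n", OF H(3) that] .
  have Dk: "D i (H k) n \<subseteq> D i (H l) n" if "k \<le> l" for i k l n
    using Hmono[OF that] by (auto simp: D_def)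
  have Di: "D i (H k) n \<subseteq> D j (H k) n" if "i \<le> j" for i j k n
    using mono_chain[of "\<lambda>i. D i (H k) n", OF D_Suc[OF H(1)] that] .
  have D0: "{\<zero>\<^bsub>M\<^esub>} \<subseteq> D i (H k) n" "D i (H k) n \<subseteq> V n" for i k n
    using smD(2)[OF gradedD(1)[OF D[OF H(1)]]] by (auto simp: D_def)
  \<comment> \<open>D i (H k) increases with i and with k. The chain condition for V is applied to
    the diagonal, which settles all i and k beyond K1, and afterwards to each of the finitely many
    rows i < K1.\<close>
  have "\<exists>K. \<forall>k\<ge>K. D k (H k) = D K (H K)"
  proof (rule graded_accD[OF acc, of "\<lambda>k. D k (H k)"])
    show "D k (H k) n \<subseteq> D (Suc k) (H (Suc k)) n" for k n
      using Di[of k "Suc k" k n] Dk[of k "Suc k" "Suc k" n] by simp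
  qed (use D H D0 in auto)
  then obtain K1 where K1: "\<And>k. k \<ge> K1 \<Longrightarrow> D k (H k) = D K1 (H K1)" by blast
  have "\<exists>K. \<forall>k\<ge>K. D i (H k) = D i (H K)" for i
  proof (rule graded_accD[OF acc, of "\<lambda>k. D i (H k)"])
    show "D i (H k) n \<subseteq> D i (H (Suc k)) n" for k n by (rule Dk) simp
  qed (use D H D0 in auto)
  then obtain N where N: "\<And>i k. k \<ge> N i \<Longrightarrow> D i (H k) = D i (H (N i))" by metis
  define K where "K = Max (insert K1 (N ` {..<K1}))"
  have K: "K \<ge> K1" "\<And>i. i < K1 \<Longrightarrow> K \<ge> N i" by (auto simp: K_def)
  have stable: "D i (H k) = D i (H K)" if k: "k \<ge> K" for i k
  proof (cases "i < K1")
    case True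
    hence "N i \<le> K" "N i \<le> k" using K(2) k by (auto intro: order_trans)
    thus ?thesis using N[of i k] N[of i K] by simp
  next
    case False
    have "D i (H k) = D K1 (H K1)" if "k \<ge> K1" for k
    proof
      fix n
      have "D i (H k) n \<subseteq> D (max i k) (H (max i k)) n"
        using Di[of i "max i k" k n] Dk[of k "max i k" "max i k" n] by simp
      hence "D i (H k) n \<subseteq> D K1 (H K1) n" using K1[of "max i k"] that by simp
      moreover have "D K1 (H K1) n \<subseteq> D i (H k) n"
        using Di[of K1 i K1 n] Dk[of K1 k i n] False that by simp
      ultimately show "D i (H k) n = D K1 (H K1) n" by simp
    qed
    thus ?thesis using K k by simp
  qed
  have Hc: "h \<in> H k n \<Longrightarrow> h \<in> carrier M" for h k n using smD(1)[OF gradedD(1)[OF H(1)]] .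
  \<comment> \<open>Induction on n, the degree left beside the factor a^(L-n). An element of H K
    with the same lowest coefficient is subtracted, and the difference is divisible by one more
    power of a. At n = 0 no tail is left, because T 0 is zero.\<close>
  have descent: "h \<in> H K L"
    if "k \<ge> K" "n \<le> L" "h \<in> H k L" "w \<in> ?W n" "h = a [^] (L - n) \<odot>\<^bsub>M\<^esub> w" for k n L h w
    using that
  proof (induct n arbitrary: h w)
    case (0 h w)
    obtain v t where vt: "v \<in> V 0" "t \<in> T 0" "w = v \<oplus>\<^bsub>M\<^esub> t" using WT[OF 0(4)] by blast
    have "v \<in> D L (H k) 0" using 0 vt by (auto simp: D_def)
    hence "v \<in> D L (H K) 0" unfolding stable[OF 0(1)] .
    thus ?case using vt 0 by (auto simp: D_def T_def)
  next
    case (Suc n h w)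
    let ?i = "L - Suc n"
    obtain v t where vt: "v \<in> V (Suc n)" "t \<in> T (Suc n)" "w = v \<oplus>\<^bsub>M\<^esub> t" using WT[OF Suc.prems(4)] by blast
    have "v \<in> D ?i (H k) (Suc n)" using Suc.prems vt by (auto simp: D_def)
    hence "v \<in> D ?i (H K) (Suc n)" unfolding stable[OF Suc.prems(1)] .
    then obtain t' where t': "t' \<in> T (Suc n)" "a [^] ?i \<odot>\<^bsub>M\<^esub> (v \<oplus>\<^bsub>M\<^esub> t') \<in> H K L"
      using Suc.prems(2) by (auto simp: D_def)
    let ?h' = "a [^] ?i \<odot>\<^bsub>M\<^esub> (v \<oplus>\<^bsub>M\<^esub> t')"
    obtain w' where w': "w' \<in> ?W n" "t \<ominus>\<^bsub>M\<^esub> t' = a \<odot>\<^bsub>M\<^esub> w'"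
      using smD(6)[OF T vt(2) t'(1)] by (auto simp: T_def)
    have c: "v \<in> carrier M" "t \<in> carrier M" "t' \<in> carrier M" "w' \<in> carrier M"
      using Vc vt Tc t' smD(1)[OF gradedD(1)[OF W] w'(1)] by auto
    have "h \<ominus>\<^bsub>M\<^esub> ?h' = a [^] ?i \<odot>\<^bsub>M\<^esub> ((v \<oplus>\<^bsub>M\<^esub> t) \<ominus>\<^bsub>M\<^esub> (v \<oplus>\<^bsub>M\<^esub> t'))"
      using Suc.prems(5) vt c ac by (simp add: smult_minus_distr)
    also have "\<dots> = a [^] ?i \<odot>\<^bsub>M\<^esub> (a \<odot>\<^bsub>M\<^esub> w')" using c w' a by (simp add: add_minus_add minus_self)
    also have "\<dots> = a [^] Suc ?i \<odot>\<^bsub>M\<^esub> w'" using c a ac by (simp add: smult_assoc1)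
    also have "Suc ?i = L - n" using Suc.prems(2) by simp
    finally have eq: "h \<ominus>\<^bsub>M\<^esub> ?h' = a [^] (L - n) \<odot>\<^bsub>M\<^esub> w'" .
    have "?h' \<in> H k L" using t'(2) Hmono[OF Suc.prems(1)] by auto
    hence "h \<ominus>\<^bsub>M\<^esub> ?h' \<in> H k L" using smD(6)[OF gradedD(1)[OF H(1)]] Suc.prems(3) by simp
    hence "h \<ominus>\<^bsub>M\<^esub> ?h' \<in> H K L" using Suc.hyps[OF Suc.prems(1) _ _ w'(1) eq] Suc.prems(2) by simp
    hence "h \<ominus>\<^bsub>M\<^esub> ?h' \<oplus>\<^bsub>M\<^esub> ?h' \<in> H K L" using smD(3)[OF gradedD(1)[OF H(1)]] t'(2) by simp
    thus ?case using Hc[OF Suc.prems(3)] Hc[OF t'(2)] by (simp add: minus_add_cancel)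
  qed
  have "H k = H K" if k: "k \<ge> K" for k
  proof
    fix n
    have "h \<in> H K n" if h: "h \<in> H k n" for h
      using descent[OF k order_refl h, of h] H(2) h Hc[OF h] by auto
    thus "H k n = H K n" using Hmono[OF k] by auto
  qed
  thus "\<exists>K. \<forall>k\<ge>K. H k = H K" by blast
qed

text \<open>The scalars that take x into H (n+1) form an ideal, so closure under generators is
  closure under the ideal they generate.\<close>

lemma graded_genideal:
  assumes "graded R M as H" "as \<subseteq> carrier R"
  shows "graded R M (Idl as) H"
proof (rule gradedI)
  show "submodule (H n) R M" for n using gradedD(1)[OF assms(1)] .
  fix b n x assume b: "b \<in> Idl as" and x: "x \<in> H n"
  have xc: "x \<in> carrier M" using smD(1)[OF gradedD(1)[OF assms(1)] x] .
  have "Idl as \<subseteq> {r \<in> carrier R. r \<odot>\<^bsub>M\<^esub> x \<in> H (Suc n)}"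
    using assms gradedD(2)[OF assms(1) _ x] by (intro R.genideal_minimal colon_ideal gradedD(1)[OF assms(1)] xc) auto
  thus "b \<odot>\<^bsub>M\<^esub> x \<in> H (Suc n)" using b by auto
qed

lemma graded_subset: "graded R M as H \<Longrightarrow> bs \<subseteq> as \<Longrightarrow> graded R M bs H"
  unfolding graded_def by auto

text \<open>The Rees module, the sum of all I^n M, is Noetherian: starting from M concentrated in
  degree 0, the generators of I are adjoined one at a time, and the resulting family contains I^n M
  in degree n.\<close>

lemma graded_acc_powers:
  assumes noeth: "noeth_on R M (carrier M)" and as: "set as \<subseteq> carrier R"
  shows "graded_acc R M (set as) (\<lambda>n. imul R M (ipow R (Idl (set as)) n) (carrier M)) (\<lambda>n. {\<zero>\<^bsub>M\<^esub>})"
proof -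
  have "\<exists>V. graded R M (set as) V \<and> V 0 = carrier M \<and> graded_acc R M (set as) V (\<lambda>n. {\<zero>\<^bsub>M\<^esub>})"
    using as
  proof (induct as)
    case Nil
    let ?V = "\<lambda>n::nat. if n = 0 then carrier M else {\<zero>\<^bsub>M\<^esub>}"
    have "graded_acc R M {} ?V (\<lambda>n. {\<zero>\<^bsub>M\<^esub>})"
      unfolding graded_acc_def
    proof (intro allI impI)
      fix H :: "nat \<Rightarrow> nat \<Rightarrow> _"
      assume g: "\<forall>k. graded R M {} (H k)"
        and "\<forall>k n. {\<zero>\<^bsub>M\<^esub>} \<subseteq> H k n \<and> H k n \<subseteq> ?V n \<and> H k n \<subseteq> H (Suc k) n"
      hence H: "\<And>k n. {\<zero>\<^bsub>M\<^esub>} \<subseteq> H k n" "\<And>k n. H k n \<subseteq> ?V n" "\<And>k n. H k n \<subseteq> H (Suc k) n" by auto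
      have g0: "submodule (H k 0) R M" for k using g gradedD(1) by blast
      have H0: "H k 0 \<subseteq> carrier M" for k using H(2)[of k 0] by simp
      have H1: "H k (Suc m) = {\<zero>\<^bsub>M\<^esub>}" for k m
      proof
        show "{\<zero>\<^bsub>M\<^esub>} \<subseteq> H k (Suc m)" by (rule H(1))
      qed (use H(2)[of k "Suc m"] in simp)
      obtain K where K: "\<forall>k\<ge>K. H k 0 = H K 0"
        using noeth_onD[where c = "\<lambda>k. H k 0", OF noeth g0 H0 H(3)] by blast
      have "H k n = H K n" if "k \<ge> K" for k n
      proof (cases n)
        case 0 thus ?thesis using K that by blast
      qed (simp only: H1)
      thus "\<exists>K. \<forall>k\<ge>K. H k = H K" by blast
    qed
    moreover have "graded R M {} ?V" by (rule gradedI) (auto simp: carrier_is_submodule sm_zero)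
    ultimately show ?case by (intro exI[of _ ?V]) simp
  next
    case (Cons a as)
    then obtain V where "graded R M (set as) V" "V 0 = carrier M" "graded_acc R M (set as) V (\<lambda>n. {\<zero>\<^bsub>M\<^esub>})" by auto
    thus ?case using Cons.prems adjoin_graded[of "set as" V a] graded_acc_adjoin[of "set as" V a]
      by (intro exI[of _ "adjoin M a V"]) simp
  qed
  then obtain V where V: "graded R M (set as) V" "V 0 = carrier M" "graded_acc R M (set as) V (\<lambda>n. {\<zero>\<^bsub>M\<^esub>})" by auto
  have V': "graded R M (Idl (set as)) V" using V(1) as by (rule graded_genideal)
  have I: "ideal (Idl (set as)) R" using as by (rule R.genideal_ideal)
  have "imul R M (ipow R (Idl (set as)) n) (carrier M) \<subseteq> V n" for n
  proof (induct n)
    case 0 show ?case using V(2) imul_ipow_0[OF carrier_is_submodule] by simp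
  next
    case (Suc n)
    show ?case unfolding imul_ipow_Suc(2)[OF I order_refl]
      by (rule imul_least[OF gradedD(1)[OF V(1)]]) (use Suc gradedD(2)[OF V'] in auto)
  qed
  thus ?thesis by (rule graded_acc_mono[OF V(3)]) simp
qed

text \<open>The chain condition is applied to families H k that agree with A up to degree k and are
  generated by A k beyond. Where this chain becomes constant, A is generated from degree K
  on.\<close>

lemma artin_rees:
  assumes I: "ideal I R" and A: "graded R M I A" and acc: "graded_acc R M I A (\<lambda>n. {\<zero>\<^bsub>M\<^esub>})"
  obtains K where "\<And>n. A (K + n) \<subseteq> imul R M (ipow R I n) (A K)"
proof -
  have cI: "I \<subseteq> carrier R" using ideal.Icarr[OF I] by auto
  have cP: "ipow R I n \<subseteq> carrier R" for n using ideal.Icarr[OF R.ipow_ideal[OF I]] by auto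
  have cA: "A n \<subseteq> carrier M" for n using smD(1)[OF gradedD(1)[OF A]] by auto
  have IA: "imul R M I (A n) \<subseteq> A (Suc n)" for n
    using gradedD(1)[OF A] gradedD(2)[OF A] by (intro imul_least) auto
  have sm: "submodule (imul R M (ipow R I n) (A k)) R M" for n k using cP cA by (rule imul_sm)
  have IiA: "imul R M (ipow R I n) (A k) \<subseteq> A (k + n)" for n k
  proof (induct n)
    case 0 show ?case using imul_ipow_0[OF gradedD(1)[OF A]] by simp
  next
    case (Suc n)
    have "imul R M (ipow R I (Suc n)) (A k) = imul R M I (imul R M (ipow R I n) (A k))"
      using I cA by (rule imul_ipow_Suc(2))
    also have "\<dots> \<subseteq> imul R M I (A (k + n))" by (rule imul_mono[OF order_refl Suc cI cA])
    also have "\<dots> \<subseteq> A (k + Suc n)" using IA[of "k + n"] by simp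
    finally show ?case .
  qed
  define H where "H = (\<lambda>k n. if n \<le> k then A n else imul R M (ipow R I (n - k)) (A k))"
  have "\<exists>K. \<forall>k\<ge>K. H k = H K"
  proof (rule graded_accD[OF acc])
    fix k
    show "graded R M I (H k)"
    proof (rule gradedI)
      show "submodule (H k n) R M" for n using gradedD(1)[OF A] sm by (simp add: H_def)
      fix a n x assume a: "a \<in> I" and x: "x \<in> H k n"
      consider "n < k" | "n = k" | "k < n" by linarith
      thus "a \<odot>\<^bsub>M\<^esub> x \<in> H k (Suc n)"
      proof cases
        case 1 thus ?thesis using x gradedD(2)[OF A a, of x n] by (simp add: H_def)
      next
        case 2
        have "imul R M (ipow R I 1) (A k) = imul R M I (A k)"
          using imul_ipow_Suc(2)[OF I cA, of 0] imul_ipow_0[OF gradedD(1)[OF A]] by simp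
        thus ?thesis using x 2 imul_incl[OF a, of x "A k"] by (simp add: H_def)
      next
        case 3
        hence "H k (Suc n) = imul R M I (H k n)"
          using imul_ipow_Suc(2)[OF I cA, of "n - k"] by (simp add: H_def Suc_diff_le)
        thus ?thesis using imul_incl[OF a x] by simp
      qed
    qed
    fix n
    show "H k n \<subseteq> A n" using IiA[of "n - k" k] by (cases "n \<le> k") (simp_all add: H_def)
    show "{\<zero>\<^bsub>M\<^esub>} \<subseteq> H k n" using smD(2)[OF sm] smD(2)[OF gradedD(1)[OF A]] by (simp add: H_def)
    show "H k n \<subseteq> H (Suc k) n"
    proof (cases "n \<le> Suc k")
      case True thus ?thesis using \<open>H k n \<subseteq> A n\<close> by (simp add: H_def)
    next
      case False
      then obtain j where n: "n = Suc k + Suc j" using less_imp_Suc_add[of "Suc k" n] by auto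
      \<comment> \<open>Beyond degree k + 1 one factor I is moved onto A k, and I A(k) lies in
        A(k+1).\<close>
      have "imul R M (ipow R I (Suc (Suc j))) (A k) = imul R M (ipow R I (Suc j)) (imul R M I (A k))"
        using I cA by (rule imul_ipow_Suc(1))
      also have "\<dots> \<subseteq> imul R M (ipow R I (Suc j)) (A (Suc k))" by (rule imul_mono[OF order_refl IA cP cA])
      finally show ?thesis unfolding n by (simp add: H_def)
    qed
  qed
  then obtain K where K: "\<And>k. k \<ge> K \<Longrightarrow> H k = H K" by blast
  have "A (K + n) \<subseteq> imul R M (ipow R I n) (A K)" for n
  proof (cases n)
    case 0 thus ?thesis using imul_ipow_0[OF gradedD(1)[OF A]] by simp
  next
    case (Suc m)
    have "A (K + n) = H (K + n) (K + n)" by (simp add: H_def)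
    also have "\<dots> = H K (K + n)" using K[of "K + n"] by simp
    also have "\<dots> = imul R M (ipow R I n) (A K)" using Suc by (simp add: H_def)
    finally show ?thesis by simp
  qed
  thus ?thesis by (rule that)
qed

abbreviation "flen A B \<equiv> real (the_enat (rlen R M A B))"

text \<open>\<open>the_enat\<close> is additive only on finite values; finiteness of the outer
  length is handed on to both parts.\<close>

lemma flen_add:
  assumes "submodule A R M" "submodule B R M" "C \<subseteq> B" "B \<subseteq> A" "rlen R M A C \<noteq> \<infinity>"
  shows "flen A C = flen A B + flen B C" "rlen R M A B \<noteq> \<infinity>" "rlen R M B C \<noteq> \<infinity>"
proof -
  have *: "rlen R M A C = rlen R M A B + rlen R M B C" using assms by (intro rlen_add)
  thus fin: "rlen R M A B \<noteq> \<infinity>" "rlen R M B C \<noteq> \<infinity>"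
    using assms(5) by (cases "rlen R M A B"; cases "rlen R M B C"; simp)+
  show "flen A C = flen A B + flen B C" using fin unfolding * by auto
qed

text \<open>Induction on the number of operators. Multiplication by a, from degree n to degree n + 1
  of A/B, has kernel K/B and cokernel A/C. Both are annihilated by a, so they inherit the chain
  condition over the remaining operators. The increment of the length of A/B is the length of A/C in
  degree n + 1 minus that of K/B in degree n.\<close>

theorem hilbert_polynomial:
  assumes "set as \<subseteq> carrier R" "graded R M (set as) A" "graded R M (set as) B" "graded_acc R M (set as) A B"
    "\<And>n. B n \<subseteq> A n" "\<And>n. rlen R M (A n) (B n) \<noteq> \<infinity>"
  shows "\<exists>k. evp k (\<lambda>n. flen (A n) (B n))"
  using assms
proof (induct as arbitrary: A B)
  case Nil
  \<comment> \<open>Without operators every family of submodules is graded. Filling up from B to A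
    degree by degree is a chain, and its stationarity forces A n = B n for large n.\<close>
  let ?H = "\<lambda>k n. if n < k then A n else B n"
  have "\<exists>K. \<forall>k\<ge>K. ?H k = ?H K"
  proof (rule graded_accD[OF Nil(4)])
    show "graded R M (set []) (?H k)" for k
      using gradedD(1)[OF Nil(2)] gradedD(1)[OF Nil(3)] by (intro gradedI) auto
  qed (use Nil(5) in auto)
  then obtain K where K: "\<And>k. k \<ge> K \<Longrightarrow> ?H k = ?H K" by blast
  have "A n = B n" if n: "n \<ge> K" for n
  proof -
    have "?H (Suc n) n = ?H K n" by (rule fun_cong[OF K]) (use n in simp)
    thus ?thesis using n by simp
  qed
  hence "\<forall>\<^sub>F n in sequentially. flen (A n) (B n) = 0"
    unfolding eventually_sequentially by (intro exI[of _ K]) (simp add: rlen_self zero_enat_def)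
  thus ?case unfolding evp_def by (intro exI[of _ 0]) simp
next
  case (Cons a as)
  note A = Cons.prems(2) and B = Cons.prems(3)
  have a: "a \<in> carrier R" and as: "set as \<subseteq> carrier R" using Cons.prems(1) by auto
  interpret a: mod_homo R M M "\<lambda>x. a \<odot>\<^bsub>M\<^esub> x" using a by (rule smult_homo)
  have As: "submodule (A n) R M" and Bs: "submodule (B n) R M" for n
    using gradedD(1)[OF A] gradedD(1)[OF B] by auto
  have Ac: "x \<in> A n \<Longrightarrow> x \<in> carrier M" for x n using smD(1)[OF As] .
  have aA: "(\<lambda>x. a \<odot>\<^bsub>M\<^esub> x) ` A n \<subseteq> A (Suc n)" and aB: "(\<lambda>x. a \<odot>\<^bsub>M\<^esub> x) ` B n \<subseteq> B (Suc n)" for n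
    using gradedD(2)[OF A] gradedD(2)[OF B] by auto
  define K where "K = (\<lambda>n. {x \<in> A n. a \<odot>\<^bsub>M\<^esub> x \<in> B (Suc n)})"
  define C where "C = (\<lambda>n. case n of 0 \<Rightarrow> B 0 | Suc m \<Rightarrow> (\<lambda>x. a \<odot>\<^bsub>M\<^esub> x) ` A m <+>\<^bsub>M\<^esub> B (Suc m))"
  have Ks: "submodule (K n) R M" for n unfolding K_def by (rule a.vimage_sm[OF As Bs])
  have Cs: "submodule (C n) R M" for n
    unfolding C_def using Bs sm_add[OF a.image_sm[OF As] Bs] by (auto split: nat.split)
  have BK: "B n \<subseteq> K n" and KA: "K n \<subseteq> A n" for n
    using Cons.prems(5) aB[of n] by (auto simp: K_def)
  have BC: "B n \<subseteq> C n" for n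
    using set_add_upper2[OF a.image_sm[OF As] Bs] by (auto simp: C_def split: nat.split)
  have CA: "C n \<subseteq> A n" for n
  proof (cases n)
    case (Suc m)
    thus ?thesis using aA[of m] Cons.prems(5)[of n] set_add_least[OF As, of _ n] by (simp add: C_def)
  qed (use Cons.prems(5) in \<open>simp add: C_def\<close>)
  have bcomm: "b \<odot>\<^bsub>M\<^esub> (a \<odot>\<^bsub>M\<^esub> x) = a \<odot>\<^bsub>M\<^esub> (b \<odot>\<^bsub>M\<^esub> x)" if "b \<in> set as" "x \<in> carrier M" for b x
    using that as a by (auto intro: smult_lcomm)
  have gA: "graded R M (set as) A" and gB: "graded R M (set as) B"
    using graded_subset[OF A] graded_subset[OF B] by auto
  have gK: "graded R M (set as) K"
  proof (rule gradedI)
    fix b n x assume b: "b \<in> set as" and x: "x \<in> K n"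
    have x': "x \<in> A n" "a \<odot>\<^bsub>M\<^esub> x \<in> B (Suc n)" using x by (auto simp: K_def)
    show "b \<odot>\<^bsub>M\<^esub> x \<in> K (Suc n)"
      using gradedD(2)[OF gA b x'(1)] gradedD(2)[OF gB b x'(2)] bcomm[OF b Ac[OF x'(1)]]
      by (simp add: K_def)
  qed (rule Ks)
  have gC: "graded R M (set as) C"
  proof (rule gradedI)
    fix b n x assume b: "b \<in> set as" and x: "x \<in> C n"
    show "b \<odot>\<^bsub>M\<^esub> x \<in> C (Suc n)"
    proof (cases n)
      case 0
      hence "x \<in> B 0" using x by (simp add: C_def)
      thus ?thesis using gradedD(2)[OF gB b, of x 0] BC[of "Suc 0"] 0 by auto
    next
      case (Suc m)
      then obtain y z where yz: "y \<in> A m" "z \<in> B (Suc m)" "x = a \<odot>\<^bsub>M\<^esub> y \<oplus>\<^bsub>M\<^esub> z"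
        using x by (auto simp: C_def elim!: set_addE)
      have c: "y \<in> carrier M" "z \<in> carrier M" "b \<in> carrier R" using Ac yz smD(1)[OF Bs] b as by auto
      have "b \<odot>\<^bsub>M\<^esub> x = a \<odot>\<^bsub>M\<^esub> (b \<odot>\<^bsub>M\<^esub> y) \<oplus>\<^bsub>M\<^esub> b \<odot>\<^bsub>M\<^esub> z"
        using yz c a bcomm[OF b c(1)] by (simp add: smult_r_distr)
      thus ?thesis unfolding Suc C_def
        using gradedD(2)[OF gA b yz(1)] gradedD(2)[OF gB b yz(2)] by (auto intro!: set_addI)
    qed
  qed (rule Cs)
  have accK: "graded_acc R M (set as) K B"
    unfolding graded_acc_def
  proof (intro allI impI)
    fix H :: "nat \<Rightarrow> nat \<Rightarrow> _"
    assume g: "\<forall>k. graded R M (set as) (H k)" and H: "\<forall>k n. B n \<subseteq> H k n \<and> H k n \<subseteq> K n \<and> H k n \<subseteq> H (Suc k) n"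
    show "\<exists>K. \<forall>k\<ge>K. H k = H K"
    proof (rule graded_accD[OF Cons.prems(4)])
      fix k n
      have "B n \<subseteq> H k n \<and> H k n \<subseteq> K n \<and> H k n \<subseteq> H (Suc k) n" using H by (elim allE)
      thus "B n \<subseteq> H k n" "H k n \<subseteq> A n" "H k n \<subseteq> H (Suc k) n" using KA[of n] by (simp_all, meson order_trans)
      show "graded R M (set (a # as)) (H k)"
      proof (rule gradedI)
        fix b n x assume b: "b \<in> set (a # as)" and x: "x \<in> H k n"
        \<comment> \<open>Closure under the operator a is automatic: it maps K n into B (n+1), which
          lies in every H k.\<close>
        have "H k n \<subseteq> K n" "B (Suc n) \<subseteq> H k (Suc n)" using H by auto
        hence "a \<odot>\<^bsub>M\<^esub> x \<in> H k (Suc n)" using x by (auto simp: K_def)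
        moreover have "b \<odot>\<^bsub>M\<^esub> x \<in> H k (Suc n)" if "b \<in> set as" using g gradedD(2)[of R M "set as" "H k", OF _ that x] by simp
        ultimately show "b \<odot>\<^bsub>M\<^esub> x \<in> H k (Suc n)" using b by auto
      qed (rule gradedD(1)[OF spec[OF g]])
    qed
  qed
  have accC: "graded_acc R M (set as) A C"
    unfolding graded_acc_def
  proof (intro allI impI)
    fix H :: "nat \<Rightarrow> nat \<Rightarrow> _"
    assume g: "\<forall>k. graded R M (set as) (H k)" and H: "\<forall>k n. C n \<subseteq> H k n \<and> H k n \<subseteq> A n \<and> H k n \<subseteq> H (Suc k) n"
    show "\<exists>K. \<forall>k\<ge>K. H k = H K"
    proof (rule graded_accD[OF Cons.prems(4)])
      fix k n
      have "C n \<subseteq> H k n \<and> H k n \<subseteq> A n \<and> H k n \<subseteq> H (Suc k) n" using H by (elim allE)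
      thus "B n \<subseteq> H k n" "H k n \<subseteq> A n" "H k n \<subseteq> H (Suc k) n" using BC[of n] by (simp_all, meson order_trans)
      show "graded R M (set (a # as)) (H k)"
      proof (rule gradedI)
        fix b n x assume b: "b \<in> set (a # as)" and x: "x \<in> H k n"
        \<comment> \<open>Here closure under a holds because a maps all of A n into C (n+1).\<close>
        have "x \<in> A n" "C (Suc n) \<subseteq> H k (Suc n)" using H x by auto
        moreover have "a \<odot>\<^bsub>M\<^esub> x \<in> C (Suc n)"
          using set_add_upper1[OF a.image_sm[OF As[of n]] Bs[of "Suc n"]] calculation(1) by (auto simp: C_def)
        ultimately have "a \<odot>\<^bsub>M\<^esub> x \<in> H k (Suc n)" by auto
        moreover have "b \<odot>\<^bsub>M\<^esub> x \<in> H k (Suc n)" if "b \<in> set as" using g gradedD(2)[of R M "set as" "H k", OF _ that x] by simp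
        ultimately show "b \<odot>\<^bsub>M\<^esub> x \<in> H k (Suc n)" using b by auto
      qed (rule gradedD(1)[OF spec[OF g]])
    qed
  qed
  note lenK = flen_add[OF As Ks BK KA Cons.prems(6)]
  note lenC = flen_add[OF As Cs BC CA Cons.prems(6)]
  obtain k1 where k1: "evp k1 (\<lambda>n. flen (K n) (B n))"
    using Cons.hyps[OF as gK gB accK BK lenK(3)] by blast
  obtain k2 where k2: "evp k2 (\<lambda>n. flen (A n) (C n))"
    using Cons.hyps[OF as gA gC accC CA lenC(2)] by blast
  have eq: "rlen R M (A n) (K n) = rlen R M (C (Suc n)) (B (Suc n))" for n
    by (rule a.rlen_eq[OF As Cs Bs BC]) (simp_all add: C_def K_def)
  have diff: "flen (A (Suc n)) (B (Suc n)) - flen (A n) (B n) = flen (A (Suc n)) (C (Suc n)) - flen (K n) (B n)" for n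
    using lenK(1)[of n] lenC(1)[of "Suc n"] eq[of n] by simp
  \<comment> \<open>The shifted sequence is the difference plus the sequence itself, with the sum
    written as f - (0 - g) so that \<open>evp_diff\<close> applies.\<close>
  have "evp (Suc k2) (\<lambda>n. flen (A (Suc n)) (C (Suc n)))"
  proof -
    from evp_diff[OF evp_Suc[OF evp_difference[OF evp_Suc[OF k2]]] evp_diff[OF evp_zero evp_Suc[OF k2]]]
    show ?thesis by simp
  qed
  from evp_diff'[OF this k1] have "evp (max (Suc k2) k1) (\<lambda>n. flen (A (Suc n)) (B (Suc n)) - flen (A n) (B n))"
    by (simp only: diff)
  thus ?case using evp_antidifference[of _ "\<lambda>n. flen (A n) (B n)"] by blast
qed

end

section \<open>Tensor products\<close>

locale module_pair = M: rmodule R M + N: rmodule R N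
  for R :: "('a, 'k) ring_scheme" (structure) and M :: "('a, 'b) module" and N :: "('a, 'c) module"
begin

abbreviation "FT \<equiv> free_mod R (carrier M \<times> carrier N)"
abbreviation "KT \<equiv> tensor_ker R M N"
abbreviation "MN \<equiv> tensor_mod R M N"
abbreviation "ptens \<equiv> pure_tensor R M N"

sublocale FT: rmodule R FT
  using M.R.free_mod_module by (rule rmoduleI)

lemma gen_closed: "x \<in> carrier M \<Longrightarrow> y \<in> carrier N \<Longrightarrow> free_gen R (x, y) \<in> carrier FT"
  by (rule M.R.free_gen_closed) simp

lemma tensor_rels_least:
  assumes H: "\<And>x x' y. x \<in> carrier M \<Longrightarrow> x' \<in> carrier M \<Longrightarrow> y \<in> carrier N \<Longrightarrow>
      free_gen R (x \<oplus>\<^bsub>M\<^esub> x', y) \<ominus>\<^bsub>FT\<^esub> (free_gen R (x, y) \<oplus>\<^bsub>FT\<^esub> free_gen R (x', y)) \<in> H"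
    "\<And>x y y'. x \<in> carrier M \<Longrightarrow> y \<in> carrier N \<Longrightarrow> y' \<in> carrier N \<Longrightarrow>
      free_gen R (x, y \<oplus>\<^bsub>N\<^esub> y') \<ominus>\<^bsub>FT\<^esub> (free_gen R (x, y) \<oplus>\<^bsub>FT\<^esub> free_gen R (x, y')) \<in> H"
    "\<And>a x y. a \<in> carrier R \<Longrightarrow> x \<in> carrier M \<Longrightarrow> y \<in> carrier N \<Longrightarrow>
      free_gen R (a \<odot>\<^bsub>M\<^esub> x, y) \<ominus>\<^bsub>FT\<^esub> (a \<odot>\<^bsub>FT\<^esub> free_gen R (x, y)) \<in> H"
    "\<And>a x y. a \<in> carrier R \<Longrightarrow> x \<in> carrier M \<Longrightarrow> y \<in> carrier N \<Longrightarrow>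
      free_gen R (x, a \<odot>\<^bsub>N\<^esub> y) \<ominus>\<^bsub>FT\<^esub> (a \<odot>\<^bsub>FT\<^esub> free_gen R (x, y)) \<in> H"
  shows "tensor_rels R M N \<subseteq> H"
  unfolding tensor_rels_def Let_def
  by (intro Un_least subsetI; elim CollectE exE conjE; hypsubst; (rule H(1) | rule H(2) | rule H(3) | rule H(4)); assumption)

lemma tensor_rels_closed: "tensor_rels R M N \<subseteq> carrier FT"
  by (rule tensor_rels_least; intro FT.minus_closed FT.a_closed FT.smult_closed gen_closed
      M.a_closed N.a_closed M.smult_closed N.smult_closed; assumption)

lemma KT: "submodule KT R FT"
  unfolding tensor_ker_def by (rule FT.mod_span_sm[OF tensor_rels_closed])

lemma KT_rels: "tensor_rels R M N \<subseteq> KT"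
  unfolding tensor_ker_def by (rule FT.mod_span_incl)

sublocale q: mod_homo R FT MN "\<lambda>f. KT +>\<^bsub>FT\<^esub> f"
  unfolding tensor_mod_def by (rule FT.quot_mod_homo[OF KT])

lemma MN_carrier: "carrier MN = (\<lambda>f. KT +>\<^bsub>FT\<^esub> f) ` carrier FT"
  unfolding tensor_mod_def by (rule FT.quot_mod_simps)

lemma q_eqI: "f \<in> carrier FT \<Longrightarrow> g \<in> carrier FT \<Longrightarrow> f \<ominus>\<^bsub>FT\<^esub> g \<in> KT \<Longrightarrow> KT +>\<^bsub>FT\<^esub> f = KT +>\<^bsub>FT\<^esub> g"
  by (simp add: FT.a_r_coset_eq_iff[OF KT])

lemma q_zero_iff: "f \<in> carrier FT \<Longrightarrow> KT +>\<^bsub>FT\<^esub> f = \<zero>\<^bsub>MN\<^esub> \<longleftrightarrow> f \<in> KT"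
  unfolding tensor_mod_def FT.quot_mod_simps by (rule FT.coset_eq_zero_iff[OF KT])

lemma ptens_closed: "x \<in> carrier M \<Longrightarrow> y \<in> carrier N \<Longrightarrow> ptens x y \<in> carrier MN"
  unfolding pure_tensor_def by (intro q.closed gen_closed)

lemma ptens_add_left:
  assumes "x \<in> carrier M" "x' \<in> carrier M" "y \<in> carrier N"
  shows "ptens (x \<oplus>\<^bsub>M\<^esub> x') y = ptens x y \<oplus>\<^bsub>MN\<^esub> ptens x' y"
proof -
  have "free_gen R (x \<oplus>\<^bsub>M\<^esub> x', y) \<ominus>\<^bsub>FT\<^esub> (free_gen R (x, y) \<oplus>\<^bsub>FT\<^esub> free_gen R (x', y)) \<in> KT"
    by (rule subsetD[OF KT_rels]) (use assms in \<open>unfold tensor_rels_def Let_def, blast\<close>)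
  hence "ptens (x \<oplus>\<^bsub>M\<^esub> x') y = KT +>\<^bsub>FT\<^esub> (free_gen R (x, y) \<oplus>\<^bsub>FT\<^esub> free_gen R (x', y))"
    unfolding pure_tensor_def using assms by (intro q_eqI FT.a_closed gen_closed M.a_closed)
  thus ?thesis unfolding pure_tensor_def using assms q.add gen_closed by metis
qed

lemma ptens_smult_left:
  assumes "a \<in> carrier R" "x \<in> carrier M" "y \<in> carrier N"
  shows "ptens (a \<odot>\<^bsub>M\<^esub> x) y = a \<odot>\<^bsub>MN\<^esub> ptens x y"
proof -
  have "free_gen R (a \<odot>\<^bsub>M\<^esub> x, y) \<ominus>\<^bsub>FT\<^esub> (a \<odot>\<^bsub>FT\<^esub> free_gen R (x, y)) \<in> KT"
    by (rule subsetD[OF KT_rels]) (use assms in \<open>unfold tensor_rels_def Let_def, blast\<close>)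
  hence "ptens (a \<odot>\<^bsub>M\<^esub> x) y = KT +>\<^bsub>FT\<^esub> (a \<odot>\<^bsub>FT\<^esub> free_gen R (x, y))"
    unfolding pure_tensor_def using assms by (intro q_eqI FT.smult_closed gen_closed M.smult_closed)
  thus ?thesis unfolding pure_tensor_def using assms q.smult gen_closed by metis
qed

lemma ptens_smult_right:
  assumes "a \<in> carrier R" "x \<in> carrier M" "y \<in> carrier N"
  shows "ptens x (a \<odot>\<^bsub>N\<^esub> y) = a \<odot>\<^bsub>MN\<^esub> ptens x y"
proof -
  have "free_gen R (x, a \<odot>\<^bsub>N\<^esub> y) \<ominus>\<^bsub>FT\<^esub> (a \<odot>\<^bsub>FT\<^esub> free_gen R (x, y)) \<in> KT"
    by (rule subsetD[OF KT_rels]) (use assms in \<open>unfold tensor_rels_def Let_def, blast\<close>)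
  hence "ptens x (a \<odot>\<^bsub>N\<^esub> y) = KT +>\<^bsub>FT\<^esub> (a \<odot>\<^bsub>FT\<^esub> free_gen R (x, y))"
    unfolding pure_tensor_def using assms by (intro q_eqI FT.smult_closed gen_closed N.smult_closed)
  thus ?thesis unfolding pure_tensor_def using assms q.smult gen_closed by metis
qed

lemma tensor_induct:
  assumes H: "submodule H R MN" and "\<And>x y. x \<in> carrier M \<Longrightarrow> y \<in> carrier N \<Longrightarrow> ptens x y \<in> H"
  shows "carrier MN \<subseteq> H"
proof -
  have "f \<in> {f \<in> carrier FT. KT +>\<^bsub>FT\<^esub> f \<in> H}" if "f \<in> carrier FT" for f
    using q.vimage_sm[OF FT.carrier_is_submodule H] _ that
  proof (rule M.R.free_mod_induct)
    fix s assume "s \<in> carrier M \<times> carrier N"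
    thus "free_gen R s \<in> {f \<in> carrier FT. KT +>\<^bsub>FT\<^esub> f \<in> H}"
      using assms(2) gen_closed unfolding pure_tensor_def by (cases s) simp
  qed
  thus ?thesis unfolding MN_carrier by auto
qed

end

subsection \<open>Tensoring with \<open>R/J\<close>\<close>

locale tensor_quot = P: rmodule R P
  for R :: "('a, 'k) ring_scheme" (structure) and P :: "('a, 'b) module" +
  fixes J :: "'a set"
  assumes J: "ideal J R"
begin

abbreviation "S1 \<equiv> self_mod R"
abbreviation "Q \<equiv> quot_mod S1 J"
abbreviation "cls a \<equiv> J +>\<^bsub>S1\<^esub> a"

sublocale S: rmodule R S1
  using P.R.self_mod_module by (rule rmoduleI)

lemma Jsm: "submodule J R S1"
  using J by (simp add: P.R.submodule_self_mod_iff)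

lemma J_sub: "J \<subseteq> carrier R"
  using ideal.Icarr[OF J] by auto

sublocale c: mod_homo R S1 Q "\<lambda>a. cls a"
  by (rule S.quot_mod_homo[OF Jsm])

sublocale module_pair R P Q
  by (unfold_locales)

abbreviation "\<tau> x \<equiv> ptens x (cls \<one>)"

lemma cls_closed: "a \<in> carrier R \<Longrightarrow> cls a \<in> carrier Q"
  using c.closed by simp

lemma cls_smult_one: "a \<in> carrier R \<Longrightarrow> a \<odot>\<^bsub>Q\<^esub> cls \<one> = cls a"
  using c.smult[of a \<one>] by simp

lemma cls_eq_iff: "a \<in> carrier R \<Longrightarrow> b \<in> carrier R \<Longrightarrow> cls a = cls b \<longleftrightarrow> a \<ominus>\<^bsub>S1\<^esub> b \<in> J"
  using S.a_r_coset_eq_iff[OF Jsm] by simp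

lemma ptens_cls: "x \<in> carrier P \<Longrightarrow> a \<in> carrier R \<Longrightarrow> ptens x (cls a) = \<tau> (a \<odot>\<^bsub>P\<^esub> x)"
  using cls_smult_one[of a] ptens_smult_left[of a x "cls \<one>"] ptens_smult_right[of a x "cls \<one>"] cls_closed
  by simp

sublocale t: mod_homo R P MN "\<lambda>x. \<tau> x"
  by (intro mod_homoI mod_homI P.module_M q.N.module_M)
    (simp_all add: cls_closed ptens_closed ptens_add_left ptens_smult_left)

lemma tau_onto: "carrier MN = (\<lambda>x. \<tau> x) ` carrier P"
proof
  show "carrier MN \<subseteq> (\<lambda>x. \<tau> x) ` carrier P"
  proof (rule tensor_induct)
    show "submodule ((\<lambda>x. \<tau> x) ` carrier P) R MN" by (rule t.image_sm[OF P.carrier_is_submodule])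
    fix x y assume x: "x \<in> carrier P" and "y \<in> carrier Q"
    then obtain a where a: "a \<in> carrier R" "y = cls a" by (auto simp: S.quot_mod_simps)
    thus "ptens x y \<in> (\<lambda>x. \<tau> x) ` carrier P" using x ptens_cls[OF x a(1)] by auto
  qed
qed (use t.closed in auto)

text \<open>Together with \<open>tau_onto\<close> this identifies the tensor product of P and R/J
  with P/JP. The converse direction needs a map out of the tensor product: on free generators it
  sends (x, C) to r x, with r a chosen representative of C. The choice is not linear, but its
  defects lie in J, so all relations are mapped into JP.\<close>

lemma tau_kernel:
  assumes p: "p \<in> carrier P"
  shows "\<tau> p = \<zero>\<^bsub>MN\<^esub> \<longleftrightarrow> p \<in> imul R P J (carrier P)"
proof
  assume "p \<in> imul R P J (carrier P)"
  moreover have "imul R P J (carrier P) \<subseteq> {p \<in> carrier P. \<tau> p \<in> {\<zero>\<^bsub>MN\<^esub>}}"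
  proof (rule P.imul_least)
    show "submodule {p \<in> carrier P. \<tau> p \<in> {\<zero>\<^bsub>MN\<^esub>}} R P"
      by (rule t.vimage_sm[OF P.carrier_is_submodule q.N.sm_zero])
    fix j x assume j: "j \<in> J" and x: "x \<in> carrier P"
    have jc: "j \<in> carrier R" using j J_sub by auto
    have "cls j = cls \<zero>" using j jc S.minus_zero[of j] by (subst cls_eq_iff) auto
    hence "\<tau> (j \<odot>\<^bsub>P\<^esub> x) = \<tau> (\<zero> \<odot>\<^bsub>P\<^esub> x)" using ptens_cls[OF x jc] ptens_cls[OF x, of \<zero>] by simp
    also have "\<dots> = \<zero>\<^bsub>MN\<^esub>" using x t.zero by simp
    finally show "j \<odot>\<^bsub>P\<^esub> x \<in> {p \<in> carrier P. \<tau> p \<in> {\<zero>\<^bsub>MN\<^esub>}}" using x jc by simp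
  qed
  ultimately show "\<tau> p = \<zero>\<^bsub>MN\<^esub>" by auto
next
  assume tp: "\<tau> p = \<zero>\<^bsub>MN\<^esub>"
  define D where "D = imul R P J (carrier P)"
  have D: "submodule D R P" unfolding D_def using J_sub by (intro P.imul_sm) auto
  define rep where "rep = (\<lambda>C. SOME a. a \<in> carrier R \<and> cls a = C)"
  have rep: "rep C \<in> carrier R \<and> cls (rep C) = C" if "C \<in> carrier Q" for C
  proof -
    have "\<exists>a. a \<in> carrier R \<and> cls a = C" using that by (auto simp: S.quot_mod_simps)
    thus ?thesis unfolding rep_def by (rule someI_ex)
  qed
  have repc: "rep C \<in> carrier R" if "C \<in> carrier Q" for C using rep[OF that] by simp
  define w where "w = (\<lambda>(x, C). rep C \<odot>\<^bsub>P\<^esub> x)"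
  have w: "w s \<in> carrier P" if "s \<in> carrier P \<times> carrier Q" for s
    using that repc by (auto simp: w_def)
  interpret l: mod_homo R FT P "lin R P w" using w by (rule P.lin_homo)
  have lg: "lin R P w (free_gen R (x, C)) = rep C \<odot>\<^bsub>P\<^esub> x" if "x \<in> carrier P" "C \<in> carrier Q" for x C
    using P.lin_gen[of w "(x, C)"] w[of "(x, C)"] that by (simp add: w_def)
  \<comment> \<open>Two representatives of one class differ by an element of J, so the corresponding
    multiples of x differ by an element of JP.\<close>
  have Dsm: "a \<odot>\<^bsub>P\<^esub> x \<ominus>\<^bsub>P\<^esub> b \<odot>\<^bsub>P\<^esub> x \<in> D"
    if x: "x \<in> carrier P" and ab: "a \<in> carrier R" "b \<in> carrier R" "cls a = cls b" for a b x
  proof -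
    interpret h: mod_homo R S1 P "\<lambda>r. r \<odot>\<^bsub>P\<^esub> x"
      using x S.module_M P.module_M by (intro mod_homoI mod_homI) (auto simp: P.smult_l_distr P.smult_assoc1)
    have "a \<ominus>\<^bsub>S1\<^esub> b \<in> J" using ab cls_eq_iff by simp
    hence "(a \<ominus>\<^bsub>S1\<^esub> b) \<odot>\<^bsub>P\<^esub> x \<in> D" unfolding D_def using x by (intro P.imul_incl)
    thus ?thesis using h.minus[of a b] ab by simp
  qed
  have "tensor_rels R P Q \<subseteq> {f \<in> carrier FT. lin R P w f \<in> D}"
  proof (rule tensor_rels_least)
    fix x x' y assume c: "x \<in> carrier P" "x' \<in> carrier P" "y \<in> carrier Q"
    let ?e = "free_gen R (x \<oplus>\<^bsub>P\<^esub> x', y)" and ?f = "free_gen R (x, y)" and ?g = "free_gen R (x', y)"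
    have fc: "?e \<in> carrier FT" "?f \<in> carrier FT" "?g \<in> carrier FT" "?f \<oplus>\<^bsub>FT\<^esub> ?g \<in> carrier FT"
      using c gen_closed[of "x \<oplus>\<^bsub>P\<^esub> x'" y] gen_closed[of x y] gen_closed[of x' y]
        FT.a_closed[OF gen_closed[of x y] gen_closed[of x' y]] by simp_all
    have "lin R P w (?e \<ominus>\<^bsub>FT\<^esub> (?f \<oplus>\<^bsub>FT\<^esub> ?g)) = rep y \<odot>\<^bsub>P\<^esub> (x \<oplus>\<^bsub>P\<^esub> x') \<ominus>\<^bsub>P\<^esub> (rep y \<odot>\<^bsub>P\<^esub> x \<oplus>\<^bsub>P\<^esub> rep y \<odot>\<^bsub>P\<^esub> x')"
      unfolding l.minus[OF fc(1,4)] l.add[OF fc(2,3)] using c by (simp add: lg)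
    also have "\<dots> = \<zero>\<^bsub>P\<^esub>" using c repc by (simp add: P.smult_r_distr P.minus_self)
    finally show "?e \<ominus>\<^bsub>FT\<^esub> (?f \<oplus>\<^bsub>FT\<^esub> ?g) \<in> {f \<in> carrier FT. lin R P w f \<in> D}"
      using FT.minus_closed[OF fc(1,4)] P.smD(2)[OF D] by simp
  next
    fix x y y' assume c: "x \<in> carrier P" "y \<in> carrier Q" "y' \<in> carrier Q"
    let ?e = "free_gen R (x, y \<oplus>\<^bsub>Q\<^esub> y')" and ?f = "free_gen R (x, y)" and ?g = "free_gen R (x, y')"
    have fc: "?e \<in> carrier FT" "?f \<in> carrier FT" "?g \<in> carrier FT" "?f \<oplus>\<^bsub>FT\<^esub> ?g \<in> carrier FT"
      using c c.N.a_closed[OF c(2,3)] gen_closed[of x "y \<oplus>\<^bsub>Q\<^esub> y'"] gen_closed[of x y] gen_closed[of x y']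
        FT.a_closed[OF gen_closed[of x y] gen_closed[of x y']] by simp_all
    have yc: "y \<oplus>\<^bsub>Q\<^esub> y' \<in> carrier Q" using c by (intro c.N.a_closed)
    have "lin R P w (?e \<ominus>\<^bsub>FT\<^esub> (?f \<oplus>\<^bsub>FT\<^esub> ?g)) = rep (y \<oplus>\<^bsub>Q\<^esub> y') \<odot>\<^bsub>P\<^esub> x \<ominus>\<^bsub>P\<^esub> (rep y \<odot>\<^bsub>P\<^esub> x \<oplus>\<^bsub>P\<^esub> rep y' \<odot>\<^bsub>P\<^esub> x)"
      unfolding l.minus[OF fc(1,4)] l.add[OF fc(2,3)] using c yc by (simp add: lg)
    also have "rep y \<odot>\<^bsub>P\<^esub> x \<oplus>\<^bsub>P\<^esub> rep y' \<odot>\<^bsub>P\<^esub> x = (rep y \<oplus> rep y') \<odot>\<^bsub>P\<^esub> x"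
      using c repc by (simp add: P.smult_l_distr)
    finally show "?e \<ominus>\<^bsub>FT\<^esub> (?f \<oplus>\<^bsub>FT\<^esub> ?g) \<in> {f \<in> carrier FT. lin R P w f \<in> D}"
      using FT.minus_closed[OF fc(1,4)] Dsm[OF c(1), of "rep (y \<oplus>\<^bsub>Q\<^esub> y')" "rep y \<oplus> rep y'"]
        rep[OF yc] rep[OF c(2)] rep[OF c(3)] c.add[of "rep y" "rep y'"] by simp
  next
    fix a x y assume c: "a \<in> carrier R" "x \<in> carrier P" "y \<in> carrier Q"
    let ?e = "free_gen R (a \<odot>\<^bsub>P\<^esub> x, y)" and ?f = "free_gen R (x, y)"
    have fc: "?e \<in> carrier FT" "?f \<in> carrier FT" "a \<odot>\<^bsub>FT\<^esub> ?f \<in> carrier FT"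
      using c gen_closed[of "a \<odot>\<^bsub>P\<^esub> x" y] gen_closed[of x y] FT.smult_closed[OF c(1) gen_closed[of x y]] by simp_all
    have "lin R P w (?e \<ominus>\<^bsub>FT\<^esub> (a \<odot>\<^bsub>FT\<^esub> ?f)) = rep y \<odot>\<^bsub>P\<^esub> (a \<odot>\<^bsub>P\<^esub> x) \<ominus>\<^bsub>P\<^esub> a \<odot>\<^bsub>P\<^esub> (rep y \<odot>\<^bsub>P\<^esub> x)"
      unfolding l.minus[OF fc(1,3)] l.smult[OF c(1) fc(2)] using c by (simp add: lg)
    also have "\<dots> = \<zero>\<^bsub>P\<^esub>" using c repc by (simp add: P.smult_lcomm[of a] P.minus_self)
    finally show "?e \<ominus>\<^bsub>FT\<^esub> (a \<odot>\<^bsub>FT\<^esub> ?f) \<in> {f \<in> carrier FT. lin R P w f \<in> D}"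
      using FT.minus_closed[OF fc(1,3)] P.smD(2)[OF D] by simp
  next
    fix a x y assume c: "a \<in> carrier R" "x \<in> carrier P" "y \<in> carrier Q"
    let ?e = "free_gen R (x, a \<odot>\<^bsub>Q\<^esub> y)" and ?f = "free_gen R (x, y)"
    have fc: "?e \<in> carrier FT" "?f \<in> carrier FT" "a \<odot>\<^bsub>FT\<^esub> ?f \<in> carrier FT"
      using c c.N.smult_closed[OF c(1,3)] gen_closed[of x "a \<odot>\<^bsub>Q\<^esub> y"] gen_closed[of x y]
        FT.smult_closed[OF c(1) gen_closed[of x y]] by simp_all
    have yc: "a \<odot>\<^bsub>Q\<^esub> y \<in> carrier Q" using c by (intro c.N.smult_closed)
    have "lin R P w (?e \<ominus>\<^bsub>FT\<^esub> (a \<odot>\<^bsub>FT\<^esub> ?f)) = rep (a \<odot>\<^bsub>Q\<^esub> y) \<odot>\<^bsub>P\<^esub> x \<ominus>\<^bsub>P\<^esub> a \<odot>\<^bsub>P\<^esub> (rep y \<odot>\<^bsub>P\<^esub> x)"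
      unfolding l.minus[OF fc(1,3)] l.smult[OF c(1) fc(2)] using c yc by (simp add: lg)
    also have "a \<odot>\<^bsub>P\<^esub> (rep y \<odot>\<^bsub>P\<^esub> x) = (a \<otimes> rep y) \<odot>\<^bsub>P\<^esub> x" using c repc by (simp add: P.smult_assoc1)
    finally show "?e \<ominus>\<^bsub>FT\<^esub> (a \<odot>\<^bsub>FT\<^esub> ?f) \<in> {f \<in> carrier FT. lin R P w f \<in> D}"
      using FT.minus_closed[OF fc(1,3)] Dsm[OF c(2), of "rep (a \<odot>\<^bsub>Q\<^esub> y)" "a \<otimes> rep y"]
        rep[OF yc] rep[OF c(3)] c c.smult[of a "rep y"] by simp
  qed
  hence KD: "KT \<subseteq> {f \<in> carrier FT. lin R P w f \<in> D}"
    unfolding tensor_ker_def by (rule FT.mod_span_least[OF l.vimage_sm[OF FT.carrier_is_submodule D]])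
  have g: "free_gen R (p, cls \<one>) \<in> carrier FT" using p cls_closed by (intro gen_closed) auto
  have "free_gen R (p, cls \<one>) \<in> KT" using tp q_zero_iff[OF g] unfolding pure_tensor_def by simp
  hence 1: "rep (cls \<one>) \<odot>\<^bsub>P\<^esub> p \<in> D" using KD lg[OF p, of "cls \<one>"] cls_closed by auto
  have "\<one> \<odot>\<^bsub>P\<^esub> p \<ominus>\<^bsub>P\<^esub> rep (cls \<one>) \<odot>\<^bsub>P\<^esub> p \<in> D"
    using rep[of "cls \<one>"] cls_closed by (intro Dsm p) auto
  hence "\<one> \<odot>\<^bsub>P\<^esub> p \<ominus>\<^bsub>P\<^esub> rep (cls \<one>) \<odot>\<^bsub>P\<^esub> p \<oplus>\<^bsub>P\<^esub> rep (cls \<one>) \<odot>\<^bsub>P\<^esub> p \<in> D" using 1 P.smD(3)[OF D] by simp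
  thus "p \<in> imul R P J (carrier P)" using p P.smD(1)[OF D 1] unfolding D_def by (simp add: P.minus_add_cancel)
qed

end

text \<open>\<open>tensor_map\<close> is a definite description, so existence and uniqueness are
  both due. Existence comes from P/JP, since f maps JP into JP'; uniqueness from the surjectivity of
  \<tau>.\<close>

lemma tensor_quot_map:
  assumes P: "module R P" and P': "module R P'" and J: "ideal J R" and f: "f \<in> mod_hom R P P'"
  defines "Q \<equiv> quot_mod (self_mod R) J"
  defines "h \<equiv> tensor_map R P Q P' Q f (\<lambda>y. y)"
  shows "h \<in> mod_hom R (tensor_mod R P Q) (tensor_mod R P' Q)"
    and "x \<in> carrier P \<Longrightarrow> h (pure_tensor R P Q x (J +>\<^bsub>self_mod R\<^esub> \<one>\<^bsub>R\<^esub>)) = pure_tensor R P' Q (f x) (J +>\<^bsub>self_mod R\<^esub> \<one>\<^bsub>R\<^esub>)"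
proof -
  interpret T: tensor_quot R P J using P J by (simp add: tensor_quot_def tensor_quot_axioms_def rmoduleI)
  interpret T': tensor_quot R P' J using P' J by (simp add: tensor_quot_def tensor_quot_axioms_def rmoduleI)
  interpret f: mod_homo R P P' f using P P' f by (rule mod_homoI)
  have "(\<lambda>x. T'.\<tau> (f x)) \<in> mod_hom R P T'.MN"
    using mod_hom_comp[OF f T'.t.hom] by (simp add: comp_def)
  moreover have "T'.\<tau> (f x) = \<zero>\<^bsub>T'.MN\<^esub>" if "x \<in> carrier P" "T.\<tau> x = \<zero>\<^bsub>T.MN\<^esub>" for x
  proof -
    have "x \<in> imul R P J (carrier P)" using that T.tau_kernel by simp
    hence "f x \<in> imul R P' J (f ` carrier P)" using f.imul_image[OF T.J_sub order_refl] by auto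
    moreover have "imul R P' J (f ` carrier P) \<subseteq> imul R P' J (carrier P')"
      using f.closed T.J_sub by (intro T'.P.imul_mono) auto
    ultimately show ?thesis using T'.tau_kernel[of "f x"] f.closed that by auto
  qed
  ultimately obtain \<phi> where \<phi>: "\<phi> \<in> mod_hom R T.MN T'.MN" "\<And>x. x \<in> carrier P \<Longrightarrow> \<phi> (T.\<tau> x) = T'.\<tau> (f x)"
    using hom_factor[OF P T.q.N.module_M T'.q.N.module_M T.t.hom _, of "\<lambda>x. T'.\<tau> (f x)"] T.tau_onto by blast
  \<comment> \<open>The description asks for an extensional function; otherwise the values off the
    carrier would spoil uniqueness.\<close>
  define h0 where "h0 = restrict \<phi> (carrier T.MN)"
  let ?P = "\<lambda>h. h \<in> mod_hom R T.MN T'.MN \<and> h \<in> extensional (carrier T.MN) \<and>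
             (\<forall>x\<in>carrier P. \<forall>y\<in>carrier T.Q. h (T.ptens x y) = T'.ptens (f x) y)"
  have h0t: "h0 (T.\<tau> x) = T'.\<tau> (f x)" if "x \<in> carrier P" for x
    using that \<phi>(2) T.t.closed by (simp add: h0_def)
  have h0: "?P h0"
  proof (intro conjI ballI)
    show "h0 \<in> mod_hom R T.MN T'.MN"
      by (rule mod_hom_cong[OF \<phi>(1) T.q.N.module_M]) (simp add: h0_def)
    show "h0 \<in> extensional (carrier T.MN)" by (simp add: h0_def)
    fix x y assume x: "x \<in> carrier P" and "y \<in> carrier T.Q"
    then obtain a where a: "a \<in> carrier R" "y = T.cls a" by (auto simp: T.S.quot_mod_simps)
    show "h0 (T.ptens x y) = T'.ptens (f x) y"
      unfolding a(2) T.ptens_cls[OF x a(1)] T'.ptens_cls[OF f.closed[OF x] a(1)]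
      using h0t[of "a \<odot>\<^bsub>P\<^esub> x"] x a by (simp add: f.smult)
  qed
  have "h = h0"
    unfolding h_def tensor_map_def Q_def
  proof (rule the_equality)
    show "?P h0" by (rule h0)
    fix h' assume h': "?P h'"
    show "h' = h0"
    proof (rule extensionalityI[of _ "carrier T.MN"])
      fix t assume "t \<in> carrier T.MN"
      then obtain x where "x \<in> carrier P" "t = T.\<tau> x" using T.tau_onto by auto
      thus "h' t = h0 t" using h' h0t T.cls_closed by simp
    qed (use h' h0 in auto)
  qed
  thus "h \<in> mod_hom R (tensor_mod R P Q) (tensor_mod R P' Q)"
    "x \<in> carrier P \<Longrightarrow> h (pure_tensor R P Q x (J +>\<^bsub>self_mod R\<^esub> \<one>\<^bsub>R\<^esub>)) = pure_tensor R P' Q (f x) (J +>\<^bsub>self_mod R\<^esub> \<one>\<^bsub>R\<^esub>)"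
    using h0 h0t[of x] unfolding Q_def by auto
qed

section \<open>The length of \<open>Tor\<^sub>1(M, R/J)\<close>\<close>

definition pres_ker :: "('a, 'k) ring_scheme \<Rightarrow> ('a, 'b) module \<Rightarrow> 's set \<Rightarrow> ('s \<Rightarrow> 'b) \<Rightarrow> ('s \<Rightarrow> 'a) set" where
  "pres_ker R M S w = a_kernel (free_mod R S) M (lin R M w)"

text \<open>For a presentation \<open>0 \<rightarrow> Z \<rightarrow> F \<rightarrow> M \<rightarrow> 0\<close> with \<open>F\<close> free, \<open>Tor\<^sub>1(M, R/J)\<close> is \<open>(Z \<inter> JF) / JZ\<close>.\<close>

definition tor_len :: "('a, 'k) ring_scheme \<Rightarrow> 'a set \<Rightarrow> ('a, 'b) module \<Rightarrow> 's set \<Rightarrow> ('s \<Rightarrow> 'b) \<Rightarrow> enat" where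
  "tor_len R J M S w = rlen R (free_mod R S)
     (pres_ker R M S w \<inter> imul R (free_mod R S) J (carrier (free_mod R S)))
     (imul R (free_mod R S) J (pres_ker R M S w))"

definition presents :: "('a, 'k) ring_scheme \<Rightarrow> ('a, 'b) module \<Rightarrow> 's set \<Rightarrow> ('s \<Rightarrow> 'b) \<Rightarrow> bool" where
  "presents R M S w \<longleftrightarrow> (\<forall>s\<in>S. w s \<in> carrier M) \<and> lin R M w ` carrier (free_mod R S) = carrier M"

lemma presents_carrier:
  assumes "module R M" shows "presents R M (carrier M) (\<lambda>x. x)"
proof -
  interpret rmodule R M using assms by (rule rmoduleI)
  have "lin R M (\<lambda>x. x) ` carrier (free_mod R (carrier M)) = mod_span R M ((\<lambda>x. x) ` carrier M)"
    by (intro lin_image) auto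
  also have "\<dots> = carrier M" using mod_span_least[OF carrier_is_submodule] mod_span_incl by auto
  finally show ?thesis by (simp add: presents_def)
qed

locale presentation = M: rmodule R M
  for R :: "('a, 'k) ring_scheme" (structure) and M :: "('a, 'b) module" +
  fixes S :: "'s set" and w :: "'s \<Rightarrow> 'b"
  assumes pres: "presents R M S w"
begin

abbreviation "F \<equiv> free_mod R S"
abbreviation "Z \<equiv> pres_ker R M S w"
abbreviation "\<pi> \<equiv> lin R M w"

lemma w_closed: "s \<in> S \<Longrightarrow> w s \<in> carrier M"
  using pres by (simp add: presents_def)

sublocale \<pi>: mod_homo R F M \<pi>
  using w_closed by (rule M.lin_homo)

lemma pi_onto: "\<pi> ` carrier F = carrier M"
  using pres by (simp add: presents_def)

lemma Z_iff: "z \<in> Z \<longleftrightarrow> z \<in> carrier F \<and> \<pi> z = \<zero>\<^bsub>M\<^esub>"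
  by (simp add: pres_ker_def a_kernel_def')

lemma Z_sm: "submodule Z R F"
  unfolding pres_ker_def by (rule \<pi>.kernel_sm)

lemma Z_sub: "Z \<subseteq> carrier F"
  by (auto simp: Z_iff)

lemma imul_sms:
  assumes "J \<subseteq> carrier R"
  shows "submodule (imul R F J (carrier F)) R F" "submodule (imul R F J Z) R F"
    "submodule (Z \<inter> imul R F J (carrier F)) R F" "imul R F J Z \<subseteq> Z \<inter> imul R F J (carrier F)"
proof -
  show 1: "submodule (imul R F J (carrier F)) R F" "submodule (imul R F J Z) R F"
    using assms Z_sub by (auto intro: \<pi>.M.imul_sm)
  show "submodule (Z \<inter> imul R F J (carrier F)) R F" by (rule \<pi>.M.sm_inter[OF Z_sm 1(1)])
  show "imul R F J Z \<subseteq> Z \<inter> imul R F J (carrier F)"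
    using \<pi>.M.imul_le[OF assms Z_sm] \<pi>.M.imul_mono[OF order_refl Z_sub assms] by auto
qed

end

lemma presentationI: "module R M \<Longrightarrow> presents R M S w \<Longrightarrow> presentation R M S w"
  by (simp add: presentation_def presentation_axioms_def rmoduleI)

lemma syz_mod_eq: "syz_mod R M = (free_mod R (carrier M))\<lparr>carrier := pres_ker R M (carrier M) (\<lambda>x. x)\<rparr>"
  by (simp add: syz_mod_def pres_ker_def free_cover_eq_lin)

text \<open>Tensoring with R/J turns the complex into F2/JF2 -> F1/JF1 -> F0/JF0. The cycles lift to
  A1, the elements that d1 sends into J F0, and the boundaries to B1 = Z1 + J F1, where Z1 is the
  kernel of d1. Since d1 maps F1 onto Z, it identifies A1/B1 with (Z cap J F0)/JZ.\<close>

lemma mod_length_Tor1: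
  assumes M: "module R M" and J: "ideal J R"
  shows "mod_length R (Tor1 R M (quot_mod (self_mod R) J)) = tor_len R J M (carrier M) (\<lambda>x. x)"
proof -
  interpret p0: presentation R M "carrier M" "\<lambda>x. x"
    using M presents_carrier[OF M] by (rule presentationI)
  define Z0 where "Z0 = syz_mod R M"
  have Z0: "Z0 = p0.F\<lparr>carrier := p0.Z\<rparr>" unfolding Z0_def by (rule syz_mod_eq)
  have Z0m: "module R Z0" unfolding Z0 by (rule p0.\<pi>.M.restrict_module[OF p0.Z_sm])
  interpret p1: presentation R Z0 "carrier Z0" "\<lambda>x. x"
    using Z0m presents_carrier[OF Z0m] by (rule presentationI)
  define Z1 where "Z1 = syz_mod R Z0"
  have Z1: "Z1 = p1.F\<lparr>carrier := p1.Z\<rparr>" unfolding Z1_def by (rule syz_mod_eq)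
  have Z1m: "module R Z1" unfolding Z1 by (rule p1.\<pi>.M.restrict_module[OF p1.Z_sm])
  interpret p2: presentation R Z1 "carrier Z1" "\<lambda>x. x"
    using Z1m presents_carrier[OF Z1m] by (rule presentationI)
  have d1: "p1.\<pi> \<in> mod_hom R p1.F p0.F" and d2: "p2.\<pi> \<in> mod_hom R p2.F p1.F"
    using mod_hom_comp[OF p1.\<pi>.hom[unfolded Z0] p0.\<pi>.M.restrict_incl_hom[OF p0.Z_sm]]
      mod_hom_comp[OF p2.\<pi>.hom[unfolded Z1] p1.\<pi>.M.restrict_incl_hom[OF p1.Z_sm]]
    by (simp_all add: comp_def Z0 Z1)
  have im1: "p1.\<pi> ` carrier p1.F = p0.Z" and im2: "p2.\<pi> ` carrier p2.F = p1.Z"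
    using p1.pi_onto p2.pi_onto by (simp_all add: Z0 Z1)
  have zero0: "\<zero>\<^bsub>Z0\<^esub> = \<zero>\<^bsub>p0.F\<^esub>" by (simp add: Z0)
  interpret d1: mod_homo R p1.F p0.F p1.\<pi> using p1.\<pi>.M.module_M p0.\<pi>.M.module_M d1 by (rule mod_homoI)
  interpret d2: mod_homo R p2.F p1.F p2.\<pi> using p2.\<pi>.M.module_M p1.\<pi>.M.module_M d2 by (rule mod_homoI)
  let ?Q = "quot_mod (self_mod R) J"
  interpret T0: tensor_quot R p0.F J using J p0.\<pi>.M.module_M by (simp add: tensor_quot_def tensor_quot_axioms_def rmoduleI)
  interpret T1: tensor_quot R p1.F J using J p1.\<pi>.M.module_M by (simp add: tensor_quot_def tensor_quot_axioms_def rmoduleI)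
  interpret T2: tensor_quot R p2.F J using J p2.\<pi>.M.module_M by (simp add: tensor_quot_def tensor_quot_axioms_def rmoduleI)
  define h1 where "h1 = tensor_map R p1.F ?Q p0.F ?Q p1.\<pi> (\<lambda>y. y)"
  define h2 where "h2 = tensor_map R p2.F ?Q p1.F ?Q p2.\<pi> (\<lambda>y. y)"
  have h1: "h1 \<in> mod_hom R T1.MN T0.MN" "\<And>x. x \<in> carrier p1.F \<Longrightarrow> h1 (T1.\<tau> x) = T0.\<tau> (p1.\<pi> x)"
    using tensor_quot_map[OF p1.\<pi>.M.module_M p0.\<pi>.M.module_M J d1] by (simp_all add: h1_def)
  have h2: "h2 \<in> mod_hom R T2.MN T1.MN" "\<And>x. x \<in> carrier p2.F \<Longrightarrow> h2 (T2.\<tau> x) = T1.\<tau> (p2.\<pi> x)"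
    using tensor_quot_map[OF p2.\<pi>.M.module_M p1.\<pi>.M.module_M J d2] by (simp_all add: h2_def)
  interpret h1: mod_homo R T1.MN T0.MN h1 using T1.q.N.module_M T0.q.N.module_M h1(1) by (rule mod_homoI)
  interpret h2: mod_homo R T2.MN T1.MN h2 using T2.q.N.module_M T1.q.N.module_M h2(1) by (rule mod_homoI)
  define A where "A = a_kernel T1.MN T0.MN h1"
  define B where "B = h2 ` carrier T2.MN"
  have Tor: "Tor1 R M ?Q = quot_mod (T1.MN\<lparr>carrier := A\<rparr>) B"
    unfolding Tor1_def Let_def A_def B_def h1_def h2_def Z0_def Z1_def free_cover_eq_lin ..
  have Asm: "submodule A R T1.MN" unfolding A_def by (rule h1.kernel_sm)
  have Bsm: "submodule B R T1.MN" unfolding B_def by (rule h2.image_sm[OF T2.q.N.carrier_is_submodule])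
  have A_iff: "T1.\<tau> x \<in> A \<longleftrightarrow> p1.\<pi> x \<in> imul R p0.F J (carrier p0.F)" if x: "x \<in> carrier p1.F" for x
    unfolding A_def a_kernel_def' using x h1(2)[OF x] T0.tau_kernel[OF d1.closed[OF x]] T1.t.closed[OF x] by simp
  have B_eq: "B = (\<lambda>z. T1.\<tau> z) ` p1.Z"
  proof -
    have "B = (\<lambda>x. T1.\<tau> (p2.\<pi> x)) ` carrier p2.F"
      unfolding B_def T2.tau_onto image_image using h2(2) by (intro image_cong) auto
    thus ?thesis unfolding im2[symmetric] image_image .
  qed
  define A1 where "A1 = {x \<in> carrier p1.F. p1.\<pi> x \<in> imul R p0.F J (carrier p0.F)}"
  define B1 where "B1 = {x \<in> A1. T1.\<tau> x \<in> B}"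
  have J_sub: "J \<subseteq> carrier R" by (rule T0.J_sub)
  have A1sm: "submodule A1 R p1.F"
    unfolding A1_def by (rule d1.vimage_sm[OF p1.\<pi>.M.carrier_is_submodule p0.imul_sms(1)[OF J_sub]])
  have ZA1: "p1.Z \<subseteq> A1"
    using p0.\<pi>.M.smD(2)[OF p0.imul_sms(1)[OF J_sub]] by (auto simp: A1_def p1.Z_iff zero0)
  have A_eq: "A = (\<lambda>x. T1.\<tau> x) ` A1"
  proof
    show "(\<lambda>x. T1.\<tau> x) ` A1 \<subseteq> A" using A_iff by (auto simp: A1_def)
    show "A \<subseteq> (\<lambda>x. T1.\<tau> x) ` A1"
    proof
      fix t assume t: "t \<in> A"
      hence "t \<in> carrier T1.MN" using T1.q.N.smD(1)[OF Asm] by simp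
      then obtain x where "x \<in> carrier p1.F" "t = T1.\<tau> x" using T1.tau_onto by auto
      thus "t \<in> (\<lambda>x. T1.\<tau> x) ` A1" using t A_iff by (auto simp: A1_def)
    qed
  qed
  have BA: "B \<subseteq> A" using ZA1 unfolding B_eq A_eq by auto
  have "mod_length R (Tor1 R M ?Q) = rlen R T1.MN A B"
    unfolding Tor by (rule T1.q.N.mod_length_quot_restrict[OF Asm Bsm BA])
  also have "\<dots> = rlen R p1.F A1 B1"
  proof (rule T1.t.rlen_eq[OF A1sm Asm Bsm BA, symmetric])
    show "(\<lambda>x. T1.\<tau> x) ` A1 <+>\<^bsub>T1.MN\<^esub> B = A"
      unfolding A_eq[symmetric]
      using T1.q.N.set_add_least[OF Asm order_refl BA] T1.q.N.set_add_upper1[OF Asm Bsm] by auto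
  qed (simp add: B1_def)
  also have "\<dots> = rlen R p0.F (p0.Z \<inter> imul R p0.F J (carrier p0.F)) (imul R p0.F J p0.Z)"
  proof (rule d1.rlen_eq[OF A1sm])
    have "p1.\<pi> ` A1 = p0.Z \<inter> imul R p0.F J (carrier p0.F)" unfolding A1_def im1[symmetric] by auto
    thus "p1.\<pi> ` A1 <+>\<^bsub>p0.F\<^esub> imul R p0.F J p0.Z = p0.Z \<inter> imul R p0.F J (carrier p0.F)"
      using p0.\<pi>.M.set_add_least[OF p0.imul_sms(3)[OF J_sub] order_refl p0.imul_sms(4)[OF J_sub]]
        p0.\<pi>.M.set_add_upper1[OF p0.imul_sms(3)[OF J_sub] p0.imul_sms(2)[OF J_sub]] by auto
    have im: "p1.\<pi> ` imul R p1.F J (carrier p1.F) = imul R p0.F J p0.Z"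
      using d1.imul_image[OF J_sub order_refl] im1 by simp
    have Jc: "j \<in> imul R p1.F J (carrier p1.F) \<Longrightarrow> j \<in> carrier p1.F" for j
      using p1.\<pi>.M.smD(1)[OF p1.imul_sms(1)[OF J_sub]] .
    \<comment> \<open>Both sides say that x lies in Z1 + J F1: the left one because d1 maps J F1
      onto JZ, the right one because J F1 is the kernel of \<tau>.\<close>
    have "p1.\<pi> x \<in> imul R p0.F J p0.Z \<longleftrightarrow> T1.\<tau> x \<in> B" if x: "x \<in> carrier p1.F" for x
    proof
      assume "p1.\<pi> x \<in> imul R p0.F J p0.Z"
      then obtain j where j: "j \<in> imul R p1.F J (carrier p1.F)" "p1.\<pi> x = p1.\<pi> j" using im by auto
      let ?z = "x \<ominus>\<^bsub>p1.F\<^esub> j"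
      have zZ: "?z \<in> p1.Z"
        unfolding p1.Z_iff zero0 d1.minus[OF x Jc[OF j(1)]] j(2)
        using p1.\<pi>.M.minus_closed[OF x Jc[OF j(1)]] p0.\<pi>.M.minus_self[OF d1.closed[OF Jc[OF j(1)]]] by (rule conjI)
      have "T1.\<tau> ?z = T1.\<tau> x \<ominus>\<^bsub>T1.MN\<^esub> T1.\<tau> j" by (rule T1.t.minus[OF x Jc[OF j(1)]])
      hence tz: "T1.\<tau> ?z = T1.\<tau> x" using T1.tau_kernel[OF Jc[OF j(1)]] j(1) T1.t.closed[OF x] by (simp add: T1.q.N.minus_zero)
      show "T1.\<tau> x \<in> B" unfolding B_eq tz[symmetric] using zZ by (rule imageI)
    next
      assume "T1.\<tau> x \<in> B"
      then obtain z where z: "z \<in> p1.Z" "T1.\<tau> x = T1.\<tau> z" unfolding B_eq by auto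
      have zc: "z \<in> carrier p1.F" "p1.\<pi> z = \<zero>\<^bsub>p0.F\<^esub>" using z(1) unfolding p1.Z_iff zero0 by auto
      have "T1.\<tau> (x \<ominus>\<^bsub>p1.F\<^esub> z) = \<zero>\<^bsub>T1.MN\<^esub>"
        unfolding T1.t.minus[OF x zc(1)] using z(2) T1.t.closed[OF zc(1)] by (simp add: T1.q.N.minus_self)
      hence "x \<ominus>\<^bsub>p1.F\<^esub> z \<in> imul R p1.F J (carrier p1.F)"
        using T1.tau_kernel[of "x \<ominus>\<^bsub>p1.F\<^esub> z"] p1.\<pi>.M.minus_closed[OF x zc(1)] by simp
      hence "p1.\<pi> (x \<ominus>\<^bsub>p1.F\<^esub> z) \<in> imul R p0.F J p0.Z" using im by auto
      thus "p1.\<pi> x \<in> imul R p0.F J p0.Z"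
        unfolding d1.minus[OF x zc(1)] zc(2) p0.\<pi>.M.minus_zero[OF d1.closed[OF x]] .
    qed
    thus "{x \<in> A1. p1.\<pi> x \<in> imul R p0.F J p0.Z} = B1" by (auto simp: B1_def A1_def)
  qed (use p0.imul_sms[OF J_sub] in auto)
  finally show ?thesis by (simp add: tor_len_def)
qed

subsection \<open>Independence of the presentation\<close>

lemma mod_hom_minus:
  assumes "module R M" "module R N" "f \<in> mod_hom R M N" "g \<in> mod_hom R M N"
  shows "(\<lambda>x. f x \<ominus>\<^bsub>N\<^esub> g x) \<in> mod_hom R M N"
proof -
  interpret f: mod_homo R M N f using assms by (intro mod_homoI)
  interpret g: mod_homo R M N g using assms by (intro mod_homoI)
  show ?thesis
    by (rule mod_homI) (simp_all add: f.closed g.closed f.add g.add f.smult g.smult f.N.add_minus_add f.N.smult_minus_distr)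
qed

text \<open>Lifts \<alpha> and \<beta> of the identity of M compare the two free modules. The map id
  - \<beta>\<alpha> sends F into Z, hence JF into JZ, so \<alpha> is injective modulo JZ. Equality
  of lengths follows by exchanging the presentations.\<close>

lemma tor_len_le:
  assumes M: "module R M" and S: "presents R M S w" and T: "presents R M T v" and J: "ideal J R"
  shows "tor_len R J M S w \<le> tor_len R J M T v"
proof -
  interpret p: presentation R M S w using M S by (rule presentationI)
  interpret q: presentation R M T v using M T by (rule presentationI)
  have Jc: "J \<subseteq> carrier R" using ideal.Icarr[OF J] by auto
  obtain \<alpha> where \<alpha>: "\<alpha> \<in> mod_hom R p.F q.F" "\<And>x. x \<in> carrier p.F \<Longrightarrow> q.\<pi> (\<alpha> x) = p.\<pi> x"
    using free_lift[OF q.\<pi>.M.module_M M q.\<pi>.hom _ p.\<pi>.hom] q.pi_onto by blast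
  obtain \<beta> where \<beta>: "\<beta> \<in> mod_hom R q.F p.F" "\<And>x. x \<in> carrier q.F \<Longrightarrow> p.\<pi> (\<beta> x) = q.\<pi> x"
    using free_lift[OF p.\<pi>.M.module_M M p.\<pi>.hom _ q.\<pi>.hom] p.pi_onto by blast
  interpret a: mod_homo R p.F q.F \<alpha> using p.\<pi>.M.module_M q.\<pi>.M.module_M \<alpha>(1) by (rule mod_homoI)
  interpret b: mod_homo R q.F p.F \<beta> using q.\<pi>.M.module_M p.\<pi>.M.module_M \<beta>(1) by (rule mod_homoI)
  let ?\<delta> = "\<lambda>x. x \<ominus>\<^bsub>p.F\<^esub> \<beta> (\<alpha> x)"
  have "(\<lambda>x. \<beta> (\<alpha> x)) \<in> mod_hom R p.F p.F" using mod_hom_comp[OF \<alpha>(1) \<beta>(1)] by (simp add: comp_def)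
  hence \<delta>: "?\<delta> \<in> mod_hom R p.F p.F" by (intro mod_hom_minus p.\<pi>.M.module_M mod_hom_id)
  interpret e: mod_homo R p.F p.F ?\<delta> using p.\<pi>.M.module_M p.\<pi>.M.module_M \<delta> by (rule mod_homoI)
  have \<delta>Z: "?\<delta> ` carrier p.F \<subseteq> p.Z"
  proof clarify
    fix x assume x: "x \<in> carrier p.F"
    have c: "\<beta> (\<alpha> x) \<in> carrier p.F" using a.closed b.closed x by blast
    show "?\<delta> x \<in> p.Z"
      unfolding p.Z_iff p.\<pi>.minus[OF x c] \<beta>(2)[OF a.closed[OF x]] \<alpha>(2)[OF x]
      using e.closed[OF x] p.M.minus_self[OF p.\<pi>.closed[OF x]] by (rule conjI)
  qed
  show ?thesis unfolding tor_len_def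
  proof (rule a.rlen_inj_le)
    show "submodule (p.Z \<inter> imul R p.F J (carrier p.F)) R p.F" "submodule (q.Z \<inter> imul R q.F J (carrier q.F)) R q.F"
      "submodule (imul R q.F J q.Z) R q.F" "imul R q.F J q.Z \<subseteq> q.Z \<inter> imul R q.F J (carrier q.F)"
      using p.imul_sms[OF Jc] q.imul_sms[OF Jc] by auto
    have "\<alpha> ` imul R p.F J (carrier p.F) \<subseteq> imul R q.F J (carrier q.F)"
      unfolding a.imul_image[OF Jc order_refl] using Jc a.closed by (intro q.\<pi>.M.imul_mono) auto
    thus "\<alpha> ` (p.Z \<inter> imul R p.F J (carrier p.F)) \<subseteq> q.Z \<inter> imul R q.F J (carrier q.F)"
      using \<alpha>(2) a.closed by (auto simp: p.Z_iff q.Z_iff)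
    have \<beta>Z: "\<beta> ` imul R q.F J q.Z \<subseteq> imul R p.F J p.Z"
      unfolding b.imul_image[OF Jc q.Z_sub] using \<beta>(2) b.closed
      by (intro p.\<pi>.M.imul_mono[OF order_refl _ Jc p.Z_sub]) (auto simp: p.Z_iff q.Z_iff)
    have \<delta>J: "?\<delta> ` imul R p.F J (carrier p.F) \<subseteq> imul R p.F J p.Z"
      unfolding e.imul_image[OF Jc order_refl] by (rule p.\<pi>.M.imul_mono[OF order_refl \<delta>Z Jc p.Z_sub])
    show "{x \<in> p.Z \<inter> imul R p.F J (carrier p.F). \<alpha> x \<in> imul R q.F J q.Z} \<subseteq> imul R p.F J p.Z"
    proof clarify
      fix x assume x: "x \<in> p.Z" "x \<in> imul R p.F J (carrier p.F)" "\<alpha> x \<in> imul R q.F J q.Z"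
      have xc: "x \<in> carrier p.F" "\<beta> (\<alpha> x) \<in> carrier p.F" using x(1) p.Z_sub a.closed b.closed by auto
      have "?\<delta> x \<oplus>\<^bsub>p.F\<^esub> \<beta> (\<alpha> x) \<in> imul R p.F J p.Z"
        using \<beta>Z \<delta>J x by (intro p.\<pi>.M.smD(3)[OF p.imul_sms(2)[OF Jc]]) auto
      thus "x \<in> imul R p.F J p.Z" unfolding p.\<pi>.M.minus_add_cancel[OF xc] .
    qed
  qed
qed

definition tor1_len :: "('a, 'k) ring_scheme \<Rightarrow> 'a set \<Rightarrow> ('a, 'b) module \<Rightarrow> enat" where
  "tor1_len R J M = mod_length R (Tor1 R M (quot_mod (self_mod R) J))"

lemma tor1_len_eq:
  assumes "module R M" "presents R M S w" "ideal J R"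
  shows "tor1_len R J M = tor_len R J M S w"
  unfolding tor1_len_def mod_length_Tor1[OF assms(1,3)]
  using assms presents_carrier[OF assms(1)] by (intro antisym tor_len_le)

text \<open>The isomorphism is absorbed into the presentation: \<phi>, read as a family of
  generators of N indexed by the carrier of M, has the same free module and the same kernel as the
  functorial presentation of M. The elements of M and N may have different types.\<close>

lemma tor1_len_iso:
  assumes M: "module R M" and N: "module R N" and \<phi>: "\<phi> \<in> mod_hom R M N" "inj_on \<phi> (carrier M)" "\<phi> ` carrier M = carrier N"
    and J: "ideal J R"
  shows "tor1_len R J N = tor1_len R J M"
proof -
  interpret p: presentation R M "carrier M" "\<lambda>x. x" using M presents_carrier[OF M] by (rule presentationI)
  interpret f: mod_homo R M N \<phi> using M N \<phi>(1) by (rule mod_homoI)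
  have lin: "lin R N \<phi> f = \<phi> (p.\<pi> f)" if "f \<in> carrier p.F" for f
  proof -
    have "lin R N \<phi> f = (\<phi> \<circ> p.\<pi>) f"
    proof (rule f.N.free_hom_eqI[OF f.N.lin_hom mod_hom_comp[OF p.\<pi>.hom \<phi>(1)] _ that])
      fix s assume "s \<in> carrier M"
      thus "lin R N \<phi> (free_gen R s) = (\<phi> \<circ> p.\<pi>) (free_gen R s)"
        using f.closed by (simp add: f.N.lin_gen p.M.lin_gen)
    qed (rule f.closed)
    thus ?thesis by simp
  qed
  have "lin R N \<phi> ` carrier p.F = \<phi> ` p.\<pi> ` carrier p.F"
    unfolding image_image using lin by (intro image_cong) auto
  hence pres: "presents R N (carrier M) \<phi>"
    unfolding presents_def p.pi_onto \<phi>(3) using f.closed by simp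
  have "lin R N \<phi> f = \<zero>\<^bsub>N\<^esub> \<longleftrightarrow> p.\<pi> f = \<zero>\<^bsub>M\<^esub>" if "f \<in> carrier p.F" for f
    unfolding lin[OF that] using inj_onD[OF \<phi>(2)] f.zero p.\<pi>.closed[OF that] by (metis p.M.zero_closed)
  hence "pres_ker R N (carrier M) \<phi> = p.Z"
    by (auto simp: pres_ker_def a_kernel_def')
  thus ?thesis
    unfolding tor1_len_eq[OF N pres J] tor1_len_eq[OF M p.pres J] tor_len_def by simp
qed

subsection \<open>Subadditivity on extensions\<close>

locale extension = M: rmodule R M + N: rmodule R N
  for R :: "('a, 'k) ring_scheme" (structure) and M :: "('a, 'm) module" and N :: "('a, 'n) module" +
  fixes E :: "('a, 'n, 'x, 'm) extn"
  assumes ext: "is_ext R M N E"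
begin

abbreviation "Y \<equiv> ext_mid E"
abbreviation "\<iota> \<equiv> ext_in E"
abbreviation "\<rho> \<equiv> ext_out E"

sublocale i: mod_homo R N Y \<iota>
  using ext N.module_M by (intro mod_homoI) (auto simp: is_ext_def)

sublocale o: mod_homo R Y M \<rho>
  using ext M.module_M by (intro mod_homoI) (auto simp: is_ext_def)

lemma in_inj: "inj_on \<iota> (carrier N)"
  using ext by (simp add: is_ext_def)

lemma in_eq_zero: "n \<in> carrier N \<Longrightarrow> \<iota> n = \<zero>\<^bsub>Y\<^esub> \<longleftrightarrow> n = \<zero>\<^bsub>N\<^esub>"
  using inj_onD[OF in_inj, of n "\<zero>\<^bsub>N\<^esub>"] i.zero N.M.zero_closed by metis

lemma exact_in: "\<iota> ` carrier N = {x \<in> carrier Y. \<rho> x = \<zero>\<^bsub>M\<^esub>}"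
  using ext by (simp add: is_ext_def a_kernel_def')

lemma exact: "x \<in> carrier Y \<Longrightarrow> \<rho> x = \<zero>\<^bsub>M\<^esub> \<Longrightarrow> \<exists>n\<in>carrier N. x = \<iota> n"
  using exact_in by blast

lemma out_in: "n \<in> carrier N \<Longrightarrow> \<rho> (\<iota> n) = \<zero>\<^bsub>M\<^esub>"
  using exact_in by blast

lemma out_onto: "\<rho> ` carrier Y = carrier M"
  using ext by (simp add: is_ext_def)

end

lemma extensionI: "module R M \<Longrightarrow> module R N \<Longrightarrow> is_ext R M N E \<Longrightarrow> extension R M N E"
  by (simp add: extension_def extension_axioms_def rmoduleI)

text \<open>Horseshoe lemma: presentations of the outer terms induce one of the middle term.\<close>

locale horseshoe = extension R M N E + pN: presentation R N S g + pM: presentation R M T h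
  for R :: "('a, 'k) ring_scheme" (structure) and M :: "('a, 'm) module" and N :: "('a, 'n) module"
    and E :: "('a, 'n, 'x, 'm) extn" and S :: "'s set" and g and T :: "'t set" and h +
  fixes v :: "'s + 't \<Rightarrow> 'x" and J :: "'a set"
  assumes v_in: "\<And>s. s \<in> S \<Longrightarrow> v (Inl s) = \<iota> (g s)"
    and v_out: "\<And>t. t \<in> T \<Longrightarrow> v (Inr t) \<in> carrier Y \<and> \<rho> (v (Inr t)) = h t"
    and J: "ideal J R"
begin

abbreviation "U \<equiv> S <+> T"
abbreviation "FU \<equiv> free_mod R U"
abbreviation "inl f \<equiv> case_sum f (\<lambda>_. \<zero>)"
abbreviation "inr f \<equiv> case_sum (\<lambda>_. \<zero>) f"
abbreviation "prS f \<equiv> (\<lambda>s. f (Inl s))"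
abbreviation "prT f \<equiv> (\<lambda>t. f (Inr t))"

lemma Jc: "J \<subseteq> carrier R"
  using ideal.Icarr[OF J] by auto

lemma v_closed: "u \<in> U \<Longrightarrow> v u \<in> carrier Y"
  using v_in v_out i.closed pN.w_closed by auto

sublocale x: mod_homo R FU Y "lin R Y v"
  using v_closed by (rule i.N.lin_homo)

lemma finite_case_sum:
  assumes "finite {s. f s \<noteq> \<zero>}" "finite {t. f' t \<noteq> \<zero>}"
  shows "finite {u. case_sum f f' u \<noteq> \<zero>}"
proof -
  have "{u. case_sum f f' u \<noteq> \<zero>} \<subseteq> {s. f s \<noteq> \<zero>} <+> {t. f' t \<noteq> \<zero>}"
  proof
    fix u assume "u \<in> {u. case_sum f f' u \<noteq> \<zero>}"
    thus "u \<in> {s. f s \<noteq> \<zero>} <+> {t. f' t \<noteq> \<zero>}" by (cases u) auto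
  qed
  thus ?thesis using assms finite_Plus finite_subset by blast
qed

sublocale l: mod_homo R pN.F FU "\<lambda>f. inl f"
proof (intro mod_homoI mod_homI pN.\<pi>.M.module_M x.M.module_M)
  fix f assume "f \<in> carrier pN.F"
  thus "inl f \<in> carrier FU"
    using finite_case_sum[of f "\<lambda>_. \<zero>"] by (auto simp: M.R.free_mod_carrier_iff split: sum.splits)
qed (auto simp: fun_eq_iff split: sum.splits)

sublocale r: mod_homo R pM.F FU "\<lambda>f. inr f"
proof (intro mod_homoI mod_homI pM.\<pi>.M.module_M x.M.module_M)
  fix f assume "f \<in> carrier pM.F"
  thus "inr f \<in> carrier FU"
    using finite_case_sum[of "\<lambda>_. \<zero>" f] by (auto simp: M.R.free_mod_carrier_iff split: sum.splits)
qed (auto simp: fun_eq_iff split: sum.splits)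

sublocale ps: mod_homo R FU pN.F "\<lambda>f. prS f"
proof (intro mod_homoI mod_homI pN.\<pi>.M.module_M x.M.module_M)
  fix f assume f: "f \<in> carrier FU"
  hence "finite (Inl -` {u. f u \<noteq> \<zero>})" by (intro finite_vimageI) (auto simp: M.R.free_mod_carrier_iff)
  thus "prS f \<in> carrier pN.F" using f by (auto simp: M.R.free_mod_carrier_iff vimage_def)
qed auto

sublocale pt: mod_homo R FU pM.F "\<lambda>f. prT f"
proof (intro mod_homoI mod_homI pM.\<pi>.M.module_M x.M.module_M)
  fix f assume f: "f \<in> carrier FU"
  hence "finite (Inr -` {u. f u \<noteq> \<zero>})" by (intro finite_vimageI) (auto simp: M.R.free_mod_carrier_iff)
  thus "prT f \<in> carrier pM.F" using f by (auto simp: M.R.free_mod_carrier_iff vimage_def)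
qed auto

lemma decomp: "f \<in> carrier FU \<Longrightarrow> f = inl (prS f) \<oplus>\<^bsub>FU\<^esub> inr (prT f)"
  by (auto simp: fun_eq_iff M.R.free_mod_carrier_iff split: sum.splits)

lemma lin_inl: "f \<in> carrier pN.F \<Longrightarrow> lin R Y v (inl f) = \<iota> (pN.\<pi> f)"
proof -
  assume f: "f \<in> carrier pN.F"
  have "(lin R Y v \<circ> (\<lambda>f. inl f)) f = (\<iota> \<circ> pN.\<pi>) f"
  proof (rule i.N.free_hom_eqI[OF mod_hom_comp[OF l.hom x.hom] mod_hom_comp[OF pN.\<pi>.hom i.hom] _ f])
    fix s assume s: "s \<in> S"
    have il: "inl (free_gen R s) = free_gen R (Inl s)" by (auto simp: free_gen_def fun_eq_iff split: sum.splits)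
    have "lin R Y v (free_gen R (Inl s)) = \<iota> (g s)"
      using i.N.lin_gen[of v "Inl s"] v_closed[of "Inl s"] s v_in[OF s] by auto
    thus "(lin R Y v \<circ> (\<lambda>f. inl f)) (free_gen R s) = (\<iota> \<circ> pN.\<pi>) (free_gen R s)"
      unfolding comp_def il N.lin_gen[of g s, OF pN.w_closed[OF s]] .
  qed
  thus ?thesis by simp
qed

lemma out_lin: "f \<in> carrier FU \<Longrightarrow> \<rho> (lin R Y v f) = pM.\<pi> (prT f)"
proof -
  assume f: "f \<in> carrier FU"
  have "(\<rho> \<circ> lin R Y v) f = (pM.\<pi> \<circ> (\<lambda>f. prT f)) f"
  proof (rule M.free_hom_eqI[OF mod_hom_comp[OF x.hom o.hom] mod_hom_comp[OF pt.hom pM.\<pi>.hom] _ f])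
    fix u assume u: "u \<in> U"
    have 0: "prT (free_gen R (Inl s)) = \<zero>\<^bsub>pM.F\<^esub>" for s :: 's by (auto simp: free_gen_def)
    have 1: "prT (free_gen R (Inr t)) = free_gen R t" for t :: 't by (auto simp: free_gen_def fun_eq_iff)
    show "(\<rho> \<circ> lin R Y v) (free_gen R u) = (pM.\<pi> \<circ> (\<lambda>f. prT f)) (free_gen R u)"
    proof (cases u)
      case (Inl s)
      hence s: "s \<in> S" using u by auto
      have "lin R Y v (free_gen R (Inl s)) = \<iota> (g s)"
        using i.N.lin_gen[of v "Inl s"] v_closed[of "Inl s"] s v_in[OF s] by auto
      thus ?thesis unfolding Inl comp_def 0 pM.\<pi>.zero using out_in[OF pN.w_closed[OF s]] by simp
    next
      case (Inr t)
      hence "t \<in> T" using u by auto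
      thus ?thesis unfolding Inr comp_def 1
        using v_out[of t] i.N.lin_gen[of v "Inr t"] M.lin_gen[of h t] pM.w_closed[of t] by simp
    qed
  qed
  thus ?thesis by simp
qed

text \<open>The T-part f yields an element of Y with the same image as x in M. The error lies in the
  image of N and is removed by an S-part. Both the surjectivity of the middle presentation and that
  of the map between the kernels follow from this.\<close>

lemma correct:
  assumes x: "x \<in> carrier Y" and f: "f \<in> carrier pM.F" "\<rho> x = pM.\<pi> f"
  shows "\<exists>f'\<in>carrier pN.F. x = lin R Y v (inl f' \<oplus>\<^bsub>FU\<^esub> inr f)"
proof -
  have rf: "inr f \<in> carrier FU" using f by (intro r.closed)
  have rc: "lin R Y v (inr f) \<in> carrier Y" using rf by (rule x.closed)
  have "\<rho> (x \<ominus>\<^bsub>Y\<^esub> lin R Y v (inr f)) = \<zero>\<^bsub>M\<^esub>"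
    unfolding o.minus[OF x rc] using out_lin[OF rf] f M.minus_self[OF pM.\<pi>.closed[OF f(1)]] by simp
  then obtain n where n: "n \<in> carrier N" "x \<ominus>\<^bsub>Y\<^esub> lin R Y v (inr f) = \<iota> n"
    using exact i.N.minus_closed[OF x rc] by blast
  then obtain f' where f': "f' \<in> carrier pN.F" "n = pN.\<pi> f'" using pN.pi_onto by blast
  have lf: "inl f' \<in> carrier FU" using f' by (intro l.closed)
  have "x = \<iota> n \<oplus>\<^bsub>Y\<^esub> lin R Y v (inr f)" using n(2) i.N.minus_add_cancel[OF x rc] by simp
  also have "\<dots> = lin R Y v (inl f' \<oplus>\<^bsub>FU\<^esub> inr f)"
    unfolding x.add[OF lf rf] lin_inl[OF f'(1)] f'(2) ..
  finally show ?thesis using f' by blast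
qed

lemma pres_mid: "presents R Y U v"
proof -
  have "carrier Y \<subseteq> lin R Y v ` carrier FU"
  proof
    fix x assume x: "x \<in> carrier Y"
    hence "\<rho> x \<in> pM.\<pi> ` carrier pM.F" using pM.pi_onto o.closed by auto
    then obtain f where f: "f \<in> carrier pM.F" "\<rho> x = pM.\<pi> f" by auto
    obtain f' where f': "f' \<in> carrier pN.F" "x = lin R Y v (inl f' \<oplus>\<^bsub>FU\<^esub> inr f)"
      using correct[OF x f] by blast
    show "x \<in> lin R Y v ` carrier FU"
      unfolding f'(2) by (intro imageI x.M.a_closed l.closed r.closed f(1) f'(1))
  qed
  thus ?thesis unfolding presents_def using v_closed x.closed by auto
qed

sublocale pY: presentation R Y U v
  using i.N.module_M pres_mid by (rule presentationI)

abbreviation "AX \<equiv> pY.Z \<inter> imul R FU J (carrier FU)"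
abbreviation "CX \<equiv> imul R FU J pY.Z"
abbreviation "AN \<equiv> pN.Z \<inter> imul R pN.F J (carrier pN.F)"
abbreviation "AM \<equiv> pM.Z \<inter> imul R pM.F J (carrier pM.F)"
text \<open>The cut that realises half exactness: AX/BX embeds into the Tor of M, and BX/CX is a
  quotient of the Tor of N.\<close>

definition "BX = {x \<in> AX. prT x \<in> imul R pM.F J pM.Z}"

lemma prT_Z: "prT ` pY.Z = pM.Z"
proof
  show "prT ` pY.Z \<subseteq> pM.Z"
    using out_lin pt.closed o.zero by (auto simp: pY.Z_iff pM.Z_iff) metis
  show "pM.Z \<subseteq> prT ` pY.Z"
  proof
    fix z assume "z \<in> pM.Z"
    hence z: "z \<in> carrier pM.F" "\<rho> \<zero>\<^bsub>Y\<^esub> = pM.\<pi> z" using o.zero by (auto simp: pM.Z_iff)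
    obtain f' where f': "f' \<in> carrier pN.F" "\<zero>\<^bsub>Y\<^esub> = lin R Y v (inl f' \<oplus>\<^bsub>FU\<^esub> inr z)"
      using correct[OF i.N.zero_closed z] by blast
    have "inl f' \<oplus>\<^bsub>FU\<^esub> inr z \<in> pY.Z"
      unfolding pY.Z_iff using f'(2) by (intro conjI x.M.a_closed l.closed r.closed f'(1) z(1)) simp
    moreover have "prT (inl f' \<oplus>\<^bsub>FU\<^esub> inr z) = z" using z by (auto simp: M.R.free_mod_carrier_iff)
    ultimately show "z \<in> prT ` pY.Z" by (metis imageI)
  qed
qed

lemma prT_J: "prT ` imul R FU J (carrier FU) \<subseteq> imul R pM.F J (carrier pM.F)"
  unfolding pt.imul_image[OF Jc order_refl] using pt.closed Jc by (intro pM.\<pi>.M.imul_mono) auto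

lemma prS_J: "prS ` imul R FU J (carrier FU) \<subseteq> imul R pN.F J (carrier pN.F)"
  unfolding ps.imul_image[OF Jc order_refl] using ps.closed Jc by (intro pN.\<pi>.M.imul_mono) auto

lemma BX_sm: "submodule BX R FU" "CX \<subseteq> BX" "BX \<subseteq> AX"
proof -
  show "submodule BX R FU" unfolding BX_def
    by (rule pt.vimage_sm[OF pY.imul_sms(3)[OF Jc] pM.imul_sms(2)[OF Jc]])
  have "prT ` CX = imul R pM.F J pM.Z" unfolding pt.imul_image[OF Jc pY.Z_sub] prT_Z ..
  thus "CX \<subseteq> BX" using pY.imul_sms(4)[OF Jc] unfolding BX_def by blast
qed (auto simp: BX_def)

lemma tor_mid_split: "tor_len R J Y U v = rlen R FU AX BX + rlen R FU BX CX"
  unfolding tor_len_def using pY.imul_sms[OF Jc] BX_sm by (intro x.M.rlen_add)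

lemma tor_len_subadd: "tor_len R J Y U v \<le> tor_len R J M T h + tor_len R J N S g"
  unfolding tor_mid_split
proof (rule add_mono)
  show "rlen R FU AX BX \<le> tor_len R J M T h"
    unfolding tor_len_def
  proof (rule pt.rlen_inj_le)
    show "prT ` AX \<subseteq> AM" using prT_J prT_Z by auto
  qed (use pY.imul_sms[OF Jc] pM.imul_sms[OF Jc] in \<open>auto simp: BX_def\<close>)
  show "rlen R FU BX CX \<le> tor_len R J N S g"
    unfolding tor_len_def
  proof (rule l.rlen_surj_le)
    show "inl ` imul R pN.F J pN.Z \<subseteq> CX"
      unfolding l.imul_image[OF Jc pN.Z_sub]
      using lin_inl l.closed i.zero
      by (intro x.M.imul_mono[OF order_refl _ Jc pY.Z_sub]) (auto simp: pY.Z_iff pN.Z_iff)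
    show "BX \<subseteq> inl ` AN <+>\<^bsub>FU\<^esub> CX"
    proof
      fix x assume x: "x \<in> BX"
      have "prT ` CX = imul R pM.F J pM.Z" unfolding pt.imul_image[OF Jc pY.Z_sub] prT_Z ..
      \<comment> \<open>J times the middle kernel maps onto J times the kernel for M, so some c in
        CX has the same T-component as x; the difference lives on S alone.\<close>
      then obtain c where c: "c \<in> CX" "prT x = prT c" using x by (auto simp: BX_def)
      have cA: "c \<in> AX" "x \<in> AX" using c(1) x BX_sm by auto
      have cc: "c \<in> carrier FU" "x \<in> carrier FU" using cA pY.Z_sub by auto
      define y where "y = x \<ominus>\<^bsub>FU\<^esub> c"
      have y: "y \<in> AX" unfolding y_def by (rule x.M.smD(6)[OF pY.imul_sms(3)[OF Jc] cA(2,1)])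
      have yc: "y \<in> carrier FU" using y pY.Z_sub by auto
      have "prT y = \<zero>\<^bsub>pM.F\<^esub>"
        unfolding y_def pt.minus[OF cc(2,1)] c(2) by (rule pM.\<pi>.M.minus_self[OF pt.closed[OF cc(1)]])
      hence "inr (prT y) = \<zero>\<^bsub>FU\<^esub>" using r.zero by simp
      hence yl: "y = inl (prS y)" using decomp[OF yc] x.M.r_zero[OF l.closed[OF ps.closed[OF yc]]] by simp
      have "\<iota> (pN.\<pi> (prS y)) = \<zero>\<^bsub>Y\<^esub>"
        using lin_inl[OF ps.closed[OF yc]] y yl by (simp add: pY.Z_iff)
      hence "prS y \<in> pN.Z" using in_eq_zero[OF pN.\<pi>.closed[OF ps.closed[OF yc]]] ps.closed[OF yc] by (simp add: pN.Z_iff)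
      moreover have "prS y \<in> imul R pN.F J (carrier pN.F)" using prS_J y by auto
      ultimately have yi: "y \<in> inl ` AN" using yl by blast
      have xy: "x = y \<oplus>\<^bsub>FU\<^esub> c" unfolding y_def by (rule x.M.minus_add_cancel[OF cc(2,1), symmetric])
      show "x \<in> inl ` AN <+>\<^bsub>FU\<^esub> CX" by (subst xy) (rule x.M.set_addI[OF yi c(1)])
    qed
  qed (use pY.imul_sms[OF Jc] pN.imul_sms[OF Jc] in auto)
qed

text \<open>The two assumptions say that the kernels split along with the free modules. Then AX maps
  onto AM, and AN embeds into BX modulo CX up to JZ, which reverses both estimates of
  \<open>tor_len_subadd\<close>.\<close>

lemma tor_len_superadd:
  assumes rZ: "\<And>z. z \<in> pM.Z \<Longrightarrow> inr z \<in> pY.Z" and sZ: "\<And>f. f \<in> pY.Z \<Longrightarrow> prS f \<in> pN.Z"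
  shows "tor_len R J M T h + tor_len R J N S g \<le> tor_len R J Y U v"
  unfolding tor_mid_split
proof (rule add_mono)
  show "tor_len R J M T h \<le> rlen R FU AX BX"
    unfolding tor_len_def
  proof (rule pt.rlen_surj_le)
    have rJ: "inr ` imul R pM.F J (carrier pM.F) \<subseteq> imul R FU J (carrier FU)"
      unfolding r.imul_image[OF Jc order_refl] using r.closed Jc by (intro x.M.imul_mono) auto
    have "AM \<subseteq> prT ` AX"
    proof
      fix z assume z: "z \<in> AM"
      hence "inr z \<in> AX" using rZ rJ by auto
      thus "z \<in> prT ` AX" by (rule image_eqI[rotated]) simp
    qed
    thus "AM \<subseteq> prT ` AX <+>\<^bsub>pM.F\<^esub> imul R pM.F J pM.Z"
      using pM.\<pi>.M.set_add_upper1[OF pt.image_sm[OF pY.imul_sms(3)[OF Jc]] pM.imul_sms(2)[OF Jc]] by blast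
  qed (use pY.imul_sms[OF Jc] pM.imul_sms[OF Jc] BX_sm in \<open>auto simp: BX_def\<close>)
  show "tor_len R J N S g \<le> rlen R FU BX CX"
    unfolding tor_len_def
  proof (rule l.rlen_inj_le)
    have lJ: "inl ` imul R pN.F J (carrier pN.F) \<subseteq> imul R FU J (carrier FU)"
      unfolding l.imul_image[OF Jc order_refl] using l.closed Jc by (intro x.M.imul_mono) auto
    show "inl ` AN \<subseteq> BX"
    proof clarify
      fix z assume z: "z \<in> pN.Z" "z \<in> imul R pN.F J (carrier pN.F)"
      have "inl z \<in> pY.Z" using z(1) lin_inl[of z] l.closed[of z] i.zero by (simp add: pY.Z_iff pN.Z_iff)
      moreover have "prT (inl z) = \<zero>\<^bsub>pM.F\<^esub>" by simp
      ultimately show "inl z \<in> BX" unfolding BX_def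
        using lJ z(2) pM.\<pi>.M.smD(2)[OF pM.imul_sms(2)[OF Jc]] by auto
    qed
    have "prS ` CX \<subseteq> imul R pN.F J pN.Z"
      unfolding ps.imul_image[OF Jc pY.Z_sub]
      using sZ by (intro pN.\<pi>.M.imul_mono[OF order_refl _ Jc pN.Z_sub]) auto
    thus "{x \<in> AN. inl x \<in> CX} \<subseteq> imul R pN.F J pN.Z" by force
  qed (use pY.imul_sms[OF Jc] pN.imul_sms[OF Jc] BX_sm in auto)
qed

end

lemma tor1_len_subadd:
  assumes M: "module R M" and N: "module R N" and E: "is_ext R M N E" and J: "ideal J R"
  shows "tor1_len R J (ext_mid E) \<le> tor1_len R J M + tor1_len R J N"
proof -
  interpret e: extension R M N E using M N E by (rule extensionI)
  have "\<exists>y. y \<in> carrier e.Y \<and> e.\<rho> y = m" if "m \<in> carrier M" for m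
  proof -
    have "m \<in> e.\<rho> ` carrier e.Y" using e.out_onto that by simp
    thus ?thesis by auto
  qed
  then obtain k where k: "\<And>m. m \<in> carrier M \<Longrightarrow> k m \<in> carrier e.Y \<and> e.\<rho> (k m) = m" by metis
  interpret horseshoe R M N E "carrier N" "\<lambda>x. x" "carrier M" "\<lambda>x. x" "case_sum e.\<iota> k" J
    by (intro horseshoe.intro horseshoe_axioms.intro presentationI presents_carrier e.extension_axioms M N J) (use k in auto)
  show ?thesis
    using tor_len_subadd tor1_len_eq[OF e.i.N.module_M pres_mid J] tor1_len_eq[OF M pM.pres J] tor1_len_eq[OF N pN.pres J]
    by simp
qed

lemma split_is_ext:
  assumes M: "module R M" and N: "module R N"
  shows "is_ext R M N (split_ext M N)"
proof -
  interpret M: rmodule R M using M by (rule rmoduleI)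
  interpret N: rmodule R N using N by (rule rmoduleI)
  show ?thesis unfolding is_ext_def
  proof (intro conjI)
    show "module R (ext_mid (split_ext M N))" using dsum_module[OF N M] by (simp add: split_ext_def)
    show "ext_in (split_ext M N) \<in> mod_hom R N (ext_mid (split_ext M N))"
      "ext_out (split_ext M N) \<in> mod_hom R (ext_mid (split_ext M N)) M"
      by (auto simp: split_ext_def intro!: mod_homI)
  qed (auto simp: split_ext_def inj_on_def a_kernel_def' image_iff)
qed

lemma tor1_len_dsum:
  fixes N :: "('a, 'n) module" and M :: "('a, 'm) module"
  assumes N: "module R N" and M: "module R M" and J: "ideal J R"
  shows "tor1_len R J (dsum_mod N M) = tor1_len R J N + tor1_len R J M"
proof -
  let ?E = "split_ext M N"
  interpret e: extension R M N ?E using M N split_is_ext[OF M N] by (rule extensionI)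
  have Y: "e.Y = dsum_mod N M" by (simp add: split_ext_def)
  let ?v = "case_sum (\<lambda>n. (n, \<zero>\<^bsub>M\<^esub>)) (\<lambda>m. (\<zero>\<^bsub>N\<^esub>, m))"
  interpret horseshoe R M N ?E "carrier N" "\<lambda>x. x" "carrier M" "\<lambda>x. x" ?v J
    by (intro horseshoe.intro horseshoe_axioms.intro presentationI presents_carrier e.extension_axioms M N J)
      (auto simp: split_ext_def)
  have fst_hom: "fst \<in> mod_hom R e.Y N" by (auto simp: split_ext_def intro: mod_homI)
  have fst_lin: "fst (lin R e.Y ?v f) = pN.\<pi> (prS f)" if f: "f \<in> carrier FU" for f
  proof -
    have "(fst \<circ> lin R e.Y ?v) f = (pN.\<pi> \<circ> (\<lambda>f. prS f)) f"
    proof (rule e.N.free_hom_eqI[OF mod_hom_comp[OF x.hom fst_hom] mod_hom_comp[OF ps.hom pN.\<pi>.hom] _ f])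
      fix u assume u: "u \<in> U"
      have 0: "prS (free_gen R (Inr t)) = \<zero>\<^bsub>pN.F\<^esub>" for t :: 'm by (auto simp: free_gen_def)
      have 1: "prS (free_gen R (Inl s :: 'n + 'm)) = free_gen R s" for s by (auto simp: free_gen_def fun_eq_iff)
      show "(fst \<circ> lin R e.Y ?v) (free_gen R u) = (pN.\<pi> \<circ> (\<lambda>f. prS f)) (free_gen R u)"
      proof (cases u)
        case (Inl s)
        hence s: "s \<in> carrier N" using u by auto
        have "lin R N (\<lambda>x. x) (free_gen R s) = s" using s by (rule e.N.lin_gen)
        thus ?thesis unfolding Inl comp_def 1 using v_closed[OF u] Inl by (simp add: e.i.N.lin_gen)
      next
        case (Inr t)
        thus ?thesis unfolding comp_def using u v_closed[OF u] 0 pN.\<pi>.zero by (auto simp: e.i.N.lin_gen)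
      qed
    qed
    thus ?thesis by simp
  qed
  have z: "\<zero>\<^bsub>e.Y\<^esub> = (\<zero>\<^bsub>N\<^esub>, \<zero>\<^bsub>M\<^esub>)" by (simp add: split_ext_def)
  \<comment> \<open>For a direct sum the first projection computes the S-component, so the middle
    kernel is the product of the two outer kernels; \<open>tor_len_superadd\<close> asks for just
    this.\<close>
  have zero_iff: "f \<in> pY.Z \<longleftrightarrow> f \<in> carrier FU \<and> pN.\<pi> (prS f) = \<zero>\<^bsub>N\<^esub> \<and> pM.\<pi> (prT f) = \<zero>\<^bsub>M\<^esub>" for f
  proof -
    have "snd (lin R e.Y ?v f) = pM.\<pi> (prT f)" if "f \<in> carrier FU"
      using out_lin[OF that] by (simp add: split_ext_def)
    thus ?thesis unfolding pY.Z_iff z prod_eq_iff using fst_lin[of f] by auto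
  qed
  have "tor_len R J M (carrier M) (\<lambda>x. x) + tor_len R J N (carrier N) (\<lambda>x. x) \<le> tor_len R J e.Y U ?v"
  proof (rule tor_len_superadd)
    show "inr z \<in> pY.Z" if "z \<in> pM.Z" for z
    proof -
      have "prS (inr z) = \<zero>\<^bsub>pN.F\<^esub>" by simp
      hence "pN.\<pi> (prS (inr z)) = \<zero>\<^bsub>N\<^esub>" using pN.\<pi>.zero by simp
      thus ?thesis using that r.closed[of z] unfolding zero_iff pM.Z_iff by simp
    qed
    show "prS f \<in> pN.Z" if "f \<in> pY.Z" for f
      using that ps.closed[of f] unfolding zero_iff pN.Z_iff by simp
  qed
  hence "tor_len R J e.Y U ?v = tor_len R J M (carrier M) (\<lambda>x. x) + tor_len R J N (carrier N) (\<lambda>x. x)"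
    using tor_len_subadd by (rule antisym[rotated])
  thus ?thesis
    using tor1_len_eq[OF e.i.N.module_M pres_mid J] tor1_len_eq[OF M pM.pres J] tor1_len_eq[OF N pN.pres J]
    by (simp add: Y add.commute)
qed

section \<open>The multiplicity\<close>

text \<open>More operators leave fewer graded families to test. This passes from a finite generating
  set to the ideal itself, as \<open>artin_rees\<close> requires.\<close>

lemma (in rmodule) graded_acc_superset:
  assumes "graded_acc R M as A B" "as \<subseteq> bs" shows "graded_acc R M bs A B"
  unfolding graded_acc_def
proof (intro allI impI)
  fix H :: "nat \<Rightarrow> nat \<Rightarrow> _"
  assume g: "\<forall>k. graded R M bs (H k)" and H: "\<forall>k n. B n \<subseteq> H k n \<and> H k n \<subseteq> A n \<and> H k n \<subseteq> H (Suc k) n"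
  show "\<exists>K. \<forall>k\<ge>K. H k = H K"
    by (rule graded_accD[OF assms(1)]) (use g H graded_subset[OF _ assms(2)] in auto)
qed

context primary_setup
begin

text \<open>Write t(n) for the length of A n/B n and G(n) for that of Z/B n. A priori t is
  eventually polynomial of unknown degree. Artin-Rees puts A (n+K) into B n, so t(n+K) <= G(n+K) -
  G(n), which is a sum of K increments of G.\<close>

lemma tor_len_growth:
  assumes M: "module R M" and S: "finite S" and pres: "presents R M S w" and d: "d = Suc e"
  shows "tor_len R (ipow R I n) M S w \<noteq> \<infinity>"
    "evp d (\<lambda>n. real (the_enat (tor_len R (ipow R I n) M S w)))"
proof -
  interpret p: presentation R M S w using M pres by (rule presentationI)
  define A where "A = (\<lambda>n. p.Z \<inter> imul R p.F (ipow R I n) (carrier p.F))"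
  define B where "B = (\<lambda>n. imul R p.F (ipow R I n) p.Z)"
  have noeth: "noeth_on R p.F (carrier p.F)" by (rule noeth_free_mod[OF is_cring noetherian_ring_axioms S])
  have t: "tor_len R (ipow R I n) M S w = rlen R p.F (A n) (B n)" for n
    by (simp add: tor_len_def A_def B_def)
  have Asm: "submodule (A n) R p.F" and Bsm: "submodule (B n) R p.F" and BA: "B n \<subseteq> A n" for n
    unfolding A_def B_def using p.imul_sms[OF ipow_sub] by auto
  have AZ: "A n \<subseteq> p.Z" for n by (auto simp: A_def)
  have Ic: "I \<subseteq> carrier R" using ideal.Icarr[OF I] by auto
  have BSuc: "B (Suc n) = imul R p.F I (B n)" for n
    unfolding B_def by (rule p.\<pi>.M.imul_ipow_Suc(2)[OF I p.Z_sub])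
  have BSuc_le: "B (Suc n) \<subseteq> B n" for n unfolding BSuc by (rule p.\<pi>.M.imul_le[OF Ic Bsm])
  obtain C where C: "\<And>n. rlen R p.F p.Z (B n) \<le> enat (C * (n + 1) ^ d)"
    unfolding B_def using growth[OF p.\<pi>.M.module_M noeth p.Z_sm] by blast
  have fin: "rlen R p.F p.Z (B n) \<noteq> \<infinity>" for n using C[of n] by (cases "rlen R p.F p.Z (B n)") auto
  have BZ: "B n \<subseteq> p.Z" for n using BA AZ by blast
  note lenA = p.\<pi>.M.flen_add[OF p.Z_sm Asm BA AZ fin]
  show "tor_len R (ipow R I n) M S w \<noteq> \<infinity>" unfolding t by (rule lenA(3))
  obtain S' where S': "S' \<subseteq> carrier R" "finite S'" "I = Idl S'" using finetely_gen[OF I] by blast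
  obtain as where as: "set as = S'" using finite_list[OF S'(2)] by blast
  have asI: "set as \<subseteq> I" unfolding S'(3) as by (rule genideal_self[OF S'(1)])
  have asc: "set as \<subseteq> carrier R" using as S' by simp
  have gB: "graded R p.F I B"
    by (rule gradedI[OF Bsm]) (simp only: BSuc p.\<pi>.M.imul_incl)
  have gA: "graded R p.F I A"
  proof (rule gradedI[OF Asm])
    fix a n x assume a: "a \<in> I" and x: "x \<in> A n"
    have "a \<odot>\<^bsub>p.F\<^esub> x \<in> p.Z" using a x Ic p.\<pi>.M.smD(4)[OF p.Z_sm, of a x] by (auto simp: A_def)
    moreover have "a \<odot>\<^bsub>p.F\<^esub> x \<in> imul R p.F I (imul R p.F (ipow R I n) (carrier p.F))"
      using x by (intro p.\<pi>.M.imul_incl a) (simp add: A_def)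
    ultimately show "a \<odot>\<^bsub>p.F\<^esub> x \<in> A (Suc n)"
      unfolding A_def p.\<pi>.M.imul_ipow_Suc(2)[OF I order_refl] by simp
  qed
  have acc: "graded_acc R p.F (set as) (\<lambda>n. imul R p.F (ipow R I n) (carrier p.F)) (\<lambda>n. {\<zero>\<^bsub>p.F\<^esub>})"
    using p.\<pi>.M.graded_acc_powers[OF noeth asc] S'(3) as by simp
  have accA: "graded_acc R p.F (set as) A (\<lambda>n. {\<zero>\<^bsub>p.F\<^esub>})"
    by (rule graded_acc_mono[OF acc]) (auto simp: A_def)
  have acc': "graded_acc R p.F (set as) A' B'" if "\<And>n. A' n \<subseteq> A n" "\<And>n. submodule (B' n) R p.F" for A' B'
    by (rule graded_acc_mono[OF accA that(1)]) (use p.\<pi>.M.smD(2)[OF that(2)] in auto)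
  let ?t = "\<lambda>n. p.\<pi>.M.flen (A n) (B n)"
  obtain k where k: "evp k ?t"
    using p.\<pi>.M.hilbert_polynomial[OF asc p.\<pi>.M.graded_subset[OF gA asI] p.\<pi>.M.graded_subset[OF gB asI]
      acc'[OF order_refl Bsm] BA lenA(3)] by blast
  define G where "G = (\<lambda>n. p.\<pi>.M.flen p.Z (B n))"
  have Bmono: "B (n + j) \<subseteq> B n" for n j
    by (induct j) (use BSuc_le in auto)
  have lenG: "G (n + j) = G n + p.\<pi>.M.flen (B n) (B (n + j))" "rlen R p.F (B n) (B (n + j)) \<noteq> \<infinity>" for n j
    using p.\<pi>.M.flen_add[OF p.Z_sm Bsm Bmono BZ fin] by (auto simp: G_def)
  have gB': "graded R p.F (set as) (\<lambda>n. B (Suc n))"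
    using gradedD[OF p.\<pi>.M.graded_subset[OF gB asI]] by (intro gradedI) auto
  \<comment> \<open>The associated graded module of Z. From it G becomes eventually polynomial,
    which turns the bound on G into a bound on single increments.\<close>
  have "\<exists>k. evp k (\<lambda>n. p.\<pi>.M.flen (B n) (B (Suc n)))"
    using lenG(2)[of _ 1]
    by (intro p.\<pi>.M.hilbert_polynomial[OF asc p.\<pi>.M.graded_subset[OF gB asI] gB' acc'[OF BA Bsm] BSuc_le]) simp
  then obtain k' where "evp k' (\<lambda>n. p.\<pi>.M.flen (B n) (B (Suc n)))" by blast
  hence "evp k' (\<lambda>n. G (Suc n) - G n)" using lenG(1)[of _ 1] by simp
  hence "evp (Suc k') G" by (rule evp_antidifference)
  moreover have "\<bar>G n\<bar> \<le> real C * (real n + 1) ^ d" for n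
  proof -
    have "the_enat (rlen R p.F p.Z (B n)) \<le> C * (n + 1) ^ d" using C[of n] fin[of n] by auto
    hence "G n \<le> real (C * (n + 1) ^ d)" unfolding G_def of_nat_le_iff .
    also have "\<dots> = real C * (real n + 1) ^ d" by (simp add: add.commute)
    finally show ?thesis by (simp add: G_def)
  qed
  hence "\<forall>\<^sub>F n in sequentially. \<bar>G n\<bar> \<le> real C * (real n + 1) ^ d" by simp
  ultimately have "evp (Suc d) G" by (rule evp_bounded)
  hence "evp (Suc e) (\<lambda>n. G (Suc n) - G n)" unfolding d by (rule evp_difference)
  then obtain C' where C': "C' \<ge> 0" "\<forall>\<^sub>F n in sequentially. \<bar>G (Suc n) - G n\<bar> \<le> C' * (real n + 1) ^ e"
    by (rule evp_bound)
  then obtain N where N: "\<And>n. n \<ge> N \<Longrightarrow> \<bar>G (Suc n) - G n\<bar> \<le> C' * (real n + 1) ^ e"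
    unfolding eventually_sequentially by blast
  obtain K where K: "\<And>n. A (K + n) \<subseteq> imul R p.F (ipow R I n) (A K)"
    using p.\<pi>.M.artin_rees[OF I gA p.\<pi>.M.graded_acc_superset[OF accA asI]] by blast
  have AB: "A (K + n) \<subseteq> B n" for n
    using K[of n] p.\<pi>.M.imul_mono[OF order_refl AZ ipow_sub p.Z_sub, of n K] unfolding B_def by blast
  have tG: "?t (n + K) \<le> G (n + K) - G n" for n
  proof -
    have "A (n + K) \<subseteq> B n" using AB[of n] by (simp add: add.commute)
    from p.\<pi>.M.flen_add(1)[OF Bsm Asm BA this lenG(2)]
    have "p.\<pi>.M.flen (B n) (B (n + K)) \<ge> ?t (n + K)" by simp
    thus ?thesis using lenG(1)[of n K] by simp
  qed
  \<comment> \<open>All j increments are estimated by the value of the bound at the right end, as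
    the bound increases with n.\<close>
  have Gdiff: "G (n + j) - G n \<le> real j * (C' * (real (n + j) + 1) ^ e)" if "n \<ge> N" for n j
  proof (induct j)
    case (Suc j)
    have "G (n + Suc j) - G (n + j) \<le> C' * (real (n + j) + 1) ^ e" using N[of "n + j"] that by simp
    also have "\<dots> \<le> C' * (real (n + Suc j) + 1) ^ e" using C'(1) by (intro mult_left_mono power_mono) auto
    finally have 1: "G (n + Suc j) - G (n + j) \<le> C' * (real (n + Suc j) + 1) ^ e" .
    have "real j * (C' * (real (n + j) + 1) ^ e) \<le> real j * (C' * (real (n + Suc j) + 1) ^ e)"
      using C'(1) by (intro mult_left_mono power_mono) auto
    with 1 Suc have "G (n + Suc j) - G n \<le> C' * (real (n + Suc j) + 1) ^ e + real j * (C' * (real (n + Suc j) + 1) ^ e)"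
      by linarith
    also have "\<dots> = real (Suc j) * (C' * (real (n + Suc j) + 1) ^ e)" by (simp add: distrib_right)
    finally show ?case .
  qed simp
  have "\<forall>\<^sub>F m in sequentially. \<bar>?t m\<bar> \<le> (real K * C') * (real m + 1) ^ e"
    unfolding eventually_sequentially
  proof (intro exI[of _ "N + K"] allI impI)
    fix m assume m: "m \<ge> N + K"
    show "\<bar>?t m\<bar> \<le> (real K * C') * (real m + 1) ^ e"
    proof -
      have mK: "N \<le> m - K" "m - K + K = m" using m by auto
      show ?thesis using tG[of "m - K"] Gdiff[OF mK(1), of K] unfolding mK(2) by (simp add: mult.assoc)
    qed
  qed
  from evp_bounded[OF k this] show "evp d (\<lambda>n. real (the_enat (tor_len R (ipow R I n) M S w)))"
    unfolding t d .
qed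

end

lemma fg_presents:
  assumes "M \<in> fg_modules R"
  obtains S where "finite S" "S \<subseteq> carrier M" "presents R M S (\<lambda>x. x)"
  using fg_presentation[OF assms] unfolding presents_def by (metis subsetD)

locale primary_setup_dim = primary_setup +
  assumes dim: "krull_dim R = enat d" and d_pos: "d \<ge> 1"
begin

definition tor_seq :: "('a, 'c) module \<Rightarrow> nat \<Rightarrow> real" where
  "tor_seq M n = real (the_enat (tor1_len R (ipow R I (n + 1)) M)) / real n ^ (d - 1)"

lemma eT_eq: "eT R I M = fact (d - 1) * lim (tor_seq M)"
  unfolding eT_def Let_def dim the_enat.simps tor_seq_def tor1_len_def ..

text \<open>Needed wherever inequalities or sums of lengths are transported through
  \<open>the_enat\<close>.\<close>

lemma tor1_len_fin:
  assumes "M \<in> fg_modules R" shows "tor1_len R (ipow R I n) M \<noteq> \<infinity>"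
proof -
  obtain S where "finite S" "S \<subseteq> carrier M" and "presents R M S (\<lambda>x. x)" by (rule fg_presents[OF assms])
  hence S: "finite S" "presents R M S (\<lambda>x. x)" by simp_all
  have "d = Suc (d - 1)" using d_pos by simp
  from tor_len_growth(1)[OF fg_modulesD[OF assms] S this] show ?thesis
    unfolding tor1_len_eq[OF fg_modulesD[OF assms] S(2) ipow_ideal[OF I]] .
qed

text \<open>\<open>lim\<close> is meaningful only for a convergent sequence. The functorial
  presentation is exchanged for a finite one, to which \<open>tor_len_growth\<close>
  applies.\<close>

lemma tor_seq_lim:
  assumes "M \<in> fg_modules R" shows "tor_seq M \<longlonglongrightarrow> lim (tor_seq M)"
proof -
  obtain S where "finite S" "S \<subseteq> carrier M" and "presents R M S (\<lambda>x. x)" by (rule fg_presents[OF assms])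
  hence S: "finite S" "presents R M S (\<lambda>x. x)" by simp_all
  have d: "d = Suc (d - 1)" using d_pos by simp
  have "evp (Suc (d - 1)) (\<lambda>n. real (the_enat (tor_len R (ipow R I n) M S (\<lambda>x. x))))"
    using tor_len_growth(2)[OF fg_modulesD[OF assms] S d] d by simp
  hence "convergent (\<lambda>n. real (the_enat (tor_len R (ipow R I (Suc n)) M S (\<lambda>x. x))) / real n ^ (d - 1))"
    by (rule evp_convergent)
  moreover have "(\<lambda>n. real (the_enat (tor_len R (ipow R I (Suc n)) M S (\<lambda>x. x))) / real n ^ (d - 1)) = tor_seq M"
    unfolding tor_seq_def tor1_len_eq[OF fg_modulesD[OF assms] S(2) ipow_ideal[OF I]] by simp
  ultimately show ?thesis by (simp add: convergent_LIMSEQ_iff)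
qed

lemma eT_iso:
  assumes "module R M" "module R N" "\<phi> \<in> mod_hom R M N" "inj_on \<phi> (carrier M)" "\<phi> ` carrier M = carrier N"
  shows "eT R I N = eT R I M"
proof -
  have "tor_seq N = tor_seq M"
    unfolding tor_seq_def tor1_len_iso[OF assms ipow_ideal[OF I]] ..
  thus ?thesis unfolding eT_eq by simp
qed

lemma eT_subadd:
  assumes M: "M \<in> fg_modules R" and N: "N \<in> fg_modules R" and E: "is_ext R M N E" and fg: "ext_mid E \<in> fg_modules R"
  shows "eT R I (ext_mid E) \<le> eT R I M + eT R I N"
proof -
  have "lim (tor_seq (ext_mid E)) \<le> lim (tor_seq M) + lim (tor_seq N)"
  proof (rule LIMSEQ_le)
    show "tor_seq (ext_mid E) \<longlonglongrightarrow> lim (tor_seq (ext_mid E))" by (rule tor_seq_lim[OF fg])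
    show "(\<lambda>n. tor_seq M n + tor_seq N n) \<longlonglongrightarrow> lim (tor_seq M) + lim (tor_seq N)"
      by (rule tendsto_add[OF tor_seq_lim[OF M] tor_seq_lim[OF N]])
    have "tor_seq (ext_mid E) n \<le> tor_seq M n + tor_seq N n" for n
    proof -
      let ?t = "\<lambda>M. tor1_len R (ipow R I (n + 1)) M"
      have "?t (ext_mid E) \<le> ?t M + tor1_len R (ipow R I (n + 1)) N"
        by (rule tor1_len_subadd[OF fg_modulesD[OF M] fg_modulesD[OF N] E ipow_ideal[OF I]])
      hence "the_enat (tor1_len R (ipow R I (n + 1)) (ext_mid E)) \<le>
          the_enat (?t M) + the_enat (tor1_len R (ipow R I (n + 1)) N)"
        using tor1_len_fin[OF M, of "n + 1"] tor1_len_fin[OF N, of "n + 1"] tor1_len_fin[OF fg, of "n + 1"] by auto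
      thus ?thesis unfolding tor_seq_def add_divide_distrib[symmetric] of_nat_add[symmetric]
        by (intro divide_right_mono) auto
    qed
    thus "\<exists>N'. \<forall>n\<ge>N'. tor_seq (ext_mid E) n \<le> tor_seq M n + tor_seq N n" by blast
  qed
  thus ?thesis unfolding eT_eq distrib_left[symmetric] by (intro mult_left_mono) auto
qed

lemma eT_dsum:
  assumes M: "M \<in> fg_modules R" and N: "N \<in> fg_modules R"
  shows "eT R I (dsum_mod M N) = eT R I M + eT R I N"
proof -
  have *: "tor_seq (dsum_mod M N) n = tor_seq M n + tor_seq N n" for n
    using tor1_len_fin[OF M, of "n + 1"] tor1_len_fin[OF N, of "n + 1"]
    unfolding tor_seq_def tor1_len_dsum[OF fg_modulesD[OF M] fg_modulesD[OF N] ipow_ideal[OF I]]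
    by (auto simp: add_divide_distrib)
  have "tor_seq (dsum_mod M N) \<longlonglongrightarrow> lim (tor_seq M) + lim (tor_seq N)"
    using tendsto_add[OF tor_seq_lim[OF M] tor_seq_lim[OF N]] unfolding *[symmetric] .
  hence "lim (tor_seq (dsum_mod M N)) = lim (tor_seq M) + lim (tor_seq N)" by (rule limI)
  thus ?thesis unfolding eT_eq by (simp add: distrib_left)
qed

end

section \<open>Extensions and their classifying maps\<close>

lemma dsum_hom:
  assumes "module R N" "module R L" "module R Y" "a \<in> mod_hom R N Y" "b \<in> mod_hom R L Y"
  shows "(\<lambda>p. a (fst p) \<oplus>\<^bsub>Y\<^esub> b (snd p)) \<in> mod_hom R (dsum_mod N L) Y"
proof -
  interpret a: mod_homo R N Y a using assms by (intro mod_homoI)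
  interpret b: mod_homo R L Y b using assms by (intro mod_homoI)
  show ?thesis
    by (rule mod_homI) (auto simp: a.closed b.closed a.add b.add a.smult b.smult a.N.smult_r_distr a.N.M.a_ac)
qed

lemma pair_hom:
  "a \<in> mod_hom R L N \<Longrightarrow> b \<in> mod_hom R L M \<Longrightarrow> (\<lambda>x. (a x, b x)) \<in> mod_hom R L (dsum_mod N M)"
  by (rule mod_homI) (auto simp: mod_homD)

text \<open>Generators of N together with lifted generators of M generate Y. This is read off from
  the horseshoe presentation, with the unit ideal put in for its ideal parameter.\<close>

lemma (in extension) is_ext_mid_fg:
  assumes "M \<in> fg_modules R" "N \<in> fg_modules R"
  shows "Y \<in> fg_modules R"
proof -
  obtain S where S: "finite S" "S \<subseteq> carrier N" "presents R N S (\<lambda>x. x)" using assms(2) by (rule fg_presents)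
  obtain T where T: "finite T" "T \<subseteq> carrier M" "presents R M T (\<lambda>x. x)" using assms(1) by (rule fg_presents)
  have "\<exists>y. y \<in> carrier Y \<and> \<rho> y = m" if "m \<in> T" for m
  proof -
    have "m \<in> \<rho> ` carrier Y" using out_onto that T(2) by auto
    thus ?thesis by auto
  qed
  then obtain k where k: "\<And>m. m \<in> T \<Longrightarrow> k m \<in> carrier Y \<and> \<rho> (k m) = m" by metis
  interpret h: horseshoe R M N E S "\<lambda>x. x" T "\<lambda>x. x" "case_sum \<iota> k" "carrier R"
    by (intro horseshoe.intro horseshoe_axioms.intro presentationI extension_axioms M.module_M N.module_M S T M.R.oneideal)
      (use k in auto)
  have "mod_span R Y (case_sum \<iota> k ` (S <+> T)) = carrier Y"
    using h.pres_mid i.N.lin_image[of "S <+> T" "case_sum \<iota> k", OF h.v_closed] unfolding presents_def by simp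
  moreover have "case_sum \<iota> k ` (S <+> T) \<subseteq> carrier Y" using h.v_closed by auto
  moreover have "finite (case_sum \<iota> k ` (S <+> T))" using S T by simp
  ultimately show ?thesis using i.N.module_M unfolding fg_modules_def by blast
qed

text \<open>Short five lemma. \<open>ext_equiv\<close> asks only for a homomorphism compatible with
  both ends; bijectivity is what carries the multiplicity from one representative to
  another.\<close>

lemma ext_equiv_iso:
  assumes "extension R M N E" "extension R M N E'"
    and \<phi>: "\<phi> \<in> mod_hom R (ext_mid E) (ext_mid E')" "\<And>n. n \<in> carrier N \<Longrightarrow> \<phi> (ext_in E n) = ext_in E' n"
      "\<And>x. x \<in> carrier (ext_mid E) \<Longrightarrow> ext_out E' (\<phi> x) = ext_out E x"
  shows "inj_on \<phi> (carrier (ext_mid E))" "\<phi> ` carrier (ext_mid E) = carrier (ext_mid E')"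
proof -
  interpret e: extension R M N E by fact
  interpret e': extension R M N E' by fact
  interpret f: mod_homo R e.Y e'.Y \<phi> using e.i.N.module_M e'.i.N.module_M \<phi>(1) by (rule mod_homoI)
  have ker: "x = \<zero>\<^bsub>e.Y\<^esub>" if x: "x \<in> carrier e.Y" "\<phi> x = \<zero>\<^bsub>e'.Y\<^esub>" for x
  proof -
    have "e.\<rho> x = \<zero>\<^bsub>M\<^esub>" using \<phi>(3)[OF x(1)] x(2) e'.o.zero by simp
    then obtain n where n: "n \<in> carrier N" "x = e.\<iota> n" using e.exact x(1) by blast
    hence "e'.\<iota> n = \<zero>\<^bsub>e'.Y\<^esub>" using \<phi>(2) x(2) by simp
    hence "n = \<zero>\<^bsub>N\<^esub>" using e'.in_eq_zero n by simp
    thus ?thesis using n e.i.zero by simp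
  qed
  show "inj_on \<phi> (carrier e.Y)"
  proof (rule inj_onI)
    fix x y assume xy: "x \<in> carrier e.Y" "y \<in> carrier e.Y" "\<phi> x = \<phi> y"
    have "\<phi> (x \<ominus>\<^bsub>e.Y\<^esub> y) = \<zero>\<^bsub>e'.Y\<^esub>"
      unfolding f.minus[OF xy(1,2)] xy(3) by (rule e'.i.N.minus_self[OF f.closed[OF xy(2)]])
    hence "x \<ominus>\<^bsub>e.Y\<^esub> y = \<zero>\<^bsub>e.Y\<^esub>" by (rule ker[OF e.i.N.minus_closed[OF xy(1,2)]])
    thus "x = y" using e.i.N.minus_eq_zero_iff xy by simp
  qed
  show "\<phi> ` carrier e.Y = carrier e'.Y"
  proof
    show "carrier e'.Y \<subseteq> \<phi> ` carrier e.Y"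
    proof
      fix y assume y: "y \<in> carrier e'.Y"
      hence "e'.\<rho> y \<in> e.\<rho> ` carrier e.Y" using e.out_onto e'.o.closed by simp
      then obtain x where x: "x \<in> carrier e.Y" "e'.\<rho> y = e.\<rho> x" by auto
      have fx: "\<phi> x \<in> carrier e'.Y" using x by (intro f.closed)
      have "e'.\<rho> (y \<ominus>\<^bsub>e'.Y\<^esub> \<phi> x) = \<zero>\<^bsub>M\<^esub>"
        unfolding e'.o.minus[OF y fx] \<phi>(3)[OF x(1)] x(2) by (rule e.M.minus_self[OF e.o.closed[OF x(1)]])
      then obtain n where n: "n \<in> carrier N" "y \<ominus>\<^bsub>e'.Y\<^esub> \<phi> x = e'.\<iota> n"
        using e'.exact e'.i.N.minus_closed[OF y fx] by blast
      have "y = e'.\<iota> n \<oplus>\<^bsub>e'.Y\<^esub> \<phi> x" unfolding n(2)[symmetric] by (rule e'.i.N.minus_add_cancel[OF y fx, symmetric])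
      also have "\<dots> = \<phi> (e.\<iota> n \<oplus>\<^bsub>e.Y\<^esub> x)"
        unfolding f.add[OF e.i.closed[OF n(1)] x(1)] \<phi>(2)[OF n(1)] ..
      finally show "y \<in> \<phi> ` carrier e.Y" using e.i.N.a_closed[OF e.i.closed[OF n(1)] x(1)] by blast
    qed
  qed (use f.closed in auto)
qed

section \<open>Extensions as pushouts of a fixed presentation\<close>

context presentation
begin

definition "Zm = F\<lparr>carrier := Z\<rparr>"

lemma Zm_simps [simp]:
  "carrier Zm = Z" "\<zero>\<^bsub>Zm\<^esub> = \<zero>\<^bsub>F\<^esub>" "x \<oplus>\<^bsub>Zm\<^esub> y = x \<oplus>\<^bsub>F\<^esub> y" "a \<odot>\<^bsub>Zm\<^esub> x = a \<odot>\<^bsub>F\<^esub> x"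
  by (simp_all add: Zm_def)

lemma Zm_module: "module R Zm"
  unfolding Zm_def by (rule \<pi>.M.restrict_module[OF Z_sm])

text \<open>\<open>rep N E h\<close>: the extension \<open>E\<close> is the pushout of \<open>0 \<rightarrow> Z \<rightarrow> F \<rightarrow> M \<rightarrow> 0\<close> along \<open>h : Z \<rightarrow> N\<close>.\<close>

definition rep :: "('a, 'n) module \<Rightarrow> ('a, 'n, 'x, 'b) extn \<Rightarrow> (('s \<Rightarrow> 'a) \<Rightarrow> 'n) \<Rightarrow> bool" where
  "rep N E h \<longleftrightarrow> h \<in> mod_hom R Zm N \<and> (\<exists>u\<in>mod_hom R F (ext_mid E).
     (\<forall>f\<in>carrier F. ext_out E (u f) = \<pi> f) \<and> (\<forall>z\<in>Z. u z = ext_in E (h z)))"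

lemma repI:
  assumes "h \<in> mod_hom R Zm N" "u \<in> mod_hom R F (ext_mid E)"
    "\<And>f. f \<in> carrier F \<Longrightarrow> ext_out E (u f) = \<pi> f" "\<And>z. z \<in> Z \<Longrightarrow> u z = ext_in E (h z)"
  shows "rep N E h"
  using assms unfolding rep_def by blast

lemma repE:
  assumes "rep N E h"
  obtains u where "h \<in> mod_hom R Zm N" "u \<in> mod_hom R F (ext_mid E)"
    "\<And>f. f \<in> carrier F \<Longrightarrow> ext_out E (u f) = \<pi> f" "\<And>z. z \<in> Z \<Longrightarrow> u z = ext_in E (h z)"
  using assms unfolding rep_def by blast

lemma rep_cong: "rep N E h \<Longrightarrow> (\<And>z. z \<in> Z \<Longrightarrow> h' z = h z) \<Longrightarrow> rep N E h'"
  unfolding rep_def by (auto intro: mod_hom_cong[OF _ Zm_module])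

text \<open>F is projective, so its map to M lifts to Y. On Z the lift lands in the image of N, and
  injectivity of the inclusion makes the resulting map Z -> N linear.\<close>

lemma rep_exists:
  assumes "extension R M N E" shows "\<exists>h. rep N E h"
proof -
  interpret e: extension R M N E by fact
  obtain u where u: "u \<in> mod_hom R F e.Y" "\<And>x. x \<in> carrier F \<Longrightarrow> e.\<rho> (u x) = \<pi> x"
    using free_lift[OF e.i.N.module_M M.module_M e.o.hom _ \<pi>.hom] e.out_onto by blast
  interpret u: mod_homo R F e.Y u using \<pi>.M.module_M e.i.N.module_M u(1) by (rule mod_homoI)
  have "\<exists>n. n \<in> carrier N \<and> e.\<iota> n = u z" if "z \<in> Z" for z
    using e.exact[OF u.closed, of z] u(2)[of z] that unfolding Z_iff by metis
  then obtain h where h: "\<And>z. z \<in> Z \<Longrightarrow> h z \<in> carrier N \<and> e.\<iota> (h z) = u z" by metis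
  have "h \<in> mod_hom R Zm N"
  proof (rule mod_homI)
    fix x assume x: "x \<in> carrier Zm"
    hence xZ: "x \<in> Z" by simp
    have xF: "x \<in> carrier F" using xZ Z_sub by auto
    show "h x \<in> carrier N" using h[OF xZ] by simp
    show "h (a \<odot>\<^bsub>Zm\<^esub> x) = a \<odot>\<^bsub>N\<^esub> h x" if a: "a \<in> carrier R" for a
    proof -
      have aZ: "a \<odot>\<^bsub>F\<^esub> x \<in> Z" using \<pi>.M.smD(4)[OF Z_sm a xZ] .
      have "e.\<iota> (h (a \<odot>\<^bsub>F\<^esub> x)) = e.\<iota> (a \<odot>\<^bsub>N\<^esub> h x)"
        using h[OF aZ] h[OF xZ] a u.smult[OF a xF] e.i.smult by simp
      thus ?thesis using inj_onD[OF e.in_inj] h[OF aZ] h[OF xZ] a by (metis e.N.smult_closed Zm_simps(4))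
    qed
    fix y assume y: "y \<in> carrier Zm"
    hence yZ: "y \<in> Z" by simp
    have yF: "y \<in> carrier F" using yZ Z_sub by auto
    have sZ: "x \<oplus>\<^bsub>F\<^esub> y \<in> Z" using \<pi>.M.smD(3)[OF Z_sm xZ yZ] .
    have "e.\<iota> (h (x \<oplus>\<^bsub>F\<^esub> y)) = e.\<iota> (h x \<oplus>\<^bsub>N\<^esub> h y)"
      using h[OF sZ] h[OF xZ] h[OF yZ] u.add[OF xF yF] e.i.add by simp
    thus "h (x \<oplus>\<^bsub>Zm\<^esub> y) = h x \<oplus>\<^bsub>N\<^esub> h y"
      using inj_onD[OF e.in_inj] h[OF sZ] h[OF xZ] h[OF yZ] by (metis e.N.a_closed Zm_simps(3))
  qed
  thus ?thesis using u h by (intro exI[of _ h] repI[of h N u E]) auto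
qed

text \<open>Y is a quotient of the direct sum of N and F: a pair (n, f) vanishes in Y only if f lies
  in Z and n + h f = 0. Hence compatible maps on N and on F descend to Y, and any extension
  represented by h is equivalent to E. The Yoneda class thus depends on h alone.\<close>

lemma rep_equiv:
  assumes "extension R M N E" "extension R M N E'" and rep: "rep N E h"
  shows "ext_equiv R M N E E' \<longleftrightarrow> rep N E' h"
proof -
  interpret e: extension R M N E by fact
  interpret e': extension R M N E' by fact
  obtain u where h: "h \<in> mod_hom R Zm N" and u: "u \<in> mod_hom R F e.Y"
    "\<And>f. f \<in> carrier F \<Longrightarrow> e.\<rho> (u f) = \<pi> f" "\<And>z. z \<in> Z \<Longrightarrow> u z = e.\<iota> (h z)"
    using rep by (rule repE) auto
  show ?thesis
  proof
    assume "ext_equiv R M N E E'"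
    then obtain \<phi> where \<phi>: "\<phi> \<in> mod_hom R e.Y e'.Y" "\<And>n. n \<in> carrier N \<Longrightarrow> \<phi> (e.\<iota> n) = e'.\<iota> n"
      "\<And>x. x \<in> carrier e.Y \<Longrightarrow> e'.\<rho> (\<phi> x) = e.\<rho> x" unfolding ext_equiv_def by blast
    show "rep N E' h"
    proof (rule repI[OF h mod_hom_comp[OF u(1) \<phi>(1)]])
      show "e'.\<rho> ((\<phi> \<circ> u) f) = \<pi> f" if "f \<in> carrier F" for f
        using that \<phi>(3) mod_homD(1)[OF u(1)] u(2) by simp
      show "(\<phi> \<circ> u) z = e'.\<iota> (h z)" if "z \<in> Z" for z
        using that \<phi>(2) mod_homD(1)[OF h] u(3) by simp
    qed
  next
    assume "rep N E' h"
    then obtain u' where u': "u' \<in> mod_hom R F e'.Y"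
      "\<And>f. f \<in> carrier F \<Longrightarrow> e'.\<rho> (u' f) = \<pi> f" "\<And>z. z \<in> Z \<Longrightarrow> u' z = e'.\<iota> (h z)" by (rule repE) auto
    interpret u: mod_homo R F e.Y u using \<pi>.M.module_M e.i.N.module_M u(1) by (rule mod_homoI)
    interpret u': mod_homo R F e'.Y u' using \<pi>.M.module_M e'.i.N.module_M u'(1) by (rule mod_homoI)
    let ?D = "dsum_mod N F"
    let ?q = "\<lambda>p. e.\<iota> (fst p) \<oplus>\<^bsub>e.Y\<^esub> u (snd p)"
    let ?r = "\<lambda>p. e'.\<iota> (fst p) \<oplus>\<^bsub>e'.Y\<^esub> u' (snd p)"
    have D: "module R ?D" using e.N.module_M \<pi>.M.module_M by (rule dsum_module)
    have q: "?q \<in> mod_hom R ?D e.Y" and r: "?r \<in> mod_hom R ?D e'.Y"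
      using dsum_hom[OF e.N.module_M \<pi>.M.module_M e.i.N.module_M e.i.hom u(1)]
        dsum_hom[OF e.N.module_M \<pi>.M.module_M e'.i.N.module_M e'.i.hom u'(1)] by auto
    have out_q: "e.\<rho> (?q p) = \<pi> (snd p)" "e'.\<rho> (?r p) = \<pi> (snd p)" if "p \<in> carrier ?D" for p
      using that u(2) u'(2) e.out_in e'.out_in e.i.closed e'.i.closed u.closed u'.closed \<pi>.closed
      by (auto simp: e.o.add e'.o.add)
    have onto: "carrier e.Y \<subseteq> ?q ` carrier ?D"
    proof
      fix x assume x: "x \<in> carrier e.Y"
      hence "e.\<rho> x \<in> \<pi> ` carrier F" using pi_onto e.o.closed by simp
      then obtain f where f: "f \<in> carrier F" "e.\<rho> x = \<pi> f" by auto
      have uf: "u f \<in> carrier e.Y" using f by (intro u.closed)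
      have "e.\<rho> (x \<ominus>\<^bsub>e.Y\<^esub> u f) = \<zero>\<^bsub>M\<^esub>"
        unfolding e.o.minus[OF x uf] u(2)[OF f(1)] f(2) by (rule M.minus_self[OF \<pi>.closed[OF f(1)]])
      then obtain n where n: "n \<in> carrier N" "x \<ominus>\<^bsub>e.Y\<^esub> u f = e.\<iota> n"
        using e.exact e.i.N.minus_closed[OF x uf] by blast
      have "x = ?q (n, f)" using e.i.N.minus_add_cancel[OF x uf] n(2) by simp
      thus "x \<in> ?q ` carrier ?D" by (rule image_eqI) (use n f in simp)
    qed
    have ker: "?r p = \<zero>\<^bsub>e'.Y\<^esub>" if p: "p \<in> carrier ?D" "?q p = \<zero>\<^bsub>e.Y\<^esub>" for p
    proof -
      obtain n f where nf: "p = (n, f)" "n \<in> carrier N" "f \<in> carrier F" using p(1) by auto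
      have "\<pi> f = \<zero>\<^bsub>M\<^esub>" using out_q(1)[OF p(1)] p(2) nf e.o.zero by simp
      hence fZ: "f \<in> Z" using nf by (simp add: Z_iff)
      have hf: "h f \<in> carrier N" using mod_homD(1)[OF h] fZ by simp
      have "e.\<iota> (n \<oplus>\<^bsub>N\<^esub> h f) = \<zero>\<^bsub>e.Y\<^esub>" unfolding e.i.add[OF nf(2) hf] u(3)[OF fZ, symmetric] using p(2) nf(1) by simp
      hence "n \<oplus>\<^bsub>N\<^esub> h f = \<zero>\<^bsub>N\<^esub>" using e.in_eq_zero[OF e.N.a_closed[OF nf(2) hf]] by simp
      hence "e'.\<iota> n \<oplus>\<^bsub>e'.Y\<^esub> e'.\<iota> (h f) = \<zero>\<^bsub>e'.Y\<^esub>" unfolding e'.i.add[OF nf(2) hf, symmetric] using e'.i.zero by simp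
      thus ?thesis using u'(3)[OF fZ] nf(1) by simp
    qed
    obtain \<phi> where \<phi>: "\<phi> \<in> mod_hom R e.Y e'.Y" "\<And>p. p \<in> carrier ?D \<Longrightarrow> \<phi> (?q p) = ?r p"
      using hom_factor[OF D e.i.N.module_M e'.i.N.module_M q onto r ker] by blast
    show "ext_equiv R M N E E'"
      unfolding ext_equiv_def
    proof (intro bexI[OF _ \<phi>(1)] conjI ballI)
      fix n assume n: "n \<in> carrier N"
      show "\<phi> (e.\<iota> n) = e'.\<iota> n"
        using \<phi>(2)[of "(n, \<zero>\<^bsub>F\<^esub>)"] n u.zero u'.zero \<pi>.M.zero_closed e.i.closed[OF n] e'.i.closed[OF n]
        by (simp only: fst_conv snd_conv dsum_mod_simps mem_Times_iff e.i.N.r_zero e'.i.N.r_zero simp_thms)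
    next
      fix x assume "x \<in> carrier e.Y"
      then obtain p where p: "p \<in> carrier ?D" "x = ?q p" using onto by blast
      show "e'.\<rho> (\<phi> x) = e.\<rho> x" unfolding p(2) \<phi>(2)[OF p(1)] out_q[OF p(1)] ..
    qed
  qed
qed

lemma yoneda_class_eq:
  assumes E: "extension R M N E" and "rep N E h"
  shows "yoneda_class R M N E = {E'. is_ext R M N E' \<and> rep N E' h}"
proof -
  interpret e: extension R M N E by fact
  have "extension R M N E' \<longleftrightarrow> is_ext R M N E'" for E' :: "('a, 'c, 'c \<times> 'b, 'b) extn"
    using extensionI[OF M.module_M e.N.module_M] extension.ext by blast
  thus ?thesis unfolding yoneda_class_def using rep_equiv[OF E _ assms(2)] by blast
qed

end

subsection \<open>Pushouts\<close>

context extension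
begin

context
  fixes N' :: "('a, 'l) module" and g
  assumes N': "module R N'" and g: "g \<in> mod_hom R N N'"
begin

interpretation N': rmodule R N' using N' by (rule rmoduleI)
interpretation g: mod_homo R N N' g using N.module_M N' g by (rule mod_homoI)

abbreviation (input) "PD \<equiv> dsum_mod N' Y"
abbreviation (input) "kap \<equiv> \<lambda>n. (g n, \<ominus>\<^bsub>Y\<^esub> (\<iota> n))"
abbreviation (input) "PK \<equiv> kap ` carrier N"
abbreviation (input) "pc \<equiv> \<lambda>p. PK +>\<^bsub>PD\<^esub> p"

lemma PD: "module R PD"
  using N' i.N.module_M by (rule dsum_module)

interpretation PD: rmodule R PD using PD by (rule rmoduleI)

lemma kap_hom: "kap \<in> mod_hom R N PD"
proof (rule mod_homI)
  fix x y assume "x \<in> carrier N" "y \<in> carrier N"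
  thus "kap (x \<oplus>\<^bsub>N\<^esub> y) = kap x \<oplus>\<^bsub>PD\<^esub> kap y"
    using g.add i.add i.closed by (simp add: i.N.M.minus_add)
next
  fix a x assume a: "a \<in> carrier R" "x \<in> carrier N"
  thus "kap (a \<odot>\<^bsub>N\<^esub> x) = a \<odot>\<^bsub>PD\<^esub> kap x"
    using g.smult i.smult i.closed by (simp add: i.N.smult_r_minus)
qed (use g.closed i.closed in auto)

lemma PK_sm: "submodule PK R PD"
proof -
  interpret k: mod_homo R N PD kap using N.module_M PD kap_hom by (rule mod_homoI)
  show ?thesis by (rule k.image_sm[OF N.carrier_is_submodule])
qed

interpretation c: mod_homo R PD "quot_mod PD PK" pc by (rule PD.quot_mod_homo[OF PK_sm])

text \<open>The two copies of N are glued: the difference of the two elements is the relation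
  attached to -n, the sign being due to the minus in the second component of
  \<open>kap\<close>.\<close>

lemma pc_glue:
  assumes n: "n \<in> carrier N" shows "pc (\<zero>\<^bsub>N'\<^esub>, \<iota> n) = pc (g n, \<zero>\<^bsub>Y\<^esub>)"
proof -
  have eq: "(\<zero>\<^bsub>N'\<^esub>, \<iota> n) \<ominus>\<^bsub>PD\<^esub> (g n, \<zero>\<^bsub>Y\<^esub>) = kap (\<ominus>\<^bsub>N\<^esub> n)"
    using n g.closed[OF n] i.closed[OF n]
    by (subst dsum_minus[OF N' i.N.module_M]) (simp_all add: g.neg i.neg i.N.minus_zero a_minus_def)
  have "(\<zero>\<^bsub>N'\<^esub>, \<iota> n) \<ominus>\<^bsub>PD\<^esub> (g n, \<zero>\<^bsub>Y\<^esub>) \<in> PK"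
    unfolding eq by (rule imageI[OF N.M.a_inv_closed[OF n]])
  thus ?thesis using n g.closed[OF n] i.closed[OF n] by (subst PD.a_r_coset_eq_iff[OF PK_sm]) simp_all
qed

text \<open>\<open>push_ext\<close> applies \<open>the_elem\<close> to the image of a coset. This
  image is a singleton, since members of a coset differ in their second component by an element of
  the image of N, where \<rho> vanishes.\<close>

lemma push_out:
  assumes p: "p \<in> carrier PD" shows "ext_out (push_ext N N' g E) (pc p) = \<rho> (snd p)"
proof -
  have "(\<lambda>(n', x). \<rho> x) ` pc p = {\<rho> (snd p)}"
  proof (intro equalityI subsetI)
    fix y assume "y \<in> {\<rho> (snd p)}"
    moreover have "p \<in> pc p" using p PD.smD(2)[OF PK_sm] by (simp only: PD.a_r_coset_iff[OF PK_sm p] PD.minus_self simp_thms)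
    ultimately show "y \<in> (\<lambda>(n', x). \<rho> x) ` pc p" by (auto simp: image_iff split: prod.splits intro!: bexI[of _ p])
  next
    fix y assume "y \<in> (\<lambda>(n', x). \<rho> x) ` pc p"
    then obtain q where q: "q \<in> pc p" "y = \<rho> (snd q)" by (auto simp: case_prod_beta)
    hence qc: "q \<in> carrier PD" "q \<ominus>\<^bsub>PD\<^esub> p \<in> PK" using PD.a_r_coset_iff[OF PK_sm p] by simp_all
    then obtain n where n: "n \<in> carrier N" "q \<ominus>\<^bsub>PD\<^esub> p = kap n" by auto
    hence "snd q \<ominus>\<^bsub>Y\<^esub> snd p = \<ominus>\<^bsub>Y\<^esub> \<iota> n" using dsum_minus[OF N' i.N.module_M qc(1) p] by simp
    hence "\<rho> (snd q \<ominus>\<^bsub>Y\<^esub> snd p) = \<zero>\<^bsub>M\<^esub>" using n i.closed out_in by (simp add: o.neg)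
    thus "y \<in> {\<rho> (snd p)}" using q qc p o.closed by (auto simp: o.minus M.minus_eq_zero_iff)
  qed
  thus ?thesis by (simp add: push_ext_def Let_def)
qed

lemma push_simps:
  "ext_mid (push_ext N N' g E) = quot_mod PD PK" "ext_in (push_ext N N' g E) n' = pc (n', \<zero>\<^bsub>Y\<^esub>)"
  by (simp_all add: push_ext_def Let_def)

lemma push_mid_carrier: "carrier (quot_mod PD PK) = pc ` carrier PD"
  by (rule PD.quot_mod_simps)

lemma in_left_hom: "(\<lambda>n'. (n', \<zero>\<^bsub>Y\<^esub>)) \<in> mod_hom R N' PD" and in_right_hom: "(\<lambda>x. (\<zero>\<^bsub>N'\<^esub>, x)) \<in> mod_hom R Y PD"
  by (auto intro!: mod_homI)

lemma push_is_ext: "is_ext R M N' (push_ext N N' g E)"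
  unfolding is_ext_def push_simps(1)
proof (intro conjI)
  show "module R (quot_mod PD PK)" by (rule c.N.module_M)
  have in_eq: "ext_in (push_ext N N' g E) = pc \<circ> (\<lambda>n'. (n', \<zero>\<^bsub>Y\<^esub>))" by (simp add: fun_eq_iff push_simps)
  show "ext_in (push_ext N N' g E) \<in> mod_hom R N' (quot_mod PD PK)"
    unfolding in_eq by (rule mod_hom_comp[OF in_left_hom c.hom])
  show "ext_out (push_ext N N' g E) \<in> mod_hom R (quot_mod PD PK) M"
  proof (rule mod_homI)
    fix x assume "x \<in> carrier (quot_mod PD PK)"
    then obtain p where p: "p \<in> carrier PD" "x = pc p" unfolding push_mid_carrier by blast
    show "ext_out (push_ext N N' g E) x \<in> carrier M" using p push_out[OF p(1)] o.closed by auto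
    show "ext_out (push_ext N N' g E) (a \<odot>\<^bsub>quot_mod PD PK\<^esub> x) = a \<odot>\<^bsub>M\<^esub> ext_out (push_ext N N' g E) x"
      if a: "a \<in> carrier R" for a
      unfolding p(2) c.smult[OF a p(1), symmetric] push_out[OF p(1)] push_out[OF PD.smult_closed[OF a p(1)]]
      using p a by (auto simp: o.smult)
    fix y assume "y \<in> carrier (quot_mod PD PK)"
    then obtain q where q: "q \<in> carrier PD" "y = pc q" unfolding push_mid_carrier by blast
    show "ext_out (push_ext N N' g E) (x \<oplus>\<^bsub>quot_mod PD PK\<^esub> y) = ext_out (push_ext N N' g E) x \<oplus>\<^bsub>M\<^esub> ext_out (push_ext N N' g E) y"
      unfolding p(2) q(2) c.add[OF p(1) q(1), symmetric] push_out[OF p(1)] push_out[OF q(1)] push_out[OF PD.a_closed[OF p(1) q(1)]]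
      using p q by (auto simp: o.add)
  qed
  show "inj_on (ext_in (push_ext N N' g E)) (carrier N')"
  proof (rule inj_onI)
    fix x y assume x: "x \<in> carrier N'" and y: "y \<in> carrier N'"
      and "ext_in (push_ext N N' g E) x = ext_in (push_ext N N' g E) y"
    hence xy: "x \<in> carrier N'" "y \<in> carrier N'" "pc (x, \<zero>\<^bsub>Y\<^esub>) = pc (y, \<zero>\<^bsub>Y\<^esub>)" by (simp_all only: push_simps)
    have c: "(x, \<zero>\<^bsub>Y\<^esub>) \<in> carrier PD" "(y, \<zero>\<^bsub>Y\<^esub>) \<in> carrier PD" using xy by simp_all
    have "(x, \<zero>\<^bsub>Y\<^esub>) \<ominus>\<^bsub>PD\<^esub> (y, \<zero>\<^bsub>Y\<^esub>) \<in> PK" using xy(3) PD.a_r_coset_eq_iff[OF PK_sm c] by simp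
    then obtain n where n: "n \<in> carrier N" "(x \<ominus>\<^bsub>N'\<^esub> y, \<zero>\<^bsub>Y\<^esub> \<ominus>\<^bsub>Y\<^esub> \<zero>\<^bsub>Y\<^esub>) = kap n"
      unfolding dsum_minus[OF N' i.N.module_M c] by auto
    have "\<iota> (\<ominus>\<^bsub>N\<^esub> n) = \<zero>\<^bsub>Y\<^esub>" using n by (simp add: i.neg i.N.minus_zero)
    hence "\<ominus>\<^bsub>N\<^esub> n = \<zero>\<^bsub>N\<^esub>" using in_eq_zero[of "\<ominus>\<^bsub>N\<^esub> n"] n by simp
    hence "n = \<zero>\<^bsub>N\<^esub>" using N.M.r_neg[OF n(1)] n(1) by simp
    hence "x \<ominus>\<^bsub>N'\<^esub> y = \<zero>\<^bsub>N'\<^esub>" using n g.zero by simp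
    thus "x = y" using xy N'.minus_eq_zero_iff by simp
  qed
  show "ext_in (push_ext N N' g E) ` carrier N' = a_kernel (quot_mod PD PK) M (ext_out (push_ext N N' g E))"
  proof (intro equalityI subsetI)
    fix x assume "x \<in> ext_in (push_ext N N' g E) ` carrier N'"
    then obtain n' where n': "n' \<in> carrier N'" "x = pc (n', \<zero>\<^bsub>Y\<^esub>)" by (auto simp: push_simps)
    have c: "(n', \<zero>\<^bsub>Y\<^esub>) \<in> carrier PD" using n' by simp
    show "x \<in> a_kernel (quot_mod PD PK) M (ext_out (push_ext N N' g E))"
      unfolding a_kernel_def' n'(2) using push_out[OF c] c.closed[OF c] o.zero by simp
  next
    fix x assume "x \<in> a_kernel (quot_mod PD PK) M (ext_out (push_ext N N' g E))"
    hence x: "x \<in> carrier (quot_mod PD PK)" "ext_out (push_ext N N' g E) x = \<zero>\<^bsub>M\<^esub>" by (auto simp: a_kernel_def')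
    then obtain p where p: "p \<in> carrier PD" "x = pc p" unfolding push_mid_carrier by blast
    obtain n' y where ny: "p = (n', y)" "n' \<in> carrier N'" "y \<in> carrier Y" using p(1) by auto
    have "\<rho> y = \<zero>\<^bsub>M\<^esub>" using x(2) push_out[OF p(1)] p(2) ny(1) by simp
    then obtain n where n: "n \<in> carrier N" "y = \<iota> n" using exact ny(3) by blast
    have c: "(n', \<zero>\<^bsub>Y\<^esub>) \<in> carrier PD" "(\<zero>\<^bsub>N'\<^esub>, \<iota> n) \<in> carrier PD" "(g n, \<zero>\<^bsub>Y\<^esub>) \<in> carrier PD"
      using ny n g.closed i.closed by simp_all
    have "p = (n', \<zero>\<^bsub>Y\<^esub>) \<oplus>\<^bsub>PD\<^esub> (\<zero>\<^bsub>N'\<^esub>, \<iota> n)" using ny n by simp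
    hence "x = pc (n', \<zero>\<^bsub>Y\<^esub>) \<oplus>\<^bsub>quot_mod PD PK\<^esub> pc (g n, \<zero>\<^bsub>Y\<^esub>)"
      using p(2) c.add[OF c(1,2)] pc_glue[OF n(1)] by simp
    also have "\<dots> = pc (n' \<oplus>\<^bsub>N'\<^esub> g n, \<zero>\<^bsub>Y\<^esub>)" unfolding c.add[OF c(1,3), symmetric] by simp
    finally show "x \<in> ext_in (push_ext N N' g E) ` carrier N'"
      using ny(2) g.closed[OF n(1)] by (auto simp: push_simps intro!: image_eqI[of _ _ "n' \<oplus>\<^bsub>N'\<^esub> g n"])
  qed
  show "ext_out (push_ext N N' g E) ` carrier (quot_mod PD PK) = carrier M"
  proof
    show "carrier M \<subseteq> ext_out (push_ext N N' g E) ` carrier (quot_mod PD PK)"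
    proof
      fix m assume "m \<in> carrier M"
      hence "m \<in> \<rho> ` carrier Y" using out_onto by simp
      then obtain x where x: "x \<in> carrier Y" "m = \<rho> x" by auto
      have c: "(\<zero>\<^bsub>N'\<^esub>, x) \<in> carrier PD" using x by simp
      show "m \<in> ext_out (push_ext N N' g E) ` carrier (quot_mod PD PK)"
        by (rule image_eqI[OF _ c.closed[OF c]]) (simp add: push_out[OF c] x)
    qed
    show "ext_out (push_ext N N' g E) ` carrier (quot_mod PD PK) \<subseteq> carrier M"
      unfolding push_mid_carrier using push_out o.closed by auto
  qed
qed

text \<open>The exact sequence \<open>0 \<rightarrow> N \<rightarrow> N' \<oplus> Y \<rightarrow> Y' \<rightarrow> 0\<close> attached to a pushout.\<close>

definition push_seq :: "('a, 'n, 'l \<times> 'x, ('l \<times> 'x) set) extn" where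
  "push_seq = \<lparr>ext_mid = PD, ext_in = kap, ext_out = pc\<rparr>"

lemma push_seq_is_ext: "is_ext R (ext_mid (push_ext N N' g E)) N push_seq"
  unfolding is_ext_def push_seq_def push_simps extn.simps
proof (intro conjI)
  show "inj_on kap (carrier N)"
  proof (rule inj_onI)
    fix x y assume xy: "x \<in> carrier N" "y \<in> carrier N" "kap x = kap y"
    hence "\<iota> x = \<iota> y" using i.closed by (metis i.N.M.minus_minus prod.inject)
    thus "x = y" using inj_onD[OF in_inj] xy by simp
  qed
  show "kap ` carrier N = a_kernel PD (quot_mod PD PK) pc"
    unfolding a_kernel_def' PD.quot_mod_simps(2) using PD.coset_eq_zero_iff[OF PK_sm] PD.smD(1)[OF PK_sm] by blast
qed (simp_all only: PD kap_hom c.hom push_mid_carrier)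

lemma push_seq_mid: "ext_mid push_seq = PD"
  by (simp add: push_seq_def)

end

end

text \<open>The lift F -> Y followed by the map from Y to the pushout is again a lift of the
  presentation map, and \<open>pc_glue\<close> evaluates it on Z.\<close>

lemma (in presentation) push_rep:
  assumes E: "extension R M N E" and N': "module R N'" and g: "g \<in> mod_hom R N N'" and rep: "rep N E h"
  shows "rep N' (push_ext N N' g E) (g \<circ> h)"
proof -
  interpret e: extension R M N E by fact
  obtain u where h: "h \<in> mod_hom R Zm N" and u: "u \<in> mod_hom R F e.Y"
    "\<And>f. f \<in> carrier F \<Longrightarrow> e.\<rho> (u f) = \<pi> f" "\<And>z. z \<in> Z \<Longrightarrow> u z = e.\<iota> (h z)"
    using rep by (rule repE) auto
  interpret PD: rmodule R "dsum_mod N' e.Y" using e.PD[OF N' g] by (rule rmoduleI)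
  interpret N': rmodule R N' using N' by (rule rmoduleI)
  let ?K = "(\<lambda>n. (g n, \<ominus>\<^bsub>e.Y\<^esub> (e.\<iota> n))) ` carrier N"
  have c: "(\<lambda>p. ?K +>\<^bsub>dsum_mod N' e.Y\<^esub> p) \<in> mod_hom R (dsum_mod N' e.Y) (quot_mod (dsum_mod N' e.Y) ?K)"
    by (rule PD.quot_mod_proj(2)[OF e.PK_sm[OF N' g]])
  show ?thesis
  proof (rule repI[OF mod_hom_comp[OF h g]])
    show "(\<lambda>p. ?K +>\<^bsub>dsum_mod N' e.Y\<^esub> p) \<circ> ((\<lambda>x. (\<zero>\<^bsub>N'\<^esub>, x)) \<circ> u) \<in> mod_hom R F (ext_mid (push_ext N N' g E))"
      unfolding e.push_simps[OF N' g] by (rule mod_hom_comp[OF mod_hom_comp[OF u(1) e.in_right_hom[OF N' g]] c])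
    fix f assume f: "f \<in> carrier F"
    have "(\<zero>\<^bsub>N'\<^esub>, u f) \<in> carrier (dsum_mod N' e.Y)" using mod_homD(1)[OF u(1) f] by simp
    thus "ext_out (push_ext N N' g E) (((\<lambda>p. ?K +>\<^bsub>dsum_mod N' e.Y\<^esub> p) \<circ> ((\<lambda>x. (\<zero>\<^bsub>N'\<^esub>, x)) \<circ> u)) f) = \<pi> f"
      unfolding comp_def by (subst e.push_out[OF N' g]) (simp_all add: u(2)[OF f])
  next
    fix z assume z: "z \<in> Z"
    have "h z \<in> carrier N" using mod_homD(1)[OF h] z by simp
    thus "((\<lambda>p. ?K +>\<^bsub>dsum_mod N' e.Y\<^esub> p) \<circ> ((\<lambda>x. (\<zero>\<^bsub>N'\<^esub>, x)) \<circ> u)) z = ext_in (push_ext N N' g E) ((g \<circ> h) z)"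
      unfolding comp_def e.push_simps[OF N' g] u(3)[OF z] by (rule e.pc_glue[OF N' g])
  qed
qed

subsection \<open>Pullbacks and sums\<close>

context extension
begin

context
  fixes M' :: "('a, 'l) module" and f
  assumes M': "module R M'" and f: "f \<in> mod_hom R M' M"
begin

interpretation M': rmodule R M' using M' by (rule rmoduleI)
interpretation f: mod_homo R M' M f using M' M.module_M f by (rule mod_homoI)

abbreviation (input) "LD \<equiv> dsum_mod Y M'"

lemma LD: "module R LD"
  using i.N.module_M M' by (rule dsum_module)

interpretation LD: rmodule R LD using LD by (rule rmoduleI)

definition pull_set :: "('x \<times> 'l) set" where
  "pull_set = {(x, m). x \<in> carrier Y \<and> m \<in> carrier M' \<and> \<rho> x = f m}"

lemma pull_set_iff: "p \<in> pull_set \<longleftrightarrow> fst p \<in> carrier Y \<and> snd p \<in> carrier M' \<and> \<rho> (fst p) = f (snd p)"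
  by (auto simp: pull_set_def)

lemma pull_simps: "ext_mid (pull_ext M' f E) = LD\<lparr>carrier := pull_set\<rparr>"
  "ext_in (pull_ext M' f E) = (\<lambda>n. (\<iota> n, \<zero>\<^bsub>M'\<^esub>))" "ext_out (pull_ext M' f E) = snd"
  by (simp_all add: pull_ext_def pull_set_def)

lemma pull_sm: "submodule pull_set R LD"
  by (rule LD.smI) (auto simp: pull_set_iff o.zero f.zero o.add f.add o.smult f.smult)

lemma pull_is_ext: "is_ext R M' N (pull_ext M' f E)"
  unfolding is_ext_def pull_simps
proof (intro conjI)
  show "module R (LD\<lparr>carrier := pull_set\<rparr>)" by (rule LD.restrict_module[OF pull_sm])
  show "(\<lambda>n. (\<iota> n, \<zero>\<^bsub>M'\<^esub>)) \<in> mod_hom R N (LD\<lparr>carrier := pull_set\<rparr>)"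
    by (rule mod_homI) (auto simp: pull_set_iff i.closed out_in f.zero i.add i.smult)
  show "snd \<in> mod_hom R (LD\<lparr>carrier := pull_set\<rparr>) M'"
    by (rule mod_homI) (auto simp: pull_set_iff)
  show "inj_on (\<lambda>n. (\<iota> n, \<zero>\<^bsub>M'\<^esub>)) (carrier N)"
    using in_inj by (auto simp: inj_on_def)
  show "(\<lambda>n. (\<iota> n, \<zero>\<^bsub>M'\<^esub>)) ` carrier N = a_kernel (LD\<lparr>carrier := pull_set\<rparr>) M' snd"
  proof (intro equalityI subsetI)
    fix p assume "p \<in> a_kernel (LD\<lparr>carrier := pull_set\<rparr>) M' snd"
    hence p: "fst p \<in> carrier Y" "\<rho> (fst p) = \<zero>\<^bsub>M\<^esub>" "snd p = \<zero>\<^bsub>M'\<^esub>"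
      by (auto simp: a_kernel_def' pull_set_iff f.zero)
    then obtain n where "n \<in> carrier N" "fst p = \<iota> n" using exact by blast
    thus "p \<in> (\<lambda>n. (\<iota> n, \<zero>\<^bsub>M'\<^esub>)) ` carrier N" using p(3) by (auto simp: image_iff prod_eq_iff)
  qed (auto simp: a_kernel_def' pull_set_iff f.zero i.closed out_in)
  show "snd ` carrier (LD\<lparr>carrier := pull_set\<rparr>) = carrier M'"
  proof
    show "carrier M' \<subseteq> snd ` carrier (LD\<lparr>carrier := pull_set\<rparr>)"
    proof
      fix m assume m: "m \<in> carrier M'"
      hence "f m \<in> \<rho> ` carrier Y" using out_onto f.closed by simp
      then obtain x where "x \<in> carrier Y" "f m = \<rho> x" by auto
      thus "m \<in> snd ` carrier (LD\<lparr>carrier := pull_set\<rparr>)"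
        using m by (intro image_eqI[of _ _ "(x, m)"]) (auto simp: pull_set_iff)
    qed
  qed (auto simp: pull_set_iff)
qed

text \<open>The exact sequence \<open>0 \<rightarrow> Y' \<rightarrow> Y \<oplus> M' \<rightarrow> M \<rightarrow> 0\<close> attached to a pullback.\<close>

definition pull_seq :: "('a, 'x \<times> 'l, 'x \<times> 'l, 'm) extn" where
  "pull_seq = \<lparr>ext_mid = LD, ext_in = (\<lambda>p. p), ext_out = (\<lambda>p. \<rho> (fst p) \<ominus>\<^bsub>M\<^esub> f (snd p))\<rparr>"

lemma pull_seq_mid: "ext_mid pull_seq = LD"
  by (simp add: pull_seq_def)

lemma pull_seq_is_ext: "is_ext R M (ext_mid (pull_ext M' f E)) pull_seq"
  unfolding is_ext_def pull_seq_def pull_simps extn.simps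
proof (intro conjI)
  show "module R LD" by (rule LD)
  show "(\<lambda>p. p) \<in> mod_hom R (LD\<lparr>carrier := pull_set\<rparr>) LD" by (rule LD.restrict_incl_hom[OF pull_sm])
  have "(\<rho> \<circ> fst) \<in> mod_hom R LD M" "(f \<circ> snd) \<in> mod_hom R LD M"
    by (rule mod_hom_comp[OF _ o.hom] mod_hom_comp[OF _ f]; auto intro!: mod_homI)+
  from mod_hom_minus[OF LD M.module_M this]
  show "(\<lambda>p. \<rho> (fst p) \<ominus>\<^bsub>M\<^esub> f (snd p)) \<in> mod_hom R LD M" by simp
  show "(\<lambda>p. \<rho> (fst p) \<ominus>\<^bsub>M\<^esub> f (snd p)) ` carrier LD = carrier M"
  proof
    show "carrier M \<subseteq> (\<lambda>p. \<rho> (fst p) \<ominus>\<^bsub>M\<^esub> f (snd p)) ` carrier LD"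
    proof
      fix m assume m: "m \<in> carrier M"
      hence "m \<in> \<rho> ` carrier Y" using out_onto by simp
      then obtain x where "x \<in> carrier Y" "m = \<rho> x" by auto
      thus "m \<in> (\<lambda>p. \<rho> (fst p) \<ominus>\<^bsub>M\<^esub> f (snd p)) ` carrier LD"
        using m by (intro image_eqI[of _ _ "(x, \<zero>\<^bsub>M'\<^esub>)"]) (auto simp: f.zero M.minus_zero)
    qed
  qed (auto simp: o.closed f.closed)
  show "(\<lambda>p. p) ` carrier (LD\<lparr>carrier := pull_set\<rparr>) = a_kernel LD M (\<lambda>p. \<rho> (fst p) \<ominus>\<^bsub>M\<^esub> f (snd p))"
    by (auto simp: a_kernel_def' pull_set_iff M.minus_eq_zero_iff o.closed f.closed)
qed simp

end

end

text \<open>The lift into the pullback has the components u o l and the presentation map of M'. On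
  the kernel of the latter the second component vanishes, so the classifying map is h o l.\<close>

lemma pull_rep:
  assumes p: "presentation R M S w" and p': "presentation R M' S' w'"
    and E: "extension R M N E" and f: "f \<in> mod_hom R M' M"
    and l: "l \<in> mod_hom R (free_mod R S') (free_mod R S)"
      "\<And>x. x \<in> carrier (free_mod R S') \<Longrightarrow> lin R M w (l x) = f (lin R M' w' x)"
    and rep: "presentation.rep R M S w N E h"
  shows "presentation.rep R M' S' w' N (pull_ext M' f E) (h \<circ> l)"
proof -
  interpret p: presentation R M S w by fact
  interpret p': presentation R M' S' w' by fact
  interpret e: extension R M N E by fact
  obtain u where h: "h \<in> mod_hom R p.Zm N" and u: "u \<in> mod_hom R p.F e.Y"
    "\<And>f. f \<in> carrier p.F \<Longrightarrow> e.\<rho> (u f) = p.\<pi> f" "\<And>z. z \<in> p.Z \<Longrightarrow> u z = e.\<iota> (h z)"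
    using rep by (rule p.repE) auto
  interpret f: mod_homo R M' M f using p'.M.module_M p.M.module_M f by (rule mod_homoI)
  have lc: "l x \<in> carrier p.F" if "x \<in> carrier p'.F" for x using mod_homD(1)[OF l(1) that] .
  have lZ: "l z \<in> p.Z" if "z \<in> p'.Z" for z
    using that lc l(2) f.zero by (auto simp: p.Z_iff p'.Z_iff)
  note ps = e.pull_simps[OF p'.M.module_M f]
  have lh: "l \<in> mod_hom R p'.Zm p.Zm"
  proof (rule mod_homI)
    fix x assume x: "x \<in> carrier p'.Zm"
    show "l x \<in> carrier p.Zm" using x lZ by simp
    have xF: "x \<in> carrier p'.F" using x p'.Z_sub by auto
    show "l (a \<odot>\<^bsub>p'.Zm\<^esub> x) = a \<odot>\<^bsub>p.Zm\<^esub> l x" if "a \<in> carrier R" for a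
      unfolding p'.Zm_simps p.Zm_simps using that xF by (rule mod_homD(3)[OF l(1)])
    fix y assume "y \<in> carrier p'.Zm"
    hence yF: "y \<in> carrier p'.F" using p'.Z_sub by auto
    show "l (x \<oplus>\<^bsub>p'.Zm\<^esub> y) = l x \<oplus>\<^bsub>p.Zm\<^esub> l y"
      unfolding p'.Zm_simps p.Zm_simps using xF yF by (rule mod_homD(2)[OF l(1)])
  qed
  show ?thesis
  proof (rule p'.repI[OF mod_hom_comp[OF lh h]])
    show "(\<lambda>x. (u (l x), p'.\<pi> x)) \<in> mod_hom R p'.F (ext_mid (pull_ext M' f E))"
    proof -
      have "(\<lambda>x. (u (l x), p'.\<pi> x)) \<in> mod_hom R p'.F (dsum_mod e.Y M')"
        using pair_hom[OF mod_hom_comp[OF l(1) u(1)] p'.\<pi>.hom] by simp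
      moreover have "(u (l x), p'.\<pi> x) \<in> e.pull_set M' f" if "x \<in> carrier p'.F" for x
        using that lc u(2) l(2) mod_homD(1)[OF u(1)] p'.\<pi>.closed
        by (simp add: e.pull_set_iff[OF p'.M.module_M f])
      ultimately show ?thesis unfolding ps mod_hom_restrict_iff by (simp add: mod_hom_def)
    qed
    show "ext_out (pull_ext M' f E) (u (l x), p'.\<pi> x) = p'.\<pi> x" for x unfolding ps by simp
    show "(u (l z), p'.\<pi> z) = ext_in (pull_ext M' f E) ((h \<circ> l) z)" if "z \<in> p'.Z" for z
      using that lZ u(3) unfolding ps by (simp add: p'.Z_iff)
  qed
qed

section \<open>Direct sums of extensions and the Baer sum\<close>

lemma dsum_is_ext:
  assumes "extension R M N E" "extension R M' N' E'"
  shows "is_ext R (dsum_mod M M') (dsum_mod N N') (dsum_ext E E')"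
proof -
  interpret e: extension R M N E by fact
  interpret e': extension R M' N' E' by fact
  show ?thesis
    unfolding is_ext_def dsum_ext_def extn.simps
  proof (intro conjI)
    show "module R (dsum_mod e.Y e'.Y)" by (rule dsum_module[OF e.i.N.module_M e'.i.N.module_M])
    show "map_prod e.\<iota> e'.\<iota> \<in> mod_hom R (dsum_mod N N') (dsum_mod e.Y e'.Y)"
      by (rule mod_homI) (auto simp: e.i.closed e'.i.closed e.i.add e'.i.add e.i.smult e'.i.smult)
    show "map_prod e.\<rho> e'.\<rho> \<in> mod_hom R (dsum_mod e.Y e'.Y) (dsum_mod M M')"
      by (rule mod_homI) (auto simp: e.o.closed e'.o.closed e.o.add e'.o.add e.o.smult e'.o.smult)
    show "inj_on (map_prod e.\<iota> e'.\<iota>) (carrier (dsum_mod N N'))"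
      using map_prod_inj_on[OF e.in_inj e'.in_inj] by simp
    have "map_prod e.\<iota> e'.\<iota> ` (carrier N \<times> carrier N') = (e.\<iota> ` carrier N) \<times> (e'.\<iota> ` carrier N')"
      by (rule map_prod_surj_on) auto
    thus "map_prod e.\<iota> e'.\<iota> ` carrier (dsum_mod N N') = a_kernel (dsum_mod e.Y e'.Y) (dsum_mod M M') (map_prod e.\<rho> e'.\<rho>)"
      unfolding e.exact_in e'.exact_in by (auto simp: a_kernel_def')
    have "map_prod e.\<rho> e'.\<rho> ` (carrier e.Y \<times> carrier e'.Y) = carrier M \<times> carrier M'"
      by (rule map_prod_surj_on[OF e.out_onto e'.out_onto])
    thus "map_prod e.\<rho> e'.\<rho> ` carrier (dsum_mod e.Y e'.Y) = carrier (dsum_mod M M')" by simp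
  qed
qed

lemma diag_hom: "(\<lambda>m. (m, m)) \<in> mod_hom R M (dsum_mod M M)"
  by (rule mod_homI) auto

lemma codiag_hom: "module R N \<Longrightarrow> (\<lambda>(n, n'). n \<oplus>\<^bsub>N\<^esub> n') \<in> mod_hom R (dsum_mod N N) N"
  using dsum_hom[of R N N N "\<lambda>x. x" "\<lambda>x. x"] by (simp add: mod_hom_id case_prod_unfold)

text \<open>Direct sum and pullback along the diagonal are treated in one step, so that the
  presentation of M serves throughout and none of the sum of two copies of M has to be set
  up.\<close>

lemma (in presentation) dsum_pull_rep:
  assumes E: "extension R M N E" and E': "extension R M N E'" and rep: "rep N E h" "rep N E' h'"
  shows "rep (dsum_mod N N) (pull_ext M (\<lambda>m. (m, m)) (dsum_ext E E')) (\<lambda>z. (h z, h' z))"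
proof -
  interpret e: extension R M N E by fact
  interpret e': extension R M N E' by fact
  obtain u where h: "h \<in> mod_hom R Zm N" and u: "u \<in> mod_hom R F e.Y"
    "\<And>f. f \<in> carrier F \<Longrightarrow> e.\<rho> (u f) = \<pi> f" "\<And>z. z \<in> Z \<Longrightarrow> u z = e.\<iota> (h z)"
    using rep(1) by (rule repE) auto
  obtain u' where h': "h' \<in> mod_hom R Zm N" and u': "u' \<in> mod_hom R F e'.Y"
    "\<And>f. f \<in> carrier F \<Longrightarrow> e'.\<rho> (u' f) = \<pi> f" "\<And>z. z \<in> Z \<Longrightarrow> u' z = e'.\<iota> (h' z)"
    using rep(2) by (rule repE) auto
  interpret d: extension R "dsum_mod M M" "dsum_mod N N" "dsum_ext E E'"
    by (rule extensionI[OF dsum_module[OF M.module_M M.module_M] dsum_module[OF e.N.module_M e.N.module_M] dsum_is_ext[OF E E']])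
  note ps = d.pull_simps[OF M.module_M diag_hom]
  have ds: "ext_mid (dsum_ext E E') = dsum_mod e.Y e'.Y" "ext_in (dsum_ext E E') = map_prod e.\<iota> e'.\<iota>"
    "ext_out (dsum_ext E E') = map_prod e.\<rho> e'.\<rho>" by (simp_all add: dsum_ext_def)
  show ?thesis
  proof (rule repI[OF pair_hom[OF h h']])
    show "(\<lambda>x. ((u x, u' x), \<pi> x)) \<in> mod_hom R F (ext_mid (pull_ext M (\<lambda>m. (m, m)) (dsum_ext E E')))"
    proof -
      have "(\<lambda>x. ((u x, u' x), \<pi> x)) \<in> mod_hom R F (dsum_mod d.Y M)"
        unfolding ds by (rule pair_hom[OF pair_hom[OF u(1) u'(1)] \<pi>.hom])
      moreover have "((u x, u' x), \<pi> x) \<in> d.pull_set M (\<lambda>m. (m, m))" if "x \<in> carrier F" for x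
        using that u(2) u'(2) mod_homD(1)[OF u(1)] mod_homD(1)[OF u'(1)] \<pi>.closed
        by (simp add: d.pull_set_iff[OF M.module_M diag_hom] ds)
      ultimately show ?thesis unfolding ps mod_hom_restrict_iff by (simp add: mod_hom_def)
    qed
    show "ext_out (pull_ext M (\<lambda>m. (m, m)) (dsum_ext E E')) ((u x, u' x), \<pi> x) = \<pi> x" for x unfolding ps by simp
    show "((u z, u' z), \<pi> z) = ext_in (pull_ext M (\<lambda>m. (m, m)) (dsum_ext E E')) (h z, h' z)" if "z \<in> Z" for z
      using that u(3) u'(3) unfolding ps ds by (simp add: Z_iff)
  qed
qed

lemma dsum_pull_is_ext:
  assumes E: "extension R M N E" and E': "extension R M N E'"
  shows "extension R M (dsum_mod N N) (pull_ext M (\<lambda>m. (m, m)) (dsum_ext E E'))"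
proof -
  interpret e: extension R M N E by fact
  interpret d: extension R "dsum_mod M M" "dsum_mod N N" "dsum_ext E E'"
    by (rule extensionI[OF dsum_module[OF e.M.module_M e.M.module_M] dsum_module[OF e.N.module_M e.N.module_M] dsum_is_ext[OF E E']])
  show ?thesis
    using d.pull_is_ext[OF e.M.module_M diag_hom] e.M.module_M dsum_module[OF e.N.module_M e.N.module_M]
    by (intro extensionI)
qed

lemma baer_is_ext:
  assumes E: "extension R M N E" and E': "extension R M N E'"
  shows "extension R M N (baer_ext M N E E')"
proof -
  interpret e: extension R M N E by fact
  interpret p: extension R M "dsum_mod N N" "pull_ext M (\<lambda>m. (m, m)) (dsum_ext E E')"
    by (rule dsum_pull_is_ext[OF assms])
  show ?thesis unfolding baer_ext_def
    using p.push_is_ext[OF e.N.module_M codiag_hom[OF e.N.module_M]] e.M.module_M e.N.module_M by (intro extensionI)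
qed

text \<open>Pushing out along the codiagonal composes it with the pair (h, h').\<close>

lemma (in presentation) baer_rep:
  assumes E: "extension R M N E" and E': "extension R M N E'" and rep: "rep N E h" "rep N E' h'"
  shows "rep N (baer_ext M N E E') (\<lambda>z. h z \<oplus>\<^bsub>N\<^esub> h' z)"
proof -
  interpret e: extension R M N E by fact
  have "rep N (baer_ext M N E E') ((\<lambda>(n, n'). n \<oplus>\<^bsub>N\<^esub> n') \<circ> (\<lambda>z. (h z, h' z)))"
    unfolding baer_ext_def
    by (rule push_rep[OF dsum_pull_is_ext[OF E E'] e.N.module_M codiag_hom[OF e.N.module_M] dsum_pull_rep[OF assms]])
  thus ?thesis by (simp add: comp_def)
qed

lemma (in presentation) split_rep:
  assumes "module R N" shows "rep N (split_ext M N) (\<lambda>_. \<zero>\<^bsub>N\<^esub>)"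
proof -
  interpret N: rmodule R N using assms by (rule rmoduleI)
  have 0: "(\<lambda>_. \<zero>\<^bsub>N\<^esub>) \<in> mod_hom R L N" for L :: "('a, 'z) module" by (rule mod_homI) auto
  show ?thesis
  proof (rule repI[OF 0])
    show "(\<lambda>x. (\<zero>\<^bsub>N\<^esub>, \<pi> x)) \<in> mod_hom R F (ext_mid (split_ext M N))"
      using pair_hom[OF 0 \<pi>.hom] by (simp add: split_ext_def)
  qed (simp_all add: split_ext_def Z_iff)
qed

subsection \<open>Small representatives\<close>

text \<open>Choose a set-theoretic section s of \<rho>. The map x |-> (x - s(\<rho> x), \<rho> x),
  its first component read in N, embeds Y into the product type, and the module structure is carried
  over to the image. As s is not a homomorphism in general, the copied structure need not be that of
  the direct sum.\<close>

lemma ext_small: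
  fixes M :: "('a, 'm) module" and N :: "('a, 'n) module" and E :: "('a, 'n, 'x, 'm) extn"
  assumes "extension R M N E"
  obtains E' :: "('a, 'n, 'n \<times> 'm, 'm) extn" where "extension R M N E'" "ext_equiv R M N E E'"
proof -
  interpret e: extension R M N E by fact
  have "\<exists>x. x \<in> carrier e.Y \<and> e.\<rho> x = m" if "m \<in> carrier M" for m
  proof -
    have "m \<in> e.\<rho> ` carrier e.Y" using e.out_onto that by simp
    thus ?thesis by auto
  qed
  then obtain s where s: "\<And>m. m \<in> carrier M \<Longrightarrow> s m \<in> carrier e.Y \<and> e.\<rho> (s m) = m" by metis
  have "\<exists>n. n \<in> carrier N \<and> e.\<iota> n = x \<ominus>\<^bsub>e.Y\<^esub> s (e.\<rho> x)" if x: "x \<in> carrier e.Y" for x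
  proof -
    have sx: "s (e.\<rho> x) \<in> carrier e.Y" "e.\<rho> (s (e.\<rho> x)) = e.\<rho> x" using s[OF e.o.closed[OF x]] by auto
    have "e.\<rho> (x \<ominus>\<^bsub>e.Y\<^esub> s (e.\<rho> x)) = \<zero>\<^bsub>M\<^esub>"
      unfolding e.o.minus[OF x sx(1)] sx(2) by (rule e.M.minus_self[OF e.o.closed[OF x]])
    thus ?thesis using e.exact[OF e.i.N.minus_closed[OF x sx(1)]] by metis
  qed
  then obtain k where k: "\<And>x. x \<in> carrier e.Y \<Longrightarrow> k x \<in> carrier N \<and> e.\<iota> (k x) = x \<ominus>\<^bsub>e.Y\<^esub> s (e.\<rho> x)" by metis
  define \<beta> where "\<beta> = (\<lambda>x. (k x, e.\<rho> x))"
  have inj: "inj_on \<beta> (carrier e.Y)"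
  proof (rule inj_onI)
    fix x y assume xy: "x \<in> carrier e.Y" "y \<in> carrier e.Y" "\<beta> x = \<beta> y"
    hence eq: "e.\<rho> x = e.\<rho> y" "k x = k y" by (simp_all add: \<beta>_def)
    have sx: "s (e.\<rho> x) \<in> carrier e.Y" using s[OF e.o.closed[OF xy(1)]] by auto
    have "x \<ominus>\<^bsub>e.Y\<^esub> s (e.\<rho> x) = y \<ominus>\<^bsub>e.Y\<^esub> s (e.\<rho> x)" using k[OF xy(1)] k[OF xy(2)] eq by simp
    hence "x \<ominus>\<^bsub>e.Y\<^esub> s (e.\<rho> x) \<oplus>\<^bsub>e.Y\<^esub> s (e.\<rho> x) = y \<ominus>\<^bsub>e.Y\<^esub> s (e.\<rho> x) \<oplus>\<^bsub>e.Y\<^esub> s (e.\<rho> x)" by (rule arg_cong)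
    thus "x = y" unfolding e.i.N.minus_add_cancel[OF xy(1) sx] e.i.N.minus_add_cancel[OF xy(2) sx] .
  qed
  define \<gamma> where "\<gamma> = inv_into (carrier e.Y) \<beta>"
  have \<gamma>: "\<gamma> (\<beta> x) = x" if "x \<in> carrier e.Y" for x unfolding \<gamma>_def by (rule inv_into_f_f[OF inj that])
  define Y' :: "('a, 'n \<times> 'm) module" where
    "Y' = \<lparr>carrier = \<beta> ` carrier e.Y, monoid.mult = undefined, one = undefined,
       ring.zero = \<beta> \<zero>\<^bsub>e.Y\<^esub>, ring.add = (\<lambda>x y. \<beta> (\<gamma> x \<oplus>\<^bsub>e.Y\<^esub> \<gamma> y)), module.smult = (\<lambda>a x. \<beta> (a \<odot>\<^bsub>e.Y\<^esub> \<gamma> x))\<rparr>"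
  have Y': "module R Y'" "\<beta> \<in> mod_hom R e.Y Y'"
    by (rule module_transport[OF e.i.N.module_M, of \<beta>]; simp add: Y'_def \<gamma>)+
  define E' where "E' = \<lparr>ext_mid = Y', ext_in = \<beta> \<circ> e.\<iota>, ext_out = e.\<rho> \<circ> \<gamma>\<rparr>"
  have Y'c: "carrier Y' = \<beta> ` carrier e.Y" by (simp add: Y'_def)
  have \<gamma>h: "\<gamma> \<in> mod_hom R Y' e.Y"
    by (rule mod_homI) (auto simp: Y'_def \<gamma>)
  have "is_ext R M N E'"
    unfolding is_ext_def E'_def extn.simps
  proof (intro conjI)
    show "inj_on (\<beta> \<circ> e.\<iota>) (carrier N)"
      by (rule comp_inj_on[OF e.in_inj inj_on_subset[OF inj]]) (use e.i.closed in auto)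
    show "(\<beta> \<circ> e.\<iota>) ` carrier N = a_kernel Y' M (e.\<rho> \<circ> \<gamma>)"
      unfolding image_comp[symmetric] e.exact_in a_kernel_def' Y'c using \<gamma> by auto
    show "(e.\<rho> \<circ> \<gamma>) ` carrier Y' = carrier M"
      unfolding Y'c e.out_onto[symmetric] image_image using \<gamma> by (auto simp: image_iff)
  qed (use Y' \<gamma>h e.i.hom e.o.hom in \<open>auto intro: mod_hom_comp\<close>)
  hence "extension R M N E'" using e.M.module_M e.N.module_M by (intro extensionI)
  moreover have "ext_equiv R M N E E'"
    unfolding ext_equiv_def E'_def extn.simps using \<gamma> by (intro bexI[OF _ Y'(2)]) auto
  ultimately show ?thesis by (rule that)
qed

section \<open>The module \<open>Ext\<^sup>1\<close>\<close>

text \<open>The evaluations embed H into a finite power of N. The power itself is not formed: the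
  elements killed by all evaluations outside C are handled by induction on C.\<close>

lemma noeth_joint:
  assumes H: "module R H" and N: "module R N" "noeth_on R N (carrier N)" and B: "finite B"
    and ev: "\<And>b. b \<in> B \<Longrightarrow> ev b \<in> mod_hom R H N"
    and inj: "\<And>h. h \<in> carrier H \<Longrightarrow> (\<And>b. b \<in> B \<Longrightarrow> ev b h = \<zero>\<^bsub>N\<^esub>) \<Longrightarrow> h = \<zero>\<^bsub>H\<^esub>"
  shows "noeth_on R H (carrier H)"
proof -
  interpret H: rmodule R H using H by (rule rmoduleI)
  have "noeth_on R H {h \<in> carrier H. \<forall>b\<in>B - C. ev b h = \<zero>\<^bsub>N\<^esub>}" if "finite C" "C \<subseteq> B" for C
    using that
  proof induct
    case empty
    have "{h \<in> carrier H. \<forall>b\<in>B - {}. ev b h = \<zero>\<^bsub>N\<^esub>} \<subseteq> {\<zero>\<^bsub>H\<^esub>}" using inj by auto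
    thus ?case by (rule noeth_on_subset[OF H.noeth_zero])
  next
    case (insert c C)
    interpret e: mod_homo R H N "ev c" using H N ev insert by (intro mod_homoI) auto
    show ?case
    proof (rule e.noeth_step[OF N(2)])
      show "noeth_on R H {x \<in> {h \<in> carrier H. \<forall>b\<in>B - insert c C. ev b h = \<zero>\<^bsub>N\<^esub>}. ev c x = \<zero>\<^bsub>N\<^esub>}"
        by (rule noeth_on_subset[OF insert(3)]) (use insert in auto)
    qed
  qed
  from this[OF B order_refl] show ?thesis by (rule noeth_on_subset) auto
qed

context presentation
begin

text \<open>Hom(Z, N), with functions made extensional so that the module axioms hold as equalities
  of functions.\<close>

definition hom_mod :: "('a, 'n) module \<Rightarrow> ('a, ('s \<Rightarrow> 'a) \<Rightarrow> 'n) module" where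
  "hom_mod N = \<lparr>carrier = mod_hom R Zm N \<inter> extensional Z, monoid.mult = undefined, one = undefined,
     ring.zero = (\<lambda>z\<in>Z. \<zero>\<^bsub>N\<^esub>), ring.add = (\<lambda>h h'. \<lambda>z\<in>Z. h z \<oplus>\<^bsub>N\<^esub> h' z),
     module.smult = (\<lambda>a h. \<lambda>z\<in>Z. a \<odot>\<^bsub>N\<^esub> h z)\<rparr>"

text \<open>The connecting map Hom(Z, N) -> Ext^1(M, N), given directly as the set of
  representatives of a class; by \<open>theta_cong\<close> it depends only on the values of h on
  Z.\<close>

definition theta :: "('a, 'n) module \<Rightarrow> (('s \<Rightarrow> 'a) \<Rightarrow> 'n) \<Rightarrow> ('a, 'n, 'n \<times> 'b, 'b) extn set" where
  "theta N h = {E. is_ext R M N E \<and> rep N E h}"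

lemma theta_cong:
  assumes "\<And>z. z \<in> Z \<Longrightarrow> h z = h' z" shows "theta N h = theta N h'"
  unfolding theta_def using rep_cong[of N _ h h'] rep_cong[of N _ h' h] assms by auto

lemma theta_class: "extension R M N E \<Longrightarrow> rep N E h \<Longrightarrow> yoneda_class R M N E = theta N h"
  unfolding theta_def by (rule yoneda_class_eq)

lemma thetaD:
  assumes "module R N" "E \<in> theta N h" shows "extension R M N E" "rep N E h"
  using assms extensionI[OF M.module_M] by (auto simp: theta_def)

lemma sum_hom:
  assumes "module R N" "h \<in> mod_hom R Zm N" "h' \<in> mod_hom R Zm N"
  shows "(\<lambda>z. h z \<oplus>\<^bsub>N\<^esub> h' z) \<in> mod_hom R Zm N"
proof -
  interpret h: mod_homo R Zm N h using Zm_module assms by (intro mod_homoI)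
  interpret h': mod_homo R Zm N h' using Zm_module assms by (intro mod_homoI)
  show ?thesis
  proof (rule mod_homI)
    fix x y assume x: "x \<in> carrier Zm" and y: "y \<in> carrier Zm"
    show "h (x \<oplus>\<^bsub>Zm\<^esub> y) \<oplus>\<^bsub>N\<^esub> h' (x \<oplus>\<^bsub>Zm\<^esub> y) = h x \<oplus>\<^bsub>N\<^esub> h' x \<oplus>\<^bsub>N\<^esub> (h y \<oplus>\<^bsub>N\<^esub> h' y)"
      unfolding h.add[OF x y] h'.add[OF x y]
      using h.closed[OF x] h.closed[OF y] h'.closed[OF x] h'.closed[OF y] by (simp add: h.N.M.a_ac)
  next
    fix a x assume a: "a \<in> carrier R" and x: "x \<in> carrier Zm"
    show "h (a \<odot>\<^bsub>Zm\<^esub> x) \<oplus>\<^bsub>N\<^esub> h' (a \<odot>\<^bsub>Zm\<^esub> x) = a \<odot>\<^bsub>N\<^esub> (h x \<oplus>\<^bsub>N\<^esub> h' x)"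
      unfolding h.smult[OF a x] h'.smult[OF a x]
      by (rule h.N.smult_r_distr[OF a h.closed[OF x] h'.closed[OF x], symmetric])
  qed (use h.closed h'.closed in auto)
qed

lemma smult_hom_comp:
  assumes "module R N" "a \<in> carrier R" "h \<in> mod_hom R Zm N"
  shows "(\<lambda>z. a \<odot>\<^bsub>N\<^esub> h z) \<in> mod_hom R Zm N"
proof -
  interpret N: rmodule R N using assms(1) by (rule rmoduleI)
  show ?thesis using mod_hom_comp[OF assms(3) N.smult_hom[OF assms(2)]] by (simp add: comp_def)
qed

lemma restrict_hom: "h \<in> mod_hom R Zm N \<Longrightarrow> restrict h Z \<in> mod_hom R Zm N \<inter> extensional Z"
  using mod_hom_cong[OF _ Zm_module, of h N "restrict h Z"] by simp

lemma hom_mod_module: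
  assumes "module R N" shows "module R (hom_mod N)"
proof -
  interpret N: rmodule R N using assms by (rule rmoduleI)
  have 0: "(\<lambda>_. \<zero>\<^bsub>N\<^esub>) \<in> mod_hom R Zm N" by (rule mod_homI) auto
  have c: "h z \<in> carrier N" if "h \<in> mod_hom R Zm N" "z \<in> Z" for h z
    using mod_homD(1)[OF that(1)] that(2) by simp
  have cl: "(\<lambda>z\<in>Z. h z \<oplus>\<^bsub>N\<^esub> h' z) \<in> mod_hom R Zm N \<inter> extensional Z" "(\<lambda>z\<in>Z. a \<odot>\<^bsub>N\<^esub> h z) \<in> mod_hom R Zm N \<inter> extensional Z"
    if "h \<in> mod_hom R Zm N" "h' \<in> mod_hom R Zm N" "a \<in> carrier R" for h h' a
    using restrict_hom[OF sum_hom[OF assms that(1,2)]] restrict_hom[OF smult_hom_comp[OF assms that(3,1)]] by auto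
  have eqI: "h = h'" if "h \<in> extensional Z" "h' \<in> extensional Z" "\<And>z. z \<in> Z \<Longrightarrow> h z = h' z" for h h' :: "('s \<Rightarrow> 'a) \<Rightarrow> _"
    using that by (rule extensionalityI)
  show ?thesis
  proof (rule moduleI)
    show "cring R" by (rule M.R.is_cring)
    show "abelian_group (hom_mod N)"
    proof (rule abelian_groupI)
      fix h assume "h \<in> carrier (hom_mod N)"
      hence h: "h \<in> mod_hom R Zm N" "h \<in> extensional Z" by (auto simp: hom_mod_def)
      show "\<zero>\<^bsub>hom_mod N\<^esub> \<oplus>\<^bsub>hom_mod N\<^esub> h = h"
        using h c[OF h(1)] by (auto simp: hom_mod_def intro!: eqI)
      show "\<exists>y\<in>carrier (hom_mod N). y \<oplus>\<^bsub>hom_mod N\<^esub> h = \<zero>\<^bsub>hom_mod N\<^esub>"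
      proof (rule bexI[of _ "\<lambda>z\<in>Z. (\<ominus> \<one>) \<odot>\<^bsub>N\<^esub> h z"])
        show "(\<lambda>z\<in>Z. (\<ominus> \<one>) \<odot>\<^bsub>N\<^esub> h z) \<in> carrier (hom_mod N)" using cl(2)[OF h(1) h(1), of "\<ominus> \<one>"] by (simp add: hom_mod_def)
        show "(\<lambda>z\<in>Z. (\<ominus> \<one>) \<odot>\<^bsub>N\<^esub> h z) \<oplus>\<^bsub>hom_mod N\<^esub> h = \<zero>\<^bsub>hom_mod N\<^esub>"
          using c[OF h(1)] by (auto simp: hom_mod_def N.smult_l_minus N.M.l_neg intro!: eqI)
      qed
      fix h' assume "h' \<in> carrier (hom_mod N)"
      hence h': "h' \<in> mod_hom R Zm N" "h' \<in> extensional Z" by (auto simp: hom_mod_def)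
      show "h \<oplus>\<^bsub>hom_mod N\<^esub> h' \<in> carrier (hom_mod N)" using cl(1)[OF h(1) h'(1) M.R.one_closed] by (simp add: hom_mod_def)
      show "h \<oplus>\<^bsub>hom_mod N\<^esub> h' = h' \<oplus>\<^bsub>hom_mod N\<^esub> h"
        using c[OF h(1)] c[OF h'(1)] by (auto simp: hom_mod_def N.M.a_comm intro!: eqI)
      fix h'' assume "h'' \<in> carrier (hom_mod N)"
      hence h'': "h'' \<in> mod_hom R Zm N" by (auto simp: hom_mod_def)
      show "h \<oplus>\<^bsub>hom_mod N\<^esub> h' \<oplus>\<^bsub>hom_mod N\<^esub> h'' = h \<oplus>\<^bsub>hom_mod N\<^esub> (h' \<oplus>\<^bsub>hom_mod N\<^esub> h'')"
        using c[OF h(1)] c[OF h'(1)] c[OF h''] by (auto simp: hom_mod_def N.M.a_assoc intro!: eqI)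
    next
      show "\<zero>\<^bsub>hom_mod N\<^esub> \<in> carrier (hom_mod N)" using restrict_hom[OF 0] by (simp add: hom_mod_def)
    qed
    fix h a b assume "h \<in> carrier (hom_mod N)" and a: "a \<in> carrier R" 
    hence h: "h \<in> mod_hom R Zm N" "h \<in> extensional Z" by (auto simp: hom_mod_def)
    show "a \<odot>\<^bsub>hom_mod N\<^esub> h \<in> carrier (hom_mod N)" using cl(2)[OF h(1) h(1) a] by (simp add: hom_mod_def)
    show "a \<odot>\<^bsub>hom_mod N\<^esub> (h \<oplus>\<^bsub>hom_mod N\<^esub> h') = a \<odot>\<^bsub>hom_mod N\<^esub> h \<oplus>\<^bsub>hom_mod N\<^esub> a \<odot>\<^bsub>hom_mod N\<^esub> h'"
      if "h' \<in> carrier (hom_mod N)" for h'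
    proof -
      have "h' \<in> mod_hom R Zm N" using that by (simp add: hom_mod_def)
      thus ?thesis using c[OF h(1)] c a by (auto simp: hom_mod_def N.smult_r_distr intro!: eqI)
    qed
    assume b: "b \<in> carrier R"
    show "(a \<oplus> b) \<odot>\<^bsub>hom_mod N\<^esub> h = a \<odot>\<^bsub>hom_mod N\<^esub> h \<oplus>\<^bsub>hom_mod N\<^esub> b \<odot>\<^bsub>hom_mod N\<^esub> h"
      using c[OF h(1)] a b by (auto simp: hom_mod_def N.smult_l_distr intro!: eqI)
    show "(a \<otimes> b) \<odot>\<^bsub>hom_mod N\<^esub> h = a \<odot>\<^bsub>hom_mod N\<^esub> (b \<odot>\<^bsub>hom_mod N\<^esub> h)"
      using c[OF h(1)] a b by (auto simp: hom_mod_def N.smult_assoc1 intro!: eqI)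
  next
    fix h assume "h \<in> carrier (hom_mod N)"
    hence h: "h \<in> mod_hom R Zm N" "h \<in> extensional Z" by (auto simp: hom_mod_def)
    show "\<one> \<odot>\<^bsub>hom_mod N\<^esub> h = h" using h c[OF h(1)] by (auto simp: hom_mod_def intro!: eqI)
  qed
qed

lemma hom_mod_noeth:
  assumes R: "noetherian_ring R" and S: "finite S" and N: "module R N" "noeth_on R N (carrier N)"
  shows "noeth_on R (hom_mod N) (carrier (hom_mod N))"
proof -
  have "noeth_on R F (carrier F)" by (rule noeth_free_mod[OF M.R.is_cring R S])
  then obtain B where B: "finite B" "B \<subseteq> Z" "mod_span R F B = Z"
    using \<pi>.M.noeth_fg[OF _ Z_sm Z_sub] by blast
  interpret N: rmodule R N using N(1) by (rule rmoduleI)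
  show ?thesis
  proof (rule noeth_joint[OF hom_mod_module[OF N(1)] N B(1), of "\<lambda>b h. h b"])
    fix b assume "b \<in> B"
    hence b: "b \<in> Z" using B by auto
    show "(\<lambda>h. h b) \<in> mod_hom R (hom_mod N) N"
      by (rule mod_homI) (use b mod_homD(1)[of _ R Zm N] in \<open>auto simp: hom_mod_def\<close>)
  next
    fix h assume "h \<in> carrier (hom_mod N)" and h0: "\<And>b. b \<in> B \<Longrightarrow> h b = \<zero>\<^bsub>N\<^esub>"
    hence h: "h \<in> mod_hom R Zm N" "h \<in> extensional Z" by (auto simp: hom_mod_def)
    interpret h: mod_homo R Zm N h using Zm_module N(1) h(1) by (rule mod_homoI)
    have "mod_span R Zm B = Z" unfolding Zm_def by (subst \<pi>.M.mod_span_restrict[OF Z_sm B(2)]) (rule B(3))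
    moreover have "h ` mod_span R Zm B \<subseteq> {\<zero>\<^bsub>N\<^esub>}"
      by (rule h.span_image_le[OF _ N.sm_zero]) (use B h0 in auto)
    ultimately have "h z = \<zero>\<^bsub>N\<^esub>" if "z \<in> Z" for z using that by auto
    thus "h = \<zero>\<^bsub>hom_mod N\<^esub>" using h(2) by (auto simp: hom_mod_def intro!: extensionalityI[of _ Z])
  qed
qed

text \<open>The universal extension, classified by the identity of Z; its pushout along h is
  classified by h.\<close>

definition pres_ext :: "('a, 's \<Rightarrow> 'a, 's \<Rightarrow> 'a, 'b) extn" where
  "pres_ext = \<lparr>ext_mid = F, ext_in = (\<lambda>z. z), ext_out = \<pi>\<rparr>"

lemma pres_ext: "extension R M Zm pres_ext" "rep Zm pres_ext (\<lambda>z. z)"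
proof -
  have incl: "(\<lambda>z. z) \<in> mod_hom R Zm F" unfolding Zm_def by (rule \<pi>.M.restrict_incl_hom[OF Z_sm])
  have "is_ext R M Zm pres_ext"
    unfolding is_ext_def pres_ext_def extn.simps
    using \<pi>.M.module_M incl \<pi>.hom pi_onto by (auto simp: a_kernel_def' Z_iff)
  thus "extension R M Zm pres_ext" by (rule extensionI[OF M.module_M Zm_module])
  show "rep Zm pres_ext (\<lambda>z. z)"
    by (rule repI[of _ _ "\<lambda>x. x"]) (auto simp: pres_ext_def mod_hom_id)
qed

lemma theta_nonempty:
  assumes "module R N" "h \<in> mod_hom R Zm N" obtains E where "E \<in> theta N h"
proof -
  interpret k: extension R M Zm pres_ext by (rule pres_ext(1))
  let ?E = "push_ext Zm N h pres_ext"
  have E: "extension R M N ?E"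
    using k.push_is_ext[OF assms] by (rule extensionI[OF M.module_M assms(1)])
  have rep: "rep N ?E h" using push_rep[OF pres_ext(1) assms pres_ext(2)] by (simp add: comp_def)
  \<comment> \<open>The pushout lives in a type of sets, whereas members of \<open>theta\<close>
    have their middle term in the product type.\<close>
  obtain E' :: "('a, 'c, 'c \<times> 'b, 'b) extn" where E': "extension R M N E'" "ext_equiv R M N ?E E'"
    using E by (rule ext_small)
  have "E' \<in> theta N h" using E' rep_equiv[OF E E'(1) rep] extension.ext[OF E'(1)] by (simp add: theta_def)
  thus ?thesis by (rule that)
qed

text \<open>The unions in \<open>Ext1\<close> and \<open>Ext1_map\<close> run over representatives
  with equal contributions; that a class is nonempty makes the union equal to their common
  value.\<close>

lemma theta_UN:
  assumes "module R N" "h \<in> mod_hom R Zm N" "\<And>E. E \<in> theta N h \<Longrightarrow> f E = c"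
  shows "(\<Union>E\<in>theta N h. f E) = c"
proof -
  obtain E where "E \<in> theta N h" using assms(1,2) by (rule theta_nonempty)
  thus ?thesis using assms(3) by blast
qed

text \<open>Surjectivity of \<open>theta\<close>. With \<open>theta_add\<close> and
  \<open>theta_smult\<close> it transports the module axioms from Hom(Z, N), so that associativity
  of the Baer sum is never checked on extensions.\<close>

lemma Ext1_carrier:
  assumes N: "module R N"
  shows "carrier (Ext1 R M N) = theta N ` carrier (hom_mod N)"
proof (intro equalityI subsetI)
  fix c assume "c \<in> carrier (Ext1 R M N)"
  then obtain E :: "('a, 'c, 'c \<times> 'b, 'b) extn" where E: "is_ext R M N E" "c = yoneda_class R M N E"
    by (auto simp: Ext1_def)
  have e: "extension R M N E" using M.module_M N E(1) by (rule extensionI)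
  obtain h where h: "rep N E h" using rep_exists[OF e] by blast
  hence hh: "h \<in> mod_hom R Zm N" by (auto simp: rep_def)
  have "c = theta N (restrict h Z)"
    unfolding E(2) theta_class[OF e h] by (rule theta_cong) simp
  thus "c \<in> theta N ` carrier (hom_mod N)" using restrict_hom[OF hh] by (auto simp: hom_mod_def)
next
  fix c assume "c \<in> theta N ` carrier (hom_mod N)"
  then obtain h where h: "h \<in> mod_hom R Zm N" "c = theta N h" by (auto simp: hom_mod_def)
  obtain E where E: "E \<in> theta N h" using N h(1) by (rule theta_nonempty)
  have "c = yoneda_class R M N E" unfolding h(2) using theta_class[OF thetaD[OF N E]] by simp
  thus "c \<in> carrier (Ext1 R M N)" using E by (auto simp: Ext1_def theta_def)
qed

lemma theta_zero: "module R N \<Longrightarrow> \<zero>\<^bsub>Ext1 R M N\<^esub> = theta N (\<lambda>_. \<zero>\<^bsub>N\<^esub>)"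
  using theta_class[OF extensionI[OF M.module_M _ split_is_ext[OF M.module_M]] split_rep] by (simp add: Ext1_def)

lemma theta_add:
  assumes N: "module R N" and h: "h \<in> mod_hom R Zm N" "h' \<in> mod_hom R Zm N"
  shows "theta N h \<oplus>\<^bsub>Ext1 R M N\<^esub> theta N h' = theta N (\<lambda>z. h z \<oplus>\<^bsub>N\<^esub> h' z)"
proof -
  have "theta N h \<oplus>\<^bsub>Ext1 R M N\<^esub> theta N h' = (\<Union>E\<in>theta N h. \<Union>E'\<in>theta N h'. yoneda_class R M N (baer_ext M N E E'))"
    by (simp add: Ext1_def)
  also have "\<dots> = theta N (\<lambda>z. h z \<oplus>\<^bsub>N\<^esub> h' z)"
  proof (intro theta_UN N h)
    fix E E' assume "E \<in> theta N h" "E' \<in> theta N h'"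
    note e = thetaD[OF N this(1)] thetaD[OF N this(2)]
    show "yoneda_class R M N (baer_ext M N E E') = theta N (\<lambda>z. h z \<oplus>\<^bsub>N\<^esub> h' z)"
      by (rule theta_class[OF baer_is_ext[OF e(1,3)] baer_rep[OF e(1,3,2,4)]])
  qed
  finally show ?thesis .
qed

lemma push_class:
  assumes N: "module R N" and N': "module R N'" and g: "g \<in> mod_hom R N N'" and e: "extension R M N E" "rep N E h"
  shows "yoneda_class R M N' (push_ext N N' g E) = theta N' (g \<circ> h)"
proof -
  interpret e: extension R M N E by (rule e(1))
  show ?thesis
    by (rule theta_class[OF extensionI[OF M.module_M N' e.push_is_ext[OF N' g]] push_rep[OF e(1) N' g e(2)]])
qed

lemma theta_smult:
  assumes N: "module R N" and h: "h \<in> mod_hom R Zm N" and a: "a \<in> carrier R"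
  shows "a \<odot>\<^bsub>Ext1 R M N\<^esub> theta N h = theta N (\<lambda>z. a \<odot>\<^bsub>N\<^esub> h z)"
proof -
  interpret N: rmodule R N using N by (rule rmoduleI)
  have "a \<odot>\<^bsub>Ext1 R M N\<^esub> theta N h = (\<Union>E\<in>theta N h. yoneda_class R M N (push_ext N N (\<lambda>n. a \<odot>\<^bsub>N\<^esub> n) E))"
    by (simp add: Ext1_def)
  also have "\<dots> = theta N (\<lambda>z. a \<odot>\<^bsub>N\<^esub> h z)"
  proof (rule theta_UN[OF N h])
    fix E assume "E \<in> theta N h"
    from push_class[OF N N N.smult_hom[OF a] thetaD[OF N this]]
    show "yoneda_class R M N (push_ext N N (\<lambda>n. a \<odot>\<^bsub>N\<^esub> n) E) = theta N (\<lambda>z. a \<odot>\<^bsub>N\<^esub> h z)"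
      by (simp add: comp_def)
  qed
  finally show ?thesis .
qed

lemma Ext1_module:
  assumes N: "module R N" shows "module R (Ext1 R M N)" "theta N \<in> mod_hom R (hom_mod N) (Ext1 R M N)"
proof -
  have 1: "theta N (h \<oplus>\<^bsub>hom_mod N\<^esub> h') = theta N h \<oplus>\<^bsub>Ext1 R M N\<^esub> theta N h'"
    if "h \<in> carrier (hom_mod N)" "h' \<in> carrier (hom_mod N)" for h h'
  proof -
    have "h \<in> mod_hom R Zm N" "h' \<in> mod_hom R Zm N" using that by (auto simp: hom_mod_def)
    from theta_add[OF N this] show ?thesis
      by (elim ssubst) (rule theta_cong, simp add: hom_mod_def)
  qed
  have 2: "theta N (a \<odot>\<^bsub>hom_mod N\<^esub> h) = a \<odot>\<^bsub>Ext1 R M N\<^esub> theta N h"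
    if "a \<in> carrier R" "h \<in> carrier (hom_mod N)" for a h
  proof -
    have "h \<in> mod_hom R Zm N" using that by (auto simp: hom_mod_def)
    from theta_smult[OF N this that(1)] show ?thesis
      by (elim ssubst) (rule theta_cong, simp add: hom_mod_def)
  qed
  have 3: "theta N \<zero>\<^bsub>hom_mod N\<^esub> = \<zero>\<^bsub>Ext1 R M N\<^esub>"
    unfolding theta_zero[OF N] by (rule theta_cong) (simp add: hom_mod_def)
  show "module R (Ext1 R M N)" "theta N \<in> mod_hom R (hom_mod N) (Ext1 R M N)"
    using module_transport[where \<theta> = "theta N" and E = "Ext1 R M N", OF hom_mod_module[OF N] Ext1_carrier[OF N, symmetric] 1 2 3] by auto
qed

lemma Ext1_noeth:
  assumes "noetherian_ring R" "finite S" "module R N" "noeth_on R N (carrier N)"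
  shows "noeth_on R (Ext1 R M N) (carrier (Ext1 R M N))"
proof -
  interpret t: mod_homo R "hom_mod N" "Ext1 R M N" "theta N"
    using hom_mod_module[OF assms(3)] Ext1_module[OF assms(3)] by (intro mod_homoI)
  show ?thesis using hom_mod_noeth[OF assms] by (rule t.noeth_image) (simp add: Ext1_carrier[OF assms(3)])
qed

lemma Ext1_cases:
  assumes N: "module R N" and "c \<in> carrier (Ext1 R M N)"
  obtains h where "h \<in> mod_hom R Zm N" "c = theta N h"
  using assms(2) unfolding Ext1_carrier[OF N] by (auto simp: hom_mod_def)

lemma yoneda_add:
  assumes "extension R M N E" "extension R M N E'"
  shows "yoneda_class R M N E \<oplus>\<^bsub>Ext1 R M N\<^esub> yoneda_class R M N E' = yoneda_class R M N (baer_ext M N E E')"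
proof -
  interpret e: extension R M N E by fact
  obtain h h' where h: "rep N E h" "rep N E' h'" using rep_exists assms by metis
  hence "h \<in> mod_hom R Zm N" "h' \<in> mod_hom R Zm N" by (auto simp: rep_def)
  thus ?thesis
    unfolding theta_class[OF assms(1) h(1)] theta_class[OF assms(2) h(2)]
      theta_class[OF baer_is_ext[OF assms] baer_rep[OF assms h]]
    by (rule theta_add[OF e.N.module_M])
qed

lemma yoneda_smult:
  assumes "extension R M N E" "a \<in> carrier R"
  shows "a \<odot>\<^bsub>Ext1 R M N\<^esub> yoneda_class R M N E = yoneda_class R M N (push_ext N N (\<lambda>n. a \<odot>\<^bsub>N\<^esub> n) E)"
proof -
  interpret e: extension R M N E by fact
  obtain h where h: "rep N E h" using rep_exists assms by metis
  hence hh: "h \<in> mod_hom R Zm N" by (auto simp: rep_def)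
  show ?thesis
    unfolding theta_class[OF assms(1) h] push_class[OF e.N.module_M e.N.module_M e.N.smult_hom[OF assms(2)] assms(1) h]
      theta_smult[OF e.N.module_M hh assms(2)] by (simp add: comp_def)
qed

end

subsection \<open>Functoriality\<close>

text \<open>The data that describe \<open>Ext\<^sup>1(f, g)\<close>: a lift \<open>l\<close> of \<open>f\<close> to the presentations.\<close>

locale ext_map = p: presentation R M S w + p': presentation R M' S' w' + N: rmodule R N + N': rmodule R N'
  for R :: "('a, 'k) ring_scheme" (structure) and M :: "('a, 'm) module" and S :: "'s set" and w
    and M' :: "('a, 'p) module" and S' :: "'t set" and w'
    and N :: "('a, 'n) module" and N' :: "('a, 'q) module" +
  fixes f g l
  assumes f: "f \<in> mod_hom R M' M" and g: "g \<in> mod_hom R N N'" and l: "l \<in> mod_hom R p'.F p.F"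
    and lift: "\<And>x. x \<in> carrier p'.F \<Longrightarrow> p.\<pi> (l x) = f (p'.\<pi> x)"
begin

lemma l_Z:
  assumes "z \<in> p'.Z" shows "l z \<in> p.Z"
proof -
  interpret f: mod_homo R M' M f using p'.M.module_M p.M.module_M f by (rule mod_homoI)
  show ?thesis using assms lift[of z] mod_homD(1)[OF l, of z] f.zero by (simp add: p.Z_iff p'.Z_iff)
qed

lemma map_class:
  assumes E: "extension R M N E" "p.rep N E h"
  shows "yoneda_class R M' N' (push_ext N N' g (pull_ext M' f E)) = p'.theta N' (\<lambda>z. g (h (l z)))"
proof -
  interpret e: extension R M N E by (rule E(1))
  have 1: "extension R M' N (pull_ext M' f E)"
    using e.pull_is_ext[OF p'.M.module_M f] by (rule extensionI[OF p'.M.module_M N.module_M])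
  have 2: "p'.rep N (pull_ext M' f E) (h \<circ> l)"
    by (rule pull_rep[OF p.presentation_axioms p'.presentation_axioms E(1) f l lift E(2)])
  show ?thesis
    using p'.push_class[OF N.module_M N'.module_M g 1 2] by (simp add: comp_def)
qed

text \<open>On classifying maps Ext^1(f, g) is h |-> g o h o l. Linearity and the functor laws are
  read off from this formula.\<close>

lemma Ext1_map_theta:
  assumes "h \<in> mod_hom R p.Zm N"
  shows "Ext1_map R M N M' N' f g (p.theta N h) = p'.theta N' (\<lambda>z. g (h (l z)))"
  unfolding Ext1_map_def
proof (rule p.theta_UN[OF N.module_M assms])
  fix E assume "E \<in> p.theta N h"
  from p.thetaD[OF N.module_M this]
  show "yoneda_class R M' N' (push_ext N N' g (pull_ext M' f E)) = p'.theta N' (\<lambda>z. g (h (l z)))"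
    by (rule map_class)
qed

lemma Ext1_map_yoneda:
  assumes "extension R M N E"
  shows "Ext1_map R M N M' N' f g (yoneda_class R M N E) = yoneda_class R M' N' (push_ext N N' g (pull_ext M' f E))"
proof -
  obtain h where h: "p.rep N E h" using p.rep_exists assms by metis
  hence "h \<in> mod_hom R p.Zm N" by (auto simp: p.rep_def)
  thus ?thesis
    unfolding p.theta_class[OF assms h] map_class[OF assms h] by (rule Ext1_map_theta)
qed

lemma map_hom:
  assumes "h \<in> mod_hom R p.Zm N" shows "(\<lambda>z. g (h (l z))) \<in> mod_hom R p'.Zm N'"
proof -
  have "l \<in> mod_hom R p'.Zm p.Zm"
  proof (rule mod_homI)
    fix x assume x: "x \<in> carrier p'.Zm"
    show "l x \<in> carrier p.Zm" using x l_Z by simp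
    have xF: "x \<in> carrier p'.F" using x p'.Z_sub by auto
    show "l (a \<odot>\<^bsub>p'.Zm\<^esub> x) = a \<odot>\<^bsub>p.Zm\<^esub> l x" if "a \<in> carrier R" for a
      unfolding p'.Zm_simps p.Zm_simps using that xF by (rule mod_homD(3)[OF l])
    fix y assume "y \<in> carrier p'.Zm"
    hence yF: "y \<in> carrier p'.F" using p'.Z_sub by auto
    show "l (x \<oplus>\<^bsub>p'.Zm\<^esub> y) = l x \<oplus>\<^bsub>p.Zm\<^esub> l y"
      unfolding p'.Zm_simps p.Zm_simps using xF yF by (rule mod_homD(2)[OF l])
  qed
  from mod_hom_comp[OF mod_hom_comp[OF this assms] g] show ?thesis by (simp add: comp_def)
qed

lemma Ext1_map_hom: "Ext1_map R M N M' N' f g \<in> mod_hom R (Ext1 R M N) (Ext1 R M' N')"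
proof (rule mod_homI)
  interpret E: rmodule R "Ext1 R M N" by (rule rmoduleI[OF p.Ext1_module(1)[OF N.module_M]])
  interpret g: mod_homo R N N' g using N.module_M N'.module_M g by (rule mod_homoI)
  let ?\<phi> = "Ext1_map R M N M' N' f g"
  fix c assume "c \<in> carrier (Ext1 R M N)"
  then obtain h where h: "h \<in> mod_hom R p.Zm N" "c = p.theta N h" by (rule p.Ext1_cases[OF N.module_M])
  have hc: "h (l z) \<in> carrier N" if "z \<in> p'.Z" for z using mod_homD(1)[OF h(1)] l_Z[OF that] by simp
  have "restrict (\<lambda>z. g (h (l z))) p'.Z \<in> carrier (p'.hom_mod N')"
    using p'.restrict_hom[OF map_hom[OF h(1)]] by (simp add: p'.hom_mod_def)
  moreover have "p'.theta N' (\<lambda>z. g (h (l z))) = p'.theta N' (restrict (\<lambda>z. g (h (l z))) p'.Z)"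
    by (rule p'.theta_cong) simp
  ultimately show "?\<phi> c \<in> carrier (Ext1 R M' N')"
    unfolding h(2) Ext1_map_theta[OF h(1)] p'.Ext1_carrier[OF N'.module_M] by blast
  show "?\<phi> (a \<odot>\<^bsub>Ext1 R M N\<^esub> c) = a \<odot>\<^bsub>Ext1 R M' N'\<^esub> ?\<phi> c" if a: "a \<in> carrier R" for a
    unfolding h(2) p.theta_smult[OF N.module_M h(1) a] Ext1_map_theta[OF h(1)]
      Ext1_map_theta[OF p.smult_hom_comp[OF N.module_M a h(1)]] p'.theta_smult[OF N'.module_M map_hom[OF h(1)] a]
    by (rule p'.theta_cong) (rule g.smult[OF a hc])
  fix c' assume "c' \<in> carrier (Ext1 R M N)"
  then obtain h' where h': "h' \<in> mod_hom R p.Zm N" "c' = p.theta N h'" by (rule p.Ext1_cases[OF N.module_M])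
  have hc': "h' (l z) \<in> carrier N" if "z \<in> p'.Z" for z using mod_homD(1)[OF h'(1)] l_Z[OF that] by simp
  show "?\<phi> (c \<oplus>\<^bsub>Ext1 R M N\<^esub> c') = ?\<phi> c \<oplus>\<^bsub>Ext1 R M' N'\<^esub> ?\<phi> c'"
    unfolding h(2) h'(2) p.theta_add[OF N.module_M h(1) h'(1)] Ext1_map_theta[OF h(1)] Ext1_map_theta[OF h'(1)]
      Ext1_map_theta[OF p.sum_hom[OF N.module_M h(1) h'(1)]] p'.theta_add[OF N'.module_M map_hom[OF h(1)] map_hom[OF h'(1)]]
    by (rule p'.theta_cong) (rule g.add[OF hc hc'])
qed

end

lemma ext_mapI:
  assumes "presentation R M S w" "presentation R M' S' w'" "module R N" "module R N'"
    "f \<in> mod_hom R M' M" "g \<in> mod_hom R N N'"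
  obtains l where "ext_map R M S w M' S' w' N N' f g l"
proof -
  interpret p: presentation R M S w by fact
  interpret p': presentation R M' S' w' by fact
  have "(\<lambda>x. f (p'.\<pi> x)) \<in> mod_hom R p'.F M" using mod_hom_comp[OF p'.\<pi>.hom assms(5)] by (simp add: comp_def)
  then obtain l where "l \<in> mod_hom R p'.F p.F" "\<And>x. x \<in> carrier p'.F \<Longrightarrow> p.\<pi> (l x) = f (p'.\<pi> x)"
    using free_lift[OF p.\<pi>.M.module_M p.M.module_M p.\<pi>.hom, of "\<lambda>x. f (p'.\<pi> x)"] p.pi_onto by blast
  hence "ext_map R M S w M' S' w' N N' f g l"
    using assms by (simp add: ext_map_def ext_map_axioms_def rmoduleI)
  thus ?thesis by (rule that)
qed

section \<open>Finite generation of \<open>Ext1\<close> and the functor laws\<close>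

lemma presentation_carrier: "module R M \<Longrightarrow> presentation R M (carrier M) (\<lambda>x. x)"
  by (intro presentationI presents_carrier)

lemma Ext1_fg:
  assumes "noetherian_ring R" "M \<in> fg_modules R" "N \<in> fg_modules R"
  shows "module R (Ext1 R M N)" "noeth_on R (Ext1 R M N) (carrier (Ext1 R M N))"
proof -
  obtain S where S: "finite S" "S \<subseteq> carrier M" "presents R M S (\<lambda>x. x)" using assms(2) by (rule fg_presents)
  interpret p: presentation R M S "\<lambda>x. x" using fg_modulesD[OF assms(2)] S(3) by (rule presentationI)
  show "module R (Ext1 R M N)" by (rule p.Ext1_module[OF fg_modulesD[OF assms(3)]])
  show "noeth_on R (Ext1 R M N) (carrier (Ext1 R M N))"
    by (rule p.Ext1_noeth[OF assms(1) S(1) fg_modulesD[OF assms(3)] fg_modules_noeth[OF assms(1,3)]])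
qed

lemma Ext1_map_id:
  assumes M: "module R M" and N: "module R N" and c: "c \<in> carrier (Ext1 R M N)"
  shows "Ext1_map R M N M N id id c = c"
proof -
  interpret p: presentation R M "carrier M" "\<lambda>x. x" using M by (rule presentation_carrier)
  interpret e: ext_map R M "carrier M" "\<lambda>x. x" M "carrier M" "\<lambda>x. x" N N id id "\<lambda>x. x"
    using M N by (intro ext_map.intro ext_map_axioms.intro presentation_carrier rmoduleI mod_hom_id) simp_all
  obtain h where h: "h \<in> mod_hom R p.Zm N" "c = p.theta N h" using c by (rule p.Ext1_cases[OF N])
  show ?thesis unfolding h(2) e.Ext1_map_theta[OF h(1)] by simp
qed

lemma Ext1_map_comp:
  assumes M: "module R M" "module R M'" "module R M''" and N: "module R N" "module R N'" "module R N''"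
    and f: "f \<in> mod_hom R M' M" "f' \<in> mod_hom R M'' M'" and g: "g \<in> mod_hom R N N'" "g' \<in> mod_hom R N' N''"
    and c: "c \<in> carrier (Ext1 R M N)"
  shows "Ext1_map R M N M'' N'' (f \<circ> f') (g' \<circ> g) c = Ext1_map R M' N' M'' N'' f' g' (Ext1_map R M N M' N' f g c)"
proof -
  note p = M[THEN presentation_carrier]
  obtain l where l: "ext_map R M (carrier M) (\<lambda>x. x) M' (carrier M') (\<lambda>x. x) N N' f g l"
    by (rule ext_mapI[OF p(1,2) N(1,2) f(1) g(1)])
  obtain l' where l': "ext_map R M' (carrier M') (\<lambda>x. x) M'' (carrier M'') (\<lambda>x. x) N' N'' f' g' l'"
    by (rule ext_mapI[OF p(2,3) N(2,3) f(2) g(2)])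
  interpret e: ext_map R M "carrier M" "\<lambda>x. x" M' "carrier M'" "\<lambda>x. x" N N' f g l by (rule l)
  interpret e': ext_map R M' "carrier M'" "\<lambda>x. x" M'' "carrier M''" "\<lambda>x. x" N' N'' f' g' l' by (rule l')
  \<comment> \<open>The composite of the two lifts is a lift of f o f', so both sides of the functor
    law are evaluated with the same map of presentations.\<close>
  interpret e'': ext_map R M "carrier M" "\<lambda>x. x" M'' "carrier M''" "\<lambda>x. x" N N'' "f \<circ> f'" "g' \<circ> g" "l \<circ> l'"
    by (intro ext_map.intro ext_map_axioms.intro p rmoduleI N mod_hom_comp[OF f(2,1)] mod_hom_comp[OF g]
        mod_hom_comp[OF e'.l e.l])
      (simp add: e.lift e'.lift mod_homD(1)[OF e'.l])
  obtain h where h: "h \<in> mod_hom R e.p.Zm N" "c = e.p.theta N h" using c by (rule e.p.Ext1_cases[OF N(1)])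
  show ?thesis
    unfolding h(2) e''.Ext1_map_theta[OF h(1)] e.Ext1_map_theta[OF h(1)] e'.Ext1_map_theta[OF e.map_hom[OF h(1)]] by simp
qed

section \<open>The subfunctor\<close>

context primary_setup_dim
begin

lemma eT_push:
  assumes E: "extension R M N E" and fg: "M \<in> fg_modules R" "N \<in> fg_modules R" "N' \<in> fg_modules R"
    and g: "g \<in> mod_hom R N N'" and eq: "eT R I (ext_mid E) = eT R I M + eT R I N"
  shows "eT R I (ext_mid (push_ext N N' g E)) = eT R I M + eT R I N'"
proof -
  interpret e: extension R M N E by fact
  note N' = fg_modulesD[OF fg(3)]
  interpret p: extension R M N' "push_ext N N' g E"
    by (rule extensionI[OF e.M.module_M N' e.push_is_ext[OF N' g]])
  interpret s: extension R p.Y N "e.push_seq N' g"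
    by (rule extensionI[OF p.i.N.module_M e.N.module_M e.push_seq_is_ext[OF N' g]])
  have Yfg: "e.Y \<in> fg_modules R" "p.Y \<in> fg_modules R" using e.is_ext_mid_fg p.is_ext_mid_fg fg by auto
  have "eT R I p.Y \<le> eT R I M + eT R I N'" by (rule eT_subadd[OF fg(1,3) p.ext Yfg(2)])
  moreover have "eT R I s.Y \<le> eT R I p.Y + eT R I N"
    by (rule eT_subadd[OF Yfg(2) fg(2) s.ext s.is_ext_mid_fg[OF Yfg(2) fg(2)]])
  hence "eT R I N' + eT R I e.Y \<le> eT R I p.Y + eT R I N"
    unfolding e.push_seq_mid[OF N' g] eT_dsum[OF fg(3) Yfg(1)] .
  ultimately show ?thesis using eq by simp
qed

lemma eT_pull:
  assumes E: "extension R M N E" and fg: "M \<in> fg_modules R" "N \<in> fg_modules R" "M' \<in> fg_modules R"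
    and f: "f \<in> mod_hom R M' M" and eq: "eT R I (ext_mid E) = eT R I M + eT R I N"
  shows "eT R I (ext_mid (pull_ext M' f E)) = eT R I M' + eT R I N"
proof -
  interpret e: extension R M N E by fact
  note M' = fg_modulesD[OF fg(3)]
  interpret p: extension R M' N "pull_ext M' f E"
    by (rule extensionI[OF M' e.N.module_M e.pull_is_ext[OF M' f]])
  interpret s: extension R M p.Y "e.pull_seq M' f"
    by (rule extensionI[OF e.M.module_M p.i.N.module_M e.pull_seq_is_ext[OF M' f]])
  have Yfg: "e.Y \<in> fg_modules R" "p.Y \<in> fg_modules R" using e.is_ext_mid_fg p.is_ext_mid_fg fg by auto
  have "eT R I p.Y \<le> eT R I M' + eT R I N" by (rule eT_subadd[OF fg(3,2) p.ext Yfg(2)])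
  moreover have "eT R I s.Y \<le> eT R I M + eT R I p.Y"
    by (rule eT_subadd[OF fg(1) Yfg(2) s.ext s.is_ext_mid_fg[OF fg(1) Yfg(2)]])
  hence "eT R I e.Y + eT R I M' \<le> eT R I M + eT R I p.Y"
    unfolding e.pull_seq_mid[OF M' f] eT_dsum[OF Yfg(1) fg(3)] .
  ultimately show ?thesis using eq by simp
qed

lemma dsum_fg: "M \<in> fg_modules R \<Longrightarrow> N \<in> fg_modules R \<Longrightarrow> dsum_mod N M \<in> fg_modules R"
  using extension.is_ext_mid_fg[OF extensionI[OF fg_modulesD fg_modulesD split_is_ext[OF fg_modulesD fg_modulesD]]]
  by (auto simp: split_ext_def)

text \<open>The direct sum of the extensions has two copies of M and of N at its ends, and its
  additivity is the sum of the two hypotheses. The pullback along the diagonal and the pushout along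
  the codiagonal then each repair one end.\<close>

lemma eT_baer:
  assumes E: "extension R M N E" and E': "extension R M N E'" and fg: "M \<in> fg_modules R" "N \<in> fg_modules R"
    and eq: "eT R I (ext_mid E) = eT R I M + eT R I N" "eT R I (ext_mid E') = eT R I M + eT R I N"
  shows "eT R I (ext_mid (baer_ext M N E E')) = eT R I M + eT R I N"
proof -
  interpret e: extension R M N E by fact
  interpret e': extension R M N E' by fact
  have Yfg: "e.Y \<in> fg_modules R" "e'.Y \<in> fg_modules R" using e.is_ext_mid_fg e'.is_ext_mid_fg fg by auto
  have fg2: "dsum_mod M M \<in> fg_modules R" "dsum_mod N N \<in> fg_modules R" using fg by (auto intro: dsum_fg)
  have d: "extension R (dsum_mod M M) (dsum_mod N N) (dsum_ext E E')"
    by (rule extensionI[OF fg2[THEN fg_modulesD] dsum_is_ext[OF E E']])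
  have "eT R I (ext_mid (dsum_ext E E')) = eT R I (dsum_mod M M) + eT R I (dsum_mod N N)"
    using eq by (simp add: dsum_ext_def eT_dsum Yfg fg)
  from eT_pull[OF d fg2 fg(1) diag_hom this]
  have "eT R I (ext_mid (pull_ext M (\<lambda>m. (m, m)) (dsum_ext E E'))) = eT R I M + eT R I (dsum_mod N N)" .
  from eT_push[OF dsum_pull_is_ext[OF E E'] fg(1) fg2(2) fg(2) codiag_hom[OF fg_modulesD[OF fg(2)]] this]
  show ?thesis unfolding baer_ext_def .
qed

text \<open>Membership is defined by a representative with middle term in the product type, but
  pushouts and Baer sums live in types of sets. The small copy is isomorphic to the given middle
  term, and \<open>eT\<close> is invariant under isomorphism.\<close>

lemma yoneda_in_Ext1_eT:
  fixes E :: "('a, 'n, 'x, 'm) extn"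
  assumes E: "extension R M N E" and eq: "eT R I (ext_mid E) = eT R I M + eT R I N"
  shows "yoneda_class R M N E \<in> Ext1_eT R I M N"
proof -
  interpret e: extension R M N E by fact
  interpret p: presentation R M "carrier M" "\<lambda>x. x" using e.M.module_M by (rule presentation_carrier)
  obtain E' :: "('a, 'n, 'n \<times> 'm, 'm) extn" where E': "extension R M N E'" "ext_equiv R M N E E'"
    using E by (rule ext_small)
  interpret e': extension R M N E' by (rule E'(1))
  obtain \<phi> where \<phi>: "\<phi> \<in> mod_hom R e.Y e'.Y" "\<And>n. n \<in> carrier N \<Longrightarrow> \<phi> (e.\<iota> n) = e'.\<iota> n"
    "\<And>x. x \<in> carrier e.Y \<Longrightarrow> e'.\<rho> (\<phi> x) = e.\<rho> x" using E'(2) unfolding ext_equiv_def by blast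
  have "eT R I e'.Y = eT R I e.Y"
    by (rule eT_iso[OF e.i.N.module_M e'.i.N.module_M \<phi>(1) ext_equiv_iso[OF E E'(1) \<phi>]])
  moreover obtain h where h: "p.rep N E h" using p.rep_exists[OF E] by blast
  have "yoneda_class R M N E = yoneda_class R M N E'"
    using p.theta_class[OF E h] p.theta_class[OF E'(1), of h] p.rep_equiv[OF E E'(1) h] E'(2) by simp
  ultimately show ?thesis using e'.ext eq unfolding Ext1_eT_def by auto
qed

lemma Ext1_eT_cases:
  fixes M :: "('a, 'm) module" and N :: "('a, 'n) module"
  assumes "module R M" "module R N" "c \<in> Ext1_eT R I M N"
  obtains E :: "('a, 'n, 'n \<times> 'm, 'm) extn" where "extension R M N E" "c = yoneda_class R M N E"
    "eT R I (ext_mid E) = eT R I M + eT R I N"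
proof -
  from assms(3) obtain E :: "('a, 'n, 'n \<times> 'm, 'm) extn" where "is_ext R M N E" "c = yoneda_class R M N E"
    "eT R I (ext_mid E) = eT R I M + eT R I N" unfolding Ext1_eT_def by auto
  thus ?thesis by (intro that extensionI[OF assms(1,2)])
qed

lemma Ext1_eT_submodule:
  fixes M :: "('a, 'm) module" and N :: "('a, 'n) module"
  assumes fg: "M \<in> fg_modules R" "N \<in> fg_modules R"
  shows "submodule (Ext1_eT R I M N) R (Ext1 R M N)"
proof -
  note m = fg[THEN fg_modulesD]
  interpret E: rmodule R "Ext1 R M N" by (rule rmoduleI[OF Ext1_fg(1)[OF noetherian_ring_axioms fg]])
  interpret p: presentation R M "carrier M" "\<lambda>x. x" using m(1) by (rule presentation_carrier)
  interpret N: rmodule R N using m(2) by (rule rmoduleI)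
  show ?thesis
  proof (rule E.smI)
    show "Ext1_eT R I M N \<subseteq> carrier (Ext1 R M N)" by (auto simp: Ext1_eT_def Ext1_def)
    have "eT R I (ext_mid (split_ext M N)) = eT R I M + eT R I N"
      by (simp add: split_ext_def eT_dsum fg)
    from yoneda_in_Ext1_eT[OF extensionI[OF m split_is_ext[OF m]] this]
    show "\<zero>\<^bsub>Ext1 R M N\<^esub> \<in> Ext1_eT R I M N" by (simp add: Ext1_def)
  next
    fix c c' assume "c \<in> Ext1_eT R I M N" "c' \<in> Ext1_eT R I M N"
    note c = this
    obtain E :: "('a, 'n, 'n \<times> 'm, 'm) extn" where E1: "extension R M N E" "c = yoneda_class R M N E" "eT R I (ext_mid E) = eT R I M + eT R I N"
      using c(1) by (rule Ext1_eT_cases[OF m])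
    obtain E' :: "('a, 'n, 'n \<times> 'm, 'm) extn" where E2: "extension R M N E'" "c' = yoneda_class R M N E'" "eT R I (ext_mid E') = eT R I M + eT R I N"
      using c(2) by (rule Ext1_eT_cases[OF m])
    note E = E1 E2
    show "c \<oplus>\<^bsub>Ext1 R M N\<^esub> c' \<in> Ext1_eT R I M N"
      unfolding E(2,5) p.yoneda_add[OF E(1,4)]
      by (rule yoneda_in_Ext1_eT[OF baer_is_ext[OF E(1,4)] eT_baer[OF E(1,4) fg E(3,6)]])
  next
    fix a c assume a: "a \<in> carrier R" and "c \<in> Ext1_eT R I M N"
    from this(2) obtain E :: "('a, 'n, 'n \<times> 'm, 'm) extn" where E: "extension R M N E" "c = yoneda_class R M N E" "eT R I (ext_mid E) = eT R I M + eT R I N"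
      by (rule Ext1_eT_cases[OF m])
    interpret e: extension R M N E by (rule E(1))
    show "a \<odot>\<^bsub>Ext1 R M N\<^esub> c \<in> Ext1_eT R I M N"
      unfolding E(2) p.yoneda_smult[OF E(1) a]
      by (rule yoneda_in_Ext1_eT[OF extensionI[OF m e.push_is_ext[OF m(2) N.smult_hom[OF a]]]
            eT_push[OF E(1) fg fg(2) N.smult_hom[OF a] E(3)]])
  qed
qed

lemma Ext1_eT_map:
  fixes M :: "('a, 'm) module" and N :: "('a, 'n) module"
  assumes fg: "M \<in> fg_modules R" "N \<in> fg_modules R" "M' \<in> fg_modules R" "N' \<in> fg_modules R"
    and f: "f \<in> mod_hom R M' M" and g: "g \<in> mod_hom R N N'"
  shows "Ext1_map R M N M' N' f g ` Ext1_eT R I M N \<subseteq> Ext1_eT R I M' N'"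
proof clarify
  note m = fg[THEN fg_modulesD]
  fix c assume "c \<in> Ext1_eT R I M N"
  then obtain E :: "('a, 'n, 'n \<times> 'm, 'm) extn" where E: "extension R M N E" "c = yoneda_class R M N E" "eT R I (ext_mid E) = eT R I M + eT R I N"
    by (rule Ext1_eT_cases[OF m(1,2)])
  obtain l where "ext_map R M (carrier M) (\<lambda>x. x) M' (carrier M') (\<lambda>x. x) N N' f g l"
    by (rule ext_mapI[OF presentation_carrier[OF m(1)] presentation_carrier[OF m(3)] m(2,4) f g])
  then interpret e: ext_map R M "carrier M" "\<lambda>x. x" M' "carrier M'" "\<lambda>x. x" N N' f g l .
  interpret x: extension R M N E by (rule E(1))
  have 1: "extension R M' N (pull_ext M' f E)" by (rule extensionI[OF m(3,2) x.pull_is_ext[OF m(3) f]])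
  interpret y: extension R M' N "pull_ext M' f E" by (rule 1)
  have 2: "extension R M' N' (push_ext N N' g (pull_ext M' f E))"
    by (rule extensionI[OF m(3,4) y.push_is_ext[OF m(4) g]])
  show "Ext1_map R M N M' N' f g c \<in> Ext1_eT R I M' N'"
    unfolding E(2) e.Ext1_map_yoneda[OF E(1)]
    by (rule yoneda_in_Ext1_eT[OF 2 eT_push[OF 1 fg(3,2,4) g eT_pull[OF E(1) fg(1,2,3) f E(3)]]])
qed

end

section \<open>The bifunctor and the passage to the local ring\<close>

lemma Ext1_bifunctor:
  assumes R: "noetherian_ring R" and C: "C \<subseteq> fg_modules R"
  shows "mod_bifunctor R C (Ext1 R) (Ext1_map R)"
  unfolding mod_bifunctor_def
proof (intro conjI ballI)
  have m: "module R M" if "M \<in> C" for M using that C fg_modulesD by auto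
  fix M N assume MN: "M \<in> C" "N \<in> C"
  show "Ext1 R M N \<in> fg_modules R"
    using noeth_imp_fg Ext1_fg[OF R, of M N] MN C by blast
  show "Ext1_map R M N M N id id c = c" if "c \<in> carrier (Ext1 R M N)" for c
    using m[OF MN(1)] m[OF MN(2)] that by (rule Ext1_map_id)
  fix M' N' f g assume MN': "M' \<in> C" "N' \<in> C" and f: "f \<in> mod_hom R M' M" and g: "g \<in> mod_hom R N N'"
  obtain l where "ext_map R M (carrier M) (\<lambda>x. x) M' (carrier M') (\<lambda>x. x) N N' f g l"
    by (rule ext_mapI[OF presentation_carrier[OF m[OF MN(1)]] presentation_carrier[OF m[OF MN'(1)]] m[OF MN(2)] m[OF MN'(2)] f g])
  thus "Ext1_map R M N M' N' f g \<in> mod_hom R (Ext1 R M N) (Ext1 R M' N')" by (rule ext_map.Ext1_map_hom)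
  fix M'' N'' f' g' c assume "M'' \<in> C" "N'' \<in> C" "f' \<in> mod_hom R M'' M'" "g' \<in> mod_hom R N' N''" "c \<in> carrier (Ext1 R M N)"
  thus "Ext1_map R M N M'' N'' (f \<circ> f') (g' \<circ> g) c = Ext1_map R M' N' M'' N'' f' g' (Ext1_map R M N M' N' f g c)"
    using m MN MN' f g by (intro Ext1_map_comp) auto
qed

text \<open>The chain condition yields an ideal that is maximal among the proper ones above P; it is
  a maximal ideal, hence \<mm> by uniqueness.\<close>

lemma noeth_local_prime_le:
  assumes R: "noeth_local_ring R \<mm>" and P: "primeideal P R"
  shows "P \<subseteq> \<mm>"
proof -
  have cr: "cring R" "noetherian_ring R" using R by (auto simp: noeth_local_ring_def)
  interpret cring R by (rule cr)
  let ?S = "{J. ideal J R \<and> P \<subseteq> J \<and> J \<noteq> carrier R}"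
  have P': "ideal P R" "P \<noteq> carrier R"
    using P primeideal.axioms(1) primeideal.I_notcarr by auto
  have 1: "?S \<noteq> {}" using P' by auto
  have 2: "submodule J R (self_mod R)" "J \<subseteq> carrier R" if "J \<in> ?S" for J
    using that ideal.Icarr[of J R] by (simp_all add: submodule_self_mod_iff subset_iff)
  obtain J where J: "J \<in> ?S" "\<And>J'. J' \<in> ?S \<Longrightarrow> J \<subseteq> J' \<Longrightarrow> J' = J"
    by (rule noeth_max[OF noeth_self_mod[OF cr] 1 2]) auto
  have "maximalideal J R"
  proof (rule maximalidealI)
    fix J' assume "ideal J' R" "J \<subseteq> J'"
    thus "J' = J \<or> J' = carrier R" using J by auto
  qed (use J in auto)
  hence "J = \<mm>" using R by (simp add: noeth_local_ring_def)
  thus ?thesis using J by auto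
qed

theorem theorem4p17:
  fixes R :: "('a, 'k) ring_scheme" and \<mm> I :: "'a set" and d :: nat
  assumes "noeth_local_ring R \<mm>"
    and "krull_dim R = enat d" and "d \<ge> 1"
    and "equidimensional R"
    and "serre R 1 (self_mod R)"
    and "primary_ideal_of R \<mm> I"
  shows "mod_subfunctor R (S1_modules R :: ('a, 'b) module set) (Ext1_eT R I) (Ext1 R) (Ext1_map R)"
proof -
  have cr: "cring R" "noetherian_ring R" "maximalideal \<mm> R" using assms(1) by (auto simp: noeth_local_ring_def)
  interpret cring R by (rule cr)
  have I: "ideal I R" "{a \<in> carrier R. \<exists>n::nat. a [^]\<^bsub>R\<^esub> n \<in> I} = \<mm>"
    using assms(6) by (auto simp: primary_ideal_of_def)
  interpret primary_setup_dim R \<mm> I d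
  proof (intro primary_setup_dim.intro primary_setup.intro primary_setup_axioms.intro primary_setup_dim_axioms.intro)
    show "P \<subseteq> \<mm>" if "primeideal P R" for P using assms(1) that by (rule noeth_local_prime_le)
    show "\<exists>n::nat. y [^]\<^bsub>R\<^esub> n \<in> I" if "y \<in> \<mm>" for y using that I(2) by auto
    fix n and c :: "nat \<Rightarrow> 'a set"
    assume c: "\<And>i. i \<le> n \<Longrightarrow> primeideal (c i) R" "\<And>i. i < n \<Longrightarrow> c i \<subset> c (Suc i)"
    have "enat n \<le> krull_dim R" unfolding krull_dim_def by (rule Sup_upper) (use c in blast)
    thus "n \<le> d" using assms(2) by simp
  qed (use cr I assms in auto)
  have C: "(S1_modules R :: ('a, 'b) module set) \<subseteq> fg_modules R" by (auto simp: S1_modules_def)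
  show ?thesis
    unfolding mod_subfunctor_def
  proof (intro conjI ballI)
    show "mod_bifunctor R (S1_modules R :: ('a, 'b) module set) (Ext1 R) (Ext1_map R)"
      by (rule Ext1_bifunctor[OF cr(2) C])
    fix M N :: "('a, 'b) module" assume "M \<in> S1_modules R" "N \<in> S1_modules R"
    hence fg: "M \<in> fg_modules R" "N \<in> fg_modules R" using C by auto
    show sm: "submodule (Ext1_eT R I M N) R (Ext1 R M N)" by (rule Ext1_eT_submodule[OF fg])
    \<comment> \<open>Finite generation passes to a submodule only through the chain condition,
      which \<open>Ext1_fg\<close> provides for \<open>Ext1\<close>.\<close>
    show "(Ext1 R M N)\<lparr>carrier := Ext1_eT R I M N\<rparr> \<in> fg_modules R"
      using Ext1_fg[OF cr(2) fg] sm by (intro rmodule.noeth_submodule_fg rmoduleI)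
    fix M' N' :: "('a, 'b) module" and f g
    assume "M' \<in> S1_modules R" "N' \<in> S1_modules R" "f \<in> mod_hom R M' M" "g \<in> mod_hom R N N'"
    thus "Ext1_map R M N M' N' f g ` Ext1_eT R I M N \<subseteq> Ext1_eT R I M' N'"
      using fg C by (intro Ext1_eT_map) auto
  qed
qed

end
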